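(* Let $n \geq 1$ and let $\mathbf{q} = (q_0, \dots, q_n)$ be positive integers with $\gcd(q_0, \dots, q_n) = 1$. For $S \subseteq \{0,\dots,n\}$ with $|S| \geq 2$ put $\mathbf{q}_S = (q_i)_{i\in S}$, $q_S = \operatorname{lcm}_{i \in S} q_i$, $d = d_S = \gcd_{i \in S} q_i$, and $$\alpha_S = q_S\, a(\mathbf{q}_S), \qquad \beta_S = \beta(\mathbf{q}_S), \qquad c_{\mathbf{q}_S} = d^{\beta_S}\, c_{\mathbf{q}_S/d},$$ where $a(\mathbf{q}_S)$, $\beta(\mathbf{q}_S)$ are computed from the exponents $q_S/q_i$, $i \in S$, and $c_{\mathbf{q}_S/d} > 0$ is the interior leading constant of the coprime weights $\mathbf{q}_S/d$ (see context). Let $(\alpha,\beta)$ be the lexicographic maximum of the pairs $(\alpha_S,\beta_S)$ over all $S$ with $|S|\ge 2$. Then, as $X \to \infty$, the number $Z_{\mathfrak{h}}(\mathbb{WP}^n_{\mathbf{q}}(\mathbb{Q}),X)$ of points $\mathfrak{p}\in \mathbb{WP}^n_{\mathbf{q}}(\mathbb{Q})$ with $\mathfrak{h}(\mathfrak{p}) \leq X$ satisfies $$Z_{\mathfrak{h}}\big(\mathbb{WP}^n_{\mathbf{q}}(\mathbb{Q}), X\big) \sim \Big( \sum_{S\,:\,(\alpha_S,\beta_S) = (\alpha,\beta)} c_{\mathbf{q}_S} \Big) X^{\alpha} (\log X)^{\beta}.$$ Moreover $a(\mathbf{q}_S) \leq |S|$, so $\alpha_S \leq q_S |S| \leq qn$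 for every proper subset $S$ with $|S|\ge 2$, where $q = \operatorname{lcm}(q_0,\dots,q_n)$; hence $Z_{\mathfrak{h}}(\mathbb{WP}^n_{\mathbf{q}}(\mathbb{Q}),X) = o(X^{q(n+1)})$ whenever $a(\mathbf{q}) < n+1$.
   Context: Weighted projective space: for positive integer weights $\mathbf{q}=(q_0,\dots,q_n)$, $\mathbb{WP}^n_{\mathbf{q}}(\overline{\mathbb{Q}})$ is the set of nonzero tuples $\mathbf{x} \in \overline{\mathbb{Q}}^{n+1}$ modulo $\mathbf{x} \sim (\lambda^{q_0}x_0, \dots, \lambda^{q_n}x_n)$, $\lambda \in \overline{\mathbb{Q}}^{\times}$; $\mathbb{WP}^n_{\mathbf{q}}(\mathbb{Q})$ is the subset of classes admitting a representative in $\mathbb{Q}^{n+1}$. Weighted height: for $\mathfrak{p} = [x_0:\dots:x_n]$ with $x_i\in\mathbb{Q}$, $\mathfrak{h}(\mathfrak{p}) = \prod_{v} \max_i |x_i|_v^{1/q_i}$ over all places $v$ of $\mathbb{Q}$; equivalently $\mathfrak{h}(\mathfrak{p}) = H([x_0^{q/q_0}:\dots:x_n^{q/q_n}])^{1/q}$ with $H$ the Weil height and $q = \operatorname{lcm}(q_i)$. Linear program: for weights $\mathbf{u} = (u_i)_{i\in S}$ with lcm $u$, put $n_i = u/u_i$, $M_{\mathbf{u}} = \{t \in \mathbb{Z}_{\ge 0}^{S} : \min_i t_i = 0,\ t_i \equiv t_j \pmod{\gcd(n_i,n_j)}\ \forall i,j\}$, and let $T_{\mathbf{u}}$ be the finite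 set of coordinatewise-minimal elements of $M_{\mathbf{u}}\setminus\{0\}$. Then $a(\mathbf{u})$ and $\beta(\mathbf{u})$ are the optimal value and the dimension of the optimal face of: maximize $\sum_{g\in T_{\mathbf{u}}} c_g$ subject to $c_g \ge 0$, $\sum_{g} c_g g_i \le 1$ for all $i \in S$. Interior leading constant: for coprime weights $\mathbf{u}$ with at least two entries and lcm $u$, the number $Z^{\circ}_{\mathfrak{h}}$ of points of $\mathbb{WP}_{\mathbf{u}}(\mathbb{Q})$ with all coordinates nonzero and weighted height at most $X$ satisfies $Z^{\circ}_{\mathfrak{h}} \sim c_{\mathbf{u}} X^{u\,a(\mathbf{u})}(\log X)^{\beta(\mathbf{u})}$ for a constant $c_{\mathbf{u}} > 0$ (this is the main theorem of the paper, of which this is a corollary); this defines $c_{\mathbf{u}}$. Terminology: a proper stratum $\{x_j = 0 : j \notin S\}$ whose pair $(\alpha_S,\beta_S)$ is lexicographically larger than the pair of the full support $\{0,\dots,n\}$ is called an accumulating subvariety for the weighted height. *)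

theory Defs
  imports "HOL-Analysis.Analysis" "HOL-Library.Function_Algebras" "HOL-Library.Landau_Symbols"
    "HOL-Number_Theory.Cong"
begin

text \<open>
  A weight system is a finite index set \<open>I :: nat set\<close> together with \<open>q :: nat \<Rightarrow> nat\<close>, of which only
  the values on \<open>I\<close> matter.  Restricting to a subset of the coordinates amounts to shrinking \<open>I\<close>.
  The field of algebraic numbers is the set of algebraic elements of \<^typ>\<open>complex\<close>.
\<close>

definition wp_tuples :: "nat set \<Rightarrow> (nat \<Rightarrow> complex) set" where
  "wp_tuples I = {x \<in> I \<rightarrow>\<^sub>E {z. algebraic z}. \<exists>i\<in>I. x i \<noteq> 0}"

definition wp_rel :: "nat set \<Rightarrow> (nat \<Rightarrow> nat) \<Rightarrow> ((nat \<Rightarrow> complex) \<times> (nat \<Rightarrow> complex)) set" where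
  "wp_rel I q = {(x, y). x \<in> wp_tuples I \<and> y \<in> wp_tuples I \<and>
     (\<exists>l. algebraic l \<and> l \<noteq> 0 \<and> (\<forall>i\<in>I. y i = l ^ q i * x i))}"

definition wp_space :: "nat set \<Rightarrow> (nat \<Rightarrow> nat) \<Rightarrow> (nat \<Rightarrow> complex) set set" where
  "wp_space I q = wp_tuples I // wp_rel I q"

definition represents :: "nat set \<Rightarrow> (nat \<Rightarrow> rat) \<Rightarrow> (nat \<Rightarrow> complex) set \<Rightarrow> bool" where
  "represents I x P \<longleftrightarrow> (\<lambda>i\<in>I. of_rat (x i)) \<in> P"

definition wp_rational :: "nat set \<Rightarrow> (nat \<Rightarrow> nat) \<Rightarrow> (nat \<Rightarrow> complex) set set" where
  "wp_rational I q = {P \<in> wp_space I q. \<exists>x. represents I x P}"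

definition padic_abs :: "nat \<Rightarrow> rat \<Rightarrow> real" where
  "padic_abs p x = (if x = 0 then 0 else
     real p powr (real (multiplicity (int p) (snd (quotient_of x)))
                  - real (multiplicity (int p) (fst (quotient_of x)))))"

definition local_height :: "(rat \<Rightarrow> real) \<Rightarrow> nat set \<Rightarrow> (nat \<Rightarrow> nat) \<Rightarrow> (nat \<Rightarrow> rat) \<Rightarrow> real" where
  "local_height v I q x = Max ((\<lambda>i. v (x i) powr (1 / real (q i))) ` I)"

text \<open>
  The product over all places of the rationals.  For a nonzero tuple only finitely many primes have
  a local factor different from 1; the others are left out because \<^const>\<open>prod\<close> is 1 on infinite sets.
\<close>

definition tuple_height :: "nat set \<Rightarrow> (nat \<Rightarrow> nat) \<Rightarrow> (nat \<Rightarrow> rat) \<Rightarrow> real" where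
  "tuple_height I q x =
     local_height (\<lambda>r. \<bar>real_of_rat r\<bar>) I q x *
     (\<Prod>p \<in> {p. prime p \<and> local_height (padic_abs p) I q x \<noteq> 1}. local_height (padic_abs p) I q x)"

text \<open>The value does not depend on the rational representative that is chosen.\<close>

definition weighted_height :: "nat set \<Rightarrow> (nat \<Rightarrow> nat) \<Rightarrow> (nat \<Rightarrow> complex) set \<Rightarrow> real" where
  "weighted_height I q P = tuple_height I q (SOME x. represents I x P)"

definition point_count :: "nat set \<Rightarrow> (nat \<Rightarrow> nat) \<Rightarrow> real \<Rightarrow> nat" where
  "point_count I q X = card {P \<in> wp_rational I q. weighted_height I q P \<le> X}"

definition interior_count :: "nat set \<Rightarrow> (nat \<Rightarrow> nat) \<Rightarrow> real \<Rightarrow> nat" where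
  "interior_count I q X =
     card {P \<in> wp_rational I q. (\<forall>x\<in>P. \<forall>i\<in>I. x i \<noteq> 0) \<and> weighted_height I q P \<le> X}"

definition weight_lcm :: "nat set \<Rightarrow> (nat \<Rightarrow> nat) \<Rightarrow> nat" where
  "weight_lcm I u = Lcm (u ` I)"

definition weight_gcd :: "nat set \<Rightarrow> (nat \<Rightarrow> nat) \<Rightarrow> nat" where
  "weight_gcd I u = Gcd (u ` I)"

definition lp_exponent :: "nat set \<Rightarrow> (nat \<Rightarrow> nat) \<Rightarrow> nat \<Rightarrow> nat" where
  "lp_exponent I u i = weight_lcm I u div u i"

definition lp_M :: "nat set \<Rightarrow> (nat \<Rightarrow> nat) \<Rightarrow> (nat \<Rightarrow> nat) set" where
  "lp_M I u = {t \<in> I \<rightarrow>\<^sub>E UNIV. Min (t ` I) = 0 \<and>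
     (\<forall>i\<in>I. \<forall>j\<in>I. [t i = t j] (mod gcd (lp_exponent I u i) (lp_exponent I u j)))}"

definition lp_T :: "nat set \<Rightarrow> (nat \<Rightarrow> nat) \<Rightarrow> (nat \<Rightarrow> nat) set" where
  "lp_T I u = {t \<in> lp_M I u - {\<lambda>i\<in>I. 0}.
     \<forall>s \<in> lp_M I u - {\<lambda>i\<in>I. 0}. (\<forall>i\<in>I. s i \<le> t i) \<longrightarrow> s = t}"

text \<open>
  Vectors indexed by \<^term>\<open>lp_T I u\<close> are functions vanishing outside that set, so that they form a
  linear subspace of the function space.
\<close>

definition lp_feasible :: "nat set \<Rightarrow> (nat \<Rightarrow> nat) \<Rightarrow> ((nat \<Rightarrow> nat) \<Rightarrow> real) set" where
  "lp_feasible I u = {c. (\<forall>g. g \<notin> lp_T I u \<longrightarrow> c g = 0) \<and> (\<forall>g\<in>lp_T I u. 0 \<le> c g) \<and>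
     (\<forall>i\<in>I. (\<Sum>g\<in>lp_T I u. c g * real (g i)) \<le> 1)}"

definition lp_objective :: "nat set \<Rightarrow> (nat \<Rightarrow> nat) \<Rightarrow> ((nat \<Rightarrow> nat) \<Rightarrow> real) \<Rightarrow> real" where
  "lp_objective I u c = (\<Sum>g\<in>lp_T I u. c g)"

definition lp_value :: "nat set \<Rightarrow> (nat \<Rightarrow> nat) \<Rightarrow> real" where
  "lp_value I u = (SUP c \<in> lp_feasible I u. lp_objective I u c)"

definition lp_optimal_face :: "nat set \<Rightarrow> (nat \<Rightarrow> nat) \<Rightarrow> ((nat \<Rightarrow> nat) \<Rightarrow> real) set" where
  "lp_optimal_face I u = {c \<in> lp_feasible I u. lp_objective I u c = lp_value I u}"

text \<open>
  The dimension of a nonempty set of real-valued functions as the dimension of the direction space of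
  its affine hull; \<^const>\<open>aff_dim\<close> is only available on Euclidean spaces.
\<close>

definition fun_aff_dim :: "('a \<Rightarrow> real) set \<Rightarrow> nat" where
  "fun_aff_dim F = vector_space.dim (\<lambda>r f x. r * f x) {c - c' | c c'. c \<in> F \<and> c' \<in> F}"

definition lp_beta :: "nat set \<Rightarrow> (nat \<Rightarrow> nat) \<Rightarrow> nat" where
  "lp_beta I u = fun_aff_dim (lp_optimal_face I u)"

text \<open>Used only for weights that are coprime on an index set with at least two elements.\<close>

definition interior_const :: "nat set \<Rightarrow> (nat \<Rightarrow> nat) \<Rightarrow> real" where
  "interior_const I u = (THE c. c > 0 \<and>
     (\<lambda>X. real (interior_count I u X)) \<sim>[at_top]
     (\<lambda>X. c * X powr (real (weight_lcm I u) * lp_value I u) * ln X ^ lp_beta I u))"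

definition stratum_alpha :: "(nat \<Rightarrow> nat) \<Rightarrow> nat set \<Rightarrow> real" where
  "stratum_alpha q S = real (weight_lcm S q) * lp_value S q"

definition stratum_beta :: "(nat \<Rightarrow> nat) \<Rightarrow> nat set \<Rightarrow> nat" where
  "stratum_beta q S = lp_beta S q"

definition stratum_reduced :: "(nat \<Rightarrow> nat) \<Rightarrow> nat set \<Rightarrow> nat \<Rightarrow> nat" where
  "stratum_reduced q S i = q i div weight_gcd S q"

definition stratum_const :: "(nat \<Rightarrow> nat) \<Rightarrow> nat set \<Rightarrow> real" where
  "stratum_const q S = real (weight_gcd S q) ^ stratum_beta q S * interior_const S (stratum_reduced q S)"

definition strata :: "nat \<Rightarrow> nat set set" where
  "strata n = {S. S \<subseteq> {0..n} \<and> card S \<ge> 2}"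

text \<open>
  The order is spelled out because \<open>HOL-Analysis\<close> already puts the componentwise order on pairs.
\<close>

definition lex_le :: "real \<times> nat \<Rightarrow> real \<times> nat \<Rightarrow> bool" where
  "lex_le p p' \<longleftrightarrow> fst p < fst p' \<or> (fst p = fst p' \<and> snd p \<le> snd p')"

definition is_lex_max :: "real \<times> nat \<Rightarrow> (real \<times> nat) set \<Rightarrow> bool" where
  "is_lex_max p A \<longleftrightarrow> p \<in> A \<and> (\<forall>p'\<in>A. lex_le p' p)"

end

theory Submission
  imports Defs
begin

text \<open>
  Up to signs, a rational point whose nonzero coordinates are those in \<open>S\<close> is a family \<open>(t\<^sub>p)\<close> of vectors
  of \<open>lp_M S q\<close>, one for each prime and almost all of them zero: scaling by \<open>\<mu>\<close> shifts all \<open>n\<^sub>i v\<^sub>p(x\<^sub>i)\<close> by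
  the same multiple of the lcm, and one normalises the minimum over \<open>i\<close> to be zero.  The height condition becomes
  \<open>\<Sum>\<^sub>p t\<^sub>p(i) log p \<le> L\<close> for all \<open>i\<close>, with \<open>L = q\<^sub>S log X\<close>.

  A strictly complementary dual solution \<open>s\<close> of the linear program has \<open>s\<^sub>i > 0\<close> for all \<open>i\<close>, because \<open>lp_M\<close>
  contains multiples of the unit vectors.  Hence \<open>\<langle>s, t\<rangle> = 1\<close> exactly on the support \<open>T'\<close> of the optimal face,
  while \<open>\<langle>s, t\<rangle> \<ge> 1 + d\<close> on the rest of \<open>lp_M - {0}\<close>.  Primes with \<open>t\<^sub>p \<notin> T'\<close> contribute a
  convergent Euler product; those with \<open>t\<^sub>p = g\<close> multiply to square-free, pairwise coprime numbers \<open>m\<^sub>g\<close> with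
  \<open>\<Sum>\<^sub>g g\<^sub>i log m\<^sub>g \<le> b\<^sub>i\<close>.  Without the coprimality the number of such tuples is a volume: after \<open>z = log m\<close> it is
  \<open>exp \<langle>s, b\<rangle>\<close> times the integral of \<open>exp (- \<langle>s, b - G z\<rangle>)\<close> over \<open>z \<ge> 0\<close>, \<open>G z \<le> b\<close>.  The integrand
  decays away from the fibre \<open>G z = b\<close>, a polytope that grows like \<open>L\<close> in \<open>\<beta>\<close> directions.  Coprimality is periodic
  up to primes \<open>> Q\<close>, which lose only \<open>O(1/Q)\<close>.  Only the existence and the positivity of the limits are needed.
\<close>

section \<open>Products of algebraic numbers\<close>

text \<open>The interior constants enter through a definite description, so an asymptotic formula
  with a positive constant has to be proved on every stratum before the sum over strata means
  anything. Weights with common divisor \<open>d\<close> and the reduced weights have the same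
  exponents \<open>n_i\<close>, hence the same families of vectors. Both counts are one function of
  \<open>L\<close>, evaluated at \<open>L = qS log X\<close> and at \<open>L = U log X\<close> with
  \<open>qS = d * U\<close>, and \<open>L ^ \<beta>\<close> turns this into the factor
  \<open>d ^ \<beta>\<close>. Each family carries \<open>2 ^ (|S| - 1)\<close> sign patterns:
  coprime weights include an odd one, so scaling by -1 identifies the patterns in pairs. The linear
  algebra is done in coordinates. A maximal independent set of columns of the optimal face serves as
  pivots; the other columns parametrise the fibre, and their number is \<open>\<beta>\<close>. In
  the volume they are scaled by \<open>L\<close>, while the pivots are only translated, since the
  density decays off the fibre at a rate that does not depend on \<open>L\<close>. Convergence alone
  does not exclude a zero limit, so positivity is argued separately for the volume and for the
  square-free tuples.\<close>

lemma vector_space_of_rat: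
  "vector_space (\<lambda>(r::rat) (z::'a::field_char_0). of_rat r * z)"
  by unfold_locales (auto simp: algebra_simps of_rat_add of_rat_mult)

text \<open>A polynomial relation divided by its leading coefficient expresses \<open>x ^ m\<close>,
  with \<open>m\<close> the degree, through lower powers; \<open>m > 0\<close> because a nonzero
  constant has no root.\<close>

lemma algebraic_power_in_span:
  fixes x :: "'a::field_char_0"
  assumes "algebraic x"
  shows "\<exists>m>0. x ^ m \<in> module.span (\<lambda>(r::rat) (z::'a). of_rat r * z) ((\<lambda>i. x ^ i) ` {..<m})"
proof -
  interpret Q: vector_space "\<lambda>(r::rat) (z::'a). of_rat r * z" by (rule vector_space_of_rat)
  from assms obtain p where p: "\<And>i. coeff p i \<in> \<rat>" "p \<noteq> 0" "poly p x = 0"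
    unfolding algebraic_altdef by blast
  then have "\<forall>i. \<exists>r. coeff p i = of_rat r" by (metis Rats_cases)
  then obtain r where r: "\<And>i. coeff p i = of_rat (r i)" by metis
  define m where "m = degree p"
  have "m > 0"
  proof (rule ccontr)
    assume "\<not> m > 0"
    then obtain a where "p = [:a:]" by (metis degree_eq_zeroE gr0I m_def)
    with p(2,3) show False by simp
  qed
  have lc: "of_rat (r m) \<noteq> (0::'a)" using p(2) by (simp add: m_def flip: r)
  have "0 = (\<Sum>i\<le>m. of_rat (r i) * x ^ i)"
    using p(3) by (simp add: poly_altdef r m_def)
  also have "\<dots> = (\<Sum>i<m. of_rat (r i) * x ^ i) + of_rat (r m) * x ^ m"
    by (simp add: lessThan_Suc_atMost [symmetric])
  finally have eq: "of_rat (r m) * x ^ m = - (\<Sum>i<m. of_rat (r i) * x ^ i)"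
    by (simp add: eq_neg_iff_add_eq_0 add.commute)
  have "x ^ m = of_rat (- 1 / r m) * (\<Sum>i<m. of_rat (r i) * x ^ i)"
    using eq lc by (simp add: of_rat_divide of_rat_minus field_simps)
  also have "\<dots> \<in> Q.span ((\<lambda>i. x ^ i) ` {..<m})"
    by (intro Q.span_scale Q.span_sum Q.span_base) auto
  finally show ?thesis using \<open>m > 0\<close> by blast
qed

text \<open>Transitivity of \<open>wp_rel\<close> rests on this. The span of the
  \<open>x ^ i * y ^ j\<close> with \<open>i < m\<close>, \<open>j < n\<close> is stable under
  multiplication by \<open>x\<close> and by \<open>y\<close>, so it contains every power of
  \<open>x * y\<close>, and finite dimension gives a relation among these powers.\<close>

lemma algebraic_mult:
  fixes x y :: "'a::field_char_0"
  assumes "algebraic x" "algebraic y"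
  shows "algebraic (x * y)"
proof -
  interpret Q: vector_space "\<lambda>(r::rat) (z::'a). of_rat r * z" by (rule vector_space_of_rat)
  obtain m where m: "m > 0" "x ^ m \<in> Q.span ((\<lambda>i. x ^ i) ` {..<m})"
    using algebraic_power_in_span[OF assms(1)] by blast
  obtain n where n: "n > 0" "y ^ n \<in> Q.span ((\<lambda>i. y ^ i) ` {..<n})"
    using algebraic_power_in_span[OF assms(2)] by blast
  define B where "B = (\<lambda>(i, j). x ^ i * y ^ j) ` ({..<m} \<times> {..<n})"
  have finB: "finite B" unfolding B_def by simp
  have mult_span: "w * v \<in> Q.span B" if "v \<in> Q.span A" "\<And>a. a \<in> A \<Longrightarrow> w * a \<in> Q.span B" for v w A
    using that(1)
  proof (induction rule: Q.span_induct_alt)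
    case base
    then show ?case by (simp add: Q.span_zero)
  next
    case (step c a v)
    have "w * (of_rat c * a + v) = of_rat c * (w * a) + w * v" by (simp add: algebra_simps)
    then show ?case using step that(2) by (simp add: Q.span_add Q.span_scale)
  qed
  have base: "x ^ i * y ^ j \<in> Q.span B" if "i < m" "j < n" for i j
    using that unfolding B_def by (intro Q.span_base) auto
  have xB: "x * b \<in> Q.span B" if "b \<in> B" for b
  proof -
    from that obtain i j where ij: "i < m" "j < n" "b = x ^ i * y ^ j" by (auto simp: B_def)
    have "y ^ j * x ^ Suc i \<in> Q.span B"
    proof (cases "Suc i < m")
      case True then show ?thesis using base[of "Suc i" j] ij by (simp add: mult.commute)
    next
      case False
      then have "Suc i = m" using ij by simp
      have "y ^ j * x ^ m \<in> Q.span B"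
        by (rule mult_span[OF m(2)]) (use base ij in \<open>auto simp: mult.commute\<close>)
      then show ?thesis using \<open>Suc i = m\<close> by simp
    qed
    then show ?thesis by (simp add: ij mult_ac)
  qed
  have yB: "y * b \<in> Q.span B" if "b \<in> B" for b
  proof -
    from that obtain i j where ij: "i < m" "j < n" "b = x ^ i * y ^ j" by (auto simp: B_def)
    have "x ^ i * y ^ Suc j \<in> Q.span B"
    proof (cases "Suc j < n")
      case True then show ?thesis using base[of i "Suc j"] ij by simp
    next
      case False
      then have "Suc j = n" using ij by simp
      have "x ^ i * y ^ n \<in> Q.span B"
        by (rule mult_span[OF n(2)]) (use base ij in auto)
      then show ?thesis using \<open>Suc j = n\<close> by simp
    qed
    then show ?thesis by (simp add: ij mult_ac)
  qed
  have pow: "(x * y) ^ k \<in> Q.span B" for k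
  proof (induction k)
    case 0
    then show ?case using base[of 0 0] m n by simp
  next
    case (Suc k)
    have "y * (x * y) ^ k \<in> Q.span B" by (rule mult_span[OF Suc yB])
    then have "x * (y * (x * y) ^ k) \<in> Q.span B" by (rule mult_span[OF _ xB])
    then show ?case by (simp add: mult_ac)
  qed
  define N where "N = card B"
  show ?thesis
  proof (cases "inj_on (\<lambda>k. (x * y) ^ k) {..N}")
    \<comment> \<open>A repetition among the powers makes \<open>x * y\<close> a root of
      \<open>X ^ a - X ^ b\<close>. It is treated apart because linear dependence is a notion for
      the set of powers, where repetitions disappear.\<close>
    case False
    then obtain a b where ab: "a \<noteq> b" "(x * y) ^ a = (x * y) ^ b" by (auto simp: inj_on_def)
    show ?thesis
    proof (rule algebraicI')
      show "coeff (monom 1 a - monom 1 b :: 'a poly) i \<in> \<rat>" for i by (simp add: coeff_diff)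
      show "monom 1 a - monom 1 b \<noteq> (0 :: 'a poly)" using ab(1) by (simp add: monom_eq_iff')
      show "poly (monom 1 a - monom 1 b) (x * y) = 0" using ab(2) by (simp add: poly_monom)
    qed
  next
    case inj: True
    define C where "C = (\<lambda>k. (x * y) ^ k) ` {..N}"
    have "card C = Suc N" unfolding C_def by (simp add: card_image inj)
    have "Q.dependent C"
    proof (rule ccontr)
      assume "\<not> Q.dependent C"
      from Q.independent_span_bound[OF finB this] pow have "card C \<le> N"
        unfolding C_def N_def by blast
      with \<open>card C = Suc N\<close> show False by simp
    qed
    then obtain u where u: "\<exists>v\<in>C. u v \<noteq> 0" "(\<Sum>v\<in>C. of_rat (u v) * v) = 0"
      using Q.dependent_finite[of C] unfolding C_def by auto
    define p where "p = (\<Sum>k\<le>N. monom (of_rat (u ((x * y) ^ k))) k :: 'a poly)"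
    have cp: "coeff p k = (if k \<le> N then of_rat (u ((x * y) ^ k)) else 0)" for k
      unfolding p_def by (simp add: coeff_sum if_distrib sum.delta cong: if_cong)
    show ?thesis
    proof (rule algebraicI')
      show "coeff p i \<in> \<rat>" for i by (simp add: cp)
      from u(1) obtain k where "k \<le> N" "u ((x * y) ^ k) \<noteq> 0" by (auto simp: C_def)
      then have "coeff p k \<noteq> 0" by (simp add: cp)
      then show "p \<noteq> 0" by auto
      have "poly p (x * y) = (\<Sum>k\<le>N. of_rat (u ((x * y) ^ k)) * (x * y) ^ k)"
        unfolding p_def by (simp add: poly_sum poly_monom)
      also have "\<dots> = (\<Sum>v\<in>C. of_rat (u v) * v)"
        unfolding C_def by (simp add: sum.reindex[OF inj])
      finally show "poly p (x * y) = 0" using u(2) by simp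
    qed
  qed
qed

section \<open>Fourier-Motzkin elimination\<close>

text \<open>A triple \<open>(a, b, st)\<close> stands for the constraint \<open>a \<bullet> x \<le> b\<close>, or \<open>a \<bullet> x < b\<close> if \<open>st\<close> holds.\<close>

type_synonym 'v lin_constraint = "('v \<Rightarrow> real) \<times> real \<times> bool"

definition lin_sat :: "'v set \<Rightarrow> ('v \<Rightarrow> real) \<Rightarrow> 'v lin_constraint \<Rightarrow> bool" where
  "lin_sat V x k \<longleftrightarrow> (case k of (a, b, st) \<Rightarrow>
     (\<Sum>v\<in>V. a v * x v) \<le> b \<and> (st \<longrightarrow> (\<Sum>v\<in>V. a v * x v) < b))"

text \<open>Scaling is restricted to \<open>r > 0\<close> so that strictness survives; a sum is
  strict as soon as one summand is.\<close>

inductive_set lin_cone :: "'v lin_constraint set \<Rightarrow> 'v lin_constraint set" for K where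
  base: "k \<in> K \<Longrightarrow> k \<in> lin_cone K"
| scale: "(a, b, st) \<in> lin_cone K \<Longrightarrow> r > 0 \<Longrightarrow> (\<lambda>v. r * a v, r * b, st) \<in> lin_cone K"
| add: "(a, b, st) \<in> lin_cone K \<Longrightarrow> (a', b', st') \<in> lin_cone K \<Longrightarrow>
    (\<lambda>v. a v + a' v, b + b', st \<or> st') \<in> lin_cone K"

lemma lin_cone_mono:
  assumes "k \<in> lin_cone K'" "K' \<subseteq> lin_cone K"
  shows "k \<in> lin_cone K"
  using assms by induction (auto intro: lin_cone.intros)

text \<open>The one-variable case of solvability. Between the largest lower and the least upper
  bound the midpoint works; if the two coincide, the pairwise condition says that no bound attained
  there is strict.\<close>

lemma separate_bounds:
  fixes A B :: "(real \<times> bool) set"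
  assumes fin: "finite A" "finite B"
    and AB: "\<And>l s u t. (l, s) \<in> A \<Longrightarrow> (u, t) \<in> B \<Longrightarrow> l \<le> u \<and> (s \<or> t \<longrightarrow> l < u)"
  shows "\<exists>y. (\<forall>(l, s)\<in>A. l \<le> y \<and> (s \<longrightarrow> l < y)) \<and> (\<forall>(u, t)\<in>B. y \<le> u \<and> (t \<longrightarrow> y < u))"
proof (cases "A = {} \<or> B = {}")
  case True
  then show ?thesis
  proof
    assume "A = {}"
    \<comment> \<open>\<open>insert 0\<close> provides a nonempty set in case \<open>B\<close> is
      empty as well.\<close>
    have "Min (insert 0 (fst ` B)) - 1 < u" if "(u, t) \<in> B" for u t
    proof -
      have "Min (insert 0 (fst ` B)) \<le> u" using fin that by (intro Min_le) force+
      then show ?thesis by simp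
    qed
    with \<open>A = {}\<close> show ?thesis by (intro exI[of _ "Min (insert 0 (fst ` B)) - 1"]) (auto intro: less_imp_le)
  next
    assume "B = {}"
    have "l < Max (insert 0 (fst ` A)) + 1" if "(l, t) \<in> A" for l t
    proof -
      have "l \<le> Max (insert 0 (fst ` A))" using fin that by (intro Max_ge) force+
      then show ?thesis by simp
    qed
    with \<open>B = {}\<close> show ?thesis by (intro exI[of _ "Max (insert 0 (fst ` A)) + 1"]) (auto intro: less_imp_le)
  qed
next
  case False
  define l where "l = Max (fst ` A)"
  define u where "u = Min (fst ` B)"
  have "l \<in> fst ` A" unfolding l_def using fin False by (intro Max_in) auto
  then obtain sl where sl: "(l, sl) \<in> A" by auto
  have "u \<in> fst ` B" unfolding u_def using fin False by (intro Min_in) auto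
  then obtain su where su: "(u, su) \<in> B" by auto
  have lA: "l' \<le> l" if "(l', s) \<in> A" for l' s
    unfolding l_def using fin that by (intro Max_ge) force+
  have uB: "u \<le> u'" if "(u', s) \<in> B" for u' s
    unfolding u_def using fin that by (intro Min_le) force+
  have "l \<le> u" using AB[OF sl su] by simp
  show ?thesis
  proof (cases "l < u")
    case True
    show ?thesis
    proof (intro exI[of _ "(l + u) / 2"] conjI ballI)
      fix k assume "k \<in> A"
      then show "case k of (l', s) \<Rightarrow> l' \<le> (l + u) / 2 \<and> (s \<longrightarrow> l' < (l + u) / 2)"
        using lA True by (cases k) force
    next
      fix k assume "k \<in> B"
      then show "case k of (u', s) \<Rightarrow> (l + u) / 2 \<le> u' \<and> (s \<longrightarrow> (l + u) / 2 < u')"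
        using uB True by (cases k) force
    qed
  next
    case False
    with \<open>l \<le> u\<close> have "l = u" by simp
    show ?thesis
    proof (intro exI[of _ l] conjI ballI)
      fix k assume "k \<in> A"
      then show "case k of (l', s) \<Rightarrow> l' \<le> l \<and> (s \<longrightarrow> l' < l)"
        using lA AB[OF _ su] \<open>l = u\<close> by (cases k) force
    next
      fix k assume "k \<in> B"
      then show "case k of (u', s) \<Rightarrow> l \<le> u' \<and> (s \<longrightarrow> l < u')"
        using uB AB[OF sl] \<open>l = u\<close> by (cases k) force
    qed
  qed
qed

text \<open>Constraints with positive coefficient at \<open>w\<close> bound it from above, those
  with negative coefficient from below. The sums that cancel \<open>w\<close> say precisely that
  every lower bound is compatible with every upper bound, so infeasibility passes to the system
  without \<open>w\<close>.\<close>

lemma fourier_motzkin: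
  assumes "finite V" "finite K" "\<nexists>x. \<forall>k\<in>K. lin_sat V x k"
  shows "\<exists>a b st. (a, b, st) \<in> lin_cone K \<and> (\<forall>v\<in>V. a v = 0) \<and> (b < 0 \<or> b = 0 \<and> st)"
  using assms
proof (induction V arbitrary: K rule: finite_induct)
  case empty
  then obtain a b st where k: "(a, b, st) \<in> K" "\<not> lin_sat {} (\<lambda>_. 0) (a, b, st)"
    by (metis prod_cases3)
  then have "b < 0 \<or> b = 0 \<and> st" by (auto simp: lin_sat_def)
  with lin_cone.base[OF k(1)] show ?case by blast
next
  case (insert w V)
  define Z where "Z = {k\<in>K. fst k w = 0}"
  define Pos where "Pos = {k\<in>K. fst k w > 0}"
  define Neg where "Neg = {k\<in>K. fst k w < 0}"
  \<comment> \<open>Scaled so that \<open>w\<close> has coefficient 1 in the first and -1 in the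
    second constraint.\<close>
  define comb :: "'a lin_constraint \<Rightarrow> 'a lin_constraint \<Rightarrow> 'a lin_constraint" where
    "comb = (\<lambda>(a, b, st) (a', b', st').
       (\<lambda>v. 1 / a w * a v + 1 / - a' w * a' v, 1 / a w * b + 1 / - a' w * b', st \<or> st'))"
  define K' where "K' = Z \<union> (\<lambda>(p, m). comb p m) ` (Pos \<times> Neg)"
  have finK': "finite K'" using insert.prems(1) by (simp add: K'_def Z_def Pos_def Neg_def)
  have comb_in: "comb p m \<in> lin_cone K" if "p \<in> Pos" "m \<in> Neg" for p m
  proof -
    obtain a b st where p: "p = (a, b, st)" by (cases p) auto
    obtain a' b' st' where m: "m = (a', b', st')" by (cases m) auto
    have "a w > 0" "a' w < 0" using that p m by (auto simp: Pos_def Neg_def)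
    moreover have "(a, b, st) \<in> lin_cone K" "(a', b', st') \<in> lin_cone K"
      using that p m by (auto simp: Pos_def Neg_def intro: lin_cone.base)
    ultimately show ?thesis unfolding p m comb_def
      using lin_cone.add[OF lin_cone.scale[of a b st K "1 / a w"]
          lin_cone.scale[of a' b' st' K "1 / - a' w"]] by simp
  qed
  have sub: "K' \<subseteq> lin_cone K"
    using comb_in by (auto simp: K'_def Z_def intro: lin_cone.base)
  have zero: "fst k w = 0" if "k \<in> K'" for k
    using that unfolding K'_def by (auto simp: Z_def Pos_def Neg_def comb_def)
  have zero_cone: "fst k w = 0" if "k \<in> lin_cone K'" for k
    using that by induction (auto dest: zero)
  have "\<nexists>x. \<forall>k\<in>K'. lin_sat V x k"
  proof
    assume "\<exists>x. \<forall>k\<in>K'. lin_sat V x k"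
    then obtain x where x: "\<And>k. k \<in> K' \<Longrightarrow> lin_sat V x k" by blast
    define S where "S = (\<lambda>a :: 'a \<Rightarrow> real. \<Sum>v\<in>V. a v * x v)"
    \<comment> \<open>The bound on the value at \<open>w\<close> that a constraint imposes once the
      other variables have the values \<open>x\<close>: an upper one for \<open>Pos\<close>, a lower
      one for \<open>Neg\<close>.\<close>
    define bnd where "bnd = (\<lambda>(a, b, st). ((b - S a) / a w, st :: bool))"
    have "\<exists>y. (\<forall>(l, s)\<in>bnd ` Neg. l \<le> y \<and> (s \<longrightarrow> l < y)) \<and> (\<forall>(u, t)\<in>bnd ` Pos. y \<le> u \<and> (t \<longrightarrow> y < u))"
    proof (rule separate_bounds)
      show "finite (bnd ` Neg)" "finite (bnd ` Pos)"
        using insert.prems(1) by (auto simp: Neg_def Pos_def)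
      fix l s u t assume "(l, s) \<in> bnd ` Neg" "(u, t) \<in> bnd ` Pos"
      then obtain a b a' b' where
        m: "(a', b', s) \<in> Neg" "l = (b' - S a') / a' w" and
        p: "(a, b, t) \<in> Pos" "u = (b - S a) / a w"
        by (auto simp: bnd_def)
      have sgn: "a w > 0" "a' w < 0" using p m by (auto simp: Pos_def Neg_def)
      have "comb (a, b, t) (a', b', s) \<in> K'" using p m by (force simp: K'_def)
      from x[OF this] have
        "S (\<lambda>v. 1 / a w * a v + 1 / - a' w * a' v) \<le> 1 / a w * b + 1 / - a' w * b' \<and>
         (t \<or> s \<longrightarrow> S (\<lambda>v. 1 / a w * a v + 1 / - a' w * a' v) < 1 / a w * b + 1 / - a' w * b')"
        by (simp add: lin_sat_def comb_def S_def)
      moreover have "S (\<lambda>v. 1 / a w * a v + 1 / - a' w * a' v) = 1 / a w * S a + 1 / - a' w * S a'"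
        unfolding S_def sum_distrib_left sum.distrib[symmetric]
        by (intro sum.cong) (auto simp: algebra_simps)
      moreover have "(1 / a w * b + 1 / - a' w * b') - (1 / a w * S a + 1 / - a' w * S a') = u - l"
        unfolding p(2) m(2) by (simp add: diff_divide_distrib)
      ultimately show "l \<le> u \<and> (s \<or> t \<longrightarrow> l < u)" by linarith
    qed
    then obtain y where y: "\<forall>(l, s)\<in>bnd ` Neg. l \<le> y \<and> (s \<longrightarrow> l < y)"
      "\<forall>(u, t)\<in>bnd ` Pos. y \<le> u \<and> (t \<longrightarrow> y < u)" by (elim exE conjE)
    have yl: "l \<le> y \<and> (s \<longrightarrow> l < y)" if "(l, s) \<in> bnd ` Neg" for l s
      using bspec[OF y(1) that] by simp
    have yu: "y \<le> u \<and> (t \<longrightarrow> y < u)" if "(u, t) \<in> bnd ` Pos" for u t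
      using bspec[OF y(2) that] by simp
    define x' where "x' = x(w := y)"
    have Sx': "(\<Sum>v\<in>insert w V. a v * x' v) = a w * y + S a" for a
    proof -
      have "(\<Sum>v\<in>V. a v * x' v) = S a" unfolding S_def x'_def
        using insert.hyps by (intro sum.cong) auto
      then show ?thesis using insert.hyps by (simp add: x'_def)
    qed
    have "lin_sat (insert w V) x' k" if "k \<in> K" for k
    proof -
      obtain a b st where k: "k = (a, b, st)" by (cases k) auto
      consider "a w = 0" | "a w > 0" | "a w < 0" by linarith
      then have "a w * y + S a \<le> b \<and> (st \<longrightarrow> a w * y + S a < b)"
      proof cases
        case 1
        then have "k \<in> K'" using that k by (auto simp: K'_def Z_def)
        from x[OF this] show ?thesis using 1 by (simp add: k lin_sat_def S_def)
      next
        case 2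
        then have "k \<in> Pos" using that k by (auto simp: Pos_def)
        then have "((b - S a) / a w, st) \<in> bnd ` Pos" unfolding k bnd_def by force
        from yu[OF this] show ?thesis using 2 by (auto simp: field_simps)
      next
        case 3
        then have "k \<in> Neg" using that k by (auto simp: Neg_def)
        then have "((b - S a) / a w, st) \<in> bnd ` Neg" unfolding k bnd_def by force
        from yl[OF this] show ?thesis using 3 by (auto simp: field_simps)
      qed
      then show ?thesis by (simp add: k lin_sat_def Sx')
    qed
    with insert.prems(2) show False by blast
  qed
  from insert.IH[OF finK' this] obtain a b st where
    k: "(a, b, st) \<in> lin_cone K'" "\<forall>v\<in>V. a v = 0" "b < 0 \<or> b = 0 \<and> st" by blast
  from zero_cone[OF k(1)] have "a w = 0" by simp
  with k lin_cone_mono[OF k(1) sub] show ?case by (intro exI[of _ a] exI[of _ b] exI[of _ st]) auto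
qed

text \<open>Makes the multipliers explicit. They are attached to indices rather than to triples, so
  distinct indices may carry the same constraint.\<close>

lemma lin_cone_combination:
  fixes a :: "'c \<Rightarrow> 'v \<Rightarrow> real"
  assumes "k \<in> lin_cone ((\<lambda>c. (a c, b c, st c)) ` C)" "finite C"
  shows "\<exists>l. (\<forall>c\<in>C. l c \<ge> 0) \<and> (\<forall>v. fst k v = (\<Sum>c\<in>C. l c * a c v)) \<and>
     fst (snd k) = (\<Sum>c\<in>C. l c * b c) \<and> (snd (snd k) \<longrightarrow> (\<exists>c\<in>C. st c \<and> l c > 0))"
  using assms(1)
proof induction
  case (base k)
  then obtain c0 where c0: "c0 \<in> C" "k = (a c0, b c0, st c0)" by auto
  have *: "(\<Sum>c\<in>C. (if c = c0 then 1 else 0) * f c) = f c0" for f :: "'c \<Rightarrow> real"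
    using c0 assms(2) by (simp add: if_distrib[where f = "\<lambda>x. x * _"] sum.delta cong: if_cong)
  show ?case
    by (rule exI[of _ "\<lambda>c. if c = c0 then 1 else 0"]) (use * c0 in auto)
next
  case (scale a' b' st' r)
  then obtain l where l: "\<forall>c\<in>C. l c \<ge> 0" "\<forall>v. a' v = (\<Sum>c\<in>C. l c * a c v)"
    "b' = (\<Sum>c\<in>C. l c * b c)" "st' \<longrightarrow> (\<exists>c\<in>C. st c \<and> l c > 0)" by auto
  show ?case
    by (rule exI[of _ "\<lambda>c. r * l c"]) (use l scale.hyps in \<open>auto simp: sum_distrib_left mult.assoc\<close>)
next
  case (add a1 b1 st1 a2 b2 st2)
  from add.IH(1) obtain l where l: "\<forall>c\<in>C. l c \<ge> 0" "\<forall>v. a1 v = (\<Sum>c\<in>C. l c * a c v)"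
    "b1 = (\<Sum>c\<in>C. l c * b c)" "st1 \<longrightarrow> (\<exists>c\<in>C. st c \<and> l c > 0)" by auto
  from add.IH(2) obtain m where m: "\<forall>c\<in>C. m c \<ge> 0" "\<forall>v. a2 v = (\<Sum>c\<in>C. m c * a c v)"
    "b2 = (\<Sum>c\<in>C. m c * b c)" "st2 \<longrightarrow> (\<exists>c\<in>C. st c \<and> m c > 0)" by auto
  have "\<exists>c\<in>C. st c \<and> l c + m c > 0" if "st1 \<or> st2"
    using that l(1,4) m(1,4) by (meson add_nonneg_pos add_pos_nonneg)
  then show ?case
    by (intro exI[of _ "\<lambda>c. l c + m c"]) (use l m in \<open>auto simp: sum.distrib algebra_simps\<close>)
qed

text \<open>The combined constraint has left side zero and must be false: either its right side is
  negative, or it is zero and a strict constraint takes part. Keeping track of strictness is what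
  yields strict complementarity later.\<close>

theorem motzkin_transposition:
  fixes a :: "'c \<Rightarrow> 'v \<Rightarrow> real"
  assumes "finite V" "finite C"
    and "\<nexists>x. \<forall>c\<in>C. (\<Sum>v\<in>V. a c v * x v) \<le> b c \<and> (st c \<longrightarrow> (\<Sum>v\<in>V. a c v * x v) < b c)"
  shows "\<exists>l. (\<forall>c\<in>C. l c \<ge> 0) \<and> (\<forall>v\<in>V. (\<Sum>c\<in>C. l c * a c v) = 0) \<and>
    (\<Sum>c\<in>C. l c * b c) \<le> 0 \<and> ((\<Sum>c\<in>C. l c * b c) = 0 \<longrightarrow> (\<exists>c\<in>C. st c \<and> l c > 0))"
proof -
  have "\<nexists>x. \<forall>k\<in>(\<lambda>c. (a c, b c, st c)) ` C. lin_sat V x k"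
    using assms(3) by (simp add: lin_sat_def)
  from fourier_motzkin[OF assms(1) finite_imageI[OF assms(2)] this] obtain a' b' st' where
    k: "(a', b', st') \<in> lin_cone ((\<lambda>c. (a c, b c, st c)) ` C)" "\<forall>v\<in>V. a' v = 0"
      "b' < 0 \<or> b' = 0 \<and> st'" by blast
  from lin_cone_combination[OF k(1) assms(2)] obtain l where
    l: "\<forall>c\<in>C. l c \<ge> 0" "\<forall>v. a' v = (\<Sum>c\<in>C. l c * a c v)"
      "b' = (\<Sum>c\<in>C. l c * b c)" "st' \<longrightarrow> (\<exists>c\<in>C. st c \<and> l c > 0)" by auto
  show ?thesis by (rule exI[of _ l]) (use l k in auto)
qed

section \<open>Linear programming duality for packing problems\<close>

text \<open>\<open>G_nz\<close> bounds the program. \<open>axis\<close> forces every solution of the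
  dual constraints to be positive in each coordinate, and this in turn makes all primal constraints
  tight on the optimal face.\<close>

locale packing_lp =
  fixes I :: "'i set" and T :: "'g set" and G :: "'g \<Rightarrow> 'i \<Rightarrow> real"
  assumes finI: "finite I" and finT: "finite T" and I_ne: "I \<noteq> {}"
    and G_nonneg: "\<And>g i. g \<in> T \<Longrightarrow> i \<in> I \<Longrightarrow> 0 \<le> G g i"
    and axis: "\<And>i. i \<in> I \<Longrightarrow> \<exists>g\<in>T. G g i > 0 \<and> (\<forall>j\<in>I - {i}. G g j = 0)"
    and G_nz: "\<And>g. g \<in> T \<Longrightarrow> \<exists>i\<in>I. G g i > 0"
begin

definition feasible :: "('g \<Rightarrow> real) set" where
  "feasible = {c. (\<forall>g. g \<notin> T \<longrightarrow> c g = 0) \<and> (\<forall>g\<in>T. 0 \<le> c g) \<and> (\<forall>i\<in>I. (\<Sum>g\<in>T. c g * G g i) \<le> 1)}"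

definition value_lp :: real where
  "value_lp = (SUP c\<in>feasible. \<Sum>g\<in>T. c g)"

definition face :: "('g \<Rightarrow> real) set" where
  "face = {c \<in> feasible. (\<Sum>g\<in>T. c g) = value_lp}"

lemma feasible_bound:
  "\<exists>B. \<forall>c\<in>feasible. (\<Sum>g\<in>T. c g) \<le> B"
proof -
  from G_nz obtain h where h: "\<And>g. g \<in> T \<Longrightarrow> h g \<in> I \<and> G g (h g) > 0" by metis
  have "(\<Sum>g\<in>T. c g) \<le> (\<Sum>g\<in>T. 1 / G g (h g))" if "c \<in> feasible" for c
  proof (rule sum_mono)
    fix g assume g: "g \<in> T"
    have "c g * G g (h g) \<le> (\<Sum>g'\<in>T. c g' * G g' (h g))"
      using that g h[OF g] G_nonneg finT unfolding feasible_def
      by (intro member_le_sum) auto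
    also have "\<dots> \<le> 1" using that h[OF g] unfolding feasible_def by auto
    finally show "c g \<le> 1 / G g (h g)" using h[OF g] by (simp add: field_simps)
  qed
  then show ?thesis by blast
qed

lemma zero_feasible: "(\<lambda>_. 0) \<in> feasible"
  by (simp add: feasible_def)

lemma obj_le_value: "c \<in> feasible \<Longrightarrow> (\<Sum>g\<in>T. c g) \<le> value_lp"
  unfolding value_lp_def using feasible_bound by (intro cSUP_upper) (auto simp: bdd_above_def)

lemma value_le: "(\<And>c. c \<in> feasible \<Longrightarrow> (\<Sum>g\<in>T. c g) \<le> B) \<Longrightarrow> value_lp \<le> B"
  unfolding value_lp_def using zero_feasible by (intro cSUP_least) auto

lemma value_pos: "value_lp > 0"
proof -
  from I_ne obtain i where "i \<in> I" by blast
  with axis obtain g where g: "g \<in> T" by blast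
  define B where "B = (\<Sum>i\<in>I. G g i) + 1"
  have B: "B > 0" unfolding B_def using G_nonneg[OF g] by (intro add_nonneg_pos sum_nonneg) auto
  define c where "c = (\<lambda>g'. if g' = g then 1 / B else 0)"
  have sum_c: "(\<Sum>g'\<in>T. c g' * f g') = f g / B" for f :: "'g \<Rightarrow> real"
    unfolding c_def using g finT by (simp add: if_distrib[where f = "\<lambda>x. x * _"] sum.delta cong: if_cong)
  have "G g i \<le> B" if "i \<in> I" for i
    unfolding B_def using that finI G_nonneg[OF g] member_le_sum[of i I "G g"] by auto
  then have "\<forall>i\<in>I. (\<Sum>g'\<in>T. c g' * G g' i) \<le> 1" unfolding sum_c using B by simp
  then have "c \<in> feasible" unfolding feasible_def using g B by (simp add: c_def)
  from obj_le_value[OF this] sum_c[of "\<lambda>_. 1"] have "1 / B \<le> value_lp" by simp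
  moreover have "1 / B > 0" using B by simp
  ultimately show ?thesis by linarith
qed

text \<open>Attainment without compactness: if no feasible \<open>c\<close> reached
  \<open>value_lp\<close>, the multipliers of the infeasible system would form a dual solution of
  value below \<open>value_lp\<close>, against weak duality.\<close>

lemma face_nonempty: "face \<noteq> {}"
proof
  assume "face = {}"
  \<comment> \<open>\<open>None\<close> stands for the condition that the objective is at least
    \<open>value_lp\<close>, \<open>Inl g\<close> for \<open>c g \<ge> 0\<close>, and
    \<open>Inr i\<close> for the packing constraint at \<open>i\<close>.\<close>
  define C where "C = insert None (Some ` (T <+> I))"
  have memC: "None \<in> C" "\<And>g. g \<in> T \<Longrightarrow> Some (Inl g) \<in> C" "\<And>i. i \<in> I \<Longrightarrow> Some (Inr i) \<in> C"
    by (auto simp: C_def)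
  define a :: "('g + 'i) option \<Rightarrow> 'g \<Rightarrow> real" where
    "a = (\<lambda>k g. case k of None \<Rightarrow> - 1 | Some (Inl g') \<Rightarrow> if g' = g then - 1 else 0 | Some (Inr i) \<Rightarrow> G g i)"
  define b :: "('g + 'i) option \<Rightarrow> real" where
    "b = (\<lambda>k. case k of None \<Rightarrow> - value_lp | Some (Inl g') \<Rightarrow> 0 | Some (Inr i) \<Rightarrow> 1)"
  have sumC: "(\<Sum>k\<in>C. f k) = f None + ((\<Sum>g\<in>T. f (Some (Inl g))) + (\<Sum>i\<in>I. f (Some (Inr i))))"
    for f :: "('g + 'i) option \<Rightarrow> real"
    unfolding C_def using finI finT
    by (subst sum.insert) (auto simp: sum.reindex sum.Plus)
  have "\<nexists>x. \<forall>k\<in>C. (\<Sum>g\<in>T. a k g * x g) \<le> b k \<and> (False \<longrightarrow> (\<Sum>g\<in>T. a k g * x g) < b k)"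
  proof
    assume "\<exists>x. \<forall>k\<in>C. (\<Sum>g\<in>T. a k g * x g) \<le> b k \<and> (False \<longrightarrow> (\<Sum>g\<in>T. a k g * x g) < b k)"
    then obtain x where x: "\<And>k. k \<in> C \<Longrightarrow> (\<Sum>g\<in>T. a k g * x g) \<le> b k" by blast
    define c where "c = (\<lambda>g. if g \<in> T then x g else 0)"
    have "c g \<ge> 0" if "g \<in> T" for g
      using x[of "Some (Inl g)"] that finT
      by (simp add: memC a_def b_def c_def sum_negf if_distrib[where f = "\<lambda>x. x * _"] sum.delta cong: if_cong)
    moreover have "(\<Sum>g\<in>T. c g * G g i) \<le> 1" if "i \<in> I" for i
      using x[of "Some (Inr i)"] that by (simp add: memC a_def b_def c_def mult.commute)
    ultimately have "c \<in> feasible" by (auto simp: feasible_def c_def)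
    moreover have "(\<Sum>g\<in>T. c g) \<ge> value_lp"
      using x[of None] by (simp add: memC a_def b_def c_def sum_negf)
    ultimately have "c \<in> face" using obj_le_value[of c] by (simp add: face_def)
    with \<open>face = {}\<close> show False by simp
  qed
  note no_sol = this
  have "finite C" unfolding C_def using finI finT by simp
  from motzkin_transposition[OF finT this no_sol] obtain l where
    l': "\<forall>k\<in>C. l k \<ge> 0" "\<forall>g\<in>T. (\<Sum>k\<in>C. l k * a k g) = 0"
      "(\<Sum>k\<in>C. l k * b k) \<le> 0" "(\<Sum>k\<in>C. l k * b k) \<noteq> 0" by blast
  have l: "\<And>k. k \<in> C \<Longrightarrow> l k \<ge> 0" "\<And>g. g \<in> T \<Longrightarrow> (\<Sum>k\<in>C. l k * a k g) = 0"
      "(\<Sum>k\<in>C. l k * b k) < 0" using l' by auto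
  define m where "m = l None"
  define s where "s = (\<lambda>i. l (Some (Inr i)))"
  have m0: "m \<ge> 0" and s0: "\<And>i. i \<in> I \<Longrightarrow> s i \<ge> 0" and n0: "\<And>g. g \<in> T \<Longrightarrow> l (Some (Inl g)) \<ge> 0"
    using l(1) by (auto simp: m_def s_def memC)
  have ge: "m \<le> (\<Sum>i\<in>I. s i * G g i)" if "g \<in> T" for g
    using l(2)[OF that] n0[OF that] finT that unfolding sumC
    by (simp add: a_def m_def s_def if_distrib[where f = "\<lambda>x. _ * x"] sum.delta cong: if_cong)
  have lt: "(\<Sum>i\<in>I. s i) < m * value_lp"
    using l(3) unfolding sumC by (simp add: b_def m_def s_def)
  have "m \<noteq> 0"
    using lt s0 by (metis mult_zero_left not_less sum_nonneg)
  with m0 have m: "m > 0" by simp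
  have "value_lp \<le> (\<Sum>i\<in>I. s i) / m"
  proof (rule value_le)
    fix c assume c: "c \<in> feasible"
    have "m * (\<Sum>g\<in>T. c g) \<le> (\<Sum>g\<in>T. c g * (\<Sum>i\<in>I. s i * G g i))"
    proof -
      have "m * (\<Sum>g\<in>T. c g) = (\<Sum>g\<in>T. c g * m)" by (simp add: sum_distrib_left mult.commute)
      also have "\<dots> \<le> (\<Sum>g\<in>T. c g * (\<Sum>i\<in>I. s i * G g i))"
        using c ge by (intro sum_mono mult_left_mono) (auto simp: feasible_def)
      finally show ?thesis .
    qed
    also have "\<dots> = (\<Sum>i\<in>I. s i * (\<Sum>g\<in>T. c g * G g i))"
      unfolding sum_distrib_left by (subst sum.swap) (simp add: mult_ac)
    also have "\<dots> \<le> (\<Sum>i\<in>I. s i * 1)"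
      using c s0 by (intro sum_mono mult_left_mono) (auto simp: feasible_def)
    finally show "(\<Sum>g\<in>T. c g) \<le> (\<Sum>i\<in>I. s i) / m" using m by (simp add: field_simps)
  qed
  with lt m show False by (simp add: field_simps)
qed

text \<open>Convexity of the face, in the form that merges one optimal solution per column into a
  solution positive on the whole support.\<close>

lemma face_average:
  assumes "finite N" "N \<noteq> {}" "\<And>k. k \<in> N \<Longrightarrow> c k \<in> face"
  shows "(\<lambda>g. (\<Sum>k\<in>N. c k g) / card N) \<in> face"
proof -
  have N: "real (card N) > 0" using assms by (simp add: card_gt_0_iff)
  have f: "c k \<in> feasible" "(\<Sum>g\<in>T. c k g) = value_lp" if "k \<in> N" for k
    using assms(3)[OF that] by (auto simp: face_def)
  have swap: "(\<Sum>g\<in>T. (\<Sum>k\<in>N. c k g) / card N * f g) = (\<Sum>k\<in>N. \<Sum>g\<in>T. c k g * f g) / card N"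
    for f :: "'g \<Rightarrow> real"
    by (subst sum.swap) (simp add: sum_divide_distrib sum_distrib_right)
  have "(\<Sum>k\<in>N. \<Sum>g\<in>T. c k g * G g i) / card N \<le> 1" if "i \<in> I" for i
  proof -
    have "(\<Sum>k\<in>N. \<Sum>g\<in>T. c k g * G g i) \<le> (\<Sum>k\<in>N. 1)"
      using f that by (intro sum_mono) (auto simp: feasible_def)
    then show ?thesis using N by (simp add: field_simps)
  qed
  then have "\<forall>i\<in>I. (\<Sum>g\<in>T. (\<Sum>k\<in>N. c k g) / card N * G g i) \<le> 1"
    unfolding swap by blast
  moreover have "(\<Sum>k\<in>N. c k g) / card N \<ge> 0" if "g \<in> T" for g
    using f(1) that by (intro divide_nonneg_nonneg sum_nonneg) (auto simp: feasible_def)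
  moreover have "(\<Sum>k\<in>N. c k g) / card N = 0" if "g \<notin> T" for g
    using f(1) that by (auto simp: feasible_def)
  ultimately have "(\<lambda>g. (\<Sum>k\<in>N. c k g) / card N) \<in> feasible"
    unfolding feasible_def by blast
  moreover have "(\<Sum>g\<in>T. (\<Sum>k\<in>N. c k g) / card N) = value_lp"
    using swap[of "\<lambda>_. 1"] f N by simp
  ultimately show ?thesis by (simp add: face_def)
qed

definition supp_face :: "'g set" where
  "supp_face = {g\<in>T. \<exists>c\<in>face. c g > 0}"

lemma supp_face_subset: "supp_face \<subseteq> T"
  by (auto simp: supp_face_def)

lemma finite_supp_face: "finite supp_face"
  using supp_face_subset finT by (rule finite_subset)

lemma face_zero: "c \<in> face \<Longrightarrow> g \<notin> supp_face \<Longrightarrow> c g = 0"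
proof (cases "g \<in> T")
  case True
  assume "c \<in> face" "g \<notin> supp_face"
  then have "\<not> c g > 0" "0 \<le> c g" using True by (auto simp: supp_face_def face_def feasible_def)
  then show ?thesis by simp
qed (auto simp: face_def feasible_def)

lemma interior_face_point: "\<exists>c\<in>face. \<forall>g\<in>supp_face. c g > 0"
proof -
  have "\<forall>g\<in>supp_face. \<exists>c\<in>face. c g > 0" by (auto simp: supp_face_def)
  then obtain C where C: "\<And>g. g \<in> supp_face \<Longrightarrow> C g \<in> face" "\<And>g. g \<in> supp_face \<Longrightarrow> C g g > 0" by metis
  have ne: "supp_face \<noteq> {}"
  proof
    assume *: "supp_face = {}"
    from face_nonempty obtain c where c: "c \<in> face" by blast
    then have "(\<Sum>g\<in>T. c g) = 0" using face_zero[OF c] * by simp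
    with c value_pos show False by (simp add: face_def)
  qed
  define c where "c = (\<lambda>g. (\<Sum>k\<in>supp_face. C k g) / card supp_face)"
  have "c g > 0" if "g \<in> supp_face" for g
  proof -
    have "C g g \<le> (\<Sum>k\<in>supp_face. C k g)"
      using C that finite_supp_face supp_face_subset
      by (intro member_le_sum) (auto simp: face_def feasible_def)
    then show ?thesis unfolding c_def using C(2)[OF that] ne finite_supp_face
      by (intro divide_pos_pos) (auto simp: card_gt_0_iff)
  qed
  moreover have "c \<in> face" unfolding c_def by (rule face_average[OF finite_supp_face ne C(1)])
  ultimately show ?thesis by blast
qed

text \<open>The dual constraints are imposed strictly off \<open>supp_face\<close>. Were this
  infeasible, the multipliers would rescale to an optimal primal solution that is positive at a
  column outside \<open>supp_face\<close>. Equality on the support is complementary slackness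
  against an interior point of the face, and \<open>s i > 0\<close> comes from the column on the
  axis \<open>i\<close>.\<close>

lemma strictly_complementary_dual:
  obtains s where "\<And>i. i \<in> I \<Longrightarrow> s i > 0" "(\<Sum>i\<in>I. s i) = value_lp"
    "\<And>g. g \<in> supp_face \<Longrightarrow> (\<Sum>i\<in>I. s i * G g i) = 1"
    "\<And>g. g \<in> T - supp_face \<Longrightarrow> (\<Sum>i\<in>I. s i * G g i) > 1"
proof -
  define C where "C = insert None (Some ` (T <+> I))"
  have memC: "None \<in> C" "\<And>g. g \<in> T \<Longrightarrow> Some (Inl g) \<in> C" "\<And>i. i \<in> I \<Longrightarrow> Some (Inr i) \<in> C"
    by (auto simp: C_def)
  define a :: "('g + 'i) option \<Rightarrow> 'i \<Rightarrow> real" where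
    "a = (\<lambda>k i. case k of None \<Rightarrow> 1 | Some (Inl g) \<Rightarrow> - G g i | Some (Inr j) \<Rightarrow> if j = i then - 1 else 0)"
  define b :: "('g + 'i) option \<Rightarrow> real" where
    "b = (\<lambda>k. case k of None \<Rightarrow> value_lp | Some (Inl g) \<Rightarrow> - 1 | Some (Inr i) \<Rightarrow> 0)"
  define st :: "('g + 'i) option \<Rightarrow> bool" where
    "st = (\<lambda>k. case k of None \<Rightarrow> False | Some (Inl g) \<Rightarrow> g \<notin> supp_face | Some (Inr i) \<Rightarrow> False)"
  have sumC: "(\<Sum>k\<in>C. f k) = f None + ((\<Sum>g\<in>T. f (Some (Inl g))) + (\<Sum>i\<in>I. f (Some (Inr i))))"
    for f :: "('g + 'i) option \<Rightarrow> real"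
    unfolding C_def using finI finT
    by (subst sum.insert) (auto simp: sum.reindex sum.Plus)
  have "\<exists>x. \<forall>k\<in>C. (\<Sum>i\<in>I. a k i * x i) \<le> b k \<and> (st k \<longrightarrow> (\<Sum>i\<in>I. a k i * x i) < b k)"
  proof (rule ccontr)
    assume no: "\<not> ?thesis"
    have "finite C" unfolding C_def using finI finT by simp
    from motzkin_transposition[OF finI this no] obtain l where
      l': "\<forall>k\<in>C. l k \<ge> 0" "\<forall>i\<in>I. (\<Sum>k\<in>C. l k * a k i) = 0"
        "(\<Sum>k\<in>C. l k * b k) \<le> 0" "(\<Sum>k\<in>C. l k * b k) = 0 \<longrightarrow> (\<exists>k\<in>C. st k \<and> l k > 0)"
      by blast
    note l = l'(1)[rule_format] l'(2)[rule_format] l'(3) l'(4)[rule_format]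
    define m where "m = l None"
    define c where "c = (\<lambda>g. if g \<in> T then l (Some (Inl g)) else 0)"
    have m0: "m \<ge> 0" and c0: "\<And>g. c g \<ge> 0" and n0: "\<And>i. i \<in> I \<Longrightarrow> l (Some (Inr i)) \<ge> 0"
      using l(1) by (auto simp: m_def c_def memC)
    have le: "(\<Sum>g\<in>T. c g * G g i) \<le> m" if "i \<in> I" for i
      using l(2)[OF that] n0[OF that] finI that unfolding sumC
      by (simp add: a_def m_def c_def sum_negf if_distrib[where f = "\<lambda>x. _ * x"] sum.delta cong: if_cong)
    have obj: "m * value_lp \<le> (\<Sum>g\<in>T. c g)"
      using l(3) unfolding sumC by (simp add: b_def m_def c_def sum_negf)
    have strict: "\<exists>g\<in>T - supp_face. c g > 0" if "m * value_lp = (\<Sum>g\<in>T. c g)"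
    proof -
      have "(\<Sum>k\<in>C. l k * b k) = 0" using that unfolding sumC by (simp add: b_def m_def c_def sum_negf)
      from l(4)[OF this] show ?thesis by (auto simp: C_def st_def c_def)
    qed
    \<comment> \<open>For \<open>m = 0\<close> the constraints force \<open>c = 0\<close>; both
      sides of \<open>obj\<close> vanish, and \<open>strict\<close> would demand a positive
      entry.\<close>
    have "m \<noteq> 0"
    proof
      assume "m = 0"
      have "c g = 0" if g: "g \<in> T" for g
      proof -
        from G_nz[OF g] obtain i where i: "i \<in> I" "G g i > 0" by blast
        have "c g * G g i \<le> (\<Sum>g\<in>T. c g * G g i)"
          using g i c0 G_nonneg finT by (intro member_le_sum) auto
        with le[OF i(1)] \<open>m = 0\<close> have "c g * G g i \<le> 0" by simp
        with i c0[of g] show ?thesis by (simp add: mult_le_0_iff)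
      qed
      with strict \<open>m = 0\<close> show False by auto
    qed
    with m0 have m: "m > 0" by simp
    define c' where "c' = (\<lambda>g. c g / m)"
    have "\<forall>i\<in>I. (\<Sum>g\<in>T. c' g * G g i) \<le> 1"
      using m le by (simp add: c'_def sum_divide_distrib[symmetric])
    moreover have "\<forall>g\<in>T. 0 \<le> c' g" using c0 m by (simp add: c'_def)
    moreover have "\<forall>g. g \<notin> T \<longrightarrow> c' g = 0" by (simp add: c'_def c_def)
    ultimately have "c' \<in> feasible" unfolding feasible_def by blast
    moreover have obj': "(\<Sum>g\<in>T. c' g) \<ge> value_lp" using obj m
      by (simp add: c'_def sum_divide_distrib[symmetric] field_simps)
    ultimately have face: "c' \<in> face" using obj_le_value[of c'] by (simp add: face_def)
    then have "m * value_lp = (\<Sum>g\<in>T. c g)" using m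
      by (simp add: face_def c'_def sum_divide_distrib[symmetric] field_simps)
    from strict[OF this] obtain g where "g \<in> T - supp_face" "c g > 0" by blast
    with face_zero[OF face, of g] m show False by (simp add: c'_def)
  qed
  then obtain s where s: "\<And>k. k \<in> C \<Longrightarrow> (\<Sum>i\<in>I. a k i * s i) \<le> b k \<and> (st k \<longrightarrow> (\<Sum>i\<in>I. a k i * s i) < b k)"
    by blast
  have s0: "s i \<ge> 0" if "i \<in> I" for i
    using s[of "Some (Inr i)"] that finI
    by (simp add: memC a_def b_def st_def if_distrib[where f = "\<lambda>x. x * _"] sum.delta cong: if_cong)
  have sum_le: "(\<Sum>i\<in>I. s i) \<le> value_lp"
    using s[of None] by (simp add: memC a_def b_def)
  have ge1: "(\<Sum>i\<in>I. s i * G g i) \<ge> 1" if "g \<in> T" for g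
    using s[of "Some (Inl g)"] that by (simp add: memC a_def b_def sum_negf mult.commute)
  have gt1: "(\<Sum>i\<in>I. s i * G g i) > 1" if "g \<in> T - supp_face" for g
    using s[of "Some (Inl g)"] that by (simp add: memC a_def b_def st_def sum_negf mult.commute)
  obtain c where c: "c \<in> face" "\<And>g. g \<in> supp_face \<Longrightarrow> c g > 0"
    using interior_face_point by blast
  have swap: "(\<Sum>g\<in>T. c g * (\<Sum>i\<in>I. s i * G g i)) = (\<Sum>i\<in>I. s i * (\<Sum>g\<in>T. c g * G g i))"
    unfolding sum_distrib_left by (subst sum.swap) (simp add: mult_ac)
  have le2: "(\<Sum>i\<in>I. s i * (\<Sum>g\<in>T. c g * G g i)) \<le> (\<Sum>i\<in>I. s i * 1)"
    using c s0 by (intro sum_mono mult_left_mono) (auto simp: face_def feasible_def)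
  have le1: "(\<Sum>g\<in>T. c g * 1) \<le> (\<Sum>g\<in>T. c g * (\<Sum>i\<in>I. s i * G g i))"
    using c ge1 by (intro sum_mono mult_left_mono) (auto simp: face_def feasible_def)
  have val: "(\<Sum>g\<in>T. c g) = value_lp" using c by (simp add: face_def)
  have eq: "(\<Sum>g\<in>T. c g * (\<Sum>i\<in>I. s i * G g i)) = (\<Sum>g\<in>T. c g)"
    using le1 le2 swap val sum_le by simp
  have "(\<Sum>i\<in>I. s i) = value_lp" using le1 le2 swap val sum_le by simp
  moreover have "(\<Sum>i\<in>I. s i * G g i) = 1" if "g \<in> supp_face" for g
  proof -
    have "(\<Sum>g\<in>T. c g * ((\<Sum>i\<in>I. s i * G g i) - 1)) = 0" using eq by (simp add: algebra_simps sum_subtractf)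
    moreover have "c g * ((\<Sum>i\<in>I. s i * G g i) - 1) \<ge> 0" if "g \<in> T" for g
      using ge1[OF that] c(1) that by (auto simp: face_def feasible_def)
    ultimately have "c g * ((\<Sum>i\<in>I. s i * G g i) - 1) = 0"
      using that supp_face_subset finT by (subst (asm) sum_nonneg_eq_0_iff) auto
    with c(2)[OF that] show ?thesis by simp
  qed
  moreover have "s i > 0" if i: "i \<in> I" for i
  proof -
    from axis[OF i] obtain g where g: "g \<in> T" "G g i > 0" "\<forall>j\<in>I - {i}. G g j = 0" by blast
    have "(\<Sum>j\<in>I. s j * G g j) = s i * G g i"
      using g(3) i finI by (subst sum.remove[OF finI i]) simp
    with ge1[OF g(1)] s0[OF i] show ?thesis by (cases "s i = 0") auto
  qed
  ultimately show thesis using gt1 by (intro that) auto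
qed

text \<open>Complementary slackness from the other side: all dual weights are positive, so no
  constraint can be slack. Together with \<open>face_intro\<close> this describes the optimal face
  as the nonnegative solutions of \<open>G c = 1\<close> on its support.\<close>

lemma face_tight:
  assumes "c \<in> face" "i \<in> I"
  shows "(\<Sum>g\<in>supp_face. c g * G g i) = 1"
proof -
  obtain s where s: "\<And>i. i \<in> I \<Longrightarrow> s i > 0" "(\<Sum>i\<in>I. s i) = value_lp"
    "\<And>g. g \<in> supp_face \<Longrightarrow> (\<Sum>i\<in>I. s i * G g i) = 1"
    using strictly_complementary_dual by metis
  have red: "(\<Sum>g\<in>T. c g * f g) = (\<Sum>g\<in>supp_face. c g * f g)" for f :: "'g \<Rightarrow> real"
    using face_zero[OF assms(1)] supp_face_subset finT by (intro sum.mono_neutral_right) auto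
  have "value_lp = (\<Sum>g\<in>supp_face. c g * (\<Sum>i\<in>I. s i * G g i))"
    using assms(1) red[of "\<lambda>_. 1"] s(3) by (simp add: face_def)
  also have "\<dots> = (\<Sum>i\<in>I. s i * (\<Sum>g\<in>supp_face. c g * G g i))"
    unfolding sum_distrib_left by (subst sum.swap) (simp add: mult_ac)
  finally have "(\<Sum>i\<in>I. s i * (1 - (\<Sum>g\<in>supp_face. c g * G g i))) = 0"
    using s(2) by (simp add: algebra_simps sum_subtractf)
  moreover have "s i * (1 - (\<Sum>g\<in>supp_face. c g * G g i)) \<ge> 0" if "i \<in> I" for i
    using assms(1) s(1)[OF that] that red[of "\<lambda>g. G g i"]
    by (auto simp: face_def feasible_def intro!: mult_nonneg_nonneg)
  ultimately have "s i * (1 - (\<Sum>g\<in>supp_face. c g * G g i)) = 0"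
    using assms(2) finI by (subst (asm) sum_nonneg_eq_0_iff) auto
  with s(1)[OF assms(2)] show ?thesis by simp
qed

end

text \<open>\<open>P\<close> is a maximal independent set of columns, \<open>lam\<close> gives the
  coordinates of the others, and \<open>E\<close> is a dual family for \<open>P\<close>, which reads
  pivot coordinates off a vector \<open>G z\<close>.\<close>

lemma rank_factorisation:
  fixes G :: "'g \<Rightarrow> 'i \<Rightarrow> real"
  assumes "finite I" "finite T"
  obtains P lam E where "P \<subseteq> T"
    "\<And>\<kappa>. (\<And>i. i \<in> I \<Longrightarrow> (\<Sum>p\<in>P. \<kappa> p * G p i) = 0) \<Longrightarrow> (\<forall>p\<in>P. \<kappa> p = 0)"
    "\<And>f i. f \<in> T - P \<Longrightarrow> i \<in> I \<Longrightarrow> G f i = (\<Sum>p\<in>P. lam f p * G p i)"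
    "\<And>p p'. p \<in> P \<Longrightarrow> p' \<in> P \<Longrightarrow> (\<Sum>i\<in>I. E p i * G p' i) = (if p = p' then 1 else 0)"
proof -
  define indep where "indep = (\<lambda>P. P \<subseteq> T \<and>
    (\<forall>\<kappa>. (\<forall>i\<in>I. (\<Sum>p\<in>P. \<kappa> p * G p i) = 0) \<longrightarrow> (\<forall>p\<in>P. \<kappa> p = 0)))"
  have "indep {}" by (simp add: indep_def)
  moreover have "\<forall>P. indep P \<longrightarrow> card P < Suc (card T)"
    using assms(2) by (auto simp: indep_def card_mono less_Suc_eq_le)
  ultimately have "\<exists>P. indep P \<and> (\<forall>P'. indep P' \<longrightarrow> card P' \<le> card P)"
    by (rule ex_has_greatest_nat)
  then obtain P where P: "indep P" "\<And>P'. indep P' \<Longrightarrow> card P' \<le> card P" by blast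
  then have PT: "P \<subseteq> T" and finP: "finite P" using assms(2) by (auto simp: indep_def intro: finite_subset)
  have ind: "\<forall>p\<in>P. \<kappa> p = 0" if "\<And>i. i \<in> I \<Longrightarrow> (\<Sum>p\<in>P. \<kappa> p * G p i) = 0" for \<kappa>
    using P(1) that by (auto simp: indep_def)
  have "\<exists>l. \<forall>i\<in>I. G f i = (\<Sum>p\<in>P. l p * G p i)" if f: "f \<in> T - P" for f
  proof -
    have "\<not> indep (insert f P)" using P(2)[of "insert f P"] f finP by auto
    then obtain \<kappa> where k: "\<And>i. i \<in> I \<Longrightarrow> (\<Sum>p\<in>insert f P. \<kappa> p * G p i) = 0" "\<exists>p\<in>insert f P. \<kappa> p \<noteq> 0"
      using f PT by (auto simp: indep_def)
    have k': "\<kappa> f * G f i + (\<Sum>p\<in>P. \<kappa> p * G p i) = 0" if "i \<in> I" for i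
      using k(1)[OF that] f finP by simp
    have "\<kappa> f \<noteq> 0"
    proof
      assume "\<kappa> f = 0"
      with k' ind[of \<kappa>] k(2) show False by auto
    qed
    then have "G f i = (\<Sum>p\<in>P. (- \<kappa> p / \<kappa> f) * G p i)" if "i \<in> I" for i
      using k'[OF that] by (simp add: sum_negf sum_divide_distrib[symmetric] field_simps)
    then show ?thesis by (intro exI[of _ "\<lambda>p. - \<kappa> p / \<kappa> f"]) auto
  qed
  then obtain lam where lam: "\<And>f i. f \<in> T - P \<Longrightarrow> i \<in> I \<Longrightarrow> G f i = (\<Sum>p\<in>P. lam f p * G p i)" by metis
  have "\<exists>e. \<forall>p'\<in>P. (\<Sum>i\<in>I. e i * G p' i) = (if p = p' then 1 else 0)" if p: "p \<in> P" for p
  proof (rule ccontr)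
    assume no: "\<not> ?thesis"
    \<comment> \<open>Each equation for \<open>e\<close> becomes two inequalities of opposite sign.
      The differences of their multipliers form a linear relation among the columns in
      \<open>P\<close>, which is trivial by independence.\<close>
    define sg where "sg = (\<lambda>b. if b then 1 else - 1 :: real)"
    define a where "a = (\<lambda>(p', b) i. sg b * G p' i)"
    define d where "d = (\<lambda>(p', b). sg b * (if p = p' then 1 else 0 :: real))"
    have "\<nexists>x. \<forall>c\<in>P \<times> UNIV. (\<Sum>i\<in>I. a c i * x i) \<le> d c \<and> (False \<longrightarrow> (\<Sum>i\<in>I. a c i * x i) < d c)"
    proof
      assume "\<exists>x. \<forall>c\<in>P \<times> UNIV. (\<Sum>i\<in>I. a c i * x i) \<le> d c \<and> (False \<longrightarrow> (\<Sum>i\<in>I. a c i * x i) < d c)"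
      then obtain x where x: "\<And>p' b. p' \<in> P \<Longrightarrow> (\<Sum>i\<in>I. a (p', b) i * x i) \<le> d (p', b)" by blast
      have "(\<Sum>i\<in>I. x i * G p' i) = (if p = p' then 1 else 0)" if "p' \<in> P" for p'
        using x[OF that, of True] x[OF that, of False]
        by (simp add: a_def d_def sg_def sum_negf mult.commute split: if_splits)
      with no show False by blast
    qed
    note no_sol = this
    have "finite (P \<times> (UNIV :: bool set))" using finP by simp
    from motzkin_transposition[OF assms(1) this no_sol] obtain l where
      l': "\<forall>i\<in>I. (\<Sum>c\<in>P \<times> UNIV. l c * a c i) = 0" "(\<Sum>c\<in>P \<times> UNIV. l c * d c) \<le> 0"
        "(\<Sum>c\<in>P \<times> UNIV. l c * d c) \<noteq> 0" by blast
    have l: "\<And>i. i \<in> I \<Longrightarrow> (\<Sum>c\<in>P \<times> UNIV. l c * a c i) = 0" "(\<Sum>c\<in>P \<times> UNIV. l c * d c) < 0"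
      using l' by auto
    define \<kappa> where "\<kappa> = (\<lambda>p'. l (p', True) - l (p', False))"
    have sumP: "(\<Sum>c\<in>P \<times> (UNIV :: bool set). h c) = (\<Sum>p'\<in>P. h (p', True) + h (p', False))"
      for h :: "'g \<times> bool \<Rightarrow> real"
      using sum.Sigma[of P "\<lambda>_. UNIV" "\<lambda>p b. h (p, b)"] finP by (simp add: UNIV_bool add.commute)
    have "(\<Sum>p'\<in>P. \<kappa> p' * G p' i) = 0" if "i \<in> I" for i
      using l(1)[OF that] unfolding sumP by (simp add: a_def sg_def \<kappa>_def algebra_simps)
    then have "\<forall>p\<in>P. \<kappa> p = 0" by (rule ind)
    moreover have "(\<Sum>c\<in>P \<times> UNIV. l c * d c) = (\<Sum>p'\<in>P. \<kappa> p' * (if p = p' then 1 else 0))"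
      unfolding sumP by (simp add: d_def sg_def \<kappa>_def algebra_simps)
    ultimately show False using l(2) by simp
  qed
  then obtain E where E: "\<And>p p'. p \<in> P \<Longrightarrow> p' \<in> P \<Longrightarrow> (\<Sum>i\<in>I. E p i * G p' i) = (if p = p' then 1 else 0)" by metis
  show thesis by (rule that[OF PT ind lam E])
qed

lemma sum_fun_at: "(\<Sum>a\<in>A. f a) x = (\<Sum>a\<in>A. f a x)"
  for f :: "'a \<Rightarrow> 'b \<Rightarrow> real"
  by (induction A rule: infinite_finite_induct) auto

text \<open>Optimality is automatic: pairing the tight constraints with the dual solution gives the
  objective the value \<open>value_lp\<close>.\<close>

lemma (in packing_lp) face_intro:
  assumes "\<And>g. g \<notin> supp_face \<Longrightarrow> c g = 0" "\<And>g. g \<in> supp_face \<Longrightarrow> c g \<ge> 0"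
    and "\<And>i. i \<in> I \<Longrightarrow> (\<Sum>g\<in>supp_face. c g * G g i) = 1"
  shows "c \<in> face"
proof -
  obtain s where s: "\<And>i. i \<in> I \<Longrightarrow> s i > 0" "(\<Sum>i\<in>I. s i) = value_lp"
    "\<And>g. g \<in> supp_face \<Longrightarrow> (\<Sum>i\<in>I. s i * G g i) = 1"
    using strictly_complementary_dual by metis
  have red: "(\<Sum>g\<in>T. c g * f g) = (\<Sum>g\<in>supp_face. c g * f g)" for f :: "'g \<Rightarrow> real"
    using assms(1) supp_face_subset finT by (intro sum.mono_neutral_right) auto
  have "(\<Sum>g\<in>T. c g) = (\<Sum>g\<in>supp_face. c g * (\<Sum>i\<in>I. s i * G g i))"
    using red[of "\<lambda>_. 1"] s(3) by simp
  also have "\<dots> = (\<Sum>i\<in>I. s i * (\<Sum>g\<in>supp_face. c g * G g i))"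
    unfolding sum_distrib_left by (subst sum.swap) (simp add: mult_ac)
  also have "\<dots> = value_lp" using assms(3) s(2) by simp
  finally have "(\<Sum>g\<in>T. c g) = value_lp" .
  moreover have "c \<in> feasible"
  proof -
    have "\<forall>i\<in>I. (\<Sum>g\<in>T. c g * G g i) \<le> 1" unfolding red using assms(3) by simp
    moreover have "\<forall>g. 0 \<le> c g" using assms(1,2) by (metis order_refl)
    moreover have "\<forall>g. g \<notin> T \<longrightarrow> c g = 0" using assms(1) supp_face_subset by blast
    ultimately show ?thesis unfolding feasible_def by blast
  qed
  ultimately show ?thesis by (simp add: face_def)
qed

text \<open>From a point positive on the whole support one can move in every direction of the kernel
  of \<open>G\<close>, so the dimension is the nullity, that is, the number of columns that are not
  pivots.\<close>

lemma (in packing_lp) face_dim: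
  assumes P: "P \<subseteq> supp_face"
    and ind: "\<And>\<kappa>. (\<And>i. i \<in> I \<Longrightarrow> (\<Sum>p\<in>P. \<kappa> p * G p i) = 0) \<Longrightarrow> (\<forall>p\<in>P. \<kappa> p = 0)"
    and lam: "\<And>f i. f \<in> supp_face - P \<Longrightarrow> i \<in> I \<Longrightarrow> G f i = (\<Sum>p\<in>P. lam f p * G p i)"
  shows "fun_aff_dim face = card (supp_face - P)"
proof -
  interpret V: vector_space "\<lambda>r (f :: 'g \<Rightarrow> real) x. r * f x"
    by unfold_locales (auto simp: fun_eq_iff algebra_simps)
  define F where "F = supp_face - P"
  have finF: "finite F" and finP: "finite P"
    using finite_supp_face P by (auto simp: F_def intro: finite_subset)
  have split: "(\<Sum>g\<in>supp_face. h g) = (\<Sum>g\<in>F. h g) + (\<Sum>g\<in>P. h g)" for h :: "'g \<Rightarrow> real"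
    unfolding F_def using P finite_supp_face by (simp add: sum.subset_diff)
  \<comment> \<open>The kernel vector given by the relation between the column \<open>f\<close> and
    the pivots.\<close>
  define e where "e = (\<lambda>f x. if x = f then 1 else if x \<in> P then - lam f x else (0::real))"
  have eF: "e f x = (if x = f then 1 else 0)" if "x \<in> F" for f x
    using that by (auto simp: e_def F_def)
  have e_off: "e f x = 0" if "f \<in> F" "x \<notin> supp_face" for f x
    using that P by (auto simp: e_def F_def)
  have eP: "e f x = - lam f x" if "f \<in> F" "x \<in> P" for f x
    using that by (auto simp: e_def F_def)
  have e_ker: "(\<Sum>g\<in>supp_face. e f g * G g i) = 0" if "f \<in> F" "i \<in> I" for f i
  proof -
    have "(\<Sum>g\<in>F. e f g * G g i) = G f i" using that finF
      by (simp add: eF if_distrib[where f = "\<lambda>x. x * _"] sum.delta' cong: if_cong)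
    moreover have "(\<Sum>g\<in>P. e f g * G g i) = - G f i"
      using that lam[of f i] by (simp add: eP F_def sum_negf)
    ultimately show ?thesis by (simp add: split)
  qed
  obtain c where c: "c \<in> face" "\<And>g. g \<in> supp_face \<Longrightarrow> c g > 0" using interior_face_point by blast
  have ne: "supp_face \<noteq> {}"
  proof
    assume "supp_face = {}"
    moreover obtain i where "i \<in> I" using I_ne by blast
    ultimately show False using face_tight[OF c(1)] by simp
  qed
  define m where "m = Min (c ` supp_face)"
  have m: "m > 0" "\<And>g. g \<in> supp_face \<Longrightarrow> m \<le> c g"
    using c(2) finite_supp_face ne by (auto simp: m_def)
  define K where "K = 1 + (\<Sum>f\<in>F. \<Sum>g\<in>supp_face. \<bar>e f g\<bar>)"
  have K1: "K \<ge> 1" by (simp add: K_def sum_nonneg)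
  have K: "\<bar>e f g\<bar> \<le> K" if "f \<in> F" "g \<in> supp_face" for f g
  proof -
    have "\<bar>e f g\<bar> \<le> (\<Sum>g\<in>supp_face. \<bar>e f g\<bar>)"
      using that finite_supp_face by (intro member_le_sum) auto
    also have "\<dots> \<le> (\<Sum>f\<in>F. \<Sum>g\<in>supp_face. \<bar>e f g\<bar>)"
      using that finF by (intro member_le_sum) (auto intro: sum_nonneg)
    finally show ?thesis by (simp add: K_def)
  qed
  \<comment> \<open>The entries of \<open>e f\<close> are at most \<open>K\<close> in size and those
    of \<open>c\<close> at least \<open>m\<close> on the support, so a step of this length stays
    nonnegative.\<close>
  define \<epsilon> where "\<epsilon> = m / K"
  have eps: "\<epsilon> > 0" using m K1 by (simp add: \<epsilon>_def)
  define b where "b = (\<lambda>f x. \<epsilon> * e f x)"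
  have b_in: "b f \<in> {c - c' | c c'. c \<in> face \<and> c' \<in> face}" if f: "f \<in> F" for f
  proof -
    have "(\<lambda>g. c g + b f g) \<in> face"
    proof (rule face_intro)
      show "c g + b f g = 0" if "g \<notin> supp_face" for g
        using face_zero[OF c(1) that] e_off[OF f that] by (simp add: b_def)
      show "c g + b f g \<ge> 0" if "g \<in> supp_face" for g
      proof -
        have "\<bar>b f g\<bar> \<le> \<epsilon> * K" unfolding b_def abs_mult using eps K[OF f that] by (simp add: mult_left_mono)
        also have "\<dots> = m" using K1 by (simp add: \<epsilon>_def)
        finally show ?thesis using m(2)[OF that] by linarith
      qed
      show "(\<Sum>g\<in>supp_face. (c g + b f g) * G g i) = 1" if "i \<in> I" for i
        using face_tight[OF c(1) that] e_ker[OF f that]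
        by (simp add: b_def algebra_simps sum.distrib sum_distrib_left[symmetric])
    qed
    moreover have "b f = (\<lambda>g. c g + b f g) - c" by (auto simp: fun_eq_iff)
    ultimately show ?thesis using c(1) by blast
  qed
  have inj_b: "inj_on b F"
  proof
    fix f f' assume "f \<in> F" "f' \<in> F" "b f = b f'"
    then have "\<epsilon> * e f f = \<epsilon> * e f' f" by (metis b_def)
    with eps \<open>f \<in> F\<close> show "f = f'" by (auto simp: eF split: if_splits)
  qed
  have spanning: "d \<in> V.span (b ` F)" if d: "d \<in> {c - c' | c c'. c \<in> face \<and> c' \<in> face}" for d
  proof -
    from d obtain c1 c2 where c12: "d = c1 - c2" "c1 \<in> face" "c2 \<in> face" by blast
    have d_off: "d g = 0" if "g \<notin> supp_face" for g
      using face_zero[OF c12(2) that] face_zero[OF c12(3) that] by (simp add: c12(1))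
    have d_ker: "(\<Sum>g\<in>supp_face. d g * G g i) = 0" if "i \<in> I" for i
      using face_tight[OF c12(2) that] face_tight[OF c12(3) that]
      unfolding c12(1) by (simp add: left_diff_distrib sum_subtractf)
    \<comment> \<open>Removing the components along the \<open>e f\<close> leaves a kernel vector
      supported on the pivots, which vanishes by independence.\<close>
    define r where "r = (\<lambda>x. d x - (\<Sum>f\<in>F. d f * e f x))"
    have rF: "r x = 0" if "x \<in> F" for x
      using that finF by (simp add: r_def eF if_distrib[where f = "\<lambda>x. _ * x"] sum.delta cong: if_cong)
    have "(\<Sum>g\<in>supp_face. r g * G g i) = 0" if i: "i \<in> I" for i
    proof -
      have "(\<Sum>g\<in>supp_face. (\<Sum>f\<in>F. d f * e f g) * G g i) =
          (\<Sum>f\<in>F. d f * (\<Sum>g\<in>supp_face. e f g * G g i))"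
        unfolding sum_distrib_left sum_distrib_right by (subst sum.swap) (simp add: mult_ac)
      also have "\<dots> = 0" using e_ker i by simp
      finally show ?thesis using d_ker[OF i] by (simp add: r_def algebra_simps sum_subtractf)
    qed
    then have "(\<Sum>p\<in>P. r p * G p i) = 0" if "i \<in> I" for i
      using that by (simp add: split rF)
    then have "\<forall>p\<in>P. r p = 0" by (rule ind)
    moreover have "r x = 0" if "x \<notin> supp_face" for x using that d_off e_off by (simp add: r_def)
    ultimately have "\<And>x. r x = 0" using rF by (auto simp: F_def)
    then have d_eq: "\<And>x. d x - (\<Sum>f\<in>F. d f * e f x) = 0" unfolding r_def .
    have "d = (\<Sum>f\<in>F. (\<lambda>x. (d f / \<epsilon>) * b f x))"
    proof
      fix x
      have "(\<Sum>f\<in>F. (\<lambda>x. (d f / \<epsilon>) * b f x)) x = (\<Sum>f\<in>F. d f * e f x)"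
        unfolding sum_fun_at using eps by (intro sum.cong) (auto simp: b_def)
      also have "\<dots> = d x" using d_eq[of x] by linarith
      finally show "d x = (\<Sum>f\<in>F. (\<lambda>x. (d f / \<epsilon>) * b f x)) x" by (rule sym)
    qed
    also have "\<dots> \<in> V.span (b ` F)"
      by (intro V.span_sum V.span_scale V.span_base) auto
    finally show ?thesis .
  qed
  have "V.independent (b ` F)"
  proof (rule V.independent_if_scalars_zero)
    show "finite (b ` F)" using finF by simp
    fix u v assume u: "(\<Sum>v\<in>b ` F. (\<lambda>x. u v * v x)) = 0" and "v \<in> b ` F"
    then obtain f where f: "f \<in> F" "v = b f" by blast
    have "0 = (\<Sum>v\<in>b ` F. (\<lambda>x. u v * v x)) f" using u by simp
    also have "\<dots> = (\<Sum>f'\<in>F. u (b f') * b f' f)"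
      by (simp add: sum_fun_at sum.reindex[OF inj_b])
    also have "\<dots> = (\<Sum>f'\<in>F. if f' = f then u (b f') * \<epsilon> else 0)"
      using f by (intro sum.cong) (auto simp: b_def eF)
    also have "\<dots> = u v * \<epsilon>" using f finF by simp
    finally show "u v = 0" using eps by simp
  qed
  then have "V.dim {c - c' | c c'. c \<in> face \<and> c' \<in> face} = card F"
    using b_in spanning by (intro V.dim_unique[where B = "b ` F"]) (auto simp: card_image inj_b)
  then show ?thesis unfolding fun_aff_dim_def F_def .
qed

section \<open>Integration on products of the real line\<close>

lemma product_sigma_finite_lborel: "product_sigma_finite (\<lambda>_. lborel :: real measure)"
  by (rule product_sigma_finite.intro) (rule lborel.sigma_finite_measure_axioms)

abbreviation lborel_PiM :: "'a set \<Rightarrow> ('a \<Rightarrow> real) measure" where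
  "lborel_PiM A \<equiv> PiM A (\<lambda>_. lborel)"

text \<open>Fubini reduces this to the affine substitution on the line, one coordinate at a
  time.\<close>

lemma nn_integral_PiM_affine:
  assumes "finite A" "f \<in> borel_measurable (lborel_PiM A)" "r > 0"
  shows "(\<integral>\<^sup>+z. f z \<partial>lborel_PiM A) =
    ennreal (r ^ card A) * (\<integral>\<^sup>+z. f (\<lambda>g\<in>A. t g + r * z g) \<partial>lborel_PiM A)"
  using assms(1,2)
proof (induction A arbitrary: f rule: finite_induct)
  case empty
  interpret product_sigma_finite "\<lambda>_. lborel :: real measure" by (rule product_sigma_finite_lborel)
  show ?case by (simp add: PiM_empty nn_integral_count_space_finite restrict_def)
next
  case (insert i A)
  interpret product_sigma_finite "\<lambda>_. lborel :: real measure" by (rule product_sigma_finite_lborel)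
  note [measurable] = insert.prems
  have upd: "(\<lambda>g\<in>A. t g + r * x g)(i := t i + r * y) = (\<lambda>g\<in>insert i A. t g + r * (x(i := y)) g)" for x y
    using insert.hyps by (auto simp: fun_eq_iff)
  have [measurable]: "(\<lambda>x. f (\<lambda>g\<in>insert i A. t g + r * x g)) \<in> borel_measurable (lborel_PiM (insert i A))"
    by (rule measurable_compose[OF _ insert.prems]) measurable
  have "(\<integral>\<^sup>+z. f z \<partial>lborel_PiM (insert i A)) =
      (\<integral>\<^sup>+x. (\<integral>\<^sup>+y. f (x(i := y)) \<partial>lborel) \<partial>lborel_PiM A)"
    using insert.hyps by (intro product_nn_integral_insert) auto
  also have "\<dots> = ennreal (r ^ card A) *
      (\<integral>\<^sup>+x. (\<integral>\<^sup>+y. f ((\<lambda>g\<in>A. t g + r * x g)(i := y)) \<partial>lborel) \<partial>lborel_PiM A)"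
    by (rule insert.IH) measurable
  also have "(\<integral>\<^sup>+x. (\<integral>\<^sup>+y. f ((\<lambda>g\<in>A. t g + r * x g)(i := y)) \<partial>lborel) \<partial>lborel_PiM A) =
      (\<integral>\<^sup>+x. ennreal r * (\<integral>\<^sup>+y. f ((\<lambda>g\<in>A. t g + r * x g)(i := t i + r * y)) \<partial>lborel) \<partial>lborel_PiM A)"
  proof (rule nn_integral_cong)
    fix x assume x: "x \<in> space (lborel_PiM A)"
    have "(\<lambda>g\<in>A. t g + r * x g) \<in> space (lborel_PiM A)" by (auto simp: space_PiM)
    then have "(\<lambda>y. f ((\<lambda>g\<in>A. t g + r * x g)(i := y))) \<in> borel_measurable lborel"
      by (intro measurable_compose[OF measurable_component_update insert.prems] insert.hyps)
    then show "(\<integral>\<^sup>+y. f ((\<lambda>g\<in>A. t g + r * x g)(i := y)) \<partial>lborel) =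
      ennreal r * (\<integral>\<^sup>+y. f ((\<lambda>g\<in>A. t g + r * x g)(i := t i + r * y)) \<partial>lborel)"
      using assms(3) by (subst nn_integral_real_affine[where c = r and t = "t i"]) auto
  qed
  also have "\<dots> = ennreal r * (\<integral>\<^sup>+x. (\<integral>\<^sup>+y. f (\<lambda>g\<in>insert i A. t g + r * (x(i := y)) g) \<partial>lborel) \<partial>lborel_PiM A)"
    unfolding upd
  proof (rule nn_integral_cmult)
    have "(\<lambda>(x, y). f (\<lambda>g\<in>insert i A. t g + r * (x(i := y)) g)) \<in> borel_measurable (lborel_PiM A \<Otimes>\<^sub>M lborel)"
      unfolding split_beta'
      by (rule measurable_compose[of "\<lambda>p. (fst p)(i := snd p)", OF _ \<open>(\<lambda>x. f (\<lambda>g\<in>insert i A. t g + r * x g)) \<in> _\<close>]) measurable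
    then show "(\<lambda>x. \<integral>\<^sup>+y. f (\<lambda>g\<in>insert i A. t g + r * (x(i := y)) g) \<partial>lborel) \<in> borel_measurable (lborel_PiM A)"
      by measurable
  qed
  also have "(\<integral>\<^sup>+x. (\<integral>\<^sup>+y. f (\<lambda>g\<in>insert i A. t g + r * (x(i := y)) g) \<partial>lborel) \<partial>lborel_PiM A) =
      (\<integral>\<^sup>+z. f (\<lambda>g\<in>insert i A. t g + r * z g) \<partial>lborel_PiM (insert i A))"
    using insert.hyps by (intro product_nn_integral_insert[symmetric]) auto
  also have "ennreal (r ^ card A) * (ennreal r * X) = ennreal (r ^ card (insert i A)) * X" for X
    using insert.hyps assms(3)
    by (simp add: mult.assoc[symmetric] ennreal_mult'[symmetric] mult.commute[of "r ^ card A"])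
  finally show ?case .
qed

text \<open>With the \<open>F\<close>-part fixed, the \<open>P\<close>-part is only translated, and
  the inner integral does not notice. The Jacobian is therefore \<open>r ^ card F\<close>, which is
  where the power of \<open>log X\<close> originates.\<close>

lemma nn_integral_PiM_shear:
  assumes fin: "finite F" "finite P" "F \<inter> P = {}" and r: "r > 0"
    and f[measurable]: "f \<in> borel_measurable (lborel_PiM (F \<union> P))"
    and h[measurable]: "\<And>p. p \<in> P \<Longrightarrow> h p \<in> borel_measurable (lborel_PiM (F \<union> P))"
    and hF: "\<And>p z z'. p \<in> P \<Longrightarrow> (\<And>g. g \<in> F \<Longrightarrow> z g = z' g) \<Longrightarrow> h p z = h p z'"
  shows "(\<integral>\<^sup>+z. f z \<partial>lborel_PiM (F \<union> P)) = ennreal (r ^ card F) *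
    (\<integral>\<^sup>+z. f (\<lambda>g\<in>F \<union> P. if g \<in> F then r * z g else h g z + z g) \<partial>lborel_PiM (F \<union> P))"
proof -
  interpret product_sigma_finite "\<lambda>_. lborel :: real measure" by (rule product_sigma_finite_lborel)
  interpret FP: pair_sigma_finite "lborel_PiM F" "lborel_PiM P"
    using fin by (intro pair_sigma_finite.intro sigma_finite) auto
  define S where "S = (\<lambda>z. \<lambda>g\<in>F \<union> P. if g \<in> F then r * z g else h g z + z g)"
  have S[measurable]: "S \<in> measurable (lborel_PiM (F \<union> P)) (lborel_PiM (F \<union> P))"
    unfolding S_def
  proof (rule measurable_restrict)
    fix g assume g: "g \<in> F \<union> P"
    show "(\<lambda>z. if g \<in> F then r * z g else h g z + z g) \<in> measurable (lborel_PiM (F \<union> P)) lborel"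
      using g by (cases "g \<in> F") auto
  qed
  \<comment> \<open>\<open>h\<close> ignores the \<open>P\<close>-part, so an arbitrary
    \<open>y0\<close> may stand there; the zero function is inserted below.\<close>
  have merge1: "merge F P (\<lambda>g\<in>F. 0 + r * x g, \<lambda>p\<in>P. h p (merge F P (x, y0)) + 1 * y p) = S (merge F P (x, y))" for x y y0
  proof
    fix g
    have "h g (merge F P (x, y0)) = h g (merge F P (x, y))" if "g \<in> P" using that
      by (intro hF) (auto simp: merge_def)
    then show "merge F P (\<lambda>g\<in>F. 0 + r * x g, \<lambda>p\<in>P. h p (merge F P (x, y0)) + 1 * y p) g = S (merge F P (x, y)) g"
      using fin(3) by (auto simp: S_def merge_def)
  qed
  have m[measurable]: "(\<lambda>(x, y). f (merge F P (x, y))) \<in> borel_measurable (lborel_PiM F \<Otimes>\<^sub>M lborel_PiM P)"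
    by measurable
  have "(\<integral>\<^sup>+z. f z \<partial>lborel_PiM (F \<union> P)) =
      (\<integral>\<^sup>+x. (\<integral>\<^sup>+y. f (merge F P (x, y)) \<partial>lborel_PiM P) \<partial>lborel_PiM F)"
    using fin by (intro product_nn_integral_fold) auto
  also have "\<dots> = ennreal (r ^ card F) *
      (\<integral>\<^sup>+x. (\<integral>\<^sup>+y. f (merge F P (\<lambda>g\<in>F. 0 + r * x g, y)) \<partial>lborel_PiM P) \<partial>lborel_PiM F)"
    using fin r by (intro nn_integral_PiM_affine) auto
  also have "(\<integral>\<^sup>+x. (\<integral>\<^sup>+y. f (merge F P (\<lambda>g\<in>F. 0 + r * x g, y)) \<partial>lborel_PiM P) \<partial>lborel_PiM F) =
      (\<integral>\<^sup>+x. (\<integral>\<^sup>+y. f (S (merge F P (x, y))) \<partial>lborel_PiM P) \<partial>lborel_PiM F)"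
  proof (rule nn_integral_cong)
    fix x assume "x \<in> space (lborel_PiM F)"
    have sp: "(\<lambda>g\<in>F. 0 + r * x g) \<in> space (lborel_PiM F)" by (auto simp: space_PiM)
    have "(\<lambda>y. f (merge F P (\<lambda>g\<in>F. 0 + r * x g, y))) \<in> borel_measurable (lborel_PiM P)"
      using measurable_Pair2[OF m sp] by simp
    then have "(\<integral>\<^sup>+y. f (merge F P (\<lambda>g\<in>F. 0 + r * x g, y)) \<partial>lborel_PiM P) = ennreal (1 ^ card P) *
        (\<integral>\<^sup>+y. f (merge F P (\<lambda>g\<in>F. 0 + r * x g, \<lambda>p\<in>P. h p (merge F P (x, \<lambda>_. 0)) + 1 * y p)) \<partial>lborel_PiM P)"
      using fin by (intro nn_integral_PiM_affine) auto
    then show "(\<integral>\<^sup>+y. f (merge F P (\<lambda>g\<in>F. 0 + r * x g, y)) \<partial>lborel_PiM P) =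
        (\<integral>\<^sup>+y. f (S (merge F P (x, y))) \<partial>lborel_PiM P)"
      unfolding merge1 by simp
  qed
  also have "\<dots> = (\<integral>\<^sup>+z. f (S z) \<partial>lborel_PiM (F \<union> P))"
    using fin by (intro product_nn_integral_fold[symmetric]) auto
  finally show ?thesis unfolding S_def .
qed

text \<open>On each line in direction \<open>f\<close> the affine function has a single
  zero.\<close>

lemma AE_PiM_affine_nonzero:
  fixes u :: "'a \<Rightarrow> real"
  assumes "finite A" "A' \<subseteq> A" "f \<in> A'" "u f \<noteq> 0"
  shows "AE z in lborel_PiM A. k + (\<Sum>g\<in>A'. u g * z g) \<noteq> 0"
proof -
  interpret product_sigma_finite "\<lambda>_. lborel :: real measure" by (rule product_sigma_finite_lborel)
  define B where "B = A - {f}"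
  have A: "A = insert f B" "f \<notin> B" "finite B" using assms by (auto simp: B_def)
  define N where "N = {z \<in> space (lborel_PiM A). k + (\<Sum>g\<in>A'. u g * z g) = 0}"
  have compm: "(\<lambda>z. z g) \<in> borel_measurable (lborel_PiM A)" if "g \<in> A'" for g
    using that assms(2) by (auto intro: measurable_component_singleton)
  have "(\<lambda>z. k + (\<Sum>g\<in>A'. u g * z g)) \<in> borel_measurable (lborel_PiM A)"
    using compm by (intro borel_measurable_add borel_measurable_sum borel_measurable_times) auto
  then have N[measurable]: "N \<in> sets (lborel_PiM A)"
    unfolding N_def by measurable
  have indN: "indicator N \<in> borel_measurable (lborel_PiM (insert f B))"
    unfolding A(1)[symmetric] by simp
  have "emeasure (lborel_PiM A) N = (\<integral>\<^sup>+z. indicator N z \<partial>lborel_PiM (insert f B))"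
    unfolding A(1)[symmetric] using N by (rule nn_integral_indicator[symmetric])
  also have "\<dots> = (\<integral>\<^sup>+x. (\<integral>\<^sup>+y. indicator N (x(f := y)) \<partial>lborel) \<partial>lborel_PiM B)"
    using A indN by (intro product_nn_integral_insert)
  also have "\<dots> = (\<integral>\<^sup>+x. 0 \<partial>lborel_PiM B)"
  proof (rule nn_integral_cong)
    fix x
    have finA': "finite A'" using assms by (auto intro: finite_subset)
    define R where "R = k + (\<Sum>g\<in>A' - {f}. u g * x g)"
    have eq: "k + (\<Sum>g\<in>A'. u g * (x(f := y)) g) = u f * y + R" for y
      using finA' assms(3) by (simp add: sum.remove R_def)
    have "indicator N (x(f := y)) \<le> (indicator {- R / u f} y :: ennreal)" for y
    proof (cases "x(f := y) \<in> N")
      case True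
      then have "u f * y + R = 0" using eq by (simp add: N_def)
      then have "y = - R / u f" using assms(4) by (simp add: field_simps)
      then show ?thesis by (simp add: indicator_def)
    qed simp
    then have "(\<integral>\<^sup>+y. indicator N (x(f := y)) \<partial>lborel) \<le> (\<integral>\<^sup>+y. indicator {- R / u f} y \<partial>lborel)"
      by (intro nn_integral_mono)
    also have "\<dots> = 0" by (subst nn_integral_indicator) auto
    finally show "(\<integral>\<^sup>+y. indicator N (x(f := y)) \<partial>lborel) = (0 :: ennreal)" by simp
  qed
  finally have "N \<in> null_sets (lborel_PiM A)" using N by (auto simp: null_sets_def)
  then show ?thesis by (rule AE_I') (auto simp: N_def)
qed

lemma nn_integral_exp_abs_finite:
  fixes d :: real
  assumes "d > 0"
  shows "(\<integral>\<^sup>+y. ennreal (exp (- (d * \<bar>y\<bar>))) \<partial>lborel) < \<infinity>"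
proof -
  have half: "(\<integral>\<^sup>+y. ennreal (exp (- (d * y))) * indicator {0..} y \<partial>lborel) = ennreal (0 - (- (1 / d)))"
  proof (subst nn_integral_FTC_atLeast[where F = "\<lambda>y. - (exp (- (d * y)) / d)" and T = 0])
    show "DERIV (\<lambda>y. - (exp (- (d * y)) / d)) y :> exp (- (d * y))" for y
      using assms by (auto intro!: derivative_eq_intros simp: field_simps)
    have "filterlim (\<lambda>y. d * y) at_top at_top"
      using assms by (intro filterlim_tendsto_pos_mult_at_top[OF tendsto_const]) (auto simp: filterlim_ident)
    then have "((\<lambda>y. exp (- (d * y))) \<longlongrightarrow> 0) at_top"
      by (intro filterlim_compose[OF exp_at_bot] filterlim_uminus_at_bot_at_top[THEN filterlim_compose])
    then have "((\<lambda>y. - (exp (- (d * y)) / d)) \<longlongrightarrow> - (0 / d)) at_top"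
      using assms by (intro tendsto_intros) auto
    then show "((\<lambda>y. - (exp (- (d * y)) / d)) \<longlongrightarrow> 0) at_top" by simp
  qed auto
  have refl: "(\<integral>\<^sup>+y. ennreal (exp (d * y)) * indicator {..0} y \<partial>lborel) =
      (\<integral>\<^sup>+y. ennreal (exp (- (d * y))) * indicator {0..} y \<partial>lborel)"
    by (subst nn_integral_real_affine[where c = "-1" and t = 0])
       (auto intro!: nn_integral_cong simp: indicator_def)
  have "(\<integral>\<^sup>+y. ennreal (exp (- (d * \<bar>y\<bar>))) \<partial>lborel) \<le>
      (\<integral>\<^sup>+y. ennreal (exp (- (d * y))) * indicator {0..} y + ennreal (exp (d * y)) * indicator {..0} y \<partial>lborel)"
    by (intro nn_integral_mono) (auto simp: indicator_def abs_if)
  also have "\<dots> = (\<integral>\<^sup>+y. ennreal (exp (- (d * y))) * indicator {0..} y \<partial>lborel) +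
      (\<integral>\<^sup>+y. ennreal (exp (d * y)) * indicator {..0} y \<partial>lborel)"
    by (intro nn_integral_add) auto
  also have "\<dots> < \<infinity>" unfolding refl half by (simp add: ennreal_plus[symmetric] del: ennreal_plus)
  finally show ?thesis .
qed

section \<open>An exponential volume of a polytope\<close>

text \<open>What remains of the linear program: a dual solution \<open>s\<close>, a point
  \<open>c\<close> of the face with full support, pivots \<open>P\<close> with dual family
  \<open>E\<close>, and the other columns \<open>F\<close> with their coordinates
  \<open>lam\<close>. The point \<open>c\<close> shows that the fibre \<open>G z = 1\<close> meets
  the open positive orthant, which makes the limits positive.\<close>

locale pivot_system =
  fixes I :: "'i set" and P F :: "'g set" and G :: "'g \<Rightarrow> 'i \<Rightarrow> real"
    and s :: "'i \<Rightarrow> real" and c :: "'g \<Rightarrow> real" and lam :: "'g \<Rightarrow> 'g \<Rightarrow> real" and E :: "'g \<Rightarrow> 'i \<Rightarrow> real"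
  assumes finI: "finite I" and finP: "finite P" and finF: "finite F" and PF: "F \<inter> P = {}"
    and I_ne: "I \<noteq> {}"
    and G_nonneg: "\<And>g i. g \<in> F \<union> P \<Longrightarrow> i \<in> I \<Longrightarrow> 0 \<le> G g i"
    and s_pos: "\<And>i. i \<in> I \<Longrightarrow> 0 < s i"
    and sG: "\<And>g. g \<in> F \<union> P \<Longrightarrow> (\<Sum>i\<in>I. s i * G g i) = 1"
    and c_pos: "\<And>g. g \<in> F \<union> P \<Longrightarrow> 0 < c g"
    and cG: "\<And>i. i \<in> I \<Longrightarrow> (\<Sum>g\<in>F \<union> P. c g * G g i) = 1"
    and lam: "\<And>f i. f \<in> F \<Longrightarrow> i \<in> I \<Longrightarrow> G f i = (\<Sum>p\<in>P. lam f p * G p i)"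
    and E: "\<And>p p'. p \<in> P \<Longrightarrow> p' \<in> P \<Longrightarrow> (\<Sum>i\<in>I. E p i * G p' i) = (if p = p' then 1 else 0)"
begin

abbreviation "M \<equiv> lborel_PiM (F \<union> P)"

definition dens :: "('i \<Rightarrow> real) \<Rightarrow> real" where
  "dens x = (if \<forall>i\<in>I. 0 \<le> x i then exp (- (\<Sum>i\<in>I. s i * x i)) else 0)"

definition vol :: "('i \<Rightarrow> real) \<Rightarrow> ennreal" where
  "vol b = (\<integral>\<^sup>+z. ennreal (if \<forall>g\<in>F \<union> P. 0 \<le> z g
     then dens (\<lambda>i. b i - (\<Sum>g\<in>F \<union> P. G g i * z g)) else 0) \<partial>M)"

text \<open>The pivot coordinate of the point of the affine space \<open>G z = 1\<close> with given free coordinates.\<close>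

definition piv :: "'g \<Rightarrow> ('g \<Rightarrow> real) \<Rightarrow> real" where
  "piv p z = c p - (\<Sum>f\<in>F. lam f p * (z f - c f))"

text \<open>The integrand of \<open>vol\<close> for \<open>b = L - w\<close> in new variables: free
  coordinates are measured in units of \<open>L\<close>, pivot coordinates as unscaled deviations
  from the point \<open>L * piv\<close> of the fibre \<open>G z = L\<close>.\<close>

definition scaled :: "real \<Rightarrow> ('i \<Rightarrow> real) \<Rightarrow> ('g \<Rightarrow> real) \<Rightarrow> real" where
  "scaled L w z = (if (\<forall>f\<in>F. 0 \<le> L * z f) \<and> (\<forall>p\<in>P. 0 \<le> L * piv p z + z p)
     then dens (\<lambda>i. - w i - (\<Sum>p\<in>P. G p i * z p)) else 0)"

text \<open>The pointwise limit of \<open>scaled\<close> as \<open>L\<close> grows, except where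
  some \<open>piv p z\<close> is zero: there the sign of \<open>z p\<close> decides for every
  \<open>L\<close>, but these points form a null set.\<close>

definition limit_dens :: "('i \<Rightarrow> real) \<Rightarrow> ('g \<Rightarrow> real) \<Rightarrow> real" where
  "limit_dens w z = (if (\<forall>f\<in>F. 0 \<le> z f) \<and> (\<forall>p\<in>P. 0 < piv p z)
     then dens (\<lambda>i. - w i - (\<Sum>p\<in>P. G p i * z p)) else 0)"

definition C0 :: "('i \<Rightarrow> real) \<Rightarrow> real" where
  "C0 w = (\<integral>z. limit_dens w z \<partial>M)"

lemma dens_cong:
  assumes "\<And>i. i \<in> I \<Longrightarrow> x i = y i"
  shows "dens x = dens y"
proof -
  have "(\<forall>i\<in>I. 0 \<le> x i) = (\<forall>i\<in>I. 0 \<le> y i)" "(\<Sum>i\<in>I. s i * x i) = (\<Sum>i\<in>I. s i * y i)"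
    using assms by auto
  then show ?thesis by (simp add: dens_def)
qed

lemma sum_FP: "(\<Sum>g\<in>F \<union> P. h g) = (\<Sum>g\<in>F. h g) + (\<Sum>g\<in>P. h g)" for h :: "'g \<Rightarrow> real"
  using finF finP PF by (rule sum.union_disjoint)

lemma comp_meas[measurable]: "g \<in> F \<union> P \<Longrightarrow> (\<lambda>z. z g) \<in> borel_measurable M"
  by (auto intro: measurable_component_singleton)

lemma pred_meas: "finite A \<Longrightarrow> (\<And>g. g \<in> A \<Longrightarrow> f g \<in> borel_measurable N) \<Longrightarrow>
    Measurable.pred N (\<lambda>z. \<forall>g\<in>A. 0 \<le> (f g z :: real))"
  by (intro pred_intros_finite) (auto intro: borel_measurable_le)

lemma pred_meas': "finite A \<Longrightarrow> (\<And>g. g \<in> A \<Longrightarrow> f g \<in> borel_measurable N) \<Longrightarrow>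
    Measurable.pred N (\<lambda>z. \<forall>g\<in>A. 0 < (f g z :: real))"
  by (intro pred_intros_finite) (auto intro: borel_measurable_less)

lemma dens_meas:
  assumes "\<And>i. i \<in> I \<Longrightarrow> (\<lambda>z. x z i) \<in> borel_measurable N"
  shows "(\<lambda>z. dens (x z)) \<in> borel_measurable N"
proof -
  have "Measurable.pred N (\<lambda>z. \<forall>i\<in>I. 0 \<le> x z i)"
    using finI assms by (intro pred_meas[where f = "\<lambda>i z. x z i"]) auto
  moreover have "(\<lambda>z. exp (- (\<Sum>i\<in>I. s i * x z i))) \<in> borel_measurable N"
    using assms by (intro borel_measurable_exp[THEN measurable_compose] measurable_compose[OF _ borel_measurable_exp]
        borel_measurable_uminus borel_measurable_sum borel_measurable_times) auto
  ultimately show ?thesis unfolding dens_def by (intro measurable_If) auto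
qed

lemma lin_meas: "A \<subseteq> F \<union> P \<Longrightarrow> (\<lambda>z. k - (\<Sum>g\<in>A. u g * (z g - v g))) \<in> borel_measurable M"
  by (intro borel_measurable_diff borel_measurable_sum borel_measurable_times comp_meas) auto

lemma piv_meas[measurable]: "piv p \<in> borel_measurable M"
  unfolding piv_def using lin_meas[of F "c p" "\<lambda>f. lam f p" c] by simp

lemma lin_meas0: "A \<subseteq> F \<union> P \<Longrightarrow> (\<lambda>z. k - (\<Sum>g\<in>A. u g * z g)) \<in> borel_measurable M"
  using lin_meas[of A k u "\<lambda>_. 0"] by simp

lemma vol_meas: "(\<lambda>z. (if \<forall>g\<in>F \<union> P. 0 \<le> z g
     then dens (\<lambda>i. b i - (\<Sum>g\<in>F \<union> P. G g i * z g)) else 0)) \<in> borel_measurable M"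
proof (intro measurable_If)
  show "(\<lambda>z. dens (\<lambda>i. b i - (\<Sum>g\<in>F \<union> P. G g i * z g))) \<in> borel_measurable M"
    by (intro dens_meas lin_meas0) auto
  have "Measurable.pred M (\<lambda>z. \<forall>g\<in>F \<union> P. 0 \<le> z g)"
    using finF finP by (intro pred_meas) auto
  then show "{z \<in> space M. \<forall>g\<in>F \<union> P. 0 \<le> z g} \<in> sets M" by measurable
qed auto

lemma scaled_meas[measurable]: "scaled L w \<in> borel_measurable M"
  unfolding scaled_def
proof (intro measurable_If)
  show "(\<lambda>z. dens (\<lambda>i. - w i - (\<Sum>p\<in>P. G p i * z p))) \<in> borel_measurable M"
    by (intro dens_meas lin_meas0) auto
  have "Measurable.pred M (\<lambda>z. \<forall>f\<in>F. 0 \<le> L * z f)"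
    using finF by (intro pred_meas) auto
  moreover have "Measurable.pred M (\<lambda>z. \<forall>p\<in>P. 0 \<le> L * piv p z + z p)"
    using finP by (intro pred_meas) auto
  ultimately show "{z \<in> space M. (\<forall>f\<in>F. 0 \<le> L * z f) \<and> (\<forall>p\<in>P. 0 \<le> L * piv p z + z p)} \<in> sets M"
    by measurable
qed auto

lemma limit_dens_meas[measurable]: "limit_dens w \<in> borel_measurable M"
  unfolding limit_dens_def
proof (intro measurable_If)
  show "(\<lambda>z. dens (\<lambda>i. - w i - (\<Sum>p\<in>P. G p i * z p))) \<in> borel_measurable M"
    by (intro dens_meas lin_meas0) auto
  have "Measurable.pred M (\<lambda>z. \<forall>f\<in>F. 0 \<le> z f)"
    using finF by (intro pred_meas) auto
  moreover have "Measurable.pred M (\<lambda>z. \<forall>p\<in>P. 0 < piv p z)"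
    using finP by (intro pred_meas') auto
  ultimately show "{z \<in> space M. (\<forall>f\<in>F. 0 \<le> z f) \<and> (\<forall>p\<in>P. 0 < piv p z)} \<in> sets M"
    by measurable
qed auto

text \<open>The equation holds for \<open>c\<close>; moving the free coordinates from
  \<open>c\<close> to \<open>z\<close> is compensated in the pivots through
  \<open>lam\<close>.\<close>

lemma pivot_shift:
  assumes "i \<in> I"
  shows "(\<Sum>f\<in>F. G f i * z f) + (\<Sum>p\<in>P. G p i * piv p z) = 1"
proof -
  have "(\<Sum>p\<in>P. G p i * (\<Sum>f\<in>F. lam f p * (z f - c f))) = (\<Sum>f\<in>F. (z f - c f) * (\<Sum>p\<in>P. lam f p * G p i))"
    unfolding sum_distrib_left by (subst sum.swap) (simp add: mult_ac)
  also have "\<dots> = (\<Sum>f\<in>F. (z f - c f) * G f i)" using lam assms by simp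
  finally have "(\<Sum>p\<in>P. G p i * piv p z) = (\<Sum>p\<in>P. c p * G p i) - (\<Sum>f\<in>F. (z f - c f) * G f i)"
    by (simp add: piv_def right_diff_distrib sum_subtractf mult.commute)
  also have "\<dots> = (\<Sum>g\<in>F \<union> P. c g * G g i) - (\<Sum>f\<in>F. G f i * z f)"
    by (simp add: sum_FP algebra_simps sum_subtractf)
  finally show ?thesis using cG[OF assms] by simp
qed

text \<open>By \<open>pivot_shift\<close> the terms of size \<open>L\<close> cancel in the slack, so
  \<open>L\<close> survives only in the conditions of nonnegativity and in the Jacobian.\<close>

lemma vol_scaled:
  assumes L: "L > 0"
  shows "vol (\<lambda>i. L - w i) = ennreal (L ^ card F) * (\<integral>\<^sup>+z. ennreal (scaled L w z) \<partial>M)"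
proof -
  have "vol (\<lambda>i. L - w i) = ennreal (L ^ card F) *
    (\<integral>\<^sup>+z. ennreal ((\<lambda>z. (if \<forall>g\<in>F \<union> P. 0 \<le> z g
     then dens (\<lambda>i. (L - w i) - (\<Sum>g\<in>F \<union> P. G g i * z g)) else 0))
       (\<lambda>g\<in>F \<union> P. if g \<in> F then L * z g else (L * piv g z) + z g)) \<partial>M)"
    unfolding vol_def
  proof (rule nn_integral_PiM_shear[OF finF finP PF L])
    show "(\<lambda>z. L * piv p z) \<in> borel_measurable M" for p by measurable
    show "L * piv p z = L * piv p z'" if "\<And>g. g \<in> F \<Longrightarrow> z g = z' g" for p z z'
      using that by (simp add: piv_def cong: sum.cong)
  qed (intro measurable_compose[OF vol_meas measurable_ennreal])
  also have "(\<lambda>z. ennreal ((\<lambda>z. (if \<forall>g\<in>F \<union> P. 0 \<le> z g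
     then dens (\<lambda>i. (L - w i) - (\<Sum>g\<in>F \<union> P. G g i * z g)) else 0))
       (\<lambda>g\<in>F \<union> P. if g \<in> F then L * z g else (L * piv g z) + z g))) = (\<lambda>z. ennreal (scaled L w z))"
  proof
    fix z
    define z' where "z' = (\<lambda>g\<in>F \<union> P. if g \<in> F then L * z g else (L * piv g z) + z g)"
    have zF: "z' f = L * z f" if "f \<in> F" for f using that by (simp add: z'_def)
    have zP: "z' p = L * piv p z + z p" if "p \<in> P" for p using that PF by (auto simp: z'_def)
    have "(\<forall>g\<in>F \<union> P. 0 \<le> z' g) \<longleftrightarrow> (\<forall>f\<in>F. 0 \<le> L * z f) \<and> (\<forall>p\<in>P. 0 \<le> L * piv p z + z p)"
      by (simp add: ball_Un zF zP)
    moreover have "dens (\<lambda>i. (L - w i) - (\<Sum>g\<in>F \<union> P. G g i * z' g)) =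
        dens (\<lambda>i. - w i - (\<Sum>p\<in>P. G p i * z p))"
    proof -
      have "(L - w i) - (\<Sum>g\<in>F \<union> P. G g i * z' g) = - w i - (\<Sum>p\<in>P. G p i * z p)" if "i \<in> I" for i
      proof -
        have "(\<Sum>g\<in>F \<union> P. G g i * z' g) = (\<Sum>f\<in>F. G f i * (L * z f)) + (\<Sum>p\<in>P. G p i * (L * piv p z + z p))"
          unfolding sum_FP by (simp add: zF zP)
        also have "\<dots> = L * ((\<Sum>f\<in>F. G f i * z f) + (\<Sum>p\<in>P. G p i * piv p z)) + (\<Sum>p\<in>P. G p i * z p)"
          by (simp add: algebra_simps sum.distrib sum_distrib_left)
        finally show ?thesis using pivot_shift[OF that] by simp
      qed
      then show ?thesis by (rule dens_cong)
    qed
    ultimately show "ennreal ((\<lambda>z. (if \<forall>g\<in>F \<union> P. 0 \<le> z g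
     then dens (\<lambda>i. (L - w i) - (\<Sum>g\<in>F \<union> P. G g i * z g)) else 0)) z') = ennreal (scaled L w z)"
      by (simp add: scaled_def)
  qed
  finally show ?thesis .
qed

text \<open>Chosen so that \<open>decay\<close> times the sum over \<open>p\<close> of
  \<open>|<E p, x>|\<close> is at most \<open><s, x>\<close> on the positive orthant; the summand 1
  keeps the denominator positive.\<close>

definition decay :: real where
  "decay = 1 / (1 + (\<Sum>p\<in>P. \<Sum>i\<in>I. \<bar>E p i\<bar> / s i))"

lemma decay_pos: "decay > 0"
  unfolding decay_def using s_pos
  by (intro divide_pos_pos add_pos_nonneg sum_nonneg divide_nonneg_nonneg) (auto intro: less_imp_le)

lemma dens_nonneg: "dens x \<ge> 0" by (simp add: dens_def)

text \<open>Trades decay in the slack for decay in each pivot coordinate of the slack, so that the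
  majorant factorises over the coordinates.\<close>

lemma dens_le:
  "dens x \<le> (\<Prod>p\<in>P. exp (- (decay * \<bar>\<Sum>i\<in>I. E p i * x i\<bar>)))"
proof (cases "\<forall>i\<in>I. 0 \<le> x i")
  case True
  define Q where "Q = (\<Sum>i\<in>I. s i * x i)"
  have Q0: "Q \<ge> 0" unfolding Q_def using True s_pos by (intro sum_nonneg mult_nonneg_nonneg) (auto intro: less_imp_le)
  have si: "s i * x i \<le> Q" if "i \<in> I" for i
    unfolding Q_def using that True s_pos finI
    by (intro member_le_sum mult_nonneg_nonneg) (auto intro: less_imp_le)
  have "(\<Sum>p\<in>P. \<bar>\<Sum>i\<in>I. E p i * x i\<bar>) \<le> (\<Sum>p\<in>P. \<Sum>i\<in>I. \<bar>E p i\<bar> / s i * Q)"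
  proof (intro sum_mono order_trans[OF sum_abs])
    fix p i assume i: "i \<in> I"
    have "\<bar>E p i * x i\<bar> = \<bar>E p i\<bar> / s i * (s i * x i)" using s_pos[OF i] True i by (simp add: abs_mult)
    also have "\<dots> \<le> \<bar>E p i\<bar> / s i * Q" using si[OF i] s_pos[OF i] by (intro mult_left_mono) auto
    finally show "\<bar>E p i * x i\<bar> \<le> \<bar>E p i\<bar> / s i * Q" .
  qed
  also have "\<dots> = (\<Sum>p\<in>P. \<Sum>i\<in>I. \<bar>E p i\<bar> / s i) * Q" by (simp add: sum_distrib_right)
  also have "\<dots> \<le> (1 + (\<Sum>p\<in>P. \<Sum>i\<in>I. \<bar>E p i\<bar> / s i)) * Q" using Q0 by (simp add: algebra_simps)
  also have "\<dots> = Q / decay" by (simp add: decay_def)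
  finally have "decay * (\<Sum>p\<in>P. \<bar>\<Sum>i\<in>I. E p i * x i\<bar>) \<le> Q" using decay_pos by (simp add: field_simps)
  then have "exp (- Q) \<le> exp (\<Sum>p\<in>P. - (decay * \<bar>\<Sum>i\<in>I. E p i * x i\<bar>))"
    by (simp add: sum_negf sum_distrib_left)
  then show ?thesis using True finP by (simp add: dens_def Q_def exp_sum)
qed (auto simp: dens_def intro!: prod_nonneg)

text \<open>A majorant of \<open>scaled\<close> in which \<open>L\<close> does not occur. By
  \<open>E_apply\<close>, the functional \<open>E p\<close> sends the slack to minus the shifted
  pivot coordinate; the free coordinates are confined to a box.\<close>

definition dom :: "real \<Rightarrow> ('i \<Rightarrow> real) \<Rightarrow> ('g \<Rightarrow> real) \<Rightarrow> real" where
  "dom K w z = (\<Prod>g\<in>F \<union> P. if g \<in> F then indicator {0..K} (z g)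
     else exp (- (decay * \<bar>(\<Sum>i\<in>I. E g i * w i) + z g\<bar>)))"

definition gauge :: ennreal where
  "gauge = (\<integral>\<^sup>+y. ennreal (exp (- (decay * \<bar>y\<bar>))) \<partial>lborel)"

lemma gauge_finite: "gauge < \<infinity>"
  unfolding gauge_def using nn_integral_exp_abs_finite[OF decay_pos] .

lemma dom_meas[measurable]: "dom K w \<in> borel_measurable M"
  unfolding dom_def
proof (rule borel_measurable_prod)
  fix g assume g: "g \<in> F \<union> P"
  note [measurable] = comp_meas[OF g]
  show "(\<lambda>z. if g \<in> F then indicator {0..K} (z g)
     else exp (- (decay * \<bar>(\<Sum>i\<in>I. E g i * w i) + z g\<bar>))) \<in> borel_measurable M"
    by (cases "g \<in> F") simp_all
qed

lemma dom_integral: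
  assumes "K \<ge> 0"
  shows "(\<integral>\<^sup>+z. ennreal (dom K w z) \<partial>M) = ennreal (K ^ card F) * gauge ^ card P"
proof -
  interpret product_sigma_finite "\<lambda>_. lborel :: real measure" by (rule product_sigma_finite_lborel)
  have "(\<integral>\<^sup>+z. ennreal (dom K w z) \<partial>M) = (\<integral>\<^sup>+z. (\<Prod>g\<in>F \<union> P. ennreal (if g \<in> F then indicator {0..K} (z g)
     else exp (- (decay * \<bar>(\<Sum>i\<in>I. E g i * w i) + z g\<bar>)))) \<partial>M)"
    unfolding dom_def by (subst prod_ennreal) (auto simp: indicator_def)
  also have "\<dots> = (\<Prod>g\<in>F \<union> P. \<integral>\<^sup>+y. ennreal (if g \<in> F then indicator {0..K} y
     else exp (- (decay * \<bar>(\<Sum>i\<in>I. E g i * w i) + y\<bar>))) \<partial>lborel)"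
    using finF finP by (intro product_nn_integral_prod) auto
  also have "\<dots> = (\<Prod>g\<in>F. \<integral>\<^sup>+y. ennreal (indicator {0..K} y) \<partial>lborel) *
      (\<Prod>g\<in>P. \<integral>\<^sup>+y. ennreal (exp (- (decay * \<bar>(\<Sum>i\<in>I. E g i * w i) + y\<bar>))) \<partial>lborel)"
  proof -
    have "g \<in> P \<Longrightarrow> g \<notin> F" for g using PF by blast
    then show ?thesis using finF finP PF
      by (subst prod.union_disjoint) (auto intro!: arg_cong2[where f = "(*)"] prod.cong)
  qed
  also have "(\<integral>\<^sup>+y. ennreal (indicator {0..K} y) \<partial>lborel) = ennreal K"
    using assms by (subst ennreal_indicator) simp
  also have "(\<lambda>g. \<integral>\<^sup>+y. ennreal (exp (- (decay * \<bar>(\<Sum>i\<in>I. E g i * w i) + y\<bar>))) \<partial>lborel) = (\<lambda>g. gauge)"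
  proof
    fix g
    show "(\<integral>\<^sup>+y. ennreal (exp (- (decay * \<bar>(\<Sum>i\<in>I. E g i * w i) + y\<bar>))) \<partial>lborel) = gauge"
      unfolding gauge_def
      by (subst (2) nn_integral_real_affine[where c = 1 and t = "\<Sum>i\<in>I. E g i * w i"]) auto
  qed
  finally show ?thesis using assms by (simp add: ennreal_power)
qed

lemma E_apply:
  assumes "p \<in> P"
  shows "(\<Sum>i\<in>I. E p i * (- w i - (\<Sum>p'\<in>P. G p' i * z p'))) = - ((\<Sum>i\<in>I. E p i * w i) + z p)"
proof -
  have "(\<Sum>i\<in>I. E p i * (\<Sum>p'\<in>P. G p' i * z p')) = (\<Sum>p'\<in>P. z p' * (\<Sum>i\<in>I. E p i * G p' i))"
    unfolding sum_distrib_left by (subst sum.swap) (simp add: mult_ac)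
  also have "\<dots> = z p" using assms finP by (simp add: E if_distrib[where f = "\<lambda>x. _ * x"] sum.delta' cong: if_cong)
  finally show ?thesis by (simp add: algebra_simps sum_subtractf sum_negf)
qed

lemma le_dom:
  assumes "\<And>f. f \<in> F \<Longrightarrow> 0 \<le> z f \<and> z f \<le> K"
  shows "dens (\<lambda>i. - w i - (\<Sum>p\<in>P. G p i * z p)) \<le> dom K w z"
proof -
  have "dens (\<lambda>i. - w i - (\<Sum>p\<in>P. G p i * z p)) \<le> (\<Prod>p\<in>P. exp (- (decay * \<bar>- ((\<Sum>i\<in>I. E p i * w i) + z p)\<bar>)))"
    using dens_le[of "\<lambda>i. - w i - (\<Sum>p\<in>P. G p i * z p)"] by (simp add: E_apply cong: prod.cong)
  also have "\<dots> = dom K w z"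
    unfolding dom_def using finF finP PF assms
    by (subst prod.union_disjoint) (auto simp: indicator_def intro!: prod.cong)
  finally show ?thesis .
qed

text \<open>The box comes from pairing with \<open>s\<close>: for the unscaled point
  \<open>y\<close>, the constraint \<open>G y \<le> L - w\<close> bounds the sum of all
  \<open>y g\<close> by \<open>L * K\<close>, hence \<open>z f \<le> K\<close>.\<close>

lemma scaled_le_dom:
  assumes L: "L > 0" and K: "(\<Sum>i\<in>I. s i * (L - w i)) \<le> L * K"
  shows "scaled L w z \<le> dom K w z"
proof (cases "(\<forall>f\<in>F. 0 \<le> L * z f) \<and> (\<forall>p\<in>P. 0 \<le> L * piv p z + z p) \<and> (\<forall>i\<in>I. 0 \<le> - w i - (\<Sum>p\<in>P. G p i * z p))")
  case True
  define y where "y = (\<lambda>g. if g \<in> F then L * z g else L * piv g z + z g)"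
  have y0: "y g \<ge> 0" if "g \<in> F \<union> P" for g using True that by (auto simp: y_def)
  have Gy: "(\<Sum>g\<in>F \<union> P. G g i * y g) \<le> L - w i" if "i \<in> I" for i
  proof -
    have "(\<Sum>p\<in>P. G p i * y p) = (\<Sum>p\<in>P. G p i * (L * piv p z + z p))"
      using PF by (intro sum.cong) (auto simp: y_def)
    then have "(\<Sum>g\<in>F \<union> P. G g i * y g) = (\<Sum>f\<in>F. G f i * (L * z f)) + (\<Sum>p\<in>P. G p i * (L * piv p z + z p))"
      unfolding sum_FP by (simp add: y_def)
    also have "\<dots> = L * ((\<Sum>f\<in>F. G f i * z f) + (\<Sum>p\<in>P. G p i * piv p z)) + (\<Sum>p\<in>P. G p i * z p)"
      by (simp add: algebra_simps sum.distrib sum_distrib_left)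
    finally have "(\<Sum>g\<in>F \<union> P. G g i * y g) = L + (\<Sum>p\<in>P. G p i * z p)" using pivot_shift[OF that] by simp
    moreover have "0 \<le> - w i - (\<Sum>p\<in>P. G p i * z p)" using True that by blast
    ultimately show ?thesis by linarith
  qed
  have "(\<Sum>g\<in>F \<union> P. y g) = (\<Sum>g\<in>F \<union> P. y g * (\<Sum>i\<in>I. s i * G g i))" by (simp add: sG)
  also have "\<dots> = (\<Sum>i\<in>I. s i * (\<Sum>g\<in>F \<union> P. G g i * y g))"
    unfolding sum_distrib_left by (subst sum.swap) (simp add: mult_ac)
  also have "\<dots> \<le> (\<Sum>i\<in>I. s i * (L - w i))"
    using Gy s_pos by (intro sum_mono mult_left_mono) (auto intro: less_imp_le)
  also note K
  finally have sum_y: "(\<Sum>g\<in>F \<union> P. y g) \<le> L * K" .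
  have "0 \<le> z f \<and> z f \<le> K" if "f \<in> F" for f
  proof -
    have "y f \<le> (\<Sum>g\<in>F \<union> P. y g)" using that y0 finF finP by (intro member_le_sum) auto
    with sum_y that have "L * z f \<le> L * K" by (simp add: y_def)
    moreover have "0 \<le> L * z f" using True that by blast
    ultimately show ?thesis using L by (simp add: zero_le_mult_iff)
  qed
  then show ?thesis using le_dom[of z K w] True by (simp add: scaled_def)
next
  case False
  then have "scaled L w z = 0" by (auto simp: scaled_def dens_def)
  moreover have "dom K w z \<ge> 0" unfolding dom_def by (intro prod_nonneg) (auto simp: indicator_def)
  ultimately show ?thesis by simp
qed

lemma vol_le:
  assumes "L > 0" "(\<Sum>i\<in>I. s i * (L - w i)) \<le> L * K" "K \<ge> 0"
  shows "vol (\<lambda>i. L - w i) \<le> ennreal (L ^ card F) * (ennreal (K ^ card F) * gauge ^ card P)"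
  unfolding vol_scaled[OF assms(1)] dom_integral[OF assms(3), of w, symmetric]
  by (intro mult_left_mono nn_integral_mono ennreal_leI scaled_le_dom assms) auto

text \<open>Either \<open>piv p\<close> is a nonconstant affine function of the free coordinates, or
  it is constantly \<open>c p > 0\<close>.\<close>

lemma AE_piv_nonzero: "p \<in> P \<Longrightarrow> AE z in M. piv p z \<noteq> 0"
proof -
  assume p: "p \<in> P"
  show ?thesis
  proof (cases "\<forall>f\<in>F. lam f p = 0")
    case True
    then have "piv p z = c p" for z by (simp add: piv_def)
    then show ?thesis using c_pos[of p] p by auto
  next
    case False
    then obtain f where f: "f \<in> F" "lam f p \<noteq> 0" by blast
    have eq: "piv p z = (c p + (\<Sum>f\<in>F. lam f p * c f)) + (\<Sum>f\<in>F. (- lam f p) * z f)" for z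
      by (simp add: piv_def algebra_simps sum_subtractf sum_negf)
    show ?thesis unfolding eq
      using finF finP f by (intro AE_PiM_affine_nonzero[where f = f]) auto
  qed
qed

lemma scaled_tendsto:
  assumes "\<And>p. p \<in> P \<Longrightarrow> piv p z \<noteq> 0"
  shows "((\<lambda>L. scaled L w z) \<longlongrightarrow> limit_dens w z) at_top"
proof (rule tendsto_eventually)
  have F: "eventually (\<lambda>L. (\<forall>f\<in>F. 0 \<le> L * z f) \<longleftrightarrow> (\<forall>f\<in>F. 0 \<le> z f)) at_top"
    using eventually_gt_at_top[of 0] by eventually_elim (intro ball_cong, auto simp: zero_le_mult_iff)
  have "eventually (\<lambda>L. 0 \<le> L * piv p z + z p \<longleftrightarrow> 0 < piv p z) at_top" if p: "p \<in> P" for p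
  proof (cases "piv p z > 0")
    case True
    have "eventually (\<lambda>L. L \<ge> - z p / piv p z) at_top" by (rule eventually_ge_at_top)
    then show ?thesis by eventually_elim (use True in \<open>auto simp: field_simps\<close>)
  next
    case False
    then have neg: "piv p z < 0" using assms[OF p] by simp
    have "eventually (\<lambda>L. L > - z p / piv p z) at_top" by (rule eventually_gt_at_top)
    then show ?thesis by eventually_elim (use neg in \<open>auto simp: field_simps\<close>)
  qed
  then have "eventually (\<lambda>L. \<forall>p\<in>P. 0 \<le> L * piv p z + z p \<longleftrightarrow> 0 < piv p z) at_top"
    using finP by (simp add: eventually_ball_finite_distrib)
  with F show "eventually (\<lambda>L. scaled L w z = limit_dens w z) at_top"
    by eventually_elim (simp add: scaled_def limit_dens_def)
qed

lemma sum_s_pos: "(\<Sum>i\<in>I. s i) > 0"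
  using finI I_ne s_pos by (rule sum_pos)

lemma scaled_integral:
  assumes "L > 0"
  shows "vol (\<lambda>i. L - w i) < \<infinity>"
    and "(\<integral>z. scaled L w z \<partial>M) = enn2real (vol (\<lambda>i. L - w i)) / L ^ card F"
proof -
  define K where "K = max 0 ((\<Sum>i\<in>I. s i * (L - w i)) / L)"
  have "(\<Sum>i\<in>I. s i * (L - w i)) / L \<le> K" by (simp add: K_def)
  then have "(\<Sum>i\<in>I. s i * (L - w i)) \<le> L * K" using assms by (simp add: field_simps)
  moreover have "K \<ge> 0" by (simp add: K_def)
  ultimately have "vol (\<lambda>i. L - w i) \<le> ennreal (L ^ card F) * (ennreal (K ^ card F) * gauge ^ card P)"
    by (intro vol_le assms)
  also have "\<dots> < \<infinity>" using gauge_finite by (simp add: ennreal_mult_less_top power_less_top_ennreal)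
  finally show "vol (\<lambda>i. L - w i) < \<infinity>" .
  have nn: "scaled L w z \<ge> 0" for z by (simp add: scaled_def dens_nonneg)
  have "(\<integral>z. scaled L w z \<partial>M) = enn2real (\<integral>\<^sup>+z. ennreal (scaled L w z) \<partial>M)"
    using nn by (intro integral_eq_nn_integral) auto
  then show "(\<integral>z. scaled L w z \<partial>M) = enn2real (vol (\<lambda>i. L - w i)) / L ^ card F"
    using assms by (simp add: vol_scaled enn2real_mult)
qed

text \<open>The constant \<open>K\<close> serves all \<open>L \<ge> 1\<close> at once, so dominated
  convergence applies with a single majorant.\<close>

lemma integrable_limit_dens: "integrable M (limit_dens w)"
  and vol_tendsto: "((\<lambda>L. enn2real (vol (\<lambda>i. L - w i)) / L ^ card F) \<longlongrightarrow> C0 w) at_top"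
proof -
  define K where "K = (\<Sum>i\<in>I. s i) + (\<Sum>i\<in>I. s i * \<bar>w i\<bar>)"
  have K0: "K \<ge> 0" unfolding K_def using s_pos
    by (intro add_nonneg_nonneg sum_nonneg mult_nonneg_nonneg) (auto intro: less_imp_le)
  have bound: "(\<Sum>i\<in>I. s i * (L - w i)) \<le> L * K" if "L \<ge> 1" for L
    unfolding K_def sum.distrib[symmetric] sum_distrib_left
  proof (rule sum_mono)
    fix i assume i: "i \<in> I"
    have "\<bar>w i\<bar> \<le> L * \<bar>w i\<bar>" using that by (simp add: mult_right_mono[of 1 L "\<bar>w i\<bar>", simplified])
    then have "L - w i \<le> L + L * \<bar>w i\<bar>" by linarith
    then have "s i * (L - w i) \<le> s i * (L + L * \<bar>w i\<bar>)" using s_pos[OF i] by (intro mult_left_mono) auto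
    then show "s i * (L - w i) \<le> L * (s i + s i * \<bar>w i\<bar>)" by (simp add: algebra_simps)
  qed
  have "integrable M (dom K w)"
  proof (rule integrableI_bounded)
    have "(\<integral>\<^sup>+z. ennreal (norm (dom K w z)) \<partial>M) = (\<integral>\<^sup>+z. ennreal (dom K w z) \<partial>M)"
      by (intro nn_integral_cong) (auto simp: dom_def abs_of_nonneg prod_nonneg indicator_def)
    also have "\<dots> < \<infinity>" unfolding dom_integral[OF K0]
      using gauge_finite by (simp add: ennreal_mult_less_top power_less_top_ennreal)
    finally show "(\<integral>\<^sup>+z. ennreal (norm (dom K w z)) \<partial>M) < \<infinity>" .
  qed measurable
  moreover have bd: "eventually (\<lambda>L. AE z in M. norm (scaled L w z) \<le> dom K w z) at_top"
    using eventually_ge_at_top[of 1]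
  proof eventually_elim
    case (elim L)
    have "norm (scaled L w z) \<le> dom K w z" for z
      using scaled_le_dom[OF _ bound[OF elim], of z] elim by (simp add: scaled_def dens_nonneg)
    then show ?case by simp
  qed
  moreover have lm: "AE z in M. ((\<lambda>L. scaled L w z) \<longlongrightarrow> limit_dens w z) at_top"
  proof -
    have "AE z in M. \<forall>p\<in>P. piv p z \<noteq> 0"
      using finP AE_piv_nonzero by (simp add: AE_finite_all)
    then show ?thesis by eventually_elim (rule scaled_tendsto, blast)
  qed
  ultimately show "integrable M (limit_dens w)"
    using integrable_dominated_convergence_at_top[of "limit_dens w" M "\<lambda>L. scaled L w" "dom K w"]
    by simp
  note dominated = limit_dens_meas scaled_meas \<open>integrable M (dom K w)\<close> lm bd
  have "((\<lambda>L. \<integral>z. scaled L w z \<partial>M) \<longlongrightarrow> C0 w) at_top"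
    unfolding C0_def
    by (rule integral_dominated_convergence_at_top[OF dominated])
  then show "((\<lambda>L. enn2real (vol (\<lambda>i. L - w i)) / L ^ card F) \<longlongrightarrow> C0 w) at_top"
    by (rule Lim_transform_eventually)
       (use eventually_gt_at_top[of 0] in \<open>eventually_elim, simp add: scaled_integral\<close>)
qed

text \<open>\<open>piv\<close> depends on the free coordinates only, so translating the pivot
  coordinates changes nothing but the slack.\<close>

lemma C0_shift:
  "C0 (\<lambda>i. w i + (\<Sum>p\<in>P. G p i * t p)) = C0 w"
proof -
  define t' where "t' = (\<lambda>g. if g \<in> P then t g else 0)"
  have nn: "limit_dens w z \<ge> 0" for w z by (simp add: limit_dens_def dens_nonneg)
  have eq: "limit_dens w (\<lambda>g\<in>F \<union> P. t' g + 1 * z g) = limit_dens (\<lambda>i. w i + (\<Sum>p\<in>P. G p i * t p)) z" for z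
  proof -
    have F: "f \<in> F \<Longrightarrow> f \<notin> P" for f using PF by blast
    have "piv p (\<lambda>g\<in>F \<union> P. t' g + 1 * z g) = piv p z" for p
      by (simp add: piv_def t'_def F cong: sum.cong)
    moreover have "(\<Sum>p\<in>P. G p i * (\<lambda>g\<in>F \<union> P. t' g + 1 * z g) p) = (\<Sum>p\<in>P. G p i * t p) + (\<Sum>p\<in>P. G p i * z p)" for i
      by (simp add: t'_def sum.distrib distrib_left)
    ultimately show ?thesis by (simp add: limit_dens_def t'_def F algebra_simps cong: ball_cong)
  qed
  have "C0 w = enn2real (\<integral>\<^sup>+z. ennreal (limit_dens w z) \<partial>M)"
    unfolding C0_def using nn by (intro integral_eq_nn_integral) auto
  also have "(\<integral>\<^sup>+z. ennreal (limit_dens w z) \<partial>M) = ennreal (1 ^ card (F \<union> P)) *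
      (\<integral>\<^sup>+z. ennreal (limit_dens w (\<lambda>g\<in>F \<union> P. t' g + 1 * z g)) \<partial>M)"
    using finF finP by (intro nn_integral_PiM_affine) auto
  also have "enn2real \<dots> = C0 (\<lambda>i. w i + (\<Sum>p\<in>P. G p i * t p))"
    unfolding C0_def eq using nn by (subst integral_eq_nn_integral) auto
  finally show ?thesis by (rule sym)
qed

text \<open>The sum of all columns is a combination of the pivots. Because of this invariance,
  rounding each \<open>z g\<close> by a constant, or passing to multiples of a modulus, leaves the
  limit unchanged.\<close>

lemma C0_shift_all:
  "C0 (\<lambda>i. w i + k * (\<Sum>g\<in>F \<union> P. G g i)) = C0 w"
proof -
  define t where "t = (\<lambda>p. k * (1 + (\<Sum>f\<in>F. lam f p)))"
  have "k * (\<Sum>g\<in>F \<union> P. G g i) = (\<Sum>p\<in>P. G p i * t p)" if "i \<in> I" for i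
  proof -
    have "(\<Sum>f\<in>F. G f i) = (\<Sum>p\<in>P. G p i * (\<Sum>f\<in>F. lam f p))"
      unfolding sum_distrib_left using lam that by (subst sum.swap) (simp add: mult.commute)
    then show ?thesis by (simp add: sum_FP t_def sum.distrib algebra_simps sum_distrib_left)
  qed
  then have "dens (\<lambda>i. - (w i + k * (\<Sum>g\<in>F \<union> P. G g i)) - (\<Sum>p\<in>P. G p i * z p)) =
      dens (\<lambda>i. - (w i + (\<Sum>p\<in>P. G p i * t p)) - (\<Sum>p\<in>P. G p i * z p))" for z
    by (intro dens_cong) simp
  then have "limit_dens (\<lambda>i. w i + k * (\<Sum>g\<in>F \<union> P. G g i)) = limit_dens (\<lambda>i. w i + (\<Sum>p\<in>P. G p i * t p))"
    by (simp add: fun_eq_iff limit_dens_def)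
  then show ?thesis using C0_shift[of w t] by (simp add: C0_def)
qed

text \<open>The limit density is positive on a small box: free coordinates near \<open>c\<close>
  keep each \<open>piv p\<close> near \<open>c p > 0\<close>, and the pivot coordinates are placed
  so far down that every slack is positive.\<close>

lemma C0_pos: "C0 w > 0"
proof -
  interpret product_sigma_finite "\<lambda>_. lborel :: real measure" by (rule product_sigma_finite_lborel)
  have nn: "limit_dens w z \<ge> 0" for z by (simp add: limit_dens_def dens_nonneg)
  define K where "K = 1 + (\<Sum>i\<in>I. \<bar>w i\<bar>)"
  define m where "m = Min (insert 1 (c ` (F \<union> P)))"
  have m: "m > 0" "m \<le> 1" "\<And>g. g \<in> F \<union> P \<Longrightarrow> m \<le> c g"
    using finF finP c_pos by (auto simp: m_def)
  \<comment> \<open>One summand for each use of \<open>e\<close>: the free coordinates, the values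
    \<open>piv p z\<close>, and the slack.\<close>
  define R where "R = 1 + (\<Sum>f\<in>F. \<Sum>p\<in>P. \<bar>lam f p\<bar>) + (\<Sum>p\<in>P. \<Sum>i\<in>I. G p i)"
  have R1: "(\<Sum>f\<in>F. \<Sum>p\<in>P. \<bar>lam f p\<bar>) \<ge> 0" by (intro sum_nonneg) auto
  have R2: "(\<Sum>p\<in>P. \<Sum>i\<in>I. G p i) \<ge> 0" using G_nonneg by (intro sum_nonneg) auto
  define e where "e = m / (2 * R)"
  have R: "R \<ge> 1" using R1 R2 by (simp add: R_def)
  have e: "e > 0" using m R by (simp add: e_def)
  have "e * R = m / 2" using R by (simp add: e_def)
  then have eR: "e * R \<le> 1 / 2" "e * R < m" using m by auto
  \<comment> \<open>By \<open>pivot_shift\<close> at 0 the pivot columns send the vector of the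
    \<open>piv g 0\<close> to the all-one vector, so this choice gives every coordinate of the pivot
    sum the value \<open>- K\<close>.\<close>
  define z0 where "z0 = (\<lambda>g. if g \<in> F then c g else - K * piv g (\<lambda>_. 0))"
  define B where "B = (\<Pi>\<^sub>E g\<in>F \<union> P. {z0 g - e<..<z0 g + e})"
  have pos: "limit_dens w z > 0" if z: "z \<in> B" for z
  proof -
    have near: "\<bar>z g - z0 g\<bar> < e" if "g \<in> F \<union> P" for g
    proof -
      have "z g \<in> {z0 g - e<..<z0 g + e}" using z that unfolding B_def by blast
      then show ?thesis by auto
    qed
    have F0: "0 \<le> z f" if "f \<in> F" for f
    proof -
      have "e * 1 \<le> e * R" using e R by (intro mult_left_mono) auto
      then show ?thesis using near[of f] that m(3)[of f] eR by (auto simp: z0_def)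
    qed
    have P0: "0 < piv p z" if p: "p \<in> P" for p
    proof -
      have "(\<Sum>f\<in>F. lam f p * (z f - c f)) \<le> (\<Sum>f\<in>F. \<bar>lam f p\<bar> * e)"
      proof (rule sum_mono)
        fix f assume "f \<in> F"
        then have "\<bar>z f - c f\<bar> \<le> e" using near[of f] by (simp add: z0_def)
        then have "\<bar>lam f p * (z f - c f)\<bar> \<le> \<bar>lam f p\<bar> * e" by (simp add: abs_mult mult_left_mono)
        then show "lam f p * (z f - c f) \<le> \<bar>lam f p\<bar> * e" by linarith
      qed
      also have "\<dots> \<le> (\<Sum>f\<in>F. (\<Sum>p\<in>P. \<bar>lam f p\<bar>) * e)"
        using p finP e by (intro sum_mono mult_right_mono member_le_sum) auto
      also have "\<dots> = e * (\<Sum>f\<in>F. \<Sum>p\<in>P. \<bar>lam f p\<bar>)"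
        unfolding sum_distrib_right[symmetric] by (rule mult.commute)
      also have "\<dots> \<le> e * R" using e R2 by (intro mult_left_mono) (auto simp: R_def)
      also have "\<dots> < m" by (rule eR)
      also have "\<dots> \<le> c p" using m(3) p by simp
      finally show ?thesis by (simp add: piv_def)
    qed
    have I0: "0 \<le> - w i - (\<Sum>p\<in>P. G p i * z p)" if i: "i \<in> I" for i
    proof -
      have "(\<Sum>p\<in>P. G p i * z p) \<le> (\<Sum>p\<in>P. G p i * (z0 p + e))"
        using near G_nonneg i by (intro sum_mono mult_left_mono) (auto simp: abs_less_iff algebra_simps intro: less_imp_le)
      also have "\<dots> = (\<Sum>p\<in>P. G p i * z0 p) + e * (\<Sum>p\<in>P. G p i)"
        by (simp add: algebra_simps sum.distrib sum_distrib_left)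
      also have "(\<Sum>p\<in>P. G p i * z0 p) = (\<Sum>p\<in>P. G p i * (- K * piv p (\<lambda>_. 0)))"
        using PF by (intro sum.cong) (auto simp: z0_def)
      also have "\<dots> = - K * (\<Sum>p\<in>P. G p i * piv p (\<lambda>_. 0))"
        by (simp add: sum_distrib_left mult_ac)
      also have "\<dots> = - K" using pivot_shift[OF i, of "\<lambda>_. 0"] by simp
      also have "e * (\<Sum>p\<in>P. G p i) \<le> e * (\<Sum>p\<in>P. \<Sum>i\<in>I. G p i)"
        using e i finI G_nonneg by (intro mult_left_mono sum_mono member_le_sum) auto
      also have "\<dots> \<le> e * R" using e R1 by (intro mult_left_mono) (auto simp: R_def)
      finally have "(\<Sum>p\<in>P. G p i * z p) \<le> - K + 1 / 2" using eR by linarith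
      moreover have "\<bar>w i\<bar> \<le> (\<Sum>i\<in>I. \<bar>w i\<bar>)" using i finI by (intro member_le_sum) auto
      ultimately show ?thesis unfolding K_def by linarith
    qed
    show ?thesis using F0 P0 I0 by (simp add: limit_dens_def dens_def)
  qed
  have "C0 w \<noteq> 0"
  proof
    assume "C0 w = 0"
    then have "AE z in M. limit_dens w z = 0"
      unfolding C0_def using nn integrable_limit_dens by (subst (asm) integral_nonneg_eq_0_iff_AE) auto
    then have "AE z in M. z \<notin> B" by eventually_elim (use pos in force)
    moreover have B: "B \<in> sets M" unfolding B_def using finF finP by (intro sets_PiM_I_finite) auto
    ultimately have "emeasure M B = 0"
      using AE_iff_measurable[of B M "\<lambda>z. z \<notin> B"] sets.sets_into_space[OF B] by auto
    moreover have "emeasure M B = (\<Prod>g\<in>F \<union> P. emeasure lborel {z0 g - e<..<z0 g + e})"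
      unfolding B_def using finF finP by (intro emeasure_PiM) auto
    moreover have "(\<Prod>g\<in>F \<union> P. emeasure lborel {z0 g - e<..<z0 g + e}) \<noteq> 0"
      using finF finP e by (simp add: prod_zero_iff)
    ultimately show False by simp
  qed
  moreover have "C0 w \<ge> 0" unfolding C0_def using nn by (intro Bochner_Integration.integral_nonneg_AE) auto
  ultimately show ?thesis by simp
qed

end

section \<open>Integer tuples under multiplicative inequalities\<close>

text \<open>Up to an endpoint the cell of \<open>k\<close> is the interval from \<open>ln k\<close>
  to \<open>ln (k + 1)\<close>, over which \<open>exp\<close> integrates to 1.\<close>

lemma nn_integral_exp_floor:
  assumes "k > (0::nat)"
  shows "(\<integral>\<^sup>+y. ennreal (exp y * indicator {0..} y) * indicator {y. max 1 (nat \<lfloor>exp y\<rfloor>) = k} y \<partial>lborel) = 1"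
proof -
  have ln: "0 \<le> ln (real k)" "ln (real k) \<le> ln (real (Suc k))" using assms by auto
  have eq: "(exp y * indicator {0..} y) * indicator {y. max 1 (nat \<lfloor>exp y\<rfloor>) = k} y =
      exp y * indicator {ln (real k)..ln (real (Suc k))} y" if y: "y \<noteq> ln (real (Suc k))" for y :: real
  proof (cases "y \<ge> 0")
    case False
    then have "y < ln (real k)" using ln by linarith
    with False show ?thesis by (simp add: indicator_def)
  next
    case True
    then have e1: "exp y \<ge> 1" by simp
    have "\<lfloor>exp y\<rfloor> \<ge> 1" using e1 by linarith
    then have "max 1 (nat \<lfloor>exp y\<rfloor>) = k \<longleftrightarrow> \<lfloor>exp y\<rfloor> = int k" by linarith
    also have "\<dots> \<longleftrightarrow> real k \<le> exp y \<and> exp y < real (Suc k)" by (simp add: floor_eq_iff add.commute)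
    also have "\<dots> \<longleftrightarrow> ln (real k) \<le> y \<and> y < ln (real (Suc k))"
      using assms by (metis exp_less_cancel_iff exp_le_cancel_iff exp_ln of_nat_0_less_iff zero_less_Suc)
    finally show ?thesis using True y by (auto simp: indicator_def)
  qed
  have ae: "AE y in lborel. y \<noteq> ln (real (Suc k))"
    by (rule AE_lborel_singleton)
  have "(\<integral>\<^sup>+y. ennreal (exp y * indicator {0..} y) * indicator {y. max 1 (nat \<lfloor>exp y\<rfloor>) = k} y \<partial>lborel) =
      (\<integral>\<^sup>+y. ennreal (exp y) * indicator {ln (real k)..ln (real (Suc k))} y \<partial>lborel)"
  proof (rule nn_integral_cong_AE, use ae in eventually_elim)
    case (elim y)
    from eq[OF elim] show ?case
      by (auto simp: indicator_def split: if_splits)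
  qed
  also have "\<dots> = ennreal (exp (ln (real (Suc k))) - exp (ln (real k)))"
    using ln by (intro nn_integral_FTC_Icc) (auto intro!: derivative_eq_intros)
  also have "\<dots> = 1" using assms by simp
  finally show ?thesis .
qed

text \<open>\<open>max 1\<close> keeps the values positive also for negative \<open>z g\<close>,
  where \<open>exp_weight\<close> vanishes anyway.\<close>

definition exp_floor :: "'a set \<Rightarrow> ('a \<Rightarrow> real) \<Rightarrow> 'a \<Rightarrow> nat" where
  "exp_floor A z = (\<lambda>g\<in>A. max 1 (nat \<lfloor>exp (z g)\<rfloor>))"

definition exp_weight :: "'a set \<Rightarrow> ('a \<Rightarrow> real) \<Rightarrow> ennreal" where
  "exp_weight A z = (\<Prod>g\<in>A. ennreal (exp (z g) * indicator {0..} (z g)))"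

abbreviation pos_tuples :: "'a set \<Rightarrow> ('a \<Rightarrow> nat) set" where
  "pos_tuples A \<equiv> A \<rightarrow>\<^sub>E {0<..}"

lemma exp_weight_meas[measurable]: "exp_weight A \<in> borel_measurable (lborel_PiM A)"
  unfolding exp_weight_def
proof (rule borel_measurable_prod_ennreal)
  fix g assume "g \<in> A"
  then have [measurable]: "(\<lambda>z. z g) \<in> borel_measurable (lborel_PiM A)"
    by (auto intro: measurable_component_singleton)
  show "(\<lambda>z. ennreal (exp (z g) * indicator {0..} (z g))) \<in> borel_measurable (lborel_PiM A)"
    by measurable
qed

lemma exp_weight_eq:
  "finite A \<Longrightarrow> exp_weight A z = ennreal (if \<forall>g\<in>A. 0 \<le> z g then exp (\<Sum>g\<in>A. z g) else 0)"
proof (cases "\<forall>g\<in>A. 0 \<le> z g")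
  case True
  then show ?thesis if "finite A" using that unfolding exp_weight_def by (simp add: prod_ennreal exp_sum)
next
  case False
  then obtain g where "g \<in> A" "z g < 0" by force
  then show ?thesis if "finite A" using that unfolding exp_weight_def
    by (subst if_not_P[OF False]) (simp add: prod_zero_iff, intro bexI[of _ g], auto)
qed

lemma exp_floor_meas:
  assumes "finite A"
  shows "exp_floor A \<in> measurable (lborel_PiM A) (count_space (pos_tuples A))"
proof (subst measurable_count_space_eq_countable)
  show cnt: "countable (pos_tuples A)" using assms by (intro countable_PiE) auto
  have "exp_floor A -` {a} \<inter> space (lborel_PiM A) \<in> sets (lborel_PiM A)" if a: "a \<in> pos_tuples A" for a
  proof -
    have "exp_floor A -` {a} \<inter> space (lborel_PiM A) =
        {z \<in> space (lborel_PiM A). \<forall>g\<in>A. max 1 (nat \<lfloor>exp (z g)\<rfloor>) = a g}"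
      using a unfolding exp_floor_def PiE_def extensional_def by (auto simp: fun_eq_iff)
    also have "\<dots> \<in> sets (lborel_PiM A)"
    proof (intro sets.sets_Collect_finite_All assms)
      fix g assume "g \<in> A"
      then have [measurable]: "(\<lambda>z. z g) \<in> borel_measurable (lborel_PiM A)"
        by (auto intro: measurable_component_singleton)
      show "{z \<in> space (lborel_PiM A). max 1 (nat \<lfloor>exp (z g)\<rfloor>) = a g} \<in> sets (lborel_PiM A)"
        by measurable
    qed
    finally show ?thesis .
  qed
  then show "exp_floor A \<in> space (lborel_PiM A) \<rightarrow> pos_tuples A \<and>
    (\<forall>a\<in>pos_tuples A. exp_floor A -` {a} \<inter> space (lborel_PiM A) \<in> sets (lborel_PiM A))"
    by (auto simp: exp_floor_def)
qed

text \<open>Under \<open>z \<mapsto> \<lfloor>exp z\<rfloor>\<close> the measure \<open>exp z dz\<close> on the positive axis becomes counting measure.\<close>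

lemma nn_integral_count_tuples:
  fixes f :: "('a \<Rightarrow> nat) \<Rightarrow> ennreal"
  assumes fin: "finite A"
  shows "(\<integral>\<^sup>+m. f m \<partial>count_space (pos_tuples A)) =
    (\<integral>\<^sup>+z. exp_weight A z * f (exp_floor A z) \<partial>lborel_PiM A)"
proof -
  interpret product_sigma_finite "\<lambda>_. lborel :: real measure" by (rule product_sigma_finite_lborel)
  define N where "N = distr (density (lborel_PiM A) (exp_weight A)) (count_space (pos_tuples A)) (exp_floor A)"
  have efm[measurable]: "exp_floor A \<in> measurable (lborel_PiM A) (count_space (pos_tuples A))"
    by (rule exp_floor_meas[OF fin])
  have "N = count_space (pos_tuples A)"
  proof (rule measure_eqI_countable)
    show "sets N = Pow (pos_tuples A)" by (simp add: N_def)
    show "countable (pos_tuples A)" using fin by (intro countable_PiE) auto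
    fix a assume a: "a \<in> pos_tuples A"
    have "emeasure N {a} = (\<integral>\<^sup>+z. exp_weight A z * indicator (exp_floor A -` {a} \<inter> space (lborel_PiM A)) z \<partial>lborel_PiM A)"
      unfolding N_def using a
      by (subst emeasure_distr) (auto simp: emeasure_density measurable_sets[OF efm])
    also have "\<dots> = (\<integral>\<^sup>+z. (\<Prod>g\<in>A. ennreal (exp (z g) * indicator {0..} (z g)) *
        indicator {y. max 1 (nat \<lfloor>exp y\<rfloor>) = a g} (z g)) \<partial>lborel_PiM A)"
    proof (rule nn_integral_cong)
      fix z assume z: "z \<in> space (lborel_PiM A)"
      have "indicator (exp_floor A -` {a} \<inter> space (lborel_PiM A)) z =
          (\<Prod>g\<in>A. indicator {y. max 1 (nat \<lfloor>exp y\<rfloor>) = a g} (z g) :: ennreal)"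
      proof (cases "exp_floor A z = a")
        case True
        then have "max 1 (nat \<lfloor>exp (z g)\<rfloor>) = a g" if "g \<in> A" for g
          using that unfolding exp_floor_def by (auto simp: fun_eq_iff split: if_splits)
        then show ?thesis using True z by (simp add: indicator_def)
      next
        case False
        have "\<exists>g\<in>A. max 1 (nat \<lfloor>exp (z g)\<rfloor>) \<noteq> a g"
        proof (rule ccontr)
          assume "\<not> (\<exists>g\<in>A. max 1 (nat \<lfloor>exp (z g)\<rfloor>) \<noteq> a g)"
          then have "exp_floor A z = a"
            by (intro PiE_ext[OF _ a]) (auto simp: exp_floor_def)
          with False show False by blast
        qed
        then obtain g where "g \<in> A" "max 1 (nat \<lfloor>exp (z g)\<rfloor>) \<noteq> a g" by blast
        then have "(\<Prod>g\<in>A. indicator {y. max 1 (nat \<lfloor>exp y\<rfloor>) = a g} (z g) :: ennreal) = 0"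
          using fin by (intro prod_zero) (auto simp: indicator_def)
        then show ?thesis using False by (simp add: indicator_def)
      qed
      then show "exp_weight A z * indicator (exp_floor A -` {a} \<inter> space (lborel_PiM A)) z =
        (\<Prod>g\<in>A. ennreal (exp (z g) * indicator {0..} (z g)) *
        indicator {y. max 1 (nat \<lfloor>exp y\<rfloor>) = a g} (z g))"
        by (simp add: exp_weight_def prod.distrib)
    qed
    also have "\<dots> = (\<Prod>g\<in>A. \<integral>\<^sup>+y. ennreal (exp y * indicator {0..} y) *
        indicator {y. max 1 (nat \<lfloor>exp y\<rfloor>) = a g} y \<partial>lborel)"
      using fin by (intro product_nn_integral_prod) auto
    also have "\<dots> = 1" using a by (intro prod.neutral ballI nn_integral_exp_floor) auto
    finally show "emeasure N {a} = emeasure (count_space (pos_tuples A)) {a}" using a by simp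
  qed simp
  then have "(\<integral>\<^sup>+m. f m \<partial>count_space (pos_tuples A)) = (\<integral>\<^sup>+m. f m \<partial>N)" by simp
  also have "\<dots> = (\<integral>\<^sup>+z. exp_weight A z * f (exp_floor A z) \<partial>lborel_PiM A)"
  proof -
    have [measurable]: "(\<lambda>z. f (exp_floor A z)) \<in> borel_measurable (lborel_PiM A)"
      by (rule measurable_compose[OF efm]) simp
    show ?thesis unfolding N_def by (subst nn_integral_distr) (auto simp: nn_integral_density)
  qed
  finally show ?thesis .
qed

section \<open>Integer tuples as cells in the exponential volume\<close>

context pivot_system
begin

abbreviation "T \<equiv> F \<union> P"

text \<open>The change of \<open>G z\<close> when every coordinate is raised by 1.\<close>

definition Gsum :: "'i \<Rightarrow> real" where "Gsum i = (\<Sum>g\<in>T. G g i)"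

definition lin :: "('g \<Rightarrow> real) \<Rightarrow> 'i \<Rightarrow> real" where
  "lin z i = (\<Sum>g\<in>T. G g i * z g)"

definition pairing :: "('i \<Rightarrow> real) \<Rightarrow> real" where "pairing b = (\<Sum>i\<in>I. s i * b i)"

definition tuples :: "('i \<Rightarrow> real) \<Rightarrow> ('g \<Rightarrow> nat) set" where
  "tuples b = {m \<in> pos_tuples T. \<forall>i\<in>I. lin (\<lambda>g. ln (real (m g))) i \<le> b i}"

lemma finT: "finite T" using finF finP by simp

lemma lin_mono: "(\<And>g. g \<in> T \<Longrightarrow> z g \<le> z' g) \<Longrightarrow> i \<in> I \<Longrightarrow> lin z i \<le> lin z' i"
  unfolding lin_def using G_nonneg by (intro sum_mono mult_left_mono) auto

text \<open>Every column pairs to 1 with \<open>s\<close>. Hence the weight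
  \<open>exp (\<Sum>g\<in>T. z g)\<close> is at most \<open>exp (pairing b)\<close> wherever
  \<open>lin z \<le> b\<close>.\<close>

lemma pairing_lin: "pairing (lin z) = (\<Sum>g\<in>T. z g)"
proof -
  have "pairing (lin z) = (\<Sum>g\<in>T. z g * (\<Sum>i\<in>I. s i * G g i))"
    unfolding pairing_def lin_def sum_distrib_left by (subst sum.swap) (simp add: mult_ac)
  then show ?thesis by (simp add: sG)
qed

lemma pairing_Gsum: "pairing Gsum = card T"
  using pairing_lin[of "\<lambda>_. 1"] by (simp add: lin_def[abs_def] Gsum_def[abs_def])

lemma pairing_add: "pairing (\<lambda>i. b i + k * b' i) = pairing b + k * pairing b'"
  by (simp add: pairing_def algebra_simps sum.distrib sum_distrib_left)

lemma pairing_diff: "pairing (\<lambda>i. b i - k * b' i) = pairing b - k * pairing b'"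
  by (simp add: pairing_def algebra_simps sum_subtractf sum_distrib_left)

lemma pairing_diff': "pairing (\<lambda>i. b i - b' i) = pairing b - pairing b'"
  using pairing_diff[of b 1 b'] by simp

lemma tuple_large_coord:
  assumes "m \<in> tuples b" "g \<in> T"
  shows "ln (real (m g)) \<le> (\<Sum>i\<in>I. \<bar>s i * b i\<bar>)"
proof -
  have ln0: "ln (real (m g)) \<ge> 0" if "g \<in> T" for g
    using assms(1) that by (auto simp: tuples_def PiE_iff Suc_le_eq[symmetric])
  have "ln (real (m g)) \<le> (\<Sum>g\<in>T. ln (real (m g)))"
    using assms(2) ln0 finT by (intro member_le_sum) auto
  also have "\<dots> = pairing (lin (\<lambda>g. ln (real (m g))))" by (simp add: pairing_lin)
  also have "\<dots> \<le> (\<Sum>i\<in>I. s i * b i)" unfolding pairing_def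
    using assms(1) s_pos by (intro sum_mono mult_left_mono) (auto simp: tuples_def intro: less_imp_le)
  also have "\<dots> \<le> (\<Sum>i\<in>I. \<bar>s i * b i\<bar>)" by (intro sum_mono) auto
  finally show ?thesis .
qed

lemma finite_tuples: "finite (tuples b)"
proof (rule finite_subset)
  define B where "B = nat \<lfloor>exp (\<Sum>i\<in>I. \<bar>s i * b i\<bar>)\<rfloor>"
  show "tuples b \<subseteq> T \<rightarrow>\<^sub>E {..B}"
  proof
    fix m assume m: "m \<in> tuples b"
    have "m g \<le> B" if "g \<in> T" for g
    proof -
      have "m g > 0" using m that by (auto simp: tuples_def PiE_iff)
      then have "real (m g) \<le> exp (\<Sum>i\<in>I. \<bar>s i * b i\<bar>)"
        using tuple_large_coord[OF m that] by (metis exp_le_cancel_iff exp_ln of_nat_0_less_iff)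
      then show ?thesis unfolding B_def by linarith
    qed
    then show "m \<in> T \<rightarrow>\<^sub>E {..B}" using m by (auto simp: tuples_def PiE_iff)
  qed
  show "finite (T \<rightarrow>\<^sub>E {..B})" using finT by (intro finite_PiE) auto
qed

lemma card_tuples_integral:
  assumes "S \<subseteq> tuples b"
  shows "ennreal (real (card S)) = (\<integral>\<^sup>+z. exp_weight T z * indicator S (exp_floor T z) \<partial>M)"
proof -
  have fin: "finite S" using assms finite_tuples by (rule finite_subset)
  have sub: "S \<subseteq> pos_tuples T" using assms by (auto simp: tuples_def)
  have "(\<integral>\<^sup>+m. indicator S m \<partial>count_space (pos_tuples T)) = ennreal (real (card S))"
    using fin sub by (subst nn_integral_indicator) (auto simp: ennreal_of_nat_eq_real_of_nat)
  then show ?thesis using nn_integral_count_tuples[OF finT, of "indicator S"] by simp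
qed

lemma set_meas: "{z \<in> space M. (\<forall>g\<in>T. k \<le> z g) \<and> (\<forall>i\<in>I. lin z i \<le> b i)} \<in> sets M"
proof -
  have 1: "Measurable.pred M (\<lambda>z. \<forall>g\<in>T. 0 \<le> z g - k)"
    using finT by (intro pred_meas) auto
  have "Measurable.pred M (\<lambda>z. \<forall>i\<in>I. 0 \<le> b i - lin z i)"
    unfolding lin_def using finI by (intro pred_meas lin_meas0) auto
  with 1 have "Measurable.pred M (\<lambda>z. (\<forall>g\<in>T. 0 \<le> z g - k) \<and> (\<forall>i\<in>I. 0 \<le> b i - lin z i))"
    by measurable
  then show ?thesis by (simp add: pred_def)
qed

text \<open>On the region, \<open>exp_weight\<close> is \<open>exp (pairing b)\<close> times the
  density of the slack, since \<open>pairing\<close> of the slack is \<open>pairing b\<close> minus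
  the sum of the coordinates.\<close>

lemma exp_vol:
  "(\<integral>\<^sup>+z. exp_weight T z * indicator {z. \<forall>i\<in>I. lin z i \<le> b i} z \<partial>M) = ennreal (exp (pairing b)) * vol b"
proof -
  have "ennreal (exp (pairing b)) * vol b = (\<integral>\<^sup>+z. ennreal (exp (pairing b)) * ennreal (if \<forall>g\<in>T. 0 \<le> z g
     then dens (\<lambda>i. b i - (\<Sum>g\<in>T. G g i * z g)) else 0) \<partial>M)"
    unfolding vol_def by (intro nn_integral_cmult[symmetric] measurable_compose[OF vol_meas measurable_ennreal])
  also have "\<dots> = (\<integral>\<^sup>+z. exp_weight T z * indicator {z. \<forall>i\<in>I. lin z i \<le> b i} z \<partial>M)"
  proof (rule nn_integral_cong)
    fix z
    have "exp (pairing b) * dens (\<lambda>i. b i - lin z i) = exp (\<Sum>g\<in>T. z g) * indicator {z. \<forall>i\<in>I. lin z i \<le> b i} z"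
      using pairing_diff'[of b "lin z"] pairing_lin[of z]
      by (auto simp: dens_def indicator_def pairing_def[of "\<lambda>i. b i - lin z i"] exp_add[symmetric])
    then show "ennreal (exp (pairing b)) * ennreal (if \<forall>g\<in>T. 0 \<le> z g
     then dens (\<lambda>i. b i - (\<Sum>g\<in>T. G g i * z g)) else 0) = exp_weight T z * indicator {z. \<forall>i\<in>I. lin z i \<le> b i} z"
      unfolding exp_weight_eq[OF finT] lin_def[symmetric]
      by (auto simp: ennreal_mult'[symmetric] indicator_def split: if_splits)
  qed
  finally show ?thesis by simp
qed

text \<open>Translation by \<open>k\<close> multiplies the weight by
  \<open>exp (k * card T)\<close>, and the lowered bound loses exactly this factor in
  \<open>exp (pairing b)\<close>.\<close>

lemma exp_vol_shift:
  assumes "k \<ge> 0"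
  shows "(\<integral>\<^sup>+z. exp_weight T z * indicator {z. (\<forall>g\<in>T. k \<le> z g) \<and> (\<forall>i\<in>I. lin z i \<le> b i)} z \<partial>M) =
    ennreal (exp (pairing b)) * vol (\<lambda>i. b i - k * Gsum i)"
proof -
  let ?A = "{z. (\<forall>g\<in>T. k \<le> z g) \<and> (\<forall>i\<in>I. lin z i \<le> b i)}"
  have "(\<integral>\<^sup>+z. exp_weight T z * indicator ?A z \<partial>M) =
      (\<integral>\<^sup>+z. exp_weight T z * indicator {z \<in> space M. (\<forall>g\<in>T. k \<le> z g) \<and> (\<forall>i\<in>I. lin z i \<le> b i)} z \<partial>M)"
    by (intro nn_integral_cong) (auto simp: indicator_def)
  also have "\<dots> = ennreal (1 ^ card T) * (\<integral>\<^sup>+z. exp_weight T (\<lambda>g\<in>T. k + 1 * z g) *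
      indicator {z \<in> space M. (\<forall>g\<in>T. k \<le> z g) \<and> (\<forall>i\<in>I. lin z i \<le> b i)} (\<lambda>g\<in>T. k + 1 * z g) \<partial>M)"
    using set_meas by (intro nn_integral_PiM_affine[OF finT]) auto
  also have "\<dots> = (\<integral>\<^sup>+z. ennreal (exp (k * card T)) *
      (exp_weight T z * indicator {z. \<forall>i\<in>I. lin z i \<le> b i - k * Gsum i} z) \<partial>M)"
  proof (simp only: power_one ennreal_1 mult_1_left, rule nn_integral_cong)
    fix z
    define z' where "z' = (\<lambda>g\<in>T. k + z g)"
    have lin': "lin z' i = lin z i + k * Gsum i" for i
      by (simp add: lin_def Gsum_def z'_def algebra_simps sum.distrib sum_distrib_left)
    have sp: "z' \<in> space M" by (simp add: z'_def space_PiM)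
    have zg: "z' g = k + z g" if "g \<in> T" for g using that by (simp add: z'_def)
    have pos: "(\<forall>g\<in>T. k \<le> z' g) \<longleftrightarrow> (\<forall>g\<in>T. 0 \<le> z g)" using zg by simp
    show "exp_weight T z' * indicator {z \<in> space M. (\<forall>g\<in>T. k \<le> z g) \<and> (\<forall>i\<in>I. lin z i \<le> b i)} z' =
      ennreal (exp (k * card T)) * (exp_weight T z * indicator {z. \<forall>i\<in>I. lin z i \<le> b i - k * Gsum i} z)"
    proof (cases "(\<forall>g\<in>T. 0 \<le> z g) \<and> (\<forall>i\<in>I. lin z i \<le> b i - k * Gsum i)")
      case True
      then have T': "\<forall>g\<in>T. 0 \<le> z' g" using assms zg by simp
      have "(\<Sum>g\<in>T. z' g) = k * card T + (\<Sum>g\<in>T. z g)" by (simp add: zg sum.distrib)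
      moreover have "\<forall>i\<in>I. lin z' i \<le> b i" using True by (simp add: lin' algebra_simps)
      ultimately show ?thesis using True T' pos sp
        by (simp add: exp_weight_eq[OF finT] ennreal_mult'[symmetric] exp_add)
    next
      case False
      then consider "\<not> (\<forall>g\<in>T. 0 \<le> z g)" | "\<not> (\<forall>i\<in>I. lin z' i \<le> b i)" "\<not> (\<forall>i\<in>I. lin z i \<le> b i - k * Gsum i)"
        by (auto simp: lin' algebra_simps)
      then show ?thesis
        using pos by cases (auto simp: exp_weight_eq[OF finT] indicator_def)
    qed
  qed
  also have "\<dots> = ennreal (exp (k * card T)) *
      (\<integral>\<^sup>+z. (exp_weight T z * indicator {z. \<forall>i\<in>I. lin z i \<le> b i - k * Gsum i} z) \<partial>M)"
  proof (rule nn_integral_cmult)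
    have "(\<lambda>z. exp_weight T z * indicator {z \<in> space M. (\<forall>g\<in>T. 0 \<le> z g) \<and> (\<forall>i\<in>I. lin z i \<le> b i - k * Gsum i)} z)
        \<in> borel_measurable M" using set_meas[of 0 "\<lambda>i. b i - k * Gsum i"] by measurable
    then show "(\<lambda>z. exp_weight T z * indicator {z. \<forall>i\<in>I. lin z i \<le> b i - k * Gsum i} z) \<in> borel_measurable M"
    proof (rule measurable_cong[THEN iffD1, rotated])
      fix z assume "z \<in> space M"
      then show "exp_weight T z * indicator {z \<in> space M. (\<forall>g\<in>T. 0 \<le> z g) \<and> (\<forall>i\<in>I. lin z i \<le> b i - k * Gsum i)} z =
        exp_weight T z * indicator {z. \<forall>i\<in>I. lin z i \<le> b i - k * Gsum i} z"
        by (auto simp: exp_weight_eq[OF finT] indicator_def)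
    qed
  qed
  also have "\<dots> = ennreal (exp (pairing b)) * vol (\<lambda>i. b i - k * Gsum i)"
    unfolding exp_vol by (simp add: mult.assoc[symmetric] ennreal_mult'[symmetric] exp_add[symmetric]
        pairing_diff pairing_Gsum)
  finally show ?thesis .
qed

end

section \<open>Counting tuples by volumes\<close>

context pivot_system
begin

definition rvol :: "('i \<Rightarrow> real) \<Rightarrow> real" where "rvol b = enn2real (vol b)"

lemma vol_finite: "vol b < \<infinity>"
  using scaled_integral(1)[of 1 "\<lambda>i. 1 - b i"] by simp

lemma vol_rvol: "vol b = ennreal (rvol b)"
  unfolding rvol_def using vol_finite[of b] by simp

lemma rvol_nonneg: "rvol b \<ge> 0" by (simp add: rvol_def)

text \<open>Tuples whose entries can all be lowered by up to \<open>q\<close> and stay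
  positive.\<close>

definition deep :: "nat \<Rightarrow> ('i \<Rightarrow> real) \<Rightarrow> ('g \<Rightarrow> nat) set" where
  "deep q b = {m \<in> tuples b. \<forall>g\<in>T. q < m g}"

lemma deep_subset: "deep q b \<subseteq> tuples b" by (auto simp: deep_def)

lemma exp_floor_in: "exp_floor T z \<in> pos_tuples T"
  by (auto simp: exp_floor_def)

lemma exp_floor_le: "g \<in> T \<Longrightarrow> 0 \<le> z g \<Longrightarrow> ln (real (exp_floor T z g)) \<le> z g"
proof -
  assume g: "g \<in> T" "0 \<le> z g"
  then have "exp (z g) \<ge> 1" by simp
  then have "\<lfloor>exp (z g)\<rfloor> \<ge> 1" by linarith
  then have "real (max 1 (nat \<lfloor>exp (z g)\<rfloor>)) \<le> exp (z g)" by (simp add: max_def)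
  then have "real (exp_floor T z g) \<le> exp (z g)" "exp_floor T z g > 0" using g
    by (simp_all add: exp_floor_def)
  then show ?thesis by (metis ln_exp ln_mono of_nat_0_less_iff)
qed

lemma exp_floor_gt: "g \<in> T \<Longrightarrow> z g < ln (real (Suc (exp_floor T z g)))"
proof -
  assume g: "g \<in> T"
  have "exp (z g) < real (Suc (exp_floor T z g))" using g by (simp add: exp_floor_def) linarith
  then show ?thesis by (metis exp_less_cancel_iff exp_ln of_nat_0_less_iff zero_less_Suc)
qed

lemma exp_floor_gt': "g \<in> T \<Longrightarrow> z g \<le> ln (real (exp_floor T z g)) + ln 2"
proof -
  assume g: "g \<in> T"
  have pos: "exp_floor T z g > 0" using g by (simp add: exp_floor_def)
  have "ln (real (Suc (exp_floor T z g))) \<le> ln (real (exp_floor T z g) * 2)"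
    using pos by (intro ln_mono) auto
  also have "\<dots> = ln (real (exp_floor T z g)) + ln 2" using pos by (simp add: ln_mult)
  finally show ?thesis using exp_floor_gt[OF g, of z] by simp
qed

text \<open>Rounding down keeps the upper bounds, and a coordinate of at least
  \<open>ln (q + 1)\<close> rounds to an entry above \<open>q\<close>.\<close>

lemma deep_lower: "exp (pairing b) * rvol (\<lambda>i. b i - ln (real (Suc q)) * Gsum i) \<le> real (card (deep q b))"
proof -
  have "ennreal (exp (pairing b)) * vol (\<lambda>i. b i - ln (real (Suc q)) * Gsum i) \<le> ennreal (real (card (deep q b)))"
    unfolding card_tuples_integral[OF deep_subset]
  proof (subst exp_vol_shift[symmetric], simp, intro nn_integral_mono mult_left_mono)
    fix z :: "'g \<Rightarrow> real"
    show "indicator {z. (\<forall>g\<in>T. ln (real (Suc q)) \<le> z g) \<and> (\<forall>i\<in>I. lin z i \<le> b i)} z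
        \<le> (indicator (deep q b) (exp_floor T z) :: ennreal)"
    proof (cases "(\<forall>g\<in>T. ln (real (Suc q)) \<le> z g) \<and> (\<forall>i\<in>I. lin z i \<le> b i)")
      case True
      have z0: "0 \<le> z g" if "g \<in> T" for g
      proof -
        have "0 \<le> ln (real (Suc q))" by simp
        then show ?thesis using True that by (blast intro: order_trans)
      qed
      have "lin (\<lambda>g. ln (real (exp_floor T z g))) i \<le> b i" if "i \<in> I" for i
        using lin_mono[OF exp_floor_le[OF _ z0] that] True that by (meson order_trans)
      then have "exp_floor T z \<in> tuples b" using exp_floor_in by (simp add: tuples_def)
      moreover have "q < exp_floor T z g" if g: "g \<in> T" for g
      proof -
        have "real (Suc q) \<le> exp (z g)" using True g
          by (metis exp_le_cancel_iff exp_ln of_nat_0_less_iff zero_less_Suc)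
        then show ?thesis using g by (simp add: exp_floor_def) linarith
      qed
      ultimately show ?thesis by (simp add: deep_def indicator_def)
    qed (auto simp: indicator_def)
  qed simp
  then show ?thesis unfolding vol_rvol
    by (simp add: ennreal_mult'[symmetric])
qed

text \<open>Each tuple is charged to the cell of its predecessor, whose points lie below the
  logarithms of the tuple and so satisfy the constraints. No constant factor is lost this way;
  entries of at least 2 make the predecessor positive.\<close>

lemma shift_upper: "real (card (deep 1 b)) \<le> exp (pairing b) * rvol b"
proof -
  define D where "D = {m \<in> pos_tuples T. (\<lambda>g\<in>T. Suc (m g)) \<in> deep 1 b}"
  have "D \<subseteq> tuples b"
  proof
    fix m assume m: "m \<in> D"
    have "lin (\<lambda>g. ln (real (m g))) i \<le> b i" if i: "i \<in> I" for i
    proof -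
      have "lin (\<lambda>g. ln (real (m g))) i \<le> lin (\<lambda>g. ln (real ((\<lambda>g\<in>T. Suc (m g)) g))) i"
      proof (rule lin_mono[OF _ i])
        fix g assume "g \<in> T"
        then have "m g > 0" using m by (auto simp: D_def PiE_iff)
        then show "ln (real (m g)) \<le> ln (real ((\<lambda>g\<in>T. Suc (m g)) g))" using \<open>g \<in> T\<close> by simp
      qed
      also have "\<dots> \<le> b i" using m i by (simp add: D_def deep_def tuples_def)
      finally show ?thesis .
    qed
    then show "m \<in> tuples b" using m by (simp add: D_def tuples_def)
  qed
  note subD = this
  have "card (deep 1 b) = card D"
  proof (rule bij_betw_same_card[OF bij_betw_byWitness[where f = "\<lambda>m. \<lambda>g\<in>T. m g - 1" and f' = "\<lambda>m. \<lambda>g\<in>T. Suc (m g)"]])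
    have inv: "(\<lambda>g\<in>T. Suc ((\<lambda>g\<in>T. m g - 1) g)) = m" if "m \<in> deep 1 b" for m
      using that by (auto simp: deep_def tuples_def fun_eq_iff PiE_iff extensional_def)
    then show "\<forall>m\<in>deep 1 b. (\<lambda>g\<in>T. Suc ((\<lambda>g\<in>T. m g - 1) g)) = m" by blast
    show "\<forall>m\<in>D. (\<lambda>g\<in>T. (\<lambda>g\<in>T. Suc (m g)) g - 1) = m"
      by (auto simp: D_def fun_eq_iff PiE_iff extensional_def)
    show "(\<lambda>m. \<lambda>g\<in>T. m g - 1) ` deep 1 b \<subseteq> D"
      using inv by (auto simp: D_def deep_def PiE_iff)
    show "(\<lambda>m. \<lambda>g\<in>T. Suc (m g)) ` D \<subseteq> deep 1 b" by (auto simp: D_def)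
  qed
  then have "ennreal (real (card (deep 1 b))) = (\<integral>\<^sup>+z. exp_weight T z * indicator D (exp_floor T z) \<partial>M)"
    using card_tuples_integral[OF subD] by simp
  also have "\<dots> \<le> (\<integral>\<^sup>+z. exp_weight T z * indicator {z. \<forall>i\<in>I. lin z i \<le> b i} z \<partial>M)"
  proof (intro nn_integral_mono mult_left_mono)
    fix z :: "'g \<Rightarrow> real"
    show "indicator D (exp_floor T z) \<le> (indicator {z. \<forall>i\<in>I. lin z i \<le> b i} z :: ennreal)"
    proof (cases "exp_floor T z \<in> D")
      case True
      have "lin z i \<le> b i" if i: "i \<in> I" for i
      proof -
        have "lin z i \<le> lin (\<lambda>g. ln (real ((\<lambda>g\<in>T. Suc (exp_floor T z g)) g))) i"
          using exp_floor_gt by (intro lin_mono[OF _ i]) (auto intro: less_imp_le)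
        also have "\<dots> \<le> b i" using True i by (simp add: D_def deep_def tuples_def)
        finally show ?thesis .
      qed
      then show ?thesis by (simp add: indicator_def)
    qed (simp add: indicator_def)
  qed simp
  also have "\<dots> = ennreal (exp (pairing b) * rvol b)"
    unfolding exp_vol by (simp add: vol_rvol ennreal_mult')
  finally show ?thesis by (simp add: rvol_nonneg)
qed

text \<open>A cell reaches at most \<open>ln 2\<close> above the logarithm of its tuple, because
  \<open>m + 1 \<le> 2 * m\<close>.\<close>

definition up :: "('i \<Rightarrow> real) \<Rightarrow> 'i \<Rightarrow> real" where "up b i = b i + ln 2 * Gsum i"

lemma tuple_up:
  assumes "exp_floor T z \<in> tuples b" "i \<in> I"
  shows "lin z i \<le> up b i"
proof -
  have "lin z i \<le> lin (\<lambda>g. ln (real (exp_floor T z g)) + ln 2) i"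
    using exp_floor_gt' assms(2) by (intro lin_mono)
  also have "\<dots> = lin (\<lambda>g. ln (real (exp_floor T z g))) i + ln 2 * Gsum i"
    by (simp add: lin_def Gsum_def algebra_simps sum.distrib sum_distrib_left)
  also have "\<dots> \<le> up b i" using assms by (simp add: tuples_def up_def)
  finally show ?thesis .
qed

lemma tuples_upper: "real (card (tuples b)) \<le> exp (pairing (up b)) * rvol (up b)"
proof -
  have "ennreal (real (card (tuples b))) \<le> (\<integral>\<^sup>+z. exp_weight T z * indicator {z. \<forall>i\<in>I. lin z i \<le> up b i} z \<partial>M)"
    unfolding card_tuples_integral[OF order_refl]
    by (intro nn_integral_mono mult_left_mono) (auto simp: indicator_def tuple_up)
  also have "\<dots> = ennreal (exp (pairing (up b)) * rvol (up b))"
    unfolding exp_vol by (simp add: vol_rvol ennreal_mult')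
  finally show ?thesis by (simp add: rvol_nonneg)
qed

text \<open>A tuple with an entry 1 has its cell below \<open>ln 2\<close> in that coordinate,
  disjoint from the region where all coordinates are at least \<open>ln 2\<close>. That region under
  the bound \<open>up b\<close> is a translate of the one for \<open>b\<close>, so what remains is a
  difference of two volumes with the same asymptotics.\<close>

lemma boundary_upper:
  "real (card (tuples b - deep 1 b)) \<le> exp (pairing (up b)) * (rvol (up b) - rvol b)"
proof -
  let ?A = "{z. \<forall>i\<in>I. lin z i \<le> up b i}" and ?B = "{z. (\<forall>g\<in>T. ln 2 \<le> z g) \<and> (\<forall>i\<in>I. lin z i \<le> up b i)}"
  have 1: "indicator (tuples b - deep 1 b) (exp_floor T z) + indicator ?B z \<le> (indicator ?A z :: ennreal)"
    for z :: "'g \<Rightarrow> real"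
  proof (cases "exp_floor T z \<in> tuples b - deep 1 b")
    case True
    then have "\<not> (\<forall>g\<in>T. 1 < exp_floor T z g)" unfolding deep_def by blast
    then obtain g where g: "g \<in> T" "exp_floor T z g \<le> 1" by (meson not_less)
    have "z g < ln (real (Suc (exp_floor T z g)))" using exp_floor_gt[OF g(1)] .
    also have "\<dots> \<le> ln 2" using g(2) by (intro ln_mono) auto
    finally have "\<not> ln 2 \<le> z g" by simp
    then have "z \<notin> ?B" using g(1) by blast
    moreover have "z \<in> ?A" using tuple_up True by blast
    ultimately show ?thesis using True by (simp add: indicator_def)
  qed (auto simp: indicator_def)
  have "ennreal (real (card (tuples b - deep 1 b))) + ennreal (exp (pairing (up b))) * vol b =
      (\<integral>\<^sup>+z. exp_weight T z * indicator (tuples b - deep 1 b) (exp_floor T z) \<partial>M) +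
      (\<integral>\<^sup>+z. exp_weight T z * indicator ?B z \<partial>M)"
    by (subst card_tuples_integral[OF Diff_subset], subst exp_vol_shift) (auto simp: up_def)
  also have "\<dots> = (\<integral>\<^sup>+z. exp_weight T z * indicator (tuples b - deep 1 b) (exp_floor T z) + exp_weight T z * indicator ?B z \<partial>M)"
  proof (rule nn_integral_add[symmetric])
    have "(\<lambda>z. indicator (tuples b - deep 1 b) (exp_floor T z) :: ennreal) \<in> borel_measurable M"
      by (rule measurable_compose[OF exp_floor_meas[OF finT]]) simp
    then show "(\<lambda>z. exp_weight T z * indicator (tuples b - deep 1 b) (exp_floor T z)) \<in> borel_measurable M"
      by (intro borel_measurable_times_ennreal exp_weight_meas)
    have "(\<lambda>z. exp_weight T z * indicator {z \<in> space M. (\<forall>g\<in>T. ln 2 \<le> z g) \<and> (\<forall>i\<in>I. lin z i \<le> up b i)} z)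
        \<in> borel_measurable M" using set_meas[of "ln 2" "up b"] by measurable
    then show "(\<lambda>z. exp_weight T z * indicator ?B z) \<in> borel_measurable M"
      by (rule measurable_cong[THEN iffD1, rotated]) (auto simp: indicator_def)
  qed
  also have "\<dots> \<le> (\<integral>\<^sup>+z. exp_weight T z * indicator ?A z \<partial>M)"
    unfolding distrib_left[symmetric] by (intro nn_integral_mono mult_left_mono 1) simp
  also have "\<dots> = ennreal (exp (pairing (up b)) * rvol (up b))"
    unfolding exp_vol by (simp add: vol_rvol ennreal_mult')
  finally have "ennreal (real (card (tuples b - deep 1 b)) + exp (pairing (up b)) * rvol b)
      \<le> ennreal (exp (pairing (up b)) * rvol (up b))"
    by (simp add: vol_rvol ennreal_mult'[symmetric] rvol_nonneg)
  then have "real (card (tuples b - deep 1 b)) + exp (pairing (up b)) * rvol b \<le> exp (pairing (up b)) * rvol (up b)"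
    using rvol_nonneg by (subst (asm) ennreal_le_iff) auto
  then show ?thesis by (simp add: right_diff_distrib)
qed

lemma pairing_up: "pairing (up b) = pairing b + ln 2 * card T"
  by (simp add: up_def[abs_def] pairing_add pairing_Gsum)

lemma exp_pairing_up: "exp (pairing (up b)) = exp (pairing b) * 2 ^ card T"
  by (simp add: pairing_up exp_add mult.commute[of "ln 2"] exp_of_nat_mult)

definition dens_count :: "('g \<Rightarrow> nat) set \<Rightarrow> ('i \<Rightarrow> real) \<Rightarrow> real" where
  "dens_count S b = real (card (S \<inter> tuples b)) * exp (- pairing b)"

lemma dens_count_bounds:
  "rvol (\<lambda>i. b i - ln (real (Suc q)) * Gsum i) \<le> dens_count (deep q b) b"
  "dens_count UNIV b \<le> rvol b + 2 ^ card T * (rvol (up b) - rvol b)"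
  "dens_count UNIV b \<le> 2 ^ card T * rvol (up b)"
proof -
  have e: "exp (pairing b) * x * exp (- pairing b) = x" for x
    by (simp add: exp_minus)
  show "rvol (\<lambda>i. b i - ln (real (Suc q)) * Gsum i) \<le> dens_count (deep q b) b"
    using mult_right_mono[OF deep_lower[of b q], of "exp (- pairing b)"] deep_subset
    by (simp add: dens_count_def e Int_absorb2)
  have "card (tuples b) = card (tuples b - deep 1 b) + card (deep 1 b)"
    using card_Diff_subset[of "deep 1 b" "tuples b"] finite_subset[OF deep_subset finite_tuples] deep_subset
      card_mono[OF finite_tuples deep_subset] by simp
  then have "real (card (tuples b)) \<le> exp (pairing b) * (2 ^ card T * (rvol (up b) - rvol b)) + exp (pairing b) * rvol b"
    using boundary_upper[of b] shift_upper[of b] by (simp add: exp_pairing_up mult.assoc)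
  then have "real (card (tuples b)) * exp (- pairing b) \<le>
      exp (pairing b) * (2 ^ card T * (rvol (up b) - rvol b) + rvol b) * exp (- pairing b)"
    by (intro mult_right_mono) (auto simp: distrib_left)
  then show "dens_count UNIV b \<le> rvol b + 2 ^ card T * (rvol (up b) - rvol b)"
    unfolding e by (simp add: dens_count_def)
  have "real (card (tuples b)) * exp (- pairing b) \<le> exp (pairing b) * (2 ^ card T * rvol (up b)) * exp (- pairing b)"
    using tuples_upper[of b] by (intro mult_right_mono) (auto simp: exp_pairing_up mult.assoc)
  then show "dens_count UNIV b \<le> 2 ^ card T * rvol (up b)"
    unfolding e by (simp add: dens_count_def)
qed

lemma rvol_tendsto:
  "((\<lambda>L. rvol (\<lambda>i. L - w i + k * Gsum i) / L ^ card F) \<longlongrightarrow> C0 w) at_top"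
proof -
  have "C0 (\<lambda>i. w i + (- k) * Gsum i) = C0 w"
    unfolding Gsum_def by (rule C0_shift_all)
  with vol_tendsto[of "\<lambda>i. w i + (- k) * Gsum i"] show ?thesis
    by (simp add: rvol_def algebra_simps)
qed

lemma dens_count_mono: "S \<subseteq> S' \<Longrightarrow> dens_count S b \<le> dens_count S' b"
  unfolding dens_count_def using finite_tuples[of b]
  by (intro mult_right_mono of_nat_mono card_mono) auto

text \<open>The volumes used for comparison differ only by shifts along \<open>Gsum\<close> and
  share the limit \<open>C0 w\<close>, so the boundary term disappears and the two bounds
  meet.\<close>

lemma deep_tendsto:
  "((\<lambda>L. dens_count (deep q (\<lambda>i. L - w i)) (\<lambda>i. L - w i) / L ^ card F) \<longlongrightarrow> C0 w) at_top"
  and count_tendsto: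
  "((\<lambda>L. dens_count UNIV (\<lambda>i. L - w i) / L ^ card F) \<longlongrightarrow> C0 w) at_top"
proof -
  let ?b = "\<lambda>L i. L - w i"
  have lower: "((\<lambda>L. rvol (\<lambda>i. ?b L i - ln (real (Suc q)) * Gsum i) / L ^ card F) \<longlongrightarrow> C0 w) at_top" for q
    using rvol_tendsto[of w "- ln (real (Suc q))"] by simp
  have up: "((\<lambda>L. rvol (up (?b L)) / L ^ card F) \<longlongrightarrow> C0 w) at_top"
    using rvol_tendsto[of w "ln 2"] by (simp add: up_def[abs_def])
  have mid: "((\<lambda>L. rvol (?b L) / L ^ card F) \<longlongrightarrow> C0 w) at_top"
    using rvol_tendsto[of w 0] by simp
  have "((\<lambda>L. rvol (?b L) / L ^ card F + 2 ^ card T * (rvol (up (?b L)) / L ^ card F - rvol (?b L) / L ^ card F))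
      \<longlongrightarrow> C0 w + 2 ^ card T * (C0 w - C0 w)) at_top"
    by (intro tendsto_intros up mid)
  then have upper: "((\<lambda>L. (rvol (?b L) + 2 ^ card T * (rvol (up (?b L)) - rvol (?b L))) / L ^ card F)
      \<longlongrightarrow> C0 w) at_top"
    by (simp add: add_divide_distrib diff_divide_distrib[symmetric])
  have ev: "eventually (\<lambda>L::real. L > 0) at_top" by (rule eventually_gt_at_top)
  show deep: "((\<lambda>L. dens_count (deep q (?b L)) (?b L) / L ^ card F) \<longlongrightarrow> C0 w) at_top" for q
  proof (rule tendsto_sandwich[OF _ _ lower[of q] upper])
    show "eventually (\<lambda>L. rvol (\<lambda>i. ?b L i - ln (real (Suc q)) * Gsum i) / L ^ card F \<le>
        dens_count (deep q (?b L)) (?b L) / L ^ card F) at_top"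
      using ev by eventually_elim (intro divide_right_mono dens_count_bounds, simp)
    show "eventually (\<lambda>L. dens_count (deep q (?b L)) (?b L) / L ^ card F \<le>
        (rvol (?b L) + 2 ^ card T * (rvol (up (?b L)) - rvol (?b L))) / L ^ card F) at_top"
      using ev
    proof eventually_elim
      case (elim L)
      have "dens_count (deep q (?b L)) (?b L) \<le> dens_count UNIV (?b L)" by (intro dens_count_mono) simp
      also note dens_count_bounds(2)
      finally show ?case using elim by (intro divide_right_mono) auto
    qed
  qed
  show "((\<lambda>L. dens_count UNIV (?b L) / L ^ card F) \<longlongrightarrow> C0 w) at_top"
  proof (rule tendsto_sandwich[OF _ _ deep[of 0] upper])
    show "eventually (\<lambda>L. dens_count (deep 0 (?b L)) (?b L) / L ^ card F \<le> dens_count UNIV (?b L) / L ^ card F) at_top"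
      using ev by eventually_elim (intro divide_right_mono dens_count_mono, auto)
    show "eventually (\<lambda>L. dens_count UNIV (?b L) / L ^ card F \<le>
        (rvol (?b L) + 2 ^ card T * (rvol (up (?b L)) - rvol (?b L))) / L ^ card F) at_top"
      using ev by eventually_elim (intro divide_right_mono dens_count_bounds, simp)
  qed
qed

text \<open>In contrast to the limits this is uniform in \<open>b\<close>; it controls the tails
  when summing over primes and over families of vectors.\<close>

lemma count_bound:
  "\<exists>K>0. \<forall>L\<ge>1. \<forall>b. (\<forall>i\<in>I. b i \<le> L) \<longrightarrow> dens_count UNIV b \<le> K * L ^ card F"
proof -
  define K0 where "K0 = (\<Sum>i\<in>I. s i) + card T"
  have K0: "K0 \<ge> 0" using sum_s_pos by (simp add: K0_def)
  define J where "J = enn2real (gauge ^ card P)"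
  have J: "gauge ^ card P = ennreal J" unfolding J_def
    using gauge_finite by (simp add: power_less_top_ennreal)
  have J0: "J \<ge> 0" by (simp add: J_def)
  define K where "K = 2 ^ card T * (K0 ^ card F * J) + 1"
  have "dens_count UNIV b \<le> K * L ^ card F" if L: "L \<ge> 1" and b: "\<forall>i\<in>I. b i \<le> L" for L b
  proof -
    have "pairing b \<le> (\<Sum>i\<in>I. s i * L)" unfolding pairing_def
      using b s_pos by (intro sum_mono mult_left_mono) (auto intro: less_imp_le)
    then have "pairing b \<le> L * (\<Sum>i\<in>I. s i)" by (simp add: sum_distrib_left mult.commute)
    moreover have "ln 2 * card T \<le> L * card T"
    proof (rule mult_right_mono)
      have "ln 2 \<le> (1 :: real)" using ln_2_less_1 by simp
      with L show "ln 2 \<le> L" by linarith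
    qed simp
    ultimately have "pairing (up b) \<le> L * K0"
      unfolding pairing_up K0_def by (simp add: distrib_left)
    \<comment> \<open>The volume bound speaks of \<open>L - w\<close>; here it is taken with
      \<open>w = L - up b\<close>.\<close>
    then have "(\<Sum>i\<in>I. s i * (L - (L - up b i))) \<le> L * K0" by (simp add: pairing_def)
    from vol_le[OF _ this K0] L have "vol (up b) \<le> ennreal (L ^ card F * (K0 ^ card F * J))"
      using K0 J0 by (simp add: J ennreal_mult')
    then have "rvol (up b) \<le> L ^ card F * (K0 ^ card F * J)"
      using K0 J0 L by (simp add: vol_rvol)
    then have "2 ^ card T * rvol (up b) \<le> 2 ^ card T * (L ^ card F * (K0 ^ card F * J))"
      by (intro mult_left_mono) auto
    also have "\<dots> \<le> K * L ^ card F" using L by (simp add: K_def algebra_simps)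
    finally show ?thesis using dens_count_bounds(3)[of b] by linarith
  qed
  moreover have "K > 0" unfolding K_def using K0 J0 by (intro add_nonneg_pos mult_nonneg_nonneg) auto
  ultimately show ?thesis by blast
qed

text \<open>Dividing by \<open>d\<close> lowers \<open>b\<close> by \<open>lin\<close> of the
  logarithms of \<open>d\<close>, and \<open>pairing\<close> of that vector is the logarithm of the
  product of the \<open>d g\<close>.\<close>

lemma dens_count_multiples:
  assumes d: "\<And>g. g \<in> T \<Longrightarrow> d g > 0"
  shows "dens_count {m. \<forall>g\<in>T. d g dvd m g} b =
    dens_count UNIV (\<lambda>i. b i - lin (\<lambda>g. ln (real (d g))) i) / (\<Prod>g\<in>T. real (d g))"
proof -
  let ?b = "\<lambda>i. b i - lin (\<lambda>g. ln (real (d g))) i"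
  have ln_split: "lin (\<lambda>g. ln (real (d g * m g))) i = lin (\<lambda>g. ln (real (d g))) i + lin (\<lambda>g. ln (real (m g))) i"
    if "m \<in> pos_tuples T" for m i
  proof -
    have "(\<Sum>g\<in>T. G g i * ln (real (d g * m g))) = (\<Sum>g\<in>T. G g i * ln (real (d g)) + G g i * ln (real (m g)))"
    proof (rule sum.cong)
      fix g assume g: "g \<in> T"
      then have "m g > 0" using that by (auto simp: PiE_iff)
      then show "G g i * ln (real (d g * m g)) = G g i * ln (real (d g)) + G g i * ln (real (m g))"
        using d[OF g] by (simp add: ln_mult distrib_left)
    qed simp
    then show ?thesis by (simp add: lin_def sum.distrib)
  qed
  have lin_restr: "lin (\<lambda>g. ln (real ((\<lambda>g\<in>T. d g * m g) g))) i = lin (\<lambda>g. ln (real (d g * m g))) i" for m i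
    by (simp add: lin_def)
  have "card ({m. \<forall>g\<in>T. d g dvd m g} \<inter> tuples b) = card (tuples ?b)"
  proof (rule bij_betw_same_card[OF bij_betw_byWitness[where f = "\<lambda>m. \<lambda>g\<in>T. m g div d g" and f' = "\<lambda>m. \<lambda>g\<in>T. d g * m g"]])
    have inv: "(\<lambda>g\<in>T. d g * (\<lambda>g\<in>T. m g div d g) g) = m" if "m \<in> {m. \<forall>g\<in>T. d g dvd m g} \<inter> tuples b" for m
      using that by (auto simp: tuples_def fun_eq_iff PiE_iff extensional_def)
    then show "\<forall>m\<in>{m. \<forall>g\<in>T. d g dvd m g} \<inter> tuples b. (\<lambda>g\<in>T. d g * (\<lambda>g\<in>T. m g div d g) g) = m" by blast
    show "\<forall>m\<in>tuples ?b. (\<lambda>g\<in>T. (\<lambda>g\<in>T. d g * m g) g div d g) = m"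
      using d by (auto simp: tuples_def fun_eq_iff PiE_iff extensional_def)
    show "(\<lambda>m. \<lambda>g\<in>T. d g * m g) ` tuples ?b \<subseteq> {m. \<forall>g\<in>T. d g dvd m g} \<inter> tuples b"
    proof
      fix m' assume "m' \<in> (\<lambda>m. \<lambda>g\<in>T. d g * m g) ` tuples ?b"
      then obtain m where m: "m \<in> tuples ?b" "m' = (\<lambda>g\<in>T. d g * m g)" by blast
      then have mp: "m \<in> pos_tuples T" by (simp add: tuples_def)
      then have "m' \<in> pos_tuples T" using d by (auto simp: m(2) PiE_iff)
      moreover have "lin (\<lambda>g. ln (real (m' g))) i \<le> b i" if "i \<in> I" for i
        unfolding m(2) lin_restr ln_split[OF mp] using m(1) that by (simp add: tuples_def algebra_simps)
      ultimately show "m' \<in> {m. \<forall>g\<in>T. d g dvd m g} \<inter> tuples b"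
        by (auto simp: tuples_def m(2))
    qed
    show "(\<lambda>m. \<lambda>g\<in>T. m g div d g) ` ({m. \<forall>g\<in>T. d g dvd m g} \<inter> tuples b) \<subseteq> tuples ?b"
    proof
      fix m' assume "m' \<in> (\<lambda>m. \<lambda>g\<in>T. m g div d g) ` ({m. \<forall>g\<in>T. d g dvd m g} \<inter> tuples b)"
      then obtain m where m: "m \<in> {m. \<forall>g\<in>T. d g dvd m g} \<inter> tuples b" "m' = (\<lambda>g\<in>T. m g div d g)" by blast
      have mp: "m' \<in> pos_tuples T"
      proof -
        have "m' g > 0" if g: "g \<in> T" for g
        proof -
          have "d g dvd m g" "m g > 0" using m(1) g by (auto simp: tuples_def PiE_iff)
          then show ?thesis using d[OF g] g by (simp add: m(2) div_greater_zero_iff dvd_imp_le)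
        qed
        then show ?thesis by (auto simp: PiE_iff m(2))
      qed
      have eq: "(\<lambda>g\<in>T. d g * m' g) = m" using inv[OF m(1)] m(2) by simp
      have "lin (\<lambda>g. ln (real (m' g))) i \<le> ?b i" if "i \<in> I" for i
      proof -
        have "lin (\<lambda>g. ln (real (d g))) i + lin (\<lambda>g. ln (real (m' g))) i = lin (\<lambda>g. ln (real (m g))) i"
          using ln_split[OF mp, of i] lin_restr[of m' i] unfolding eq by simp
        also have "\<dots> \<le> b i" using m(1) that by (simp add: tuples_def)
        finally show ?thesis by simp
      qed
      then show "m' \<in> tuples ?b" using mp by (simp add: tuples_def)
    qed
  qed
  moreover have "exp (- pairing b) = exp (- pairing ?b) / (\<Prod>g\<in>T. real (d g))"
  proof -
    have "exp (\<Sum>g\<in>T. ln (real (d g))) = (\<Prod>g\<in>T. real (d g))"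
      using d finT by (simp add: exp_sum)
    moreover have "- pairing b = - pairing ?b - (\<Sum>g\<in>T. ln (real (d g)))"
      by (simp add: pairing_diff' pairing_lin)
    ultimately show ?thesis by (metis exp_diff)
  qed
  ultimately show ?thesis by (simp add: dens_count_def)
qed

end

section \<open>Square-free tuples\<close>

text \<open>A Cauchy criterion for limits that are accessible only through approximations.\<close>

lemma tendsto_at_top_if_approx:
  fixes f :: "real \<Rightarrow> real"
  assumes "\<And>e. e > 0 \<Longrightarrow> \<exists>l. eventually (\<lambda>x. \<bar>f x - l\<bar> \<le> e) at_top"
  shows "\<exists>l. (f \<longlongrightarrow> l) at_top"
proof -
  have "\<forall>n. \<exists>l. eventually (\<lambda>x. \<bar>f x - l\<bar> \<le> 1 / real (Suc n)) at_top" using assms by simp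
  then obtain l where l: "\<And>n. eventually (\<lambda>x. \<bar>f x - l n\<bar> \<le> 1 / real (Suc n)) at_top" by metis
  have dist: "\<bar>l m - l n\<bar> \<le> 1 / real (Suc m) + 1 / real (Suc n)" for m n
  proof -
    have "eventually (\<lambda>x. \<bar>l m - l n\<bar> \<le> 1 / real (Suc m) + 1 / real (Suc n)) (at_top :: real filter)"
      using l[of m] l[of n] by eventually_elim linarith
    then show ?thesis by simp
  qed
  have "Cauchy l"
  proof (rule metric_CauchyI)
    fix e :: real assume "e > 0"
    then have "e / 2 > 0" by simp
    then obtain n where n: "1 / real (Suc n) < e / 2" by (rule nat_approx_posE)
    define N where "N = Suc n"
    have N: "N > 0" "1 / real N < e / 2" using n by (auto simp: N_def)
    show "\<exists>M. \<forall>m\<ge>M. \<forall>n\<ge>M. dist (l m) (l n) < e"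
    proof (intro exI[of _ N] allI impI)
      fix m n assume mn: "N \<le> m" "N \<le> n"
      have "1 / real (Suc m) \<le> 1 / real N" "1 / real (Suc n) \<le> 1 / real N"
        using mn N(1) by (simp_all add: frac_le)
      then show "dist (l m) (l n) < e" using dist[of m n] N by (simp add: dist_real_def)
    qed
  qed
  then obtain a where a: "l \<longlonglongrightarrow> a" by (metis Cauchy_convergent_iff convergent_def)
  have "(f \<longlongrightarrow> a) at_top"
  proof (rule tendstoI)
    fix e :: real assume e: "e > 0"
    have "eventually (\<lambda>n. dist (l n) a < e / 2) sequentially" using a e by (intro tendstoD) auto
    moreover have "eventually (\<lambda>n. 1 / real (Suc n) < e / 2) sequentially"
      using e LIMSEQ_inverse_real_of_nat by (intro order_tendstoD) (auto simp: inverse_eq_divide)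
    ultimately have "eventually (\<lambda>n. dist (l n) a < e / 2 \<and> 1 / real (Suc n) < e / 2) sequentially"
      by eventually_elim blast
    from eventually_happens'[OF sequentially_bot this]
    obtain n where n: "dist (l n) a < e / 2" "1 / real (Suc n) < e / 2" by blast
    show "eventually (\<lambda>x. dist (f x) a < e) at_top"
      using l[of n]
    proof eventually_elim
      case (elim x)
      then show ?case using n unfolding dist_real_def by linarith
    qed
  qed
  then show ?thesis by blast
qed

text \<open>Telescoping, with \<open>1 / p ^ 2 \<le> 1 / (p - 1) - 1 / p\<close>.\<close>

lemma sum_inverse_squares_le:
  assumes "Q > (0::nat)"
  shows "(\<Sum>p\<in>{Q<..N}. 1 / real p ^ 2) \<le> 1 / real Q"
proof (cases "Q \<le> N")
  case True
  have "(\<Sum>p\<in>{Q<..N}. 1 / real p ^ 2) \<le> 1 / real Q - 1 / real N"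
    using True
  proof (induction N rule: dec_induct)
    case (step n)
    have "{Q<..Suc n} = insert (Suc n) {Q<..n}" using step by auto
    then have "(\<Sum>p\<in>{Q<..Suc n}. 1 / real p ^ 2) = 1 / real (Suc n) ^ 2 + (\<Sum>p\<in>{Q<..n}. 1 / real p ^ 2)"
      by simp
    also have "\<dots> \<le> 1 / real (Suc n) ^ 2 + (1 / real Q - 1 / real n)" using step by simp
    also have "1 / real (Suc n) ^ 2 \<le> 1 / real n - 1 / real (Suc n)"
    proof -
      have "n > 0" using step assms by simp
      then have "1 / real n - 1 / real (Suc n) = 1 / (real n * real (Suc n))" by (simp add: field_simps)
      also have "\<dots> \<ge> 1 / (real (Suc n) * real (Suc n))" using \<open>n > 0\<close>
        by (intro divide_left_mono mult_right_mono) auto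
      finally show ?thesis by (simp add: power2_eq_square)
    qed
    finally show ?case by simp
  qed simp
  moreover have "1 / real N \<ge> 0" by simp
  ultimately show ?thesis by linarith
qed simp

text \<open>Turns a condition on the product into finitely many divisibility conditions on the
  entries, whose densities are available from \<open>dens_count_multiples\<close>.\<close>

lemma prime_square_dvd_prod:
  fixes f :: "'a \<Rightarrow> nat"
  assumes "finite A" "prime p" "p\<^sup>2 dvd (\<Prod>g\<in>A. f g)"
  shows "\<exists>g\<in>A. \<exists>h\<in>A. (g = h \<and> p\<^sup>2 dvd f g) \<or> (g \<noteq> h \<and> p dvd f g \<and> p dvd f h)"
proof -
  have "p dvd (\<Prod>g\<in>A. f g)" using assms(3) by (rule dvd_trans[rotated]) simp
  then obtain g where g: "g \<in> A" "p dvd f g" using assms(1,2) by (meson prime_dvd_prod_iff)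
  show ?thesis
  proof (cases "p\<^sup>2 dvd f g")
    case True
    then show ?thesis using g by blast
  next
    case False
    obtain a where a: "f g = p * a" using g by blast
    have p0: "p > 0" using assms(2) prime_gt_0_nat by blast
    have na: "\<not> p dvd a" using False a p0 by (auto simp: power2_eq_square)
    have "p * p dvd p * (a * (\<Prod>g\<in>A - {g}. f g))"
      using assms(3) g(1) assms(1) by (simp add: prod.remove a power2_eq_square mult.assoc)
    then have "p dvd a * (\<Prod>g\<in>A - {g}. f g)" using p0 by simp
    then have "p dvd (\<Prod>g\<in>A - {g}. f g)" using na assms(2) by (simp add: prime_dvd_mult_iff)
    then obtain h where "h \<in> A - {g}" "p dvd f h" using assms(1,2) by (metis finite_Diff prime_dvd_prod_iff)
    then show ?thesis using g by blast
  qed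
qed

section \<open>Sieving for square-free tuples\<close>

context pivot_system
begin

definition tprod :: "('g \<Rightarrow> nat) \<Rightarrow> nat" where "tprod m = (\<Prod>g\<in>T. m g)"

text \<open>A square-free product encodes at once that the entries are square-free and pairwise
  coprime; \<open>D\<close> collects primes that are already occupied by vectors outside
  \<open>T\<close>.\<close>

definition good_upto :: "nat \<Rightarrow> nat \<Rightarrow> ('g \<Rightarrow> nat) set" where
  "good_upto Q D = {m. \<forall>p. prime p \<and> p \<le> Q \<longrightarrow> \<not> p\<^sup>2 dvd tprod m \<and> (p dvd D \<longrightarrow> \<not> p dvd tprod m)}"

definition good :: "nat \<Rightarrow> ('g \<Rightarrow> nat) set" where
  "good D = {m. \<forall>p. prime p \<longrightarrow> \<not> p\<^sup>2 dvd tprod m \<and> (p dvd D \<longrightarrow> \<not> p dvd tprod m)}"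

lemma good_subset: "good D \<subseteq> good_upto Q D" by (auto simp: good_def good_upto_def)

definition rescl :: "nat \<Rightarrow> ('g \<Rightarrow> nat) \<Rightarrow> ('g \<Rightarrow> nat) set" where
  "rescl q r = {m. \<forall>g\<in>T. m g mod q = r g}"

lemma dens_count_Un: "dens_count (S \<union> S') b \<le> dens_count S b + dens_count S' b"
proof -
  have "card ((S \<union> S') \<inter> tuples b) \<le> card (S \<inter> tuples b) + card (S' \<inter> tuples b)"
    unfolding Int_Un_distrib2 by (rule card_Un_le)
  then have "real (card ((S \<union> S') \<inter> tuples b)) \<le> real (card (S \<inter> tuples b)) + real (card (S' \<inter> tuples b))"
    by linarith
  from mult_right_mono[OF this, of "exp (- pairing b)"] show ?thesis
    by (simp add: dens_count_def distrib_right)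
qed

lemma dens_count_UN: "finite N \<Longrightarrow> dens_count (\<Union>n\<in>N. S n) b \<le> (\<Sum>n\<in>N. dens_count (S n) b)"
proof (induction N rule: finite_induct)
  case (insert n N)
  show ?case using dens_count_Un[of "S n" "\<Union>n\<in>N. S n" b] insert by simp
qed (simp add: dens_count_def)

lemma dens_count_UN_disjoint:
  assumes "finite N" "\<And>n n'. n \<in> N \<Longrightarrow> n' \<in> N \<Longrightarrow> n \<noteq> n' \<Longrightarrow> S n \<inter> S n' = {}"
  shows "dens_count (\<Union>n\<in>N. S n) b = (\<Sum>n\<in>N. dens_count (S n) b)"
proof -
  have "card (\<Union>n\<in>N. S n \<inter> tuples b) = (\<Sum>n\<in>N. card (S n \<inter> tuples b))"
    using assms finite_tuples by (intro card_UN_disjoint) auto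
  then show ?thesis by (simp add: dens_count_def sum_distrib_right Int_UN_distrib2)
qed

lemma dens_count_cong: "S \<inter> tuples b = S' \<inter> tuples b \<Longrightarrow> dens_count S b = dens_count S' b"
  by (simp add: dens_count_def)

lemma dens_count_nonneg: "dens_count S b \<ge> 0" by (simp add: dens_count_def)

lemma dens_count_diff: "S \<subseteq> S' \<Longrightarrow> dens_count (S' - S) b = dens_count S' b - dens_count S b"
proof -
  assume "S \<subseteq> S'"
  then have "card ((S' - S) \<inter> tuples b) = card (S' \<inter> tuples b) - card (S \<inter> tuples b)"
    "card (S \<inter> tuples b) \<le> card (S' \<inter> tuples b)"
    using card_Diff_subset[of "S \<inter> tuples b" "S' \<inter> tuples b"] finite_tuples[of b]
    by (auto simp: Diff_Int_distrib2 intro: card_mono)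
  then show ?thesis by (simp add: dens_count_def of_nat_diff left_diff_distrib)
qed

lemma dens_count_inj:
  assumes "inj_on f (S \<inter> tuples b)" "f ` (S \<inter> tuples b) \<subseteq> S' \<inter> tuples b"
  shows "dens_count S b \<le> dens_count S' b"
  unfolding dens_count_def using card_inj_on_le[OF assms] finite_tuples
  by (intro mult_right_mono) auto

lemma tuples_downward:
  assumes "m \<in> tuples b" "m' \<in> pos_tuples T" "\<And>g. g \<in> T \<Longrightarrow> m' g \<le> m g"
  shows "m' \<in> tuples b"
proof -
  have "lin (\<lambda>g. ln (real (m' g))) i \<le> b i" if i: "i \<in> I" for i
  proof -
    have "lin (\<lambda>g. ln (real (m' g))) i \<le> lin (\<lambda>g. ln (real (m g))) i"
    proof (rule lin_mono[OF _ i])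
      fix g assume g: "g \<in> T"
      then have "m' g > 0" using assms(2) by (auto simp: PiE_iff)
      then show "ln (real (m' g)) \<le> ln (real (m g))" using assms(3)[OF g] by (intro ln_mono) auto
    qed
    also have "\<dots> \<le> b i" using assms(1) i by (simp add: tuples_def)
    finally show ?thesis .
  qed
  then show ?thesis using assms(2) by (simp add: tuples_def)
qed

text \<open>Class \<open>r\<close> is compared with class 0 by subtracting at most \<open>q\<close>
  in each coordinate, which does not leave \<open>tuples b\<close>. In one direction this needs
  entries above \<open>q\<close>, hence the correction by tuples that are not deep.\<close>

lemma rescl_bounds:
  assumes q: "q > 0" and r: "\<And>g. g \<in> T \<Longrightarrow> r g < q"
  shows "dens_count {m. \<forall>g\<in>T. q dvd m g} b \<le> dens_count (rescl q r) b"
    and "dens_count (rescl q r) b \<le> dens_count {m. \<forall>g\<in>T. q dvd m g} b +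
      (dens_count UNIV b - dens_count (deep q b) b)"
proof -
  \<comment> \<open>The representative between 1 and \<open>q\<close>, so that a shifted entry stays
    positive.\<close>
  define r' where "r' = (\<lambda>g. if r g = 0 then q else r g)"
  have r': "r' g > 0" "r' g \<le> q" "r' g mod q = r g" if "g \<in> T" for g
    using q r[OF that] by (auto simp: r'_def)
  show "dens_count {m. \<forall>g\<in>T. q dvd m g} b \<le> dens_count (rescl q r) b"
  proof (rule dens_count_inj[where f = "\<lambda>m. \<lambda>g\<in>T. m g - q + r' g"])
    have ge: "m g \<ge> q" if "m \<in> {m. \<forall>g\<in>T. q dvd m g} \<inter> tuples b" "g \<in> T" for m g
      using that by (auto simp: tuples_def PiE_iff intro!: dvd_imp_le)
    show "inj_on (\<lambda>m. \<lambda>g\<in>T. m g - q + r' g) ({m. \<forall>g\<in>T. q dvd m g} \<inter> tuples b)"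
    proof (rule inj_onI)
      fix m m' assume m: "m \<in> {m. \<forall>g\<in>T. q dvd m g} \<inter> tuples b" and m': "m' \<in> {m. \<forall>g\<in>T. q dvd m g} \<inter> tuples b"
        and eq: "(\<lambda>g\<in>T. m g - q + r' g) = (\<lambda>g\<in>T. m' g - q + r' g)"
      have "m g = m' g" if g: "g \<in> T" for g
        using fun_cong[OF eq, of g] ge[OF m g] ge[OF m' g] g by simp
      then show "m = m'" using m m' by (intro PiE_ext[of m T "\<lambda>_. {0<..}" m']) (auto simp: tuples_def)
    qed
    show "(\<lambda>m. \<lambda>g\<in>T. m g - q + r' g) ` ({m. \<forall>g\<in>T. q dvd m g} \<inter> tuples b) \<subseteq> rescl q r \<inter> tuples b"
    proof
      fix m' assume "m' \<in> (\<lambda>m. \<lambda>g\<in>T. m g - q + r' g) ` ({m. \<forall>g\<in>T. q dvd m g} \<inter> tuples b)"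
      then obtain m where m: "m \<in> {m. \<forall>g\<in>T. q dvd m g} \<inter> tuples b" "m' = (\<lambda>g\<in>T. m g - q + r' g)" by blast
      have "m' \<in> tuples b"
      proof (rule tuples_downward[of m])
        show "m \<in> tuples b" using m by blast
        show "m' \<in> pos_tuples T" using r'(1) by (auto simp: m(2) PiE_iff)
        show "m' g \<le> m g" if "g \<in> T" for g using ge[OF m(1) that] r'(2)[OF that] that by (simp add: m(2))
      qed
      moreover have "m' g mod q = r g" if g: "g \<in> T" for g
      proof -
        have "q dvd m g - q" using m(1) g by (auto intro: dvd_diff_nat)
        then obtain k where "m g - q = q * k" by (elim dvdE)
        then have "m' g mod q = r' g mod q" using g by (simp add: m(2))
        then show ?thesis using r'(3)[OF g] by simp
      qed
      ultimately show "m' \<in> rescl q r \<inter> tuples b" by (simp add: rescl_def)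
    qed
  qed
  have "dens_count (rescl q r) b \<le> dens_count ((rescl q r \<inter> deep q b) \<union> (UNIV - deep q b)) b"
    by (rule dens_count_mono) blast
  also have "\<dots> \<le> dens_count (rescl q r \<inter> deep q b) b + dens_count (UNIV - deep q b) b"
    by (rule dens_count_Un)
  also have "dens_count (UNIV - deep q b) b = dens_count UNIV b - dens_count (deep q b) b"
    by (rule dens_count_diff) simp
  also have "dens_count (rescl q r \<inter> deep q b) b \<le> dens_count {m. \<forall>g\<in>T. q dvd m g} b"
  proof (rule dens_count_inj[where f = "\<lambda>m. \<lambda>g\<in>T. m g - r' g"])
    have ge: "m g > r' g" if "m \<in> rescl q r \<inter> deep q b \<inter> tuples b" "g \<in> T" for m g
      using that r'(2)[OF that(2)] by (auto simp: deep_def intro: le_less_trans)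
    show "inj_on (\<lambda>m. \<lambda>g\<in>T. m g - r' g) (rescl q r \<inter> deep q b \<inter> tuples b)"
    proof (rule inj_onI)
      fix m m' assume m: "m \<in> rescl q r \<inter> deep q b \<inter> tuples b" and m': "m' \<in> rescl q r \<inter> deep q b \<inter> tuples b"
        and eq: "(\<lambda>g\<in>T. m g - r' g) = (\<lambda>g\<in>T. m' g - r' g)"
      have "m g = m' g" if g: "g \<in> T" for g
        using fun_cong[OF eq, of g] ge[OF m g] ge[OF m' g] g by simp
      then show "m = m'" using m m' by (intro PiE_ext[of m T "\<lambda>_. {0<..}" m']) (auto simp: tuples_def)
    qed
    show "(\<lambda>m. \<lambda>g\<in>T. m g - r' g) ` (rescl q r \<inter> deep q b \<inter> tuples b) \<subseteq> {m. \<forall>g\<in>T. q dvd m g} \<inter> tuples b"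
    proof
      fix m' assume "m' \<in> (\<lambda>m. \<lambda>g\<in>T. m g - r' g) ` (rescl q r \<inter> deep q b \<inter> tuples b)"
      then obtain m where m: "m \<in> rescl q r \<inter> deep q b \<inter> tuples b" "m' = (\<lambda>g\<in>T. m g - r' g)" by blast
      have "m' \<in> tuples b"
      proof (rule tuples_downward[of m])
        show "m \<in> tuples b" using m by blast
        show "m' \<in> pos_tuples T" using ge[OF m(1)] by (auto simp: m(2) PiE_iff)
        show "m' g \<le> m g" if "g \<in> T" for g using that by (simp add: m(2))
      qed
      moreover have "q dvd m' g" if g: "g \<in> T" for g
      proof -
        have "m g mod q = r' g mod q" using m(1) r'(3)[OF g] g by (simp add: rescl_def)
        then have "q dvd m g - r' g" using ge[OF m(1) g] by (simp add: mod_eq_dvd_iff_nat)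
        then show ?thesis using g by (simp add: m(2))
      qed
      ultimately show "m' \<in> {m. \<forall>g\<in>T. q dvd m g} \<inter> tuples b" by simp
    qed
  qed
  finally show "dens_count (rescl q r) b \<le> dens_count {m. \<forall>g\<in>T. q dvd m g} b +
      (dens_count UNIV b - dens_count (deep q b) b)" by simp
qed

text \<open>All residue classes have the same density. Class 0 is a copy of all tuples with
  \<open>w\<close> changed by \<open>ln q * Gsum\<close>, which \<open>C0\<close> ignores.\<close>

lemma rescl_tendsto:
  assumes q: "q > 0" and r: "\<And>g. g \<in> T \<Longrightarrow> r g < q"
  shows "((\<lambda>L. dens_count (rescl q r) (\<lambda>i. L - w i) / L ^ card F) \<longlongrightarrow> C0 w / real q ^ card T) at_top"
proof -
  let ?b = "\<lambda>L i. L - w i"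
  have mult: "dens_count {m. \<forall>g\<in>T. q dvd m g} (?b L) =
      dens_count UNIV (\<lambda>i. L - (w i + ln (real q) * Gsum i)) / real q ^ card T" for L
  proof -
    have "lin (\<lambda>g. ln (real q)) i = ln (real q) * Gsum i" for i
      by (simp add: lin_def Gsum_def sum_distrib_left mult.commute)
    then show ?thesis using dens_count_multiples[of "\<lambda>_. q" "?b L"] q
      by (simp add: diff_diff_add)
  qed
  have "C0 (\<lambda>i. w i + ln (real q) * Gsum i) = C0 w" unfolding Gsum_def by (rule C0_shift_all)
  with count_tendsto[of "\<lambda>i. w i + ln (real q) * Gsum i"]
  have "((\<lambda>L. dens_count UNIV (\<lambda>i. L - (w i + ln (real q) * Gsum i)) / L ^ card F) \<longlongrightarrow> C0 w) at_top" by simp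
  then have "((\<lambda>L. (dens_count UNIV (\<lambda>i. L - (w i + ln (real q) * Gsum i)) / L ^ card F) / real q ^ card T)
      \<longlongrightarrow> C0 w / real q ^ card T) at_top"
    using q by (intro tendsto_divide tendsto_const) auto
  then have lim: "((\<lambda>L. dens_count {m. \<forall>g\<in>T. q dvd m g} (?b L) / L ^ card F) \<longlongrightarrow> C0 w / real q ^ card T) at_top"
    by (simp add: mult divide_divide_eq_left mult.commute)
  have "((\<lambda>L. dens_count {m. \<forall>g\<in>T. q dvd m g} (?b L) / L ^ card F +
      (dens_count UNIV (?b L) / L ^ card F - dens_count (deep q (?b L)) (?b L) / L ^ card F))
      \<longlongrightarrow> C0 w / real q ^ card T + (C0 w - C0 w)) at_top"
    by (intro tendsto_intros lim count_tendsto deep_tendsto)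
  then have up: "((\<lambda>L. (dens_count {m. \<forall>g\<in>T. q dvd m g} (?b L) +
      (dens_count UNIV (?b L) - dens_count (deep q (?b L)) (?b L))) / L ^ card F)
      \<longlongrightarrow> C0 w / real q ^ card T) at_top"
    by (simp add: add_divide_distrib diff_divide_distrib)
  have ev: "eventually (\<lambda>L::real. L > 0) at_top" by (rule eventually_gt_at_top)
  show ?thesis
  proof (rule tendsto_sandwich[OF _ _ lim up])
    show "eventually (\<lambda>L. dens_count {m. \<forall>g\<in>T. q dvd m g} (?b L) / L ^ card F \<le>
        dens_count (rescl q r) (?b L) / L ^ card F) at_top"
      using ev by eventually_elim (intro divide_right_mono rescl_bounds q r, auto)
    show "eventually (\<lambda>L. dens_count (rescl q r) (?b L) / L ^ card F \<le>
        (dens_count {m. \<forall>g\<in>T. q dvd m g} (?b L) +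
      (dens_count UNIV (?b L) - dens_count (deep q (?b L)) (?b L))) / L ^ card F) at_top"
      using ev by eventually_elim (intro divide_right_mono rescl_bounds q r, auto)
  qed
qed

text \<open>For every prime \<open>p \<le> Q\<close> the square of \<open>fact Q\<close> is
  divisible by \<open>p ^ 2\<close>, so residues modulo it decide all conditions.\<close>

lemma good_upto_periodic:
  assumes "\<And>g. g \<in> T \<Longrightarrow> m g mod (fact Q)\<^sup>2 = m' g mod (fact Q)\<^sup>2" "m \<in> good_upto Q D"
  shows "m' \<in> good_upto Q D"
proof -
  have cong: "[tprod m = tprod m'] (mod (fact Q)\<^sup>2)"
    unfolding tprod_def using assms(1) by (intro cong_prod) (simp add: cong_def)
  have "\<not> p\<^sup>2 dvd tprod m' \<and> (p dvd D \<longrightarrow> \<not> p dvd tprod m')" if p: "prime p" "p \<le> Q" for p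
  proof -
    have "p dvd fact Q" using p prime_gt_0_nat[of p] by (intro dvd_fact) auto
    then have p2: "p\<^sup>2 dvd (fact Q)\<^sup>2" by simp
    moreover have "p dvd p\<^sup>2" by simp
    ultimately have p1: "p dvd (fact Q)\<^sup>2" by (rule dvd_trans[rotated])
    have "p\<^sup>2 dvd tprod m \<longleftrightarrow> p\<^sup>2 dvd tprod m'"
      using cong_dvd_modulus_nat[OF cong p2] by (rule cong_dvd_iff)
    moreover have "p dvd tprod m \<longleftrightarrow> p dvd tprod m'"
      using cong_dvd_modulus_nat[OF cong p1] by (rule cong_dvd_iff)
    ultimately show ?thesis using assms(2) p by (auto simp: good_upto_def)
  qed
  then show ?thesis by (simp add: good_upto_def)
qed

lemma good_upto_tendsto:
  "\<exists>l. ((\<lambda>L. dens_count (good_upto Q D) (\<lambda>i. L - w i) / L ^ card F) \<longlongrightarrow> l) at_top"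
proof -
  define q :: nat where "q = (fact Q)\<^sup>2"
  have q: "q > 0" by (simp add: q_def)
  define R where "R = (T \<rightarrow>\<^sub>E {..<q}) \<inter> good_upto Q D"
  have finR: "finite R" unfolding R_def using finT by (intro finite_Int disjI1 finite_PiE) auto
  have eq: "good_upto Q D = (\<Union>r\<in>R. rescl q r)"
  proof (intro equalityI subsetI)
    fix m assume m: "m \<in> good_upto Q D"
    define r where "r = (\<lambda>g\<in>T. m g mod q)"
    have "r \<in> good_upto Q D" by (rule good_upto_periodic[OF _ m]) (simp add: r_def q_def)
    then have "r \<in> R" using q by (auto simp: R_def r_def)
    moreover have "m \<in> rescl q r" by (simp add: rescl_def r_def)
    ultimately show "m \<in> (\<Union>r\<in>R. rescl q r)" by blast
  next
    fix m assume "m \<in> (\<Union>r\<in>R. rescl q r)"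
    then obtain r where r: "r \<in> R" "m \<in> rescl q r" by blast
    have "r \<in> good_upto Q D" using r by (simp add: R_def)
    then show "m \<in> good_upto Q D"
    proof (rule good_upto_periodic[rotated])
      fix g assume g: "g \<in> T"
      have "r g < q" using r(1) g unfolding R_def by blast
      then show "r g mod (fact Q)\<^sup>2 = m g mod (fact Q)\<^sup>2" using r(2) g by (simp add: rescl_def q_def)
    qed
  qed
  have disj: "rescl q r \<inter> rescl q r' = {}" if "r \<in> R" "r' \<in> R" "r \<noteq> r'" for r r'
  proof (rule ccontr)
    assume "rescl q r \<inter> rescl q r' \<noteq> {}"
    then have "r g = r' g" if "g \<in> T" for g using that by (auto simp: rescl_def)
    then have "r = r'" using that by (intro PiE_ext[of r T "\<lambda>_. {..<q}" r']) (auto simp: R_def)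
    with that show False by simp
  qed
  have "((\<lambda>L. \<Sum>r\<in>R. dens_count (rescl q r) (\<lambda>i. L - w i) / L ^ card F) \<longlongrightarrow> (\<Sum>r\<in>R. C0 w / real q ^ card T)) at_top"
    using q by (intro tendsto_sum rescl_tendsto) (auto simp: R_def)
  moreover have "dens_count (good_upto Q D) b / x = (\<Sum>r\<in>R. dens_count (rescl q r) b / x)" for b x
    unfolding eq by (subst dens_count_UN_disjoint[OF finR disj]) (auto simp: sum_divide_distrib)
  ultimately show ?thesis by auto
qed

text \<open>The shift \<open>w\<close> is absorbed by enlarging \<open>L\<close> to
  \<open>W * L\<close>, at the cost of a constant.\<close>

lemma count_bound_shift:
  "\<exists>K>0. \<forall>L\<ge>1. \<forall>b. (\<forall>i\<in>I. b i \<le> L - w i) \<longrightarrow> dens_count UNIV b \<le> K * L ^ card F"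
proof -
  obtain K where K: "K > 0" "\<And>L b. L \<ge> 1 \<Longrightarrow> (\<forall>i\<in>I. b i \<le> L) \<Longrightarrow> dens_count UNIV b \<le> K * L ^ card F"
    using count_bound by blast
  define W where "W = 1 + (\<Sum>i\<in>I. \<bar>w i\<bar>)"
  have W: "W \<ge> 1" by (simp add: W_def sum_nonneg)
  have "dens_count UNIV b \<le> K * W ^ card F * L ^ card F" if L: "L \<ge> 1" and b: "\<forall>i\<in>I. b i \<le> L - w i" for L b
  proof -
    have "b i \<le> W * L" if i: "i \<in> I" for i
    proof -
      have "\<bar>w i\<bar> \<le> (\<Sum>i\<in>I. \<bar>w i\<bar>)" using i finI by (intro member_le_sum) auto
      then have "b i \<le> L + (W - 1)" using b i by (auto simp: W_def)
      also have "W - 1 \<le> (W - 1) * L" using W L by (simp add: mult_le_cancel_left1)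
      finally show ?thesis by (simp add: algebra_simps)
    qed
    moreover have "W * L \<ge> 1" using W L mult_mono[of 1 W 1 L] by simp
    ultimately show ?thesis using K(2)[of "W * L" b] by (simp add: power_mult_distrib mult.assoc)
  qed
  moreover have "K * W ^ card F > 0" using K W by simp
  ultimately show ?thesis by blast
qed

lemma lin_ln_nonneg:
  assumes "\<And>g. g \<in> T \<Longrightarrow> d g > 0" "i \<in> I"
  shows "lin (\<lambda>g. ln (real (d g))) i \<ge> 0"
proof -
  have "ln (real (d g)) \<ge> 0" if "g \<in> T" for g
    using assms(1)[OF that] by simp
  then show ?thesis unfolding lin_def using G_nonneg assms(2) by (intro sum_nonneg mult_nonneg_nonneg) auto
qed

lemma tprod_pos: "m \<in> tuples b \<Longrightarrow> tprod m > 0"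
  unfolding tprod_def by (intro prod_pos) (auto simp: tuples_def PiE_iff)

text \<open>Two factors \<open>p\<close> can be placed among the entries in
  \<open>card T ^ 2\<close> ways, each of density at most \<open>K / p ^ 2\<close>.\<close>

lemma prime_square_density:
  assumes K: "\<And>b'. (\<forall>i\<in>I. b' i \<le> b i) \<Longrightarrow> dens_count UNIV b' \<le> K" and p: "prime p"
  shows "dens_count {m. p\<^sup>2 dvd tprod m} b \<le> real (card T) ^ 2 * K / real p ^ 2"
proof -
  have p0: "p > 0" using p prime_gt_0_nat by blast
  \<comment> \<open>The pair \<open>(g, g')\<close> demands a factor \<open>p\<close> at either
    place, and \<open>p ^ 2\<close> if the places agree.\<close>
  define d :: "'g \<times> 'g \<Rightarrow> 'g \<Rightarrow> nat" where "d = (\<lambda>(g, g') h. p ^ ((if h = g then 1 else 0) + (if h = g' then 1 else 0)))"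
  have d0: "d x h > 0" for x h using p0 by (cases x) (simp add: d_def)
  have prod_d: "(\<Prod>h\<in>T. d (g, g') h) = p\<^sup>2" if "g \<in> T" "g' \<in> T" for g g'
  proof -
    have "(\<Prod>h\<in>T. d (g, g') h) = p ^ (\<Sum>h\<in>T. (if h = g then 1 else 0) + (if h = g' then 1 else 0))"
      by (simp add: d_def power_sum)
    also have "(\<Sum>h\<in>T. (if h = g then 1 else 0) + (if h = g' then 1 else 0 :: nat)) = 2"
      using that finT by (simp add: sum.distrib)
    finally show ?thesis .
  qed
  have "{m. p\<^sup>2 dvd tprod m} \<subseteq> (\<Union>x\<in>T \<times> T. {m. \<forall>h\<in>T. d x h dvd m h})"
  proof
    fix m assume "m \<in> {m. p\<^sup>2 dvd tprod m}"
    then obtain g h where gh: "g \<in> T" "h \<in> T" "(g = h \<and> p\<^sup>2 dvd m g) \<or> (g \<noteq> h \<and> p dvd m g \<and> p dvd m h)"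
      using prime_square_dvd_prod[OF finT p, of m] by (auto simp: tprod_def)
    then have "\<forall>x\<in>T. d (g, h) x dvd m x" by (auto simp: d_def power2_eq_square)
    then show "m \<in> (\<Union>x\<in>T \<times> T. {m. \<forall>h\<in>T. d x h dvd m h})" using gh by blast
  qed
  then have "dens_count {m. p\<^sup>2 dvd tprod m} b \<le> dens_count (\<Union>x\<in>T \<times> T. {m. \<forall>h\<in>T. d x h dvd m h}) b"
    by (rule dens_count_mono)
  also have "\<dots> \<le> (\<Sum>x\<in>T \<times> T. dens_count {m. \<forall>h\<in>T. d x h dvd m h} b)"
    using finT by (intro dens_count_UN) auto
  also have "\<dots> \<le> (\<Sum>x\<in>T \<times> T. K / real p ^ 2)"
  proof (rule sum_mono)
    fix x assume x: "x \<in> T \<times> T"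
    then obtain g g' where gg: "x = (g, g')" "g \<in> T" "g' \<in> T" by blast
    have "(\<Prod>h\<in>T. real (d x h)) = real p ^ 2"
      using prod_d[OF gg(2,3)] gg(1) by (metis of_nat_prod of_nat_power)
    then have "dens_count {m. \<forall>h\<in>T. d x h dvd m h} b =
        dens_count UNIV (\<lambda>i. b i - lin (\<lambda>g. ln (real (d x g))) i) / real p ^ 2"
      using dens_count_multiples[of "d x" b] d0 by simp
    also have "\<dots> \<le> K / real p ^ 2"
    proof (intro divide_right_mono K ballI)
      fix i assume "i \<in> I"
      then show "b i - lin (\<lambda>g. ln (real (d x g))) i \<le> b i" using lin_ln_nonneg[of "d x" i] d0 by simp
    qed simp
    finally show "dens_count {m. \<forall>h\<in>T. d x h dvd m h} b \<le> K / real p ^ 2" .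
  qed
  also have "\<dots> = real (card T) ^ 2 * K / real p ^ 2" by (simp add: card_cartesian_product power2_eq_square)
  finally show ?thesis .
qed

text \<open>With \<open>D \<le> Q\<close> all primes dividing \<open>D\<close> are sieved already,
  so a tuple lost afterwards is lost to some \<open>p ^ 2\<close> with \<open>p > Q\<close>.\<close>

lemma good_upto_error:
  assumes K: "\<And>b'. (\<forall>i\<in>I. b' i \<le> b i) \<Longrightarrow> dens_count UNIV b' \<le> K" and K0: "K \<ge> 0"
    and Q: "Q > 0" "D > 0" "D \<le> Q"
  shows "dens_count (good_upto Q D) b - dens_count (good D) b \<le> real (card T) ^ 2 * K / real Q"
proof -
  \<comment> \<open>Bounds the primes whose square can divide a product, which makes the union
    finite.\<close>
  define N where "N = Max (insert 0 (tprod ` tuples b))"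
  have N: "tprod m \<le> N" if "m \<in> tuples b" for m
    unfolding N_def using that finite_tuples by (intro Max_ge) auto
  define PR where "PR = {p\<in>{Q<..N}. prime p}"
  have "dens_count (good_upto Q D) b - dens_count (good D) b = dens_count (good_upto Q D - good D) b"
    by (rule dens_count_diff[symmetric]) (rule good_subset)
  also have "\<dots> = dens_count ((good_upto Q D - good D) \<inter> tuples b) b"
    by (rule dens_count_cong) blast
  also have "\<dots> \<le> dens_count (\<Union>p\<in>PR. {m. p\<^sup>2 dvd tprod m}) b"
  proof (rule dens_count_mono, rule subsetI)
    fix m assume m: "m \<in> (good_upto Q D - good D) \<inter> tuples b"
    then obtain p where p: "prime p" "p\<^sup>2 dvd tprod m \<or> (p dvd D \<and> p dvd tprod m)"
      by (auto simp: good_def)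
    have "\<not> p \<le> Q" using m p by (auto simp: good_upto_def)
    then have "\<not> p dvd D" using Q dvd_imp_le[of p D] by auto
    then have p2: "p\<^sup>2 dvd tprod m" using p by blast
    have "p\<^sup>2 \<le> tprod m" using p2 tprod_pos m by (auto intro: dvd_imp_le)
    moreover have "p \<le> p\<^sup>2" using prime_gt_0_nat[OF p(1)] by (simp add: power2_eq_square)
    ultimately have "p \<le> N" using N m by (meson IntD2 order_trans)
    then have "p \<in> PR" using \<open>\<not> p \<le> Q\<close> p(1) by (simp add: PR_def)
    then show "m \<in> (\<Union>p\<in>PR. {m. p\<^sup>2 dvd tprod m})" using p2 by blast
  qed
  also have "\<dots> \<le> (\<Sum>p\<in>PR. dens_count {m. p\<^sup>2 dvd tprod m} b)"
    by (rule dens_count_UN) (simp add: PR_def)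
  also have "\<dots> \<le> (\<Sum>p\<in>PR. real (card T) ^ 2 * K / real p ^ 2)"
    by (intro sum_mono prime_square_density K) (auto simp: PR_def)
  also have "\<dots> \<le> (\<Sum>p\<in>{Q<..N}. real (card T) ^ 2 * K / real p ^ 2)"
    using K0 by (intro sum_mono2) (auto simp: PR_def)
  also have "\<dots> = real (card T) ^ 2 * K * (\<Sum>p\<in>{Q<..N}. 1 / real p ^ 2)"
    by (simp add: sum_distrib_left)
  also have "\<dots> \<le> real (card T) ^ 2 * K * (1 / real Q)"
    using K0 by (intro mult_left_mono sum_inverse_squares_le Q) auto
  finally show ?thesis by simp
qed

lemma good_tendsto:
  assumes "D > 0"
  shows "\<exists>l. ((\<lambda>L. dens_count (good D) (\<lambda>i. L - w i) / L ^ card F) \<longlongrightarrow> l) at_top"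
proof (rule tendsto_at_top_if_approx)
  fix e :: real assume e: "e > 0"
  let ?b = "\<lambda>L i. L - w i"
  obtain K where K: "K > 0"
    "\<And>L b. L \<ge> 1 \<Longrightarrow> (\<forall>i\<in>I. b i \<le> L - w i) \<Longrightarrow> dens_count UNIV b \<le> K * L ^ card F"
    using count_bound_shift[of w] by blast
  obtain Q0 :: nat where Q0: "real Q0 > real (card T) ^ 2 * K / (e / 2)" using reals_Archimedean2 by blast
  define Q where "Q = max D (max 1 Q0)"
  have Q: "Q > 0" "D \<le> Q" "real Q \<ge> real Q0" by (auto simp: Q_def)
  have "real (card T) ^ 2 * K / (e / 2) \<le> real Q" using Q0 Q by linarith
  then have small: "real (card T) ^ 2 * K / real Q \<le> e / 2" using e Q by (simp add: field_simps)
  obtain l where l: "((\<lambda>L. dens_count (good_upto Q D) (?b L) / L ^ card F) \<longlongrightarrow> l) at_top"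
    using good_upto_tendsto by blast
  have "eventually (\<lambda>L. dist (dens_count (good_upto Q D) (?b L) / L ^ card F) l < e / 2) at_top"
    using l e by (intro tendstoD) auto
  moreover have "eventually (\<lambda>L::real. L \<ge> 1) at_top" by (rule eventually_ge_at_top)
  ultimately have "eventually (\<lambda>L. \<bar>dens_count (good D) (?b L) / L ^ card F - l\<bar> \<le> e) at_top"
  proof eventually_elim
    case (elim L)
    have "dens_count (good_upto Q D) (?b L) - dens_count (good D) (?b L) \<le> real (card T) ^ 2 * (K * L ^ card F) / real Q"
      using K(2)[OF elim(2)] K(1) elim(2) Q assms by (intro good_upto_error) auto
    also have "\<dots> = (real (card T) ^ 2 * K / real Q) * L ^ card F" by simp
    also have "\<dots> \<le> e / 2 * L ^ card F" using small elim(2) by (intro mult_right_mono) auto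
    finally have "dens_count (good_upto Q D) (?b L) / L ^ card F - dens_count (good D) (?b L) / L ^ card F \<le> e / 2"
      using elim(2) by (simp add: field_simps)
    moreover have "dens_count (good D) (?b L) / L ^ card F \<le> dens_count (good_upto Q D) (?b L) / L ^ card F"
      using elim(2) by (intro divide_right_mono dens_count_mono good_subset) auto
    ultimately show ?case using elim(1) unfolding dist_real_def by linarith
  qed
  then show "\<exists>l. eventually (\<lambda>L. \<bar>dens_count (good D) (?b L) / L ^ card F - l\<bar> \<le> e) at_top" by blast
qed

end

section \<open>Euler products\<close>

text \<open>Families are functions on all natural numbers with the extensional zero vector off the
  primes, so that equality of families is equality of functions.\<close>

definition conf :: "'i set \<Rightarrow> ('i \<Rightarrow> nat) set \<Rightarrow> (nat \<Rightarrow> 'i \<Rightarrow> nat) set" where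
  "conf A \<Omega> = {F. (\<forall>p. prime p \<longrightarrow> F p \<in> \<Omega>) \<and> (\<forall>p. \<not> prime p \<longrightarrow> F p = (\<lambda>i\<in>A. 0)) \<and>
     finite {p. F p \<noteq> (\<lambda>i\<in>A. 0)}}"

definition log_height :: "'i set \<Rightarrow> (nat \<Rightarrow> 'i \<Rightarrow> nat) \<Rightarrow> 'i \<Rightarrow> real" where
  "log_height A F i = (\<Sum>p | F p \<noteq> (\<lambda>i\<in>A. 0). real (F p i) * ln (real p))"

lemma conf_supp_prime: "F \<in> conf A \<Omega> \<Longrightarrow> F p \<noteq> (\<lambda>i\<in>A. 0) \<Longrightarrow> prime p"
  by (auto simp: conf_def)

lemma log_height_nonneg: "F \<in> conf A \<Omega> \<Longrightarrow> log_height A F i \<ge> 0"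
  unfolding log_height_def
  by (intro sum_nonneg mult_nonneg_nonneg)
     (auto dest!: conf_supp_prime dest: prime_gt_0_nat simp: Suc_le_eq)

text \<open>Expanding the product of the local sums over the finitely many primes that occur
  produces every family of \<open>\<A>\<close>; then
  \<open>1 + \<kappa> p \<le> exp (\<kappa> p)\<close>.\<close>

lemma euler_product_bound:
  fixes x :: "nat \<Rightarrow> ('i \<Rightarrow> nat) \<Rightarrow> real"
  assumes x0: "\<And>p t. x p t \<ge> 0"
    and local: "\<And>p B. prime p \<Longrightarrow> finite B \<Longrightarrow> B \<subseteq> \<Omega> - {\<lambda>i\<in>A. 0} \<Longrightarrow> (\<Sum>t\<in>B. x p t) \<le> \<kappa> p"
    and summ: "summable \<kappa>" "\<And>p. \<kappa> p \<ge> 0"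
    and fin: "finite \<A>" "\<A> \<subseteq> conf A \<Omega>"
  shows "(\<Sum>F\<in>\<A>. \<Prod>p | F p \<noteq> (\<lambda>i\<in>A. 0). x p (F p)) \<le> exp (suminf \<kappa>)"
proof -
  let ?z = "\<lambda>i\<in>A. (0::nat)"
  define S where "S = (\<Union>F\<in>\<A>. {p. F p \<noteq> ?z})"
  have finS: "finite S" using fin by (auto simp: S_def conf_def)
  have primeS: "prime p" if "p \<in> S" for p using that fin(2) by (auto simp: S_def dest: conf_supp_prime)
  define B where "B = (\<lambda>p. insert ?z ((\<lambda>F. F p) ` \<A>))"
  have finB: "finite (B p)" for p using fin(1) by (simp add: B_def)
  \<comment> \<open>The value 1 at the zero vector lets all families share the index set
    \<open>S\<close> of primes.\<close>
  define x' where "x' = (\<lambda>p t. if t = ?z then 1 else x p t)"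
  have inj: "inj_on (\<lambda>F. restrict F S) \<A>"
  proof (rule inj_onI, rule ext)
    fix F F' p assume F: "F \<in> \<A>" "F' \<in> \<A>" "restrict F S = restrict F' S"
    show "F p = F' p"
    proof (cases "p \<in> S")
      case True then show ?thesis using fun_cong[OF F(3), of p] by simp
    next
      case False then show ?thesis using F by (auto simp: S_def)
    qed
  qed
  have "(\<Sum>F\<in>\<A>. \<Prod>p | F p \<noteq> ?z. x p (F p)) = (\<Sum>F\<in>\<A>. \<Prod>p\<in>S. x' p (restrict F S p))"
  proof (rule sum.cong[OF refl])
    fix F assume F: "F \<in> \<A>"
    have "(\<Prod>p\<in>S. x' p (restrict F S p)) = (\<Prod>p\<in>S. x' p (F p))" by (rule prod.cong) auto
    also have "\<dots> = (\<Prod>p | F p \<noteq> ?z. x' p (F p))"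
      using F finS by (intro prod.mono_neutral_right) (auto simp: S_def x'_def)
    also have "\<dots> = (\<Prod>p | F p \<noteq> ?z. x p (F p))" by (rule prod.cong) (auto simp: x'_def)
    finally show "(\<Prod>p | F p \<noteq> ?z. x p (F p)) = (\<Prod>p\<in>S. x' p (restrict F S p))" by simp
  qed
  also have "\<dots> = (\<Sum>f\<in>(\<lambda>F. restrict F S) ` \<A>. \<Prod>p\<in>S. x' p (f p))"
    by (simp add: sum.reindex[OF inj])
  also have "\<dots> \<le> (\<Sum>f\<in>PiE S B. \<Prod>p\<in>S. x' p (f p))"
  proof (rule sum_mono2)
    show "finite (PiE S B)" using finS finB by (intro finite_PiE) auto
    show "(\<lambda>F. restrict F S) ` \<A> \<subseteq> PiE S B" by (auto simp: B_def)
    show "0 \<le> (\<Prod>p\<in>S. x' p (f p))" for f using x0 by (intro prod_nonneg) (auto simp: x'_def)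
  qed
  also have "\<dots> = (\<Prod>p\<in>S. \<Sum>t\<in>B p. x' p t)"
    using finS finB by (intro prod_sum_PiE[symmetric]) auto
  also have "\<dots> \<le> (\<Prod>p\<in>S. exp (\<kappa> p))"
  proof (rule prod_mono, rule conjI)
    fix p assume p: "p \<in> S"
    show "0 \<le> (\<Sum>t\<in>B p. x' p t)" using x0 by (intro sum_nonneg) (auto simp: x'_def)
    have "(\<Sum>t\<in>B p. x' p t) = 1 + (\<Sum>t\<in>B p - {?z}. x' p t)"
      using finB by (subst sum.remove[of _ ?z]) (auto simp: B_def x'_def)
    also have "(\<Sum>t\<in>B p - {?z}. x' p t) = (\<Sum>t\<in>B p - {?z}. x p t)"
      by (rule sum.cong) (auto simp: x'_def)
    also have "\<dots> \<le> \<kappa> p"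
      using finB fin(2) primeS[OF p] by (intro local) (auto simp: B_def conf_def)
    also have "1 + \<kappa> p \<le> exp (\<kappa> p)" by (rule exp_ge_add_one_self)
    finally show "(\<Sum>t\<in>B p. x' p t) \<le> exp (\<kappa> p)" by simp
  qed
  also have "\<dots> = exp (\<Sum>p\<in>S. \<kappa> p)" using finS by (simp add: exp_sum)
  also have "\<dots> \<le> exp (suminf \<kappa>)" using summ finS by (auto intro!: sum_le_suminf)
  finally show ?thesis .
qed

text \<open>A finite set of exponent vectors lies in a box, and over a box the sum factorises into
  partial geometric series.\<close>

lemma geometric_box_bound:
  fixes r :: "'i \<Rightarrow> real"
  assumes "finite A" "\<And>i. i \<in> A \<Longrightarrow> 0 \<le> r i \<and> r i < 1" "finite B" "B \<subseteq> A \<rightarrow>\<^sub>E UNIV"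
  shows "(\<Sum>t\<in>B. \<Prod>i\<in>A. r i ^ t i) \<le> (\<Prod>i\<in>A. 1 / (1 - r i))"
proof -
  define N where "N = Max (insert 0 ((\<lambda>(t, i). t i) ` (B \<times> A)))"
  have N: "t i \<le> N" if "t \<in> B" "i \<in> A" for t i
    unfolding N_def using that assms(1,3) by (intro Max_ge) (auto intro!: image_eqI[where x = "(t, i)"])
  have "(\<Sum>t\<in>B. \<Prod>i\<in>A. r i ^ t i) \<le> (\<Sum>t\<in>A \<rightarrow>\<^sub>E {..N}. \<Prod>i\<in>A. r i ^ t i)"
  proof (rule sum_mono2)
    show "finite (A \<rightarrow>\<^sub>E {..N})" using assms(1) by (intro finite_PiE) auto
    show "B \<subseteq> A \<rightarrow>\<^sub>E {..N}" using N assms(4) by (auto simp: PiE_iff subset_iff)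
    show "0 \<le> (\<Prod>i\<in>A. r i ^ t i)" for t :: "'i \<Rightarrow> nat" using assms(2) by (intro prod_nonneg) auto
  qed
  also have "\<dots> = (\<Prod>i\<in>A. \<Sum>k\<le>N. r i ^ k)"
    using assms(1) by (intro prod_sum_PiE[symmetric]) auto
  also have "\<dots> \<le> (\<Prod>i\<in>A. 1 / (1 - r i))"
  proof (rule prod_mono, rule conjI)
    fix i assume i: "i \<in> A"
    show "0 \<le> (\<Sum>k\<le>N. r i ^ k)" using assms(2)[OF i] by (intro sum_nonneg) auto
    have "(\<Sum>k\<le>N. r i ^ k) \<le> (\<Sum>k. r i ^ k)"
      using assms(2)[OF i] by (intro sum_le_suminf summable_geometric) auto
    also have "\<dots> = 1 / (1 - r i)" using assms(2)[OF i] by (intro suminf_geometric) auto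
    finally show "(\<Sum>k\<le>N. r i ^ k) \<le> 1 / (1 - r i)" .
  qed
  finally show ?thesis .
qed

text \<open>The exponent is shared out: a part \<open>1 - \<theta>\<close> makes the sum over primes
  converge, and a part \<open>\<theta>\<close> makes the sum over vectors geometric, uniformly in
  \<open>p\<close> because \<open>p \<ge> 2\<close>.\<close>

lemma conf_sum_bounded:
  assumes A: "finite A" and s: "\<And>i. i \<in> A \<Longrightarrow> s i > (0::real)" and \<Omega>: "\<Omega> \<subseteq> A \<rightarrow>\<^sub>E UNIV"
    and d: "d > 0" and gap: "\<And>t. t \<in> \<Omega> \<Longrightarrow> t \<noteq> (\<lambda>i\<in>A. 0) \<Longrightarrow> (\<Sum>i\<in>A. s i * real (t i)) \<ge> 1 + d"
  shows "\<exists>C. \<forall>\<A>. finite \<A> \<longrightarrow> \<A> \<subseteq> conf A \<Omega> \<longrightarrow> (\<Sum>F\<in>\<A>. exp (- (\<Sum>i\<in>A. s i * log_height A F i))) \<le> C"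
proof -
  let ?z = "\<lambda>i\<in>A. (0::nat)"
  \<comment> \<open>The solution of \<open>(1 - \<theta>) * (1 + d) = 1 + d / 2\<close>.\<close>
  define \<theta> where "\<theta> = (d / 2) / (1 + d)"
  have th: "0 < \<theta>" "\<theta> < 1" "(1 - \<theta>) * (1 + d) = 1 + d / 2"
    using d by (auto simp: \<theta>_def field_simps)
  define x where "x = (\<lambda>p t. exp (- (\<Sum>i\<in>A. s i * real (t i)) * ln (real p)))"
  define r where "r = (\<lambda>i. exp (- \<theta> * s i * ln 2))"
  have r: "0 \<le> r i \<and> r i < 1" if "i \<in> A" for i using s[OF that] th by (simp add: r_def)
  define K where "K = (\<Prod>i\<in>A. 1 / (1 - r i))"
  define \<kappa> where "\<kappa> = (\<lambda>p. K * real p powr (- (1 + d / 2)))"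
  have K0: "K \<ge> 0" unfolding K_def using r by (intro prod_nonneg) (auto intro: less_imp_le)
  have local: "(\<Sum>t\<in>B. x p t) \<le> \<kappa> p" if p: "prime p" and B: "finite B" "B \<subseteq> \<Omega> - {?z}" for p B
  proof -
    have p2: "p \<ge> 2" using p prime_ge_2_nat by blast
    have "x p t \<le> real p powr (- (1 + d / 2)) * (\<Prod>i\<in>A. r i ^ t i)" if t: "t \<in> B" for t
    proof -
      define Q where "Q = (\<Sum>i\<in>A. s i * real (t i))"
      have Q: "Q \<ge> 1 + d" unfolding Q_def using t B by (intro gap) auto
      have lnp: "ln 2 \<le> ln (real p)" "ln (real p) > 0" using p2 by (auto intro: ln_mono)
      have "(1 + d / 2) * ln (real p) \<le> (1 - \<theta>) * Q * ln (real p)"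
        unfolding th(3)[symmetric] using Q th lnp by (intro mult_right_mono mult_left_mono) auto
      moreover have "\<theta> * Q * ln 2 \<le> \<theta> * Q * ln (real p)"
        using th Q d lnp by (intro mult_left_mono) auto
      ultimately have "- Q * ln (real p) \<le> - ((1 + d / 2) * ln (real p)) + - (\<theta> * Q * ln 2)"
        by (simp add: algebra_simps)
      then have "x p t \<le> exp (- ((1 + d / 2) * ln (real p))) * exp (- (\<theta> * Q * ln 2))"
        unfolding x_def Q_def[symmetric] exp_add[symmetric] by simp
      also have "exp (- ((1 + d / 2) * ln (real p))) = real p powr (- (1 + d / 2))"
        using p2 by (simp add: powr_def algebra_simps)
      also have "exp (- (\<theta> * Q * ln 2)) = (\<Prod>i\<in>A. r i ^ t i)"
      proof -
        have "- (\<theta> * Q * ln 2) = (\<Sum>i\<in>A. real (t i) * (- \<theta> * s i * ln 2))"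
          by (simp add: Q_def sum_distrib_left sum_distrib_right sum_negf mult_ac)
        then show ?thesis unfolding r_def by (simp only: exp_sum[OF A] exp_of_nat_mult)
      qed
      finally show ?thesis .
    qed
    then have "(\<Sum>t\<in>B. x p t) \<le> (\<Sum>t\<in>B. real p powr (- (1 + d / 2)) * (\<Prod>i\<in>A. r i ^ t i))"
      by (rule sum_mono)
    also have "\<dots> = real p powr (- (1 + d / 2)) * (\<Sum>t\<in>B. \<Prod>i\<in>A. r i ^ t i)"
      by (simp add: sum_distrib_left)
    also have "\<dots> \<le> real p powr (- (1 + d / 2)) * K"
      unfolding K_def using A r B \<Omega> by (intro mult_left_mono geometric_box_bound) auto
    finally show ?thesis by (simp add: \<kappa>_def mult.commute)
  qed
  have summ: "summable \<kappa>" unfolding \<kappa>_def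
    using d by (intro summable_mult) (simp add: summable_real_powr_iff)
  have k0: "\<kappa> p \<ge> 0" for p using K0 by (simp add: \<kappa>_def)
  have "(\<Sum>F\<in>\<A>. exp (- (\<Sum>i\<in>A. s i * log_height A F i))) \<le> exp (suminf \<kappa>)"
    if "finite \<A>" "\<A> \<subseteq> conf A \<Omega>" for \<A>
  proof -
    have "exp (- (\<Sum>i\<in>A. s i * log_height A F i)) = (\<Prod>p | F p \<noteq> ?z. x p (F p))" if "F \<in> conf A \<Omega>" for F
    proof -
      have fin: "finite {p. F p \<noteq> ?z}" using that by (simp add: conf_def)
      have "(\<Sum>i\<in>A. s i * log_height A F i) = (\<Sum>p | F p \<noteq> ?z. (\<Sum>i\<in>A. s i * real (F p i)) * ln (real p))"
        unfolding log_height_def sum_distrib_left sum_distrib_right by (subst sum.swap) (simp add: mult.assoc)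
      then have eq: "- (\<Sum>i\<in>A. s i * log_height A F i) =
          (\<Sum>p | F p \<noteq> ?z. - (\<Sum>i\<in>A. s i * real (F p i)) * ln (real p))"
        by (simp add: sum_negf)
      show ?thesis unfolding eq x_def by (rule exp_sum[OF fin])
    qed
    then have "(\<Sum>F\<in>\<A>. exp (- (\<Sum>i\<in>A. s i * log_height A F i))) = (\<Sum>F\<in>\<A>. \<Prod>p | F p \<noteq> ?z. x p (F p))"
      using that by (intro sum.cong) auto
    also have "\<dots> \<le> exp (suminf \<kappa>)"
      using local summ k0 that by (intro euler_product_bound[where \<Omega> = \<Omega>]) (auto simp: x_def)
    finally show ?thesis .
  qed
  then show ?thesis by blast
qed

text \<open>A finite subsum within \<open>e\<close> of the supremum leaves at most \<open>e\<close>
  for any finite set disjoint from it.\<close>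

lemma bounded_sums_small_tail:
  fixes a :: "'a \<Rightarrow> real"
  assumes a0: "\<And>x. x \<in> C \<Longrightarrow> a x \<ge> 0"
    and bd: "\<And>\<A>. finite \<A> \<Longrightarrow> \<A> \<subseteq> C \<Longrightarrow> sum a \<A> \<le> B" and e: "e > 0"
  shows "\<exists>\<A>0. finite \<A>0 \<and> \<A>0 \<subseteq> C \<and> (\<forall>\<A>. finite \<A> \<longrightarrow> \<A> \<subseteq> C - \<A>0 \<longrightarrow> sum a \<A> \<le> e)"
proof -
  define X where "X = sum a ` {\<A>. finite \<A> \<and> \<A> \<subseteq> C}"
  have ne: "X \<noteq> {}" unfolding X_def by blast
  have bdd: "bdd_above X" unfolding X_def bdd_above_def using bd by blast
  have "Sup X - e < Sup X" using e by simp
  then obtain y where y: "y \<in> X" "Sup X - e < y" using less_cSup_iff[OF ne bdd] by blast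
  then obtain \<A>0 where A0: "finite \<A>0" "\<A>0 \<subseteq> C" "y = sum a \<A>0" by (auto simp: X_def)
  have "sum a \<A> \<le> e" if "finite \<A>" "\<A> \<subseteq> C - \<A>0" for \<A>
  proof -
    have "sum a (\<A> \<union> \<A>0) \<le> Sup X"
      using that A0 bdd by (intro cSup_upper) (auto simp: X_def)
    also have "sum a (\<A> \<union> \<A>0) = sum a \<A> + sum a \<A>0"
      using that A0 by (intro sum.union_disjoint) auto
    finally show ?thesis using y A0 by simp
  qed
  with A0 show ?thesis by blast
qed

section \<open>Positive density of the square-free tuples\<close>

context pivot_system
begin

text \<open>Primes are sorted by their total multiplicity in the tuple: those of total 1 go into the
  square-free part, and the others form a family whose nonzero vectors have coordinate sum at least
  2.\<close>

definition sq_part :: "('g \<Rightarrow> nat) \<Rightarrow> nat \<Rightarrow> 'g \<Rightarrow> nat" where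
  "sq_part m p = (\<lambda>g\<in>T. if prime p \<and> (\<Sum>h\<in>T. multiplicity p (m h)) \<noteq> 1 then multiplicity p (m g) else 0)"

definition sqfree_part :: "('g \<Rightarrow> nat) \<Rightarrow> 'g \<Rightarrow> nat" where
  "sqfree_part m = (\<lambda>g\<in>T. \<Prod>p | p \<in> prime_factors (m g) \<and> (\<Sum>h\<in>T. multiplicity p (m h)) = 1. p)"

definition nonunit_vectors :: "('g \<Rightarrow> nat) set" where
  "nonunit_vectors = {t \<in> T \<rightarrow>\<^sub>E UNIV. (\<Sum>g\<in>T. t g) \<noteq> 1}"

lemma sq_part_conf:
  assumes "m \<in> pos_tuples T"
  shows "sq_part m \<in> conf T nonunit_vectors"
  unfolding conf_def
proof (intro CollectI conjI allI impI)
  fix p :: nat assume "prime p"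
  show "sq_part m p \<in> nonunit_vectors"
  proof (cases "(\<Sum>h\<in>T. multiplicity p (m h)) = 1")
    case True
    then have "sq_part m p = (\<lambda>g\<in>T. 0)" by (auto simp: sq_part_def fun_eq_iff)
    then show ?thesis by (simp add: nonunit_vectors_def)
  next
    case False
    then have "sq_part m p = (\<lambda>g\<in>T. multiplicity p (m g))" using \<open>prime p\<close> by (auto simp: sq_part_def fun_eq_iff)
    then show ?thesis using False by (simp add: nonunit_vectors_def)
  qed
next
  fix p :: nat assume "\<not> prime p"
  then show "sq_part m p = (\<lambda>g\<in>T. 0)" by (auto simp: sq_part_def fun_eq_iff)
next
  have "{p. sq_part m p \<noteq> (\<lambda>g\<in>T. 0)} \<subseteq> (\<Union>g\<in>T. prime_factors (m g))"
  proof
    fix p assume "p \<in> {p. sq_part m p \<noteq> (\<lambda>g\<in>T. 0)}"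
    then obtain g where g: "g \<in> T" "prime p" "multiplicity p (m g) \<noteq> 0"
      by (auto simp: sq_part_def fun_eq_iff split: if_splits)
    then show "p \<in> (\<Union>g\<in>T. prime_factors (m g))" by (auto simp: prime_factors_multiplicity)
  qed
  moreover have "finite (\<Union>g\<in>T. prime_factors (m g))" using finT by simp
  ultimately show "finite {p. sq_part m p \<noteq> (\<lambda>g\<in>T. 0)}" by (rule finite_subset)
qed

lemma log_height_sq_part:
  assumes m: "m \<in> pos_tuples T" and g: "g \<in> T"
  shows "real (m g) = real (sqfree_part m g) * exp (log_height T (sq_part m) g)"
proof -
  let ?S = "\<lambda>p. \<Sum>h\<in>T. multiplicity p (m h)"
  define A1 where "A1 = {p \<in> prime_factors (m g). ?S p = 1}"
  define A2 where "A2 = {p \<in> prime_factors (m g). ?S p \<noteq> 1}"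
  have fin: "finite A1" "finite A2" by (auto simp: A1_def A2_def)
  have mg: "m g > 0" using m g by (auto simp: PiE_iff)
  have "m g = (\<Prod>p\<in>prime_factors (m g). p ^ multiplicity p (m g))"
    using mg by (rule prime_factorization_nat)
  also have "prime_factors (m g) = A1 \<union> A2" by (auto simp: A1_def A2_def)
  also have "(\<Prod>p\<in>A1 \<union> A2. p ^ multiplicity p (m g)) = (\<Prod>p\<in>A1. p ^ multiplicity p (m g)) * (\<Prod>p\<in>A2. p ^ multiplicity p (m g))"
    using fin by (intro prod.union_disjoint) (auto simp: A1_def A2_def)
  also have "(\<Prod>p\<in>A1. p ^ multiplicity p (m g)) = (\<Prod>p\<in>A1. p)"
  proof (rule prod.cong)
    fix p assume p: "p \<in> A1"
    then have "multiplicity p (m g) \<noteq> 0" by (auto simp: A1_def prime_factors_multiplicity)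
    moreover have "multiplicity p (m g) \<le> ?S p" using g finT by (intro member_le_sum) auto
    moreover have "?S p = 1" using p by (simp add: A1_def)
    ultimately have "multiplicity p (m g) = 1" by linarith
    then show "p ^ multiplicity p (m g) = p" by simp
  qed simp
  also have "(\<Prod>p\<in>A1. p) = sqfree_part m g" using g by (simp add: sqfree_part_def A1_def)
  finally have eq: "m g = sqfree_part m g * (\<Prod>p\<in>A2. p ^ multiplicity p (m g))" .
  have "log_height T (sq_part m) g = (\<Sum>p\<in>A2. real (multiplicity p (m g)) * ln (real p))"
    unfolding log_height_def
  proof (rule sum.mono_neutral_cong_right)
    have "sq_part m \<in> conf T nonunit_vectors" by (rule sq_part_conf[OF m])
    then show "finite {p. sq_part m p \<noteq> (\<lambda>i\<in>T. 0)}" by (simp add: conf_def)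
    show "A2 \<subseteq> {p. sq_part m p \<noteq> (\<lambda>i\<in>T. 0)}"
      using g by (auto simp: A2_def sq_part_def fun_eq_iff prime_factors_multiplicity)
    show "\<forall>p\<in>{p. sq_part m p \<noteq> (\<lambda>i\<in>T. 0)} - A2. real (sq_part m p g) * ln (real p) = 0"
      using g by (auto simp: A2_def sq_part_def prime_factors_multiplicity)
  qed (use g in \<open>auto simp: A2_def sq_part_def prime_factors_multiplicity\<close>)
  then have "exp (log_height T (sq_part m) g) = (\<Prod>p\<in>A2. exp (ln (real p)) ^ multiplicity p (m g))"
    by (simp only: exp_sum[OF fin(2)] exp_of_nat_mult)
  also have "\<dots> = (\<Prod>p\<in>A2. real p ^ multiplicity p (m g))"
  proof (rule prod.cong)
    fix p assume "p \<in> A2"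
    then have "prime p" by (auto simp: A2_def)
    then show "exp (ln (real p)) ^ multiplicity p (m g) = real p ^ multiplicity p (m g)"
      by (simp add: prime_gt_0_nat)
  qed simp
  finally have "exp (log_height T (sq_part m) g) = (\<Prod>p\<in>A2. real p ^ multiplicity p (m g))" .
  then show ?thesis using arg_cong[OF eq, of real] by simp
qed

lemma sqfree_part_good:
  assumes m: "m \<in> pos_tuples T"
  shows "sqfree_part m \<in> good 1"
proof -
  have mult: "multiplicity p (sqfree_part m g) = (if p \<in> prime_factors (m g) \<and> (\<Sum>h\<in>T. multiplicity p (m h)) = 1 then 1 else 0)"
    if "g \<in> T" "prime p" for p g
  proof -
    have "sqfree_part m g = (\<Prod>p | p \<in> prime_factors (m g) \<and> (\<Sum>h\<in>T. multiplicity p (m h)) = 1. p ^ 1)"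
      using that by (simp add: sqfree_part_def)
    then show ?thesis using that
      by (simp only:) (subst multiplicity_prod_prime_powers, auto)
  qed
  have pos: "sqfree_part m g > 0" if "g \<in> T" for g
    using that by (auto simp: sqfree_part_def intro!: prod_pos dest: in_prime_factors_imp_prime prime_gt_0_nat)
  have "\<not> p\<^sup>2 dvd tprod (sqfree_part m)" if p: "prime p" for p
  proof
    assume "p\<^sup>2 dvd tprod (sqfree_part m)"
    then obtain g h where gh: "g \<in> T" "h \<in> T"
      "(g = h \<and> p\<^sup>2 dvd sqfree_part m g) \<or> (g \<noteq> h \<and> p dvd sqfree_part m g \<and> p dvd sqfree_part m h)"
      using prime_square_dvd_prod[OF finT p] unfolding tprod_def by blast
    show False
    proof (cases "g = h")
      case True
      then have "p ^ 2 dvd sqfree_part m g" using gh by blast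
      then have "2 \<le> multiplicity p (sqfree_part m g)"
        using pos[OF gh(1)] p by (intro multiplicity_geI) (auto simp: prime_elem_multiplicity_eq_zero_iff dest: prime_gt_1_nat)
      then show False using mult[OF gh(1) p] by (simp split: if_splits)
    next
      case False
      then have "p dvd sqfree_part m g" "p dvd sqfree_part m h" using gh by auto
      then have "multiplicity p (sqfree_part m g) \<noteq> 0" "multiplicity p (sqfree_part m h) \<noteq> 0"
        using pos[OF gh(1)] pos[OF gh(2)] p by (auto simp: prime_elem_multiplicity_eq_zero_iff)
      then have 1: "multiplicity p (m g) \<ge> 1" "multiplicity p (m h) \<ge> 1" "(\<Sum>h\<in>T. multiplicity p (m h)) = 1"
        using mult[OF gh(1) p] mult[OF gh(2) p] by (auto simp: prime_factors_multiplicity split: if_splits)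
      have "(\<Sum>x\<in>{g, h}. multiplicity p (m x)) \<le> (\<Sum>h\<in>T. multiplicity p (m h))"
        using gh finT by (intro sum_mono2) auto
      then show False using 1 False by simp
    qed
  qed
  then show ?thesis by (auto simp: good_def)
qed

lemma sqfree_part_tuples:
  assumes "m \<in> tuples b"
  shows "sqfree_part m \<in> tuples (\<lambda>i. b i - lin (log_height T (sq_part m)) i)"
proof -
  have m: "m \<in> pos_tuples T" using assms by (simp add: tuples_def)
  have pos: "sqfree_part m g > 0" if "g \<in> T" for g
    using that by (auto simp: sqfree_part_def intro!: prod_pos dest: in_prime_factors_imp_prime prime_gt_0_nat)
  have "ln (real (m g)) = ln (real (sqfree_part m g)) + log_height T (sq_part m) g" if "g \<in> T" for g
    unfolding log_height_sq_part[OF m that] using pos[OF that] by (simp add: ln_mult)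
  then have "lin (\<lambda>g. ln (real (m g))) i = lin (\<lambda>g. ln (real (sqfree_part m g))) i + lin (log_height T (sq_part m)) i" for i
    by (simp add: lin_def sum.distrib distrib_left)
  moreover have "sqfree_part m \<in> pos_tuples T"
    using pos by (auto simp: PiE_iff) (simp add: sqfree_part_def)
  ultimately show ?thesis using assms by (auto simp: tuples_def algebra_simps)
qed

text \<open>The two parts determine the tuple. Since \<open>pairing\<close> is additive, the family
  \<open>w\<close> takes the factor \<open>exp (- (\<Sum>g\<in>T. log_height T w g))\<close> out of
  the normalisation.\<close>

lemma dens_count_le_good_sum:
  obtains W where "finite W" "W \<subseteq> conf T nonunit_vectors"
    "dens_count UNIV b \<le> (\<Sum>w\<in>W. exp (- (\<Sum>g\<in>T. log_height T w g)) *
       dens_count (good 1) (\<lambda>i. b i - lin (log_height T w) i))"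
proof -
  define W where "W = sq_part ` tuples b"
  define X where "X = (\<lambda>w. good 1 \<inter> tuples (\<lambda>i. b i - lin (log_height T w) i))"
  have finX: "finite (X w)" for w unfolding X_def using finite_tuples by blast
  have finW: "finite W" unfolding W_def using finite_tuples by blast
  have inj: "inj_on (\<lambda>m. (sq_part m, sqfree_part m)) (tuples b)"
  proof (rule inj_onI)
    fix m m' assume m: "m \<in> tuples b" "m' \<in> tuples b" "(sq_part m, sqfree_part m) = (sq_part m', sqfree_part m')"
    then have pt: "m \<in> pos_tuples T" "m' \<in> pos_tuples T" by (auto simp: tuples_def)
    have "real (m g) = real (m' g)" if "g \<in> T" for g
      using log_height_sq_part[OF pt(1) that] log_height_sq_part[OF pt(2) that] m(3) by simp
    then show "m = m'" by (intro PiE_ext[OF pt]) simp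
  qed
  have "card (tuples b) \<le> card (Sigma W X)"
  proof (rule card_inj_on_le[OF inj])
    show "(\<lambda>m. (sq_part m, sqfree_part m)) ` tuples b \<subseteq> Sigma W X"
      unfolding W_def X_def using sqfree_part_tuples sqfree_part_good by (auto simp: tuples_def)
    show "finite (Sigma W X)" using finW finX by (intro finite_SigmaI)
  qed
  also have "\<dots> = (\<Sum>w\<in>W. card (X w))" using finW finX by (intro card_SigmaI) auto
  finally have "real (card (tuples b)) \<le> (\<Sum>w\<in>W. real (card (X w)))" by (simp flip: of_nat_sum)
  then have "dens_count UNIV b \<le> (\<Sum>w\<in>W. real (card (X w))) * exp (- pairing b)"
    by (simp add: dens_count_def mult_right_mono)
  also have "\<dots> = (\<Sum>w\<in>W. exp (- (\<Sum>g\<in>T. log_height T w g)) *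
       dens_count (good 1) (\<lambda>i. b i - lin (log_height T w) i))"
    unfolding sum_distrib_right
  proof (rule sum.cong)
    fix w
    have "- pairing b = - (\<Sum>g\<in>T. log_height T w g) + - pairing (\<lambda>i. b i - lin (log_height T w) i)"
      by (simp add: pairing_diff' pairing_lin)
    then have "exp (- pairing b) = exp (- (\<Sum>g\<in>T. log_height T w g)) * exp (- pairing (\<lambda>i. b i - lin (log_height T w) i))"
      by (metis exp_add)
    then show "real (card (X w)) * exp (- pairing b) = exp (- (\<Sum>g\<in>T. log_height T w g)) *
       dens_count (good 1) (\<lambda>i. b i - lin (log_height T w) i)"
      by (simp add: dens_count_def X_def)
  qed simp
  finally show thesis using finW sq_part_conf by (intro that[of W]) (auto simp: W_def tuples_def)
qed

text \<open>A nonzero vector of coordinate sum other than 1 has sum at least 2, so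
  \<open>conf_sum_bounded\<close> applies with all weights 1 and \<open>d = 1\<close>.\<close>

lemma nonunit_sum_bounded:
  "\<exists>C. \<forall>\<A>. finite \<A> \<longrightarrow> \<A> \<subseteq> conf T nonunit_vectors \<longrightarrow> (\<Sum>w\<in>\<A>. exp (- (\<Sum>g\<in>T. log_height T w g))) \<le> C"
proof -
  have "\<exists>C. \<forall>\<A>. finite \<A> \<longrightarrow> \<A> \<subseteq> conf T nonunit_vectors \<longrightarrow> (\<Sum>w\<in>\<A>. exp (- (\<Sum>g\<in>T. 1 * log_height T w g))) \<le> C"
  proof (rule conf_sum_bounded[where d = 1])
    fix t assume t: "t \<in> nonunit_vectors" "t \<noteq> (\<lambda>i\<in>T. 0)"
    have "(\<Sum>g\<in>T. t g) \<noteq> 0"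
    proof
      assume "(\<Sum>g\<in>T. t g) = 0"
      then have "\<forall>g\<in>T. t g = 0" using finT by simp
      then have "t = (\<lambda>i\<in>T. 0)" using t(1) by (auto simp: nonunit_vectors_def PiE_iff extensional_def fun_eq_iff)
      with t(2) show False by simp
    qed
    then have "(\<Sum>g\<in>T. t g) \<ge> 2" using t(1) by (simp add: nonunit_vectors_def)
    then show "1 + 1 \<le> (\<Sum>g\<in>T. 1 * real (t g))" by (simp flip: of_nat_sum)
  qed (auto simp: finF finP nonunit_vectors_def)
  then show ?thesis by simp
qed

text \<open>Every tuple is a square-free tuple times one from a family whose reciprocals are summable, so a zero limit
  for the square-free tuples would force a zero limit for all of them.\<close>

lemma good_limit_pos:
  assumes lim: "((\<lambda>L. dens_count (good 1) (\<lambda>i. L) / L ^ card F) \<longlongrightarrow> l) at_top"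
  shows "l > 0"
proof (rule ccontr)
  assume "\<not> l > 0"
  moreover have "l \<ge> 0"
    using lim by (rule tendsto_lowerbound)
      (use eventually_gt_at_top[of 0] in \<open>eventually_elim, auto simp: dens_count_nonneg\<close>)
  ultimately have l0: "l = 0" by simp
  let ?a = "\<lambda>w. exp (- (\<Sum>g\<in>T. log_height T w g))"
  obtain K where K: "K > 0" "\<And>L b. L \<ge> 1 \<Longrightarrow> (\<forall>i\<in>I. b i \<le> L) \<Longrightarrow> dens_count UNIV b \<le> K * L ^ card F"
    using count_bound by blast
  obtain C where C: "\<And>\<A>. finite \<A> \<Longrightarrow> \<A> \<subseteq> conf T nonunit_vectors \<Longrightarrow> (\<Sum>w\<in>\<A>. ?a w) \<le> C"
    using nonunit_sum_bounded by blast
  define c0 where "c0 = C0 (\<lambda>_. 0)"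
  have c0: "c0 > 0" unfolding c0_def by (rule C0_pos)
  \<comment> \<open>A term of the tail is at most \<open>K * L ^ card F\<close> times its weight, so
    a tail of this size contributes at most \<open>c0 / 4\<close>, less than the limit
    \<open>c0\<close> for all tuples.\<close>
  have e: "c0 / (4 * K) > 0" using c0 K by simp
  obtain \<A>0 where A0: "finite \<A>0" "\<A>0 \<subseteq> conf T nonunit_vectors"
    "\<And>\<A>. finite \<A> \<Longrightarrow> \<A> \<subseteq> conf T nonunit_vectors - \<A>0 \<Longrightarrow> (\<Sum>w\<in>\<A>. ?a w) \<le> c0 / (4 * K)"
    using bounded_sums_small_tail[of "conf T nonunit_vectors" ?a C, OF _ C e] by auto
  have bound: "dens_count UNIV (\<lambda>i. L) / L ^ card F \<le>
      real (card \<A>0) * (dens_count (good 1) (\<lambda>i. L) / L ^ card F) + c0 / 4" if L: "L \<ge> 1" for L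
  proof -
    obtain W where W: "finite W" "W \<subseteq> conf T nonunit_vectors"
      "dens_count UNIV (\<lambda>i. L) \<le> (\<Sum>w\<in>W. ?a w * dens_count (good 1) (\<lambda>i. L - lin (log_height T w) i))"
      using dens_count_le_good_sum[of "\<lambda>i. L"] by blast
    have lin0: "lin (log_height T w) i \<ge> 0" if "w \<in> conf T nonunit_vectors" "i \<in> I" for w i
      unfolding lin_def using G_nonneg that log_height_nonneg[OF that(1)]
      by (intro sum_nonneg mult_nonneg_nonneg) auto
    \<comment> \<open>Two bounds for a summand: by the square-free count itself, for the finitely
      many families in \<open>\<A>0\<close>, and the uniform one below for the tail.\<close>
    have 1: "?a w * dens_count (good 1) (\<lambda>i. L - lin (log_height T w) i) \<le> dens_count (good 1) (\<lambda>i. L)"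
      if w: "w \<in> conf T nonunit_vectors" for w
    proof -
      have "tuples (\<lambda>i. L - lin (log_height T w) i) \<subseteq> tuples (\<lambda>i. L)"
        using lin0[OF w] by (auto simp: tuples_def) (smt (verit))
      then have "real (card (good 1 \<inter> tuples (\<lambda>i. L - lin (log_height T w) i))) \<le> real (card (good 1 \<inter> tuples (\<lambda>i. L)))"
        using finite_tuples by (intro of_nat_mono card_mono) auto
      then have "real (card (good 1 \<inter> tuples (\<lambda>i. L - lin (log_height T w) i))) * exp (- pairing (\<lambda>i. L)) \<le>
          dens_count (good 1) (\<lambda>i. L)"
        unfolding dens_count_def by (rule mult_right_mono) simp
      moreover have "exp (- pairing (\<lambda>i. L)) = ?a w * exp (- pairing (\<lambda>i. L - lin (log_height T w) i))"
        by (simp add: pairing_diff' pairing_lin exp_add[symmetric])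
      ultimately show ?thesis by (simp add: dens_count_def mult.left_commute)
    qed
    have 2: "dens_count (good 1) (\<lambda>i. L - lin (log_height T w) i) \<le> K * L ^ card F"
      if w: "w \<in> conf T nonunit_vectors" for w
    proof -
      have "dens_count (good 1) (\<lambda>i. L - lin (log_height T w) i) \<le> dens_count UNIV (\<lambda>i. L - lin (log_height T w) i)"
        by (rule dens_count_mono) simp
      also have "\<dots> \<le> K * L ^ card F" using lin0[OF w] by (intro K L) auto
      finally show ?thesis .
    qed
    have "dens_count UNIV (\<lambda>i. L) \<le>
        (\<Sum>w\<in>W \<inter> \<A>0. ?a w * dens_count (good 1) (\<lambda>i. L - lin (log_height T w) i)) +
        (\<Sum>w\<in>W - \<A>0. ?a w * dens_count (good 1) (\<lambda>i. L - lin (log_height T w) i))"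
      using W by (simp add: sum.Int_Diff[OF W(1), of _ \<A>0])
    also have "(\<Sum>w\<in>W \<inter> \<A>0. ?a w * dens_count (good 1) (\<lambda>i. L - lin (log_height T w) i)) \<le>
        (\<Sum>w\<in>W \<inter> \<A>0. dens_count (good 1) (\<lambda>i. L))"
      using W(2) by (intro sum_mono 1) auto
    also have "\<dots> \<le> real (card \<A>0) * dens_count (good 1) (\<lambda>i. L)"
      using A0(1) dens_count_nonneg by (simp add: mult_right_mono card_mono)
    also have "(\<Sum>w\<in>W - \<A>0. ?a w * dens_count (good 1) (\<lambda>i. L - lin (log_height T w) i)) \<le>
        (\<Sum>w\<in>W - \<A>0. ?a w * (K * L ^ card F))"
      using W(2) by (intro sum_mono mult_left_mono 2) auto
    also have "\<dots> = (\<Sum>w\<in>W - \<A>0. ?a w) * (K * L ^ card F)" by (simp add: sum_distrib_right)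
    also have "\<dots> \<le> c0 / (4 * K) * (K * L ^ card F)"
      using W K(1) L by (intro mult_right_mono A0(3)) auto
    also have "\<dots> = c0 / 4 * L ^ card F" using K(1) by simp
    finally have "dens_count UNIV (\<lambda>i. L) \<le> real (card \<A>0) * dens_count (good 1) (\<lambda>i. L) + c0 / 4 * L ^ card F"
      by simp
    then have "dens_count UNIV (\<lambda>i. L) / L ^ card F \<le>
        (real (card \<A>0) * dens_count (good 1) (\<lambda>i. L) + c0 / 4 * L ^ card F) / L ^ card F"
      using L by (intro divide_right_mono) auto
    then show ?thesis using L by (simp add: add_divide_distrib)
  qed
  have "((\<lambda>L. dens_count UNIV (\<lambda>i. L) / L ^ card F) \<longlongrightarrow> c0) at_top"
    using count_tendsto[of "\<lambda>_. 0"] by (simp add: c0_def)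
  moreover have "((\<lambda>L. real (card \<A>0) * (dens_count (good 1) (\<lambda>i. L) / L ^ card F) + c0 / 4) \<longlongrightarrow>
      real (card \<A>0) * 0 + c0 / 4) at_top"
    using lim l0 by (intro tendsto_intros) auto
  moreover have "eventually (\<lambda>L. dens_count UNIV (\<lambda>i. L) / L ^ card F \<le>
      real (card \<A>0) * (dens_count (good 1) (\<lambda>i. L) / L ^ card F) + c0 / 4) at_top"
    using eventually_ge_at_top[of 1] by eventually_elim (rule bound)
  ultimately have "c0 \<le> real (card \<A>0) * 0 + c0 / 4" by (intro tendsto_le[of at_top]) auto
  with c0 show False by simp
qed

end

section \<open>Counting with local conditions\<close>

text \<open>A prime in the support is at most \<open>exp L\<close>, and an entry is at most
  \<open>L / ln 2\<close>.\<close>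

lemma finite_bounded_conf:
  assumes A: "finite A" and \<Omega>: "\<Omega> \<subseteq> A \<rightarrow>\<^sub>E UNIV"
  shows "finite {F \<in> conf A \<Omega>. \<forall>i\<in>A. log_height A F i \<le> L}"
proof -
  let ?z = "\<lambda>i\<in>A. (0::nat)"
  define N where "N = nat \<lceil>exp L\<rceil>"
  define K where "K = nat \<lceil>L / ln 2\<rceil>"
  have bound: "p \<le> N" "F p \<in> A \<rightarrow>\<^sub>E {..K}"
    if F: "F \<in> conf A \<Omega>" "\<forall>i\<in>A. log_height A F i \<le> L" and p: "F p \<noteq> ?z" for F p
  proof -
    have fin: "finite {p. F p \<noteq> ?z}" using F by (simp add: conf_def)
    have pp: "prime p" using conf_supp_prime[OF F(1) p] .
    then have lnp: "ln 2 \<le> ln (real p)" using prime_ge_2_nat[OF pp] by (intro ln_mono) auto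
    have ext: "F p \<in> A \<rightarrow>\<^sub>E UNIV" using F(1) pp \<Omega> by (auto simp: conf_def)
    have summand: "real (F p i) * ln (real p) \<le> L" if i: "i \<in> A" for i
    proof -
      have "real (F p i) * ln (real p) \<le> log_height A F i"
        unfolding log_height_def
      proof (rule member_le_sum[of p])
        fix q assume "q \<in> {p. F p \<noteq> ?z} - {p}"
        then have "prime q" using conf_supp_prime[OF F(1)] by blast
        then show "0 \<le> real (F q i) * ln (real q)" using prime_ge_1_nat by simp
      qed (use p fin in auto)
      then show ?thesis using F(2) i by force
    qed
    obtain i where i: "i \<in> A" "F p i \<noteq> 0"
    proof -
      have "\<exists>i\<in>A. F p i \<noteq> 0"
      proof (rule ccontr)
        assume "\<not> (\<exists>i\<in>A. F p i \<noteq> 0)"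
        then have "F p = ?z" using ext by (auto simp: fun_eq_iff PiE_iff extensional_def)
        with p show False by simp
      qed
      with that show thesis by blast
    qed
    have "1 * ln (real p) \<le> real (F p i) * ln (real p)"
    proof (rule mult_right_mono)
      show "0 \<le> ln (real p)" using lnp(1) ln_gt_zero[of 2] by linarith
    qed (use i(2) in simp)
    then have "ln (real p) \<le> L" using summand[OF i(1)] by simp
    then have "real p \<le> exp L" using prime_gt_0_nat[OF pp] by (metis exp_le_cancel_iff exp_ln of_nat_0_less_iff)
    then show "p \<le> N" unfolding N_def by linarith
    have "F p i \<le> K" if "i \<in> A" for i
    proof -
      have "real (F p i) * ln 2 \<le> real (F p i) * ln (real p)" using lnp by (intro mult_left_mono) auto
      also note summand[OF that]
      finally have "real (F p i) \<le> L / ln 2" by (simp add: field_simps)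
      then show ?thesis unfolding K_def by linarith
    qed
    then show "F p \<in> A \<rightarrow>\<^sub>E {..K}" using ext by (auto simp: PiE_iff)
  qed
  have "finite {F. \<forall>p. (p \<in> {..N} \<longrightarrow> F p \<in> insert ?z (A \<rightarrow>\<^sub>E {..K})) \<and> (p \<notin> {..N} \<longrightarrow> F p = ?z)}"
    using A by (intro finite_set_of_finite_funs) (auto intro: finite_PiE)
  moreover have "{F \<in> conf A \<Omega>. \<forall>i\<in>A. log_height A F i \<le> L} \<subseteq>
      {F. \<forall>p. (p \<in> {..N} \<longrightarrow> F p \<in> insert ?z (A \<rightarrow>\<^sub>E {..K})) \<and> (p \<notin> {..N} \<longrightarrow> F p = ?z)}"
    using bound by blast
  ultimately show ?thesis by (rule finite_subset[rotated])
qed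

text \<open>The columns are now themselves local vectors. \<open>gap\<close> extends strict
  complementarity from the columns of the program to all other vectors of \<open>\<Omega>\<close>,
  with the uniform margin that the Euler product needs.\<close>

locale local_counting = pivot_system I P F "\<lambda>g i. real (g i)" s c lam E
  for I :: "'i set" and P F :: "('i \<Rightarrow> nat) set" and s c lam E +
  fixes \<Omega> :: "('i \<Rightarrow> nat) set" and d :: real
  assumes \<Omega>_ext: "\<Omega> \<subseteq> I \<rightarrow>\<^sub>E UNIV" and T_sub: "F \<union> P \<subseteq> \<Omega>" and zero_in: "(\<lambda>i\<in>I. 0) \<in> \<Omega>"
    and d_pos: "d > 0"
    and gap: "\<And>t. t \<in> \<Omega> - (F \<union> P) \<Longrightarrow> t \<noteq> (\<lambda>i\<in>I. 0) \<Longrightarrow> 1 + d \<le> (\<Sum>i\<in>I. s i * real (t i))"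
begin

abbreviation "Z \<equiv> (\<lambda>i\<in>I. 0 :: nat)"

lemma Z_notin: "Z \<notin> T"
proof
  assume "Z \<in> T"
  from sG[OF this] show False by simp
qed

text \<open>A family is cut into the primes whose vector lies in \<open>T\<close>, stored as a tuple
  of square-free integers, and a remainder. \<open>join\<close> inverts this, and
  \<open>supp_prod\<close> records the primes that the tuple has to avoid.\<close>

definition rest :: "(nat \<Rightarrow> 'i \<Rightarrow> nat) \<Rightarrow> nat \<Rightarrow> 'i \<Rightarrow> nat" where
  "rest C p = (if C p \<in> T then Z else C p)"

definition tup :: "(nat \<Rightarrow> 'i \<Rightarrow> nat) \<Rightarrow> ('i \<Rightarrow> nat) \<Rightarrow> nat" where
  "tup C = (\<lambda>g\<in>T. \<Prod>{p. C p = g})"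

text \<open>In a good tuple at most one entry is divisible by \<open>p\<close>, which gives the
  description its meaning.\<close>

definition join :: "(nat \<Rightarrow> 'i \<Rightarrow> nat) \<Rightarrow> (('i \<Rightarrow> nat) \<Rightarrow> nat) \<Rightarrow> nat \<Rightarrow> 'i \<Rightarrow> nat" where
  "join w m p = (if prime p \<and> (\<exists>g\<in>T. p dvd m g) then (THE g. g \<in> T \<and> p dvd m g) else w p)"

definition supp_prod :: "(nat \<Rightarrow> 'i \<Rightarrow> nat) \<Rightarrow> nat" where
  "supp_prod w = \<Prod>{p. w p \<noteq> Z}"

lemma conf_fin: "C \<in> conf I \<Omega>' \<Longrightarrow> finite {p. C p \<noteq> Z}"
  by (simp add: conf_def)

lemma conf_prime: "C \<in> conf I \<Omega>' \<Longrightarrow> g \<in> T \<Longrightarrow> C p = g \<Longrightarrow> prime p"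
  using conf_supp_prime Z_notin by metis

lemma fin_fibre: "C \<in> conf I \<Omega>' \<Longrightarrow> g \<in> T \<Longrightarrow> finite {p. C p = g}"
  by (rule finite_subset[OF _ conf_fin]) (use Z_notin in auto)

lemma dvd_tup:
  assumes "C \<in> conf I \<Omega>'" "g \<in> T" "prime p"
  shows "p dvd tup C g \<longleftrightarrow> C p = g"
proof -
  have "p dvd tup C g \<longleftrightarrow> (\<exists>q\<in>{q. C q = g}. p dvd q)"
    using assms(2,3) prime_dvd_prod_iff[OF fin_fibre[OF assms(1,2)] assms(3), of "\<lambda>x. x"]
    by (simp add: tup_def)
  also have "\<dots> \<longleftrightarrow> C p = g"
  proof
    assume "\<exists>q\<in>{q. C q = g}. p dvd q"
    then obtain q where q: "C q = g" "p dvd q" by blast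
    then have "prime q" using conf_prime[OF assms(1,2)] by blast
    then have "p = q" using assms(3) q(2) by (intro primes_dvd_imp_eq)
    with q(1) show "C p = g" by simp
  qed auto
  finally show ?thesis .
qed

lemma tup_pos:
  assumes "C \<in> conf I \<Omega>'" "g \<in> T"
  shows "tup C g > 0"
proof -
  have "0 < p" if "p \<in> {p. C p = g}" for p
    using conf_prime[OF assms, of p] that prime_gt_0_nat by blast
  then have "(\<Prod>p\<in>{p. C p = g}. p) > 0" by (rule prod_pos)
  then show ?thesis using assms(2) by (simp add: tup_def)
qed

lemma tup_square:
  assumes "C \<in> conf I \<Omega>'" "g \<in> T" "prime p"
  shows "\<not> p\<^sup>2 dvd tup C g"
proof
  assume a: "p\<^sup>2 dvd tup C g"
  then have "p dvd tup C g" by (rule dvd_trans[rotated]) simp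
  then have Cp: "C p = g" using dvd_tup[OF assms] by simp
  have "tup C g = p * \<Prod>({q. C q = g} - {p})"
    using assms(2) Cp fin_fibre[OF assms(1,2)] by (simp add: tup_def prod.remove)
  with a have "p * p dvd p * \<Prod>({q. C q = g} - {p})" by (simp add: power2_eq_square)
  then have "p dvd \<Prod>({q. C q = g} - {p})" using prime_gt_0_nat[OF assms(3)] by simp
  then have "\<exists>q\<in>{q. C q = g} - {p}. p dvd q"
    using prime_dvd_prod_iff[of "{q. C q = g} - {p}" p "\<lambda>x. x"] fin_fibre[OF assms(1,2)] assms(3) by simp
  then obtain q where "C q = g" "q \<noteq> p" "p dvd q" by blast
  then show False using conf_prime[OF assms(1,2)] assms(3) by (metis primes_dvd_imp_eq)
qed

lemma rest_conf: "C \<in> conf I \<Omega> \<Longrightarrow> rest C \<in> conf I (\<Omega> - T)"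
proof -
  assume C: "C \<in> conf I \<Omega>"
  have "{p. rest C p \<noteq> Z} \<subseteq> {p. C p \<noteq> Z}" by (auto simp: rest_def)
  then have "finite {p. rest C p \<noteq> Z}" using conf_fin[OF C] by (rule finite_subset)
  then show ?thesis using C zero_in Z_notin unfolding conf_def by (auto simp: rest_def)
qed

lemma supp_prod_dvd:
  assumes "w \<in> conf I \<Omega>'" "prime p"
  shows "p dvd supp_prod w \<longleftrightarrow> w p \<noteq> Z"
proof -
  have "p dvd supp_prod w \<longleftrightarrow> (\<exists>q\<in>{q. w q \<noteq> Z}. p dvd q)"
    using assms prime_dvd_prod_iff[OF conf_fin[OF assms(1)] assms(2), of "\<lambda>x. x"]
    by (simp add: supp_prod_def)
  also have "\<dots> \<longleftrightarrow> w p \<noteq> Z"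
  proof
    assume "\<exists>q\<in>{q. w q \<noteq> Z}. p dvd q"
    then obtain q where q: "w q \<noteq> Z" "p dvd q" by blast
    then have "prime q" using conf_supp_prime[OF assms(1)] by blast
    then have "p = q" using assms(2) q(2) by (intro primes_dvd_imp_eq)
    with q(1) show "w p \<noteq> Z" by simp
  qed auto
  finally show ?thesis .
qed

lemma supp_prod_pos: "w \<in> conf I \<Omega>' \<Longrightarrow> supp_prod w > 0"
proof -
  assume w: "w \<in> conf I \<Omega>'"
  have "0 < p" if "p \<in> {p. w p \<noteq> Z}" for p
    using conf_supp_prime[OF w, of p] that prime_gt_0_nat by blast
  then have "(\<Prod>p\<in>{p. w p \<noteq> Z}. p) > 0" by (rule prod_pos)
  then show ?thesis by (simp add: supp_prod_def)
qed

lemma tup_good: "C \<in> conf I \<Omega> \<Longrightarrow> tup C \<in> good (supp_prod (rest C))"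
  unfolding good_def
proof (intro CollectI allI impI conjI)
  assume C: "C \<in> conf I \<Omega>"
  fix p :: nat assume p: "prime p"
  show "\<not> p\<^sup>2 dvd tprod (tup C)"
  proof
    assume "p\<^sup>2 dvd tprod (tup C)"
    then obtain g h where gh: "g \<in> T" "h \<in> T"
      "(g = h \<and> p\<^sup>2 dvd tup C g) \<or> (g \<noteq> h \<and> p dvd tup C g \<and> p dvd tup C h)"
      using prime_square_dvd_prod[OF finT p] unfolding tprod_def by blast
    then show False using tup_square[OF C gh(1) p] dvd_tup[OF C gh(1) p] dvd_tup[OF C gh(2) p] by auto
  qed
  show "\<not> p dvd tprod (tup C)" if "p dvd supp_prod (rest C)"
  proof
    assume "p dvd tprod (tup C)"
    then obtain g where g: "g \<in> T" "p dvd tup C g"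
      using prime_dvd_prod_iff[OF finT p] unfolding tprod_def by blast
    then have "C p \<in> T" using dvd_tup[OF C g(1) p] by simp
    moreover have "rest C p \<noteq> Z" using that supp_prod_dvd[OF rest_conf[OF C] p] by simp
    ultimately show False by (simp add: rest_def)
  qed
qed

lemma log_height_split:
  assumes C: "C \<in> conf I \<Omega>"
  shows "log_height I C i = log_height I (rest C) i + lin (\<lambda>g. ln (real (tup C g))) i"
proof -
  define A where "A = {p. C p \<in> T}"
  define B where "B = {p. rest C p \<noteq> Z}"
  have fB: "finite B" unfolding B_def by (rule conf_fin[OF rest_conf[OF C]])
  have AB: "{p. C p \<noteq> Z} = A \<union> B" "A \<inter> B = {}"
    using Z_notin by (auto simp: A_def B_def rest_def)
  have fA: "finite A" using conf_fin[OF C] AB by simp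
  have "log_height I C i = (\<Sum>p\<in>A. real (C p i) * ln (real p)) + (\<Sum>p\<in>B. real (C p i) * ln (real p))"
    unfolding log_height_def AB(1) by (rule sum.union_disjoint[OF fA fB AB(2)])
  also have "(\<Sum>p\<in>B. real (C p i) * ln (real p)) = log_height I (rest C) i"
    unfolding log_height_def B_def by (rule sum.cong) (auto simp: rest_def split: if_splits)
  also have "(\<Sum>p\<in>A. real (C p i) * ln (real p)) = (\<Sum>g\<in>T. \<Sum>p\<in>{p\<in>A. C p = g}. real (C p i) * ln (real p))"
    using fA finT by (intro sum.group[symmetric]) (auto simp: A_def)
  also have "\<dots> = lin (\<lambda>g. ln (real (tup C g))) i"
    unfolding lin_def
  proof (rule sum.cong)
    fix g assume g: "g \<in> T"
    have eq: "{p\<in>A. C p = g} = {p. C p = g}" using g by (auto simp: A_def)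
    have "ln (real (tup C g)) = ln (\<Prod>p\<in>{p. C p = g}. real p)"
      using g by (simp add: tup_def)
    also have "\<dots> = (\<Sum>p\<in>{p. C p = g}. ln (real p))"
    proof -
      have "0 < real p" if "p \<in> {p. C p = g}" for p
        using conf_prime[OF C g, of p] that prime_gt_0_nat by auto
      then show ?thesis using fin_fibre[OF C g] by (intro ln_prod) auto
    qed
    finally show "(\<Sum>p\<in>{p\<in>A. C p = g}. real (C p i) * ln (real p)) = real (g i) * ln (real (tup C g))"
      unfolding eq by (simp add: sum_distrib_left)
  qed simp
  finally show ?thesis by simp
qed

lemma good_unique:
  assumes "m \<in> good D" "g \<in> T" "h \<in> T" "prime p" "p dvd m g" "p dvd m h"
  shows "g = h"
proof (rule ccontr)
  assume "g \<noteq> h"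
  then have "tprod m = m g * (m h * (\<Prod>x\<in>T - {g} - {h}. m x))"
    unfolding tprod_def using assms(2,3) finT by (simp add: prod.remove[of T g] prod.remove[of "T - {g}" h])
  then have "p * p dvd tprod m" using assms(5,6) by (simp add: mult_dvd_mono)
  with assms(1,4) show False by (auto simp: good_def power2_eq_square)
qed

lemma good_square:
  assumes "m \<in> good D" "g \<in> T" "prime p"
  shows "\<not> p\<^sup>2 dvd m g"
proof
  assume "p\<^sup>2 dvd m g"
  moreover have "m g dvd tprod m" unfolding tprod_def using assms(2) finT by (rule dvd_prodI[rotated])
  ultimately show False using assms(1,3) by (auto simp: good_def dest: dvd_trans)
qed

lemma join_other: "\<not> (prime p \<and> (\<exists>g\<in>T. p dvd m g)) \<Longrightarrow> join w m p = w p"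
  unfolding join_def by (rule if_not_P)

context
  fixes w m b
  assumes w: "w \<in> conf I (\<Omega> - T)" and mt: "m \<in> tuples b" and mg: "m \<in> good (supp_prod w)"
begin

lemma join_iff: "prime p \<Longrightarrow> g \<in> T \<Longrightarrow> join w m p = g \<longleftrightarrow> p dvd m g"
proof -
  assume p: "prime p" "g \<in> T"
  have wT: "w p \<notin> T" using w p(1) by (auto simp: conf_def)
  show ?thesis
  proof (cases "\<exists>h\<in>T. p dvd m h")
    case True
    then obtain h where h: "h \<in> T" "p dvd m h" by blast
    have "(THE g. g \<in> T \<and> p dvd m g) = h"
      using h good_unique[OF mg _ _ p(1)] by (intro the_equality) auto
    then have "join w m p = h" using True p(1) by (simp add: join_def)
    then show ?thesis using h p good_unique[OF mg] by metis
  next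
    case False
    then show ?thesis using p wT by (auto simp: join_def)
  qed
qed

lemma join_in: "prime p \<Longrightarrow> g \<in> T \<Longrightarrow> p dvd m g \<Longrightarrow> join w m p = g"
  using join_iff by blast

lemma join_conf: "join w m \<in> conf I \<Omega>"
  unfolding conf_def
proof (intro CollectI conjI allI impI)
  fix p :: nat assume p: "prime p"
  show "join w m p \<in> \<Omega>"
  proof (cases "\<exists>g\<in>T. p dvd m g")
    case True
    then obtain g where "g \<in> T" "p dvd m g" by blast
    then show ?thesis using join_in[OF p] T_sub by auto
  next
    case False
    then show ?thesis using join_other[of p] w p by (auto simp: conf_def)
  qed
next
  fix p :: nat assume p: "\<not> prime p"
  then show "join w m p = Z" using join_other[of p] w by (auto simp: conf_def)
next
  have "{p. join w m p \<noteq> Z} \<subseteq> {p. w p \<noteq> Z} \<union> (\<Union>g\<in>T. {p. p dvd m g})"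
  proof
    fix p assume p: "p \<in> {p. join w m p \<noteq> Z}"
    show "p \<in> {p. w p \<noteq> Z} \<union> (\<Union>g\<in>T. {p. p dvd m g})"
    proof (cases "prime p \<and> (\<exists>g\<in>T. p dvd m g)")
      case False
      with p show ?thesis using join_other[OF False, of w] by simp
    qed blast
  qed
  moreover have "finite ({p. w p \<noteq> Z} \<union> (\<Union>g\<in>T. {p. p dvd m g}))"
  proof -
    have "finite {p. p dvd m g}" if "g \<in> T" for g
      using mt that by (intro finite_divisors_nat) (auto simp: tuples_def PiE_iff)
    then show ?thesis using conf_fin[OF w] finT by blast
  qed
  ultimately show "finite {p. join w m p \<noteq> Z}" by (rule finite_subset)
qed

lemma rest_join: "rest (join w m) = w"
proof
  fix p
  show "rest (join w m) p = w p"
  proof (cases "prime p \<and> (\<exists>g\<in>T. p dvd m g)")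
    case True
    then obtain g where g: "prime p" "g \<in> T" "p dvd m g" by blast
    have "w p = Z"
    proof (rule ccontr)
      assume "w p \<noteq> Z"
      then have "p dvd supp_prod w" using supp_prod_dvd[OF w g(1)] by simp
      then have "\<not> p dvd tprod m" using mg g(1) by (auto simp: good_def)
      moreover have "m g dvd tprod m" unfolding tprod_def using g(2) finT by (rule dvd_prodI[rotated])
      ultimately show False using g(3) dvd_trans by blast
    qed
    then show ?thesis using join_in[OF g] g(2) by (simp add: rest_def)
  next
    case False
    have "w p \<notin> T"
    proof (cases "prime p")
      case True then show ?thesis using w by (auto simp: conf_def)
    next
      case False
      then have "w p = Z" using w by (auto simp: conf_def)
      then show ?thesis using Z_notin by metis
    qed
    then show ?thesis using join_other[OF False] by (simp add: rest_def)
  qed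
qed

lemma tup_join: "tup (join w m) = m"
proof
  fix g
  have mp: "m \<in> pos_tuples T" using mt by (simp add: tuples_def)
  show "tup (join w m) g = m g"
  proof (cases "g \<in> T")
    case True
    have m0: "m g > 0" using mp True by (auto simp: PiE_iff)
    have "{p. join w m p = g} = prime_factors (m g)"
      using join_iff[OF _ True] conf_prime[OF join_conf True] m0
      by (auto simp: prime_factors_dvd)
    then have "tup (join w m) g = (\<Prod>p\<in>prime_factors (m g). p)" using True by (simp add: tup_def)
    also have "\<dots> = (\<Prod>p\<in>prime_factors (m g). p ^ multiplicity p (m g))"
    proof (rule prod.cong)
      fix p assume p: "p \<in> prime_factors (m g)"
      then have "multiplicity p (m g) \<noteq> 0" by (simp add: prime_factors_multiplicity)
      moreover have "\<not> 2 \<le> multiplicity p (m g)"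
        using good_square[OF mg True, of p] p by (auto dest: multiplicity_dvd')
      ultimately have "multiplicity p (m g) = 1" by linarith
      then show "p = p ^ multiplicity p (m g)" by simp
    qed simp
    also have "\<dots> = m g" using prime_factorization_nat[OF m0] by simp
    finally show ?thesis .
  next
    case False
    then show ?thesis using mp by (simp add: tup_def PiE_iff extensional_def)
  qed
qed

end

definition bounded_conf :: "('i \<Rightarrow> nat) set \<Rightarrow> real \<Rightarrow> (nat \<Rightarrow> 'i \<Rightarrow> nat) set" where
  "bounded_conf \<Omega>' L = {C \<in> conf I \<Omega>'. \<forall>i\<in>I. log_height I C i \<le> L}"

lemma finite_bounded: "\<Omega>' \<subseteq> \<Omega> \<Longrightarrow> finite (bounded_conf \<Omega>' L)"
  unfolding bounded_conf_def using \<Omega>_ext finI by (intro finite_bounded_conf) auto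

lemma lin_ln_tuple_nonneg: "m \<in> pos_tuples T \<Longrightarrow> i \<in> I \<Longrightarrow> lin (\<lambda>g. ln (real (m g))) i \<ge> 0"
  by (rule lin_ln_nonneg) (auto simp: PiE_iff)

text \<open>Heights are additive under the splitting, so a remainder lowers the bound for its tuple
  by its own height. It is itself bounded by \<open>L\<close>, because the tuple contributes a
  nonnegative amount.\<close>

lemma card_bounded_conf:
  "card (bounded_conf \<Omega> L) =
    (\<Sum>w\<in>bounded_conf (\<Omega> - T) L. card (good (supp_prod w) \<inter> tuples (\<lambda>i. L - log_height I w i)))"
proof -
  define X where "X = (\<lambda>w. good (supp_prod w) \<inter> tuples (\<lambda>i. L - log_height I w i))"
  have "bij_betw (\<lambda>C. (rest C, tup C)) (bounded_conf \<Omega> L) (Sigma (bounded_conf (\<Omega> - T) L) X)"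
  proof (rule bij_betw_byWitness[where f' = "\<lambda>(w, m). join w m"])
    show "\<forall>C\<in>bounded_conf \<Omega> L. (case (rest C, tup C) of (w, m) \<Rightarrow> join w m) = C"
    proof
      fix C assume "C \<in> bounded_conf \<Omega> L"
      then have C: "C \<in> conf I \<Omega>" by (simp add: bounded_conf_def)
      have "join (rest C) (tup C) p = C p" for p
      proof (cases "prime p \<and> C p \<in> T")
        case True
        then have "(THE g. g \<in> T \<and> p dvd tup C g) = C p" "\<exists>g\<in>T. p dvd tup C g"
          using dvd_tup[OF C] by (auto intro!: the_equality)
        then show ?thesis using True by (simp add: join_def)
      next
        case False
        have "\<not> (prime p \<and> (\<exists>g\<in>T. p dvd tup C g))" using False dvd_tup[OF C] by metis
        moreover have "C p \<notin> T" using False conf_prime[OF C] by blast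
        ultimately show ?thesis using join_other by (simp add: rest_def)
      qed
      then show "(case (rest C, tup C) of (w, m) \<Rightarrow> join w m) = C" by auto
    qed
    show "\<forall>x\<in>Sigma (bounded_conf (\<Omega> - T) L) X. (rest (case x of (w, m) \<Rightarrow> join w m), tup (case x of (w, m) \<Rightarrow> join w m)) = x"
      using rest_join tup_join by (auto simp: bounded_conf_def X_def)
    show "(\<lambda>C. (rest C, tup C)) ` bounded_conf \<Omega> L \<subseteq> Sigma (bounded_conf (\<Omega> - T) L) X"
    proof (rule image_subsetI)
      fix C assume "C \<in> bounded_conf \<Omega> L"
      then have C: "C \<in> conf I \<Omega>" "\<And>i. i \<in> I \<Longrightarrow> log_height I C i \<le> L" by (auto simp: bounded_conf_def)
      have tp: "tup C \<in> pos_tuples T" using tup_pos[OF C(1)] by (auto simp: PiE_iff) (simp add: tup_def)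
      have "log_height I (rest C) i \<le> L" if "i \<in> I" for i
        using C(2)[OF that] log_height_split[OF C(1), of i] lin_ln_tuple_nonneg[OF tp that] by linarith
      moreover have "tup C \<in> tuples (\<lambda>i. L - log_height I (rest C) i)"
        using tp C(2) log_height_split[OF C(1)] by (force simp: tuples_def)
      ultimately show "(rest C, tup C) \<in> Sigma (bounded_conf (\<Omega> - T) L) X"
        using tup_good[OF C(1)] rest_conf[OF C(1)] by (auto simp: bounded_conf_def X_def)
    qed
    show "(\<lambda>(w, m). join w m) ` Sigma (bounded_conf (\<Omega> - T) L) X \<subseteq> bounded_conf \<Omega> L"
    proof (rule image_subsetI)
      fix x assume "x \<in> Sigma (bounded_conf (\<Omega> - T) L) X"
      then obtain w m where x: "x = (w, m)" and w: "w \<in> conf I (\<Omega> - T)"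
        and m: "m \<in> tuples (\<lambda>i. L - log_height I w i)" "m \<in> good (supp_prod w)"
        by (auto simp: bounded_conf_def X_def)
      have "log_height I (join w m) i \<le> L" if "i \<in> I" for i
        using log_height_split[OF join_conf[OF w m], of i] m(1) that
        unfolding rest_join[OF w m] tup_join[OF w m] by (simp add: tuples_def algebra_simps)
      then show "(case x of (w, m) \<Rightarrow> join w m) \<in> bounded_conf \<Omega> L"
        using join_conf[OF w m] by (simp add: x bounded_conf_def)
    qed
  qed
  then have "card (bounded_conf \<Omega> L) = card (Sigma (bounded_conf (\<Omega> - T) L) X)"
    by (rule bij_betw_same_card)
  also have "\<dots> = (\<Sum>w\<in>bounded_conf (\<Omega> - T) L. card (X w))"
  proof (rule card_SigmaI)
    show "finite (bounded_conf (\<Omega> - T) L)" by (rule finite_bounded) blast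
    show "\<forall>w\<in>bounded_conf (\<Omega> - T) L. finite (X w)" unfolding X_def using finite_tuples by blast
  qed
  finally show ?thesis by (simp add: X_def)
qed

text \<open>After normalisation each remainder contributes a convergent term, dominated by
  \<open>K\<close> times a summable weight, so limit and sum can be exchanged up to any error. The
  trivial remainder alone is the square-free count for \<open>D = 1\<close>, whose limit is
  positive.\<close>

theorem bounded_conf_asymptotics:
  "\<exists>l>0. ((\<lambda>L. real (card (bounded_conf \<Omega> L)) / (exp ((\<Sum>i\<in>I. s i) * L) * L ^ card F)) \<longlongrightarrow> l) at_top"
proof -
  let ?a = "\<lambda>w. exp (- (\<Sum>i\<in>I. s i * log_height I w i))"
  define f where "f = (\<lambda>w L. ?a w * (dens_count (good (supp_prod w)) (\<lambda>i. L - log_height I w i) / L ^ card F))"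
  let ?CW = "conf I (\<Omega> - T)"
  have f0: "f w L \<ge> 0" if "L \<ge> 1" for w L
    using that by (simp add: f_def dens_count_nonneg)
  obtain K where K: "K > 0" "\<And>L b. L \<ge> 1 \<Longrightarrow> (\<forall>i\<in>I. b i \<le> L) \<Longrightarrow> dens_count UNIV b \<le> K * L ^ card F"
    using count_bound by blast
  have f_le: "f w L \<le> ?a w * K" if w: "w \<in> ?CW" and L: "L \<ge> 1" for w L
  proof -
    have "dens_count (good (supp_prod w)) (\<lambda>i. L - log_height I w i) \<le> dens_count UNIV (\<lambda>i. L - log_height I w i)"
      by (rule dens_count_mono) simp
    also have "\<dots> \<le> K * L ^ card F" using log_height_nonneg[OF w] by (intro K L) auto
    finally show ?thesis unfolding f_def using L by (intro mult_left_mono) (auto simp: field_simps)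
  qed
  have f_zero: "f w L = 0" if w: "w \<in> ?CW" "w \<notin> bounded_conf (\<Omega> - T) L" for w L
  proof -
    obtain i where i: "i \<in> I" "log_height I w i > L" using w by (auto simp: bounded_conf_def not_le)
    have "tuples (\<lambda>i. L - log_height I w i) = {}"
    proof (rule ccontr)
      assume "tuples (\<lambda>i. L - log_height I w i) \<noteq> {}"
      then obtain m where m: "m \<in> tuples (\<lambda>i. L - log_height I w i)" by blast
      then have "lin (\<lambda>g. ln (real (m g))) i \<le> L - log_height I w i" using i(1) by (simp add: tuples_def)
      moreover have "lin (\<lambda>g. ln (real (m g))) i \<ge> 0"
        using m i(1) by (intro lin_ln_tuple_nonneg) (auto simp: tuples_def)
      ultimately show False using i(2) by linarith
    qed
    then show ?thesis by (simp add: f_def dens_count_def)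
  qed
  have f_lim: "\<exists>l. ((f w) \<longlongrightarrow> l) at_top" if w: "w \<in> ?CW" for w
  proof -
    obtain l where "((\<lambda>L. dens_count (good (supp_prod w)) (\<lambda>i. L - log_height I w i) / L ^ card F) \<longlongrightarrow> l) at_top"
      using good_tendsto[OF supp_prod_pos[OF w]] by blast
    then show ?thesis unfolding f_def by (intro exI, rule tendsto_mult_left)
  qed
  define N where "N = (\<lambda>L. real (card (bounded_conf \<Omega> L)) / (exp ((\<Sum>i\<in>I. s i) * L) * L ^ card F))"
  have N_eq: "N L = (\<Sum>w\<in>bounded_conf (\<Omega> - T) L. f w L)" for L
  proof -
    have pl: "pairing (\<lambda>i. L) = (\<Sum>i\<in>I. s i) * L" by (simp add: pairing_def sum_distrib_right)
    have "f w L = real (card (good (supp_prod w) \<inter> tuples (\<lambda>i. L - log_height I w i))) / (exp ((\<Sum>i\<in>I. s i) * L) * L ^ card F)" for w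
    proof -
      have "exp (- (\<Sum>i\<in>I. s i * log_height I w i)) * exp (- pairing (\<lambda>i. L - log_height I w i)) = exp (- ((\<Sum>i\<in>I. s i) * L))"
        unfolding exp_add[symmetric] pairing_diff' pl by (simp add: pairing_def)
      then have "f w L = real (card (good (supp_prod w) \<inter> tuples (\<lambda>i. L - log_height I w i))) * exp (- ((\<Sum>i\<in>I. s i) * L)) / L ^ card F"
        by (simp add: f_def dens_count_def mult.left_commute)
      then show ?thesis by (simp add: exp_minus field_simps)
    qed
    then show ?thesis unfolding N_def card_bounded_conf by (simp add: sum_divide_distrib)
  qed
  have bnd: "\<exists>B. \<forall>\<A>. finite \<A> \<longrightarrow> \<A> \<subseteq> ?CW \<longrightarrow> sum ?a \<A> \<le> B"
    using finI s_pos \<Omega>_ext d_pos gap by (intro conf_sum_bounded) auto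
  then obtain B where B: "\<And>\<A>. finite \<A> \<Longrightarrow> \<A> \<subseteq> ?CW \<Longrightarrow> sum ?a \<A> \<le> B" by blast
  have finB: "finite (bounded_conf (\<Omega> - T) L)" for L by (rule finite_bounded) blast
  have "\<exists>l. (N \<longlongrightarrow> l) at_top"
  proof (rule tendsto_at_top_if_approx)
    fix e :: real assume e: "e > 0"
    have eK: "e / (2 * K) > 0" using e K by simp
    obtain \<A>0 where A0: "finite \<A>0" "\<A>0 \<subseteq> ?CW"
      "\<And>\<A>. finite \<A> \<Longrightarrow> \<A> \<subseteq> ?CW - \<A>0 \<Longrightarrow> sum ?a \<A> \<le> e / (2 * K)"
      using bounded_sums_small_tail[of ?CW ?a B, OF _ B eK] by auto
    have "\<forall>w\<in>\<A>0. \<exists>l. ((f w) \<longlongrightarrow> l) at_top" using A0(2) f_lim by blast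
    then obtain l where l: "\<And>w. w \<in> \<A>0 \<Longrightarrow> ((f w) \<longlongrightarrow> l w) at_top" by metis
    have "((\<lambda>L. \<Sum>w\<in>\<A>0. f w L) \<longlongrightarrow> sum l \<A>0) at_top" by (intro tendsto_sum l)
    then have "eventually (\<lambda>L. dist (\<Sum>w\<in>\<A>0. f w L) (sum l \<A>0) < e / 2) at_top"
      using e by (intro tendstoD) auto
    moreover have "eventually (\<lambda>L::real. L \<ge> 1) at_top" by (rule eventually_ge_at_top)
    ultimately have "eventually (\<lambda>L. \<bar>N L - sum l \<A>0\<bar> \<le> e) at_top"
    proof eventually_elim
      case (elim L)
      let ?W = "bounded_conf (\<Omega> - T) L"
      have sub: "?W \<subseteq> ?CW" by (auto simp: bounded_conf_def)
      have "N L = (\<Sum>w\<in>?W \<inter> \<A>0. f w L) + (\<Sum>w\<in>?W - \<A>0. f w L)"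
        unfolding N_eq by (rule sum.Int_Diff[OF finB])
      \<comment> \<open>Remainders of height beyond \<open>L\<close> contribute 0, so the main sum
        runs over a set that does not depend on \<open>L\<close>.\<close>
      also have "(\<Sum>w\<in>?W \<inter> \<A>0. f w L) = (\<Sum>w\<in>\<A>0. f w L)"
        using A0 f_zero by (intro sum.mono_neutral_left) auto
      finally have eq: "N L = (\<Sum>w\<in>\<A>0. f w L) + (\<Sum>w\<in>?W - \<A>0. f w L)" .
      have "(\<Sum>w\<in>?W - \<A>0. f w L) \<le> (\<Sum>w\<in>?W - \<A>0. ?a w * K)"
        using sub elim(2) by (intro sum_mono f_le) auto
      also have "\<dots> = (\<Sum>w\<in>?W - \<A>0. ?a w) * K" by (simp add: sum_distrib_right)
      also have "\<dots> \<le> e / (2 * K) * K"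
        using finB sub K(1) by (intro mult_right_mono A0(3)) auto
      also have "\<dots> = e / 2" using K(1) by simp
      finally have "(\<Sum>w\<in>?W - \<A>0. f w L) \<le> e / 2" .
      moreover have "(\<Sum>w\<in>?W - \<A>0. f w L) \<ge> 0" using f0 elim(2) by (intro sum_nonneg) auto
      ultimately show ?case using elim(1) unfolding eq dist_real_def by linarith
    qed
    then show "\<exists>l. eventually (\<lambda>L. \<bar>N L - l\<bar> \<le> e) at_top" by blast
  qed
  then obtain l where l: "(N \<longlongrightarrow> l) at_top" by blast
  define w0 where "w0 = (\<lambda>p :: nat. Z)"
  have w0: "w0 \<in> ?CW" using zero_in Z_notin by (auto simp: w0_def conf_def)
  have lh0: "log_height I w0 i = 0" for i by (simp add: log_height_def w0_def)
  have D0: "supp_prod w0 = 1" by (simp add: supp_prod_def w0_def)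
  obtain l0 where l0: "((\<lambda>L. dens_count (good 1) (\<lambda>i. L - 0) / L ^ card F) \<longlongrightarrow> l0) at_top"
    using good_tendsto[of 1 "\<lambda>_. 0"] by auto
  then have "l0 > 0" by (intro good_limit_pos) simp
  have fw0: "f w0 L = dens_count (good 1) (\<lambda>i. L - 0) / L ^ card F" for L by (simp add: f_def lh0 D0)
  have "eventually (\<lambda>L. dens_count (good 1) (\<lambda>i. L - 0) / L ^ card F \<le> N L) at_top"
    using eventually_ge_at_top[of 1]
  proof eventually_elim
    case (elim L)
    have "w0 \<in> bounded_conf (\<Omega> - T) L" using w0 elim by (simp add: bounded_conf_def lh0)
    then show ?case unfolding fw0[symmetric] N_eq using f0[OF elim] finB by (intro member_le_sum) auto
  qed
  then have "l0 \<le> l" by (intro tendsto_le[OF _ l l0]) auto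
  with \<open>l0 > 0\<close> l show ?thesis unfolding N_def by (intro exI[of _ l]) auto
qed

end

section \<open>The linear program of a weight system\<close>

lemma lp_M_ext: "lp_M I u \<subseteq> I \<rightarrow>\<^sub>E UNIV"
  by (auto simp: lp_M_def)

lemma lp_M_eqI:
  assumes "s \<in> lp_M I u" "t \<in> lp_M I u" "\<And>i. i \<in> I \<Longrightarrow> s i = t i"
  shows "s = t"
  by (rule PiE_ext[of s I "\<lambda>_. UNIV" t]) (use assms lp_M_ext in blast)+

lemma lp_T_in_M: "g \<in> lp_T I u \<Longrightarrow> g \<in> lp_M I u"
  by (simp add: lp_T_def)

lemma lp_exponent_pos:
  assumes "finite I" "\<And>i. i \<in> I \<Longrightarrow> u i > 0" "i \<in> I"
  shows "lp_exponent I u i > 0"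
proof -
  have "0 \<notin> u ` I" using assms(2) by force
  then have "weight_lcm I u \<noteq> 0" using assms(1) by (simp add: weight_lcm_def Lcm_0_iff)
  moreover have "u i dvd weight_lcm I u" using assms(3) by (auto simp: weight_lcm_def)
  ultimately show ?thesis using assms(2)[OF assms(3)] by (auto simp: lp_exponent_def div_greater_zero_iff dest: dvd_imp_le)
qed

lemma lp_exponent_mult:
  assumes "i \<in> I"
  shows "lp_exponent I u i * u i = weight_lcm I u"
proof -
  have "u i dvd weight_lcm I u" using assms by (auto simp: weight_lcm_def)
  then show ?thesis by (simp add: lp_exponent_def)
qed

lemma zero_in_lp_M: "finite I \<Longrightarrow> I \<noteq> {} \<Longrightarrow> (\<lambda>i\<in>I. 0) \<in> lp_M I u"
  by (auto simp: lp_M_def image_constant_conv)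

text \<open>\<open>n_i\<close> times a unit vector; it satisfies the congruences since
  \<open>n_i\<close> is 0 modulo every \<open>gcd n_i n_j\<close>. It provides the columns on the
  axes and bounds the entries of minimal vectors.\<close>

definition axis_vec :: "nat set \<Rightarrow> (nat \<Rightarrow> nat) \<Rightarrow> nat \<Rightarrow> nat \<Rightarrow> nat" where
  "axis_vec I u i = (\<lambda>j\<in>I. if j = i then lp_exponent I u i else 0)"

lemma axis_vec_in:
  assumes "finite I" "card I \<ge> 2" "\<And>i. i \<in> I \<Longrightarrow> u i > 0" "i \<in> I"
  shows "axis_vec I u i \<in> lp_M I u - {\<lambda>i\<in>I. 0}"
proof -
  have "I \<noteq> {i}" using assms(2) by auto
  then obtain j where j: "j \<in> I" "j \<noteq> i" using assms(4) by blast
  have "axis_vec I u i ` I \<subseteq> {0..}" "0 \<in> axis_vec I u i ` I"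
    using j by (auto simp: axis_vec_def intro!: image_eqI[of _ _ j])
  then have "Min (axis_vec I u i ` I) = 0" using assms(1) by (intro Min_eqI) auto
  moreover have "[axis_vec I u i k = axis_vec I u i l] (mod gcd (lp_exponent I u k) (lp_exponent I u l))"
    if "k \<in> I" "l \<in> I" for k l
    using that by (auto simp: axis_vec_def cong_def mod_eq_0_iff_dvd)
  ultimately have "axis_vec I u i \<in> lp_M I u" by (auto simp: lp_M_def axis_vec_def)
  moreover have "axis_vec I u i i \<noteq> 0"
    using lp_exponent_pos[OF assms(1,3,4)] assms(4) by (simp add: axis_vec_def)
  ultimately show ?thesis using assms(4) by auto
qed

text \<open>Descent on the coordinate sum.\<close>

lemma lp_T_below:
  assumes "finite I" "t \<in> lp_M I u - {\<lambda>i\<in>I. 0}"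
  shows "\<exists>g\<in>lp_T I u. \<forall>i\<in>I. g i \<le> t i"
  using assms(2)
proof (induction "\<Sum>i\<in>I. t i" arbitrary: t rule: less_induct)
  case less
  show ?case
  proof (cases "t \<in> lp_T I u")
    case False
    then obtain s where s: "s \<in> lp_M I u - {\<lambda>i\<in>I. 0}" "\<forall>i\<in>I. s i \<le> t i" "s \<noteq> t"
      using less.prems by (auto simp: lp_T_def)
    have "\<exists>i\<in>I. s i \<noteq> t i"
    proof (rule ccontr)
      assume "\<not> (\<exists>i\<in>I. s i \<noteq> t i)"
      then have "s = t" using s(1) less.prems by (intro lp_M_eqI[of s I u t]) auto
      with s(3) show False by simp
    qed
    then have "\<exists>i\<in>I. s i < t i" using s(2) by (meson le_neq_implies_less)
    then have "(\<Sum>i\<in>I. s i) < (\<Sum>i\<in>I. t i)"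
      using s(2) assms(1) by (intro sum_strict_mono_ex1) auto
    from less.hyps[OF this s(1)] obtain g where "g \<in> lp_T I u" "\<forall>i\<in>I. g i \<le> s i" by blast
    then show ?thesis using s(2) by (meson order_trans)
  qed blast
qed

text \<open>A minimal vector exceeding \<open>n_i\<close> at \<open>i\<close> would lie strictly
  above an axis vector.\<close>

lemma lp_T_le_exponent:
  assumes "finite I" "card I \<ge> 2" "\<And>i. i \<in> I \<Longrightarrow> u i > 0" "i \<in> I" "g \<in> lp_T I u"
  shows "g i \<le> lp_exponent I u i"
proof (rule ccontr)
  assume a: "\<not> g i \<le> lp_exponent I u i"
  then have "\<forall>j\<in>I. axis_vec I u i j \<le> g j" by (auto simp: axis_vec_def)
  then have "axis_vec I u i = g" using axis_vec_in[OF assms(1-4)] assms(5) by (auto simp: lp_T_def)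
  then have "g i = lp_exponent I u i" using assms(4) by (auto simp: axis_vec_def)
  with a show False by simp
qed

lemma lp_T_nonzero:
  assumes "g \<in> lp_T I u"
  shows "\<exists>i\<in>I. g i > 0"
proof (rule ccontr)
  assume a: "\<not> (\<exists>i\<in>I. g i > 0)"
  have "g \<in> I \<rightarrow>\<^sub>E UNIV" using lp_T_in_M[OF assms] lp_M_ext by blast
  then have "g = (\<lambda>i\<in>I. 0)" using a
    by (intro PiE_ext[of g I "\<lambda>_. UNIV" "\<lambda>i\<in>I. 0"]) auto
  with assms show False by (simp add: lp_T_def)
qed

lemma packing_lp_weights:
  assumes "finite I" "card I \<ge> 2" "\<And>i. i \<in> I \<Longrightarrow> u i > 0"
  shows "packing_lp I (lp_T I u) (\<lambda>g i. real (g i))"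
proof
  show "finite I" by fact
  have "lp_T I u \<subseteq> (\<Pi>\<^sub>E i\<in>I. {..lp_exponent I u i})"
  proof
    fix g assume g: "g \<in> lp_T I u"
    have "g \<in> I \<rightarrow>\<^sub>E UNIV" using lp_T_in_M[OF g] lp_M_ext by blast
    then show "g \<in> (\<Pi>\<^sub>E i\<in>I. {..lp_exponent I u i})"
      using lp_T_le_exponent[OF assms _ g] by (simp add: PiE_iff)
  qed
  then show "finite (lp_T I u)"
    by (rule finite_subset) (use assms(1) in \<open>intro finite_PiE; auto\<close>)
  show "I \<noteq> {}" using assms(2) by auto
  show "0 \<le> real (g i)" for g :: "nat \<Rightarrow> nat" and i by simp
  show "\<exists>i\<in>I. 0 < real (g i)" if "g \<in> lp_T I u" for g using lp_T_nonzero[OF that] by simp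
  show "\<exists>g\<in>lp_T I u. 0 < real (g i) \<and> (\<forall>j\<in>I - {i}. real (g j) = 0)" if i: "i \<in> I" for i
  proof -
    \<comment> \<open>A minimal vector below the axis vector is again concentrated at
      \<open>i\<close>.\<close>
    have "axis_vec I u i \<in> lp_M I u - {\<lambda>i\<in>I. 0}" using assms i by (intro axis_vec_in)
    then obtain g where g: "g \<in> lp_T I u" "\<forall>j\<in>I. g j \<le> axis_vec I u i j"
      using lp_T_below[OF assms(1)] by blast
    have "g j = 0" if "j \<in> I - {i}" for j
    proof -
      have "g j \<le> axis_vec I u i j" using g(2) that by blast
      then show ?thesis using that by (simp add: axis_vec_def)
    qed
    note off = this
    obtain k where "k \<in> I" "g k > 0" using lp_T_nonzero[OF g(1)] by blast
    then have "g i > 0" using off[of k] by (cases "k = i") auto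
    then show ?thesis using g(1) off by auto
  qed
qed

lemma packing_lp_eqs:
  assumes "packing_lp I (lp_T I u) (\<lambda>g i. real (g i))"
  shows "packing_lp.feasible I (lp_T I u) (\<lambda>g i. real (g i)) = lp_feasible I u"
    "packing_lp.value_lp I (lp_T I u) (\<lambda>g i. real (g i)) = lp_value I u"
    "packing_lp.face I (lp_T I u) (\<lambda>g i. real (g i)) = lp_optimal_face I u"
proof -
  interpret packing_lp I "lp_T I u" "\<lambda>g i. real (g i)" by fact
  show 1: "feasible = lp_feasible I u" by (simp add: feasible_def lp_feasible_def)
  show 2: "value_lp = lp_value I u" by (simp add: value_lp_def lp_value_def lp_objective_def 1)
  show "face = lp_optimal_face I u" by (simp add: face_def lp_optimal_face_def lp_objective_def 1 2)
qed

text \<open>Every column has coordinate sum at least 1, so the objective is at most the sum of the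
  left sides of all \<open>card I\<close> constraints.\<close>

lemma lp_value_bounds:
  assumes "finite I" "card I \<ge> 2" "\<And>i. i \<in> I \<Longrightarrow> u i > 0"
  shows "0 < lp_value I u" "lp_value I u \<le> real (card I)"
proof -
  note lp = packing_lp_weights[OF assms]
  interpret packing_lp I "lp_T I u" "\<lambda>g i. real (g i)" by (rule lp)
  show "0 < lp_value I u" using value_pos by (simp add: packing_lp_eqs[OF lp])
  have "value_lp \<le> real (card I)"
  proof (rule value_le)
    fix c assume c: "c \<in> feasible"
    have "(\<Sum>g\<in>lp_T I u. c g) \<le> (\<Sum>g\<in>lp_T I u. c g * (\<Sum>i\<in>I. real (g i)))"
    proof (rule sum_mono)
      fix g assume g: "g \<in> lp_T I u"
      obtain i where i: "i \<in> I" "g i > 0" using lp_T_nonzero[OF g] by blast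
      have "1 \<le> real (g i)" using i by simp
      also have "\<dots> \<le> (\<Sum>i\<in>I. real (g i))" using i assms(1) by (intro member_le_sum) auto
      finally have "c g * 1 \<le> c g * (\<Sum>i\<in>I. real (g i))"
        using c g by (intro mult_left_mono) (auto simp: feasible_def)
      then show "c g \<le> c g * (\<Sum>i\<in>I. real (g i))" by simp
    qed
    also have "\<dots> = (\<Sum>i\<in>I. \<Sum>g\<in>lp_T I u. c g * real (g i))"
      unfolding sum_distrib_left by (rule sum.swap)
    also have "\<dots> \<le> (\<Sum>i\<in>I. 1)" using c by (intro sum_mono) (auto simp: feasible_def)
    finally show "(\<Sum>g\<in>lp_T I u. c g) \<le> real (card I)" by simp
  qed
  then show "lp_value I u \<le> real (card I)" by (simp add: packing_lp_eqs[OF lp])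
qed

definition height_count :: "nat set \<Rightarrow> (nat \<Rightarrow> nat) \<Rightarrow> real \<Rightarrow> nat" where
  "height_count I u L = card {C \<in> conf I (lp_M I u). \<forall>i\<in>I. log_height I C i \<le> L}"

theorem height_count_asymptotics:
  assumes "finite I" "card I \<ge> 2" "\<And>i. i \<in> I \<Longrightarrow> u i > 0"
  shows "\<exists>l>0. ((\<lambda>L. real (height_count I u L) / (exp (lp_value I u * L) * L ^ lp_beta I u)) \<longlongrightarrow> l) at_top"
proof -
  note lp = packing_lp_weights[OF assms]
  interpret packing_lp I "lp_T I u" "\<lambda>g i. real (g i)" by (rule lp)
  obtain s where s: "\<And>i. i \<in> I \<Longrightarrow> s i > 0" "(\<Sum>i\<in>I. s i) = value_lp"
    "\<And>g. g \<in> supp_face \<Longrightarrow> (\<Sum>i\<in>I. s i * real (g i)) = 1"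
    "\<And>g. g \<in> lp_T I u - supp_face \<Longrightarrow> (\<Sum>i\<in>I. s i * real (g i)) > 1"
    by (rule strictly_complementary_dual) (rule that, assumption+)
  obtain c where c: "c \<in> face" "\<And>g. g \<in> supp_face \<Longrightarrow> c g > 0" using interior_face_point by blast
  obtain P lam E where P: "P \<subseteq> supp_face"
    and ind: "\<And>\<kappa>. (\<And>i. i \<in> I \<Longrightarrow> (\<Sum>p\<in>P. \<kappa> p * real (p i)) = 0) \<Longrightarrow> (\<forall>p\<in>P. \<kappa> p = 0)"
    and lam: "\<And>f i. f \<in> supp_face - P \<Longrightarrow> i \<in> I \<Longrightarrow> real (f i) = (\<Sum>p\<in>P. lam f p * real (p i))"
    and E: "\<And>p p'. p \<in> P \<Longrightarrow> p' \<in> P \<Longrightarrow> (\<Sum>i\<in>I. E p i * real (p' i)) = (if p = p' then 1 else 0)"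
    by (rule rank_factorisation[OF finI finite_supp_face, of "\<lambda>g i. real (g i)"])
       (rule that; (assumption | blast))
  define F where "F = supp_face - P"
  have FP: "F \<union> P = supp_face" using P by (auto simp: F_def)
  have beta: "lp_beta I u = card F"
    using face_dim[OF P ind lam] by (simp add: lp_beta_def packing_lp_eqs[OF lp] F_def)
  define smin where "smin = Min (s ` I)"
  have smin: "smin > 0" "\<And>i. i \<in> I \<Longrightarrow> smin \<le> s i"
    using s(1) finI I_ne by (auto simp: smin_def)
  \<comment> \<open>\<open>insert 1\<close> covers the case that all minimal vectors belong to the
    optimal face.\<close>
  define gmin where "gmin = Min (insert 1 ((\<lambda>g. (\<Sum>i\<in>I. s i * real (g i)) - 1) ` (lp_T I u - supp_face)))"
  have gmin: "gmin > 0" "\<And>g. g \<in> lp_T I u - supp_face \<Longrightarrow> 1 + gmin \<le> (\<Sum>i\<in>I. s i * real (g i))"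
  proof -
    have fin: "finite (insert 1 ((\<lambda>g. (\<Sum>i\<in>I. s i * real (g i)) - 1) ` (lp_T I u - supp_face)))"
      using finT by simp
    show "gmin > 0" unfolding gmin_def using fin s(4) by (subst Min_gr_iff) auto
    show "1 + gmin \<le> (\<Sum>i\<in>I. s i * real (g i))" if g: "g \<in> lp_T I u - supp_face" for g
    proof -
      have "gmin \<le> (\<Sum>i\<in>I. s i * real (g i)) - 1"
        unfolding gmin_def by (rule Min_le[OF fin]) (use g in blast)
      then show ?thesis by simp
    qed
  qed
  \<comment> \<open>A nonzero vector off the support of the face is either minimal, with margin
    \<open>gmin\<close>, or exceeds a minimal vector by at least 1 in some coordinate, with margin
    \<open>smin\<close>.\<close>
  define d where "d = min smin gmin"
  interpret LC: local_counting I P F s c lam E "lp_M I u" d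
  proof unfold_locales
    show "finite I" "I \<noteq> {}" by (fact finI, fact I_ne)
    show "finite P" using P finite_supp_face by (rule finite_subset)
    show "finite F" using finite_supp_face by (simp add: F_def)
    show "F \<inter> P = {}" by (auto simp: F_def)
    show "0 < s i" if "i \<in> I" for i using s(1) that .
    show "(\<Sum>i\<in>I. s i * real (g i)) = 1" if "g \<in> F \<union> P" for g using s(3) that FP by simp
    show "0 < c g" if "g \<in> F \<union> P" for g using c(2) that FP by simp
    show "(\<Sum>g\<in>F \<union> P. c g * real (g i)) = 1" if "i \<in> I" for i
      using face_tight[OF c(1) that] FP by simp
    show "real (f i) = (\<Sum>p\<in>P. lam f p * real (p i))" if "f \<in> F" "i \<in> I" for f i
      using lam that by (simp add: F_def)
    show "(\<Sum>i\<in>I. E p i * real (p' i)) = (if p = p' then 1 else 0)" if "p \<in> P" "p' \<in> P" for p p'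
      using E that .
    show "lp_M I u \<subseteq> I \<rightarrow>\<^sub>E UNIV" by (rule lp_M_ext)
    show "F \<union> P \<subseteq> lp_M I u" unfolding FP using supp_face_subset by (auto simp: lp_T_def)
    show "(\<lambda>i\<in>I. 0) \<in> lp_M I u" using finI I_ne by (rule zero_in_lp_M)
    show "0 < d" using smin gmin by (simp add: d_def)
    show "1 + d \<le> (\<Sum>i\<in>I. s i * real (t i))" if t: "t \<in> lp_M I u - (F \<union> P)" "t \<noteq> (\<lambda>i\<in>I. 0)" for t
    proof (cases "t \<in> lp_T I u")
      case True
      then show ?thesis using gmin(2)[of t] t FP by (simp add: d_def)
    next
      case False
      obtain g where g: "g \<in> lp_T I u" "\<forall>i\<in>I. g i \<le> t i" using lp_T_below[OF finI, of t u] t by blast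
      have g1: "(\<Sum>i\<in>I. s i * real (g i)) \<ge> 1"
        using s(3,4) g(1) by (cases "g \<in> supp_face") (auto intro: less_imp_le)
      have "\<exists>i\<in>I. g i \<noteq> t i"
      proof (rule ccontr)
        assume "\<not> (\<exists>i\<in>I. g i \<noteq> t i)"
        then have "g = t" using lp_T_in_M[OF g(1)] t by (intro lp_M_eqI[of g I u t]) auto
        with g(1) False show False by simp
      qed
      then obtain k where k: "k \<in> I" "g k < t k" using g(2) by (meson le_neq_implies_less)
      have "smin * 1 \<le> s k * (real (t k) - real (g k))"
        using k smin s(1)[OF k(1)] by (intro mult_mono) auto
      also have "\<dots> \<le> (\<Sum>i\<in>I. s i * (real (t i) - real (g i)))"
        using k(1) g(2) s(1) finI by (intro member_le_sum mult_nonneg_nonneg) (auto intro: less_imp_le)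
      also have "\<dots> = (\<Sum>i\<in>I. s i * real (t i)) - (\<Sum>i\<in>I. s i * real (g i))"
        by (simp add: right_diff_distrib sum_subtractf)
      finally show ?thesis using g1 by (simp add: d_def)
    qed
  qed simp
  have sum_s: "(\<Sum>i\<in>I. s i) = lp_value I u" using s(2) by (simp add: packing_lp_eqs[OF lp])
  from LC.bounded_conf_asymptotics show ?thesis
    unfolding height_count_def LC.bounded_conf_def beta sum_s .
qed

section \<open>Dividing the weights by their common divisor\<close>

lemma weight_lcm_reduced:
  assumes "S \<noteq> {}" "weight_gcd S q > 0"
  shows "weight_gcd S q * weight_lcm S (stratum_reduced q S) = weight_lcm S q"
proof -
  have "q ` S = (*) (weight_gcd S q) ` (stratum_reduced q S ` S)"
    unfolding image_image
  proof (rule image_cong)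
    fix i assume "i \<in> S"
    then have "weight_gcd S q dvd q i" by (auto simp: weight_gcd_def)
    then show "q i = weight_gcd S q * stratum_reduced q S i" by (simp add: stratum_reduced_def)
  qed simp
  then show ?thesis using assms(1) unfolding weight_lcm_def by (simp add: Lcm_mult)
qed

lemma stratum_reduced_mult: "i \<in> S \<Longrightarrow> weight_gcd S q * stratum_reduced q S i = q i"
proof -
  assume "i \<in> S"
  then have "weight_gcd S q dvd q i" by (auto simp: weight_gcd_def)
  then show ?thesis by (simp add: stratum_reduced_def)
qed

lemma weight_gcd_pos: "S \<noteq> {} \<Longrightarrow> (\<And>i. i \<in> S \<Longrightarrow> q i > 0) \<Longrightarrow> weight_gcd S q > 0"
  by (force simp: weight_gcd_def Gcd_0_iff)

text \<open>The lcm is divided by the same number as the weights, so the exponents stay the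
  same.\<close>

lemma lp_M_reduced:
  assumes "S \<noteq> {}" "\<And>i. i \<in> S \<Longrightarrow> q i > 0"
  shows "lp_M S (stratum_reduced q S) = lp_M S q"
proof -
  have d: "weight_gcd S q > 0" using assms by (rule weight_gcd_pos)
  have "lp_exponent S (stratum_reduced q S) i = lp_exponent S q i" if "i \<in> S" for i
    using d stratum_reduced_mult[OF that, of q] weight_lcm_reduced[OF assms(1) d]
    unfolding lp_exponent_def by (metis nonzero_mult_div_cancel_left div_mult_mult1 less_irrefl)
  then show ?thesis unfolding lp_M_def by (intro Collect_cong) auto
qed

lemma lp_reduced:
  assumes "S \<noteq> {}" "\<And>i. i \<in> S \<Longrightarrow> q i > 0"
  shows "lp_value S (stratum_reduced q S) = lp_value S q"
    "lp_beta S (stratum_reduced q S) = lp_beta S q"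
    "height_count S (stratum_reduced q S) = height_count S q"
  using lp_M_reduced[OF assms]
  by (simp_all add: lp_value_def lp_beta_def lp_optimal_face_def lp_feasible_def lp_objective_def
      lp_T_def height_count_def fun_eq_iff)

section \<open>Valuations of rational numbers\<close>

definition vp :: "nat \<Rightarrow> rat \<Rightarrow> int" where
  "vp p x = int (multiplicity (int p) (fst (quotient_of x))) - int (multiplicity (int p) (snd (quotient_of x)))"

lemma padic_abs_vp: "x \<noteq> 0 \<Longrightarrow> padic_abs p x = real p powr (- real_of_int (vp p x))"
  by (simp add: padic_abs_def vp_def)

lemma vp_fraction:
  assumes "prime p" "a \<noteq> 0" "b \<noteq> 0"
  shows "vp p (of_int a / of_int b) = int (multiplicity (int p) a) - int (multiplicity (int p) b)"
proof -
  let ?x = "of_int a / of_int b :: rat"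
  obtain a' b' where q: "quotient_of ?x = (a', b')" by (cases "quotient_of ?x")
  have b': "b' > 0" using quotient_of_denom_pos[OF q] .
  have eq: "?x = of_int a' / of_int b'" using quotient_of_div[OF q] .
  then have "(of_int (a * b') :: rat) = of_int (a' * b)"
    using assms b' by (simp add: field_simps)
  then have ab: "a * b' = a' * b" by (simp only: of_int_eq_iff)
  have a': "a' \<noteq> 0" using ab assms b' by auto
  have pe: "prime_elem (int p)" using assms(1) by simp
  have "multiplicity (int p) a + multiplicity (int p) b' = multiplicity (int p) a' + multiplicity (int p) b"
    using arg_cong[OF ab, of "multiplicity (int p)"] assms a' b' pe
    by (simp add: prime_elem_multiplicity_mult_distrib)
  then show ?thesis by (simp add: vp_def q)
qed

lemma rat_fraction:
  fixes x :: rat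
  assumes "x \<noteq> 0"
  shows "\<exists>a b. x = of_int a / of_int b \<and> b \<noteq> 0 \<and> a \<noteq> 0"
proof -
  obtain a b where q: "quotient_of x = (a, b)" by (cases "quotient_of x")
  show ?thesis
    using quotient_of_denom_pos[OF q] quotient_of_div[OF q] assms by (intro exI[of _ a] exI[of _ b]) auto
qed

lemma vp_mult:
  assumes "prime p" "x \<noteq> 0" "y \<noteq> 0"
  shows "vp p (x * y) = vp p x + vp p y"
proof -
  obtain a b where x: "x = of_int a / of_int b" "b \<noteq> 0" "a \<noteq> 0" using rat_fraction[of x] assms by blast
  obtain c e where y: "y = of_int c / of_int e" "e \<noteq> 0" "c \<noteq> 0" using rat_fraction[of y] assms by blast
  have eq: "x * y = of_int (a * c) / of_int (b * e)" by (simp add: x y)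
  have pe: "prime_elem (int p)" using assms(1) by simp
  have "vp p (x * y) = int (multiplicity (int p) (a * c)) - int (multiplicity (int p) (b * e))"
    unfolding eq using x y assms by (intro vp_fraction) auto
  also have "\<dots> = vp p x + vp p y"
    using x y assms pe by (simp add: vp_fraction prime_elem_multiplicity_mult_distrib)
  finally show ?thesis .
qed

lemma vp_one: "prime p \<Longrightarrow> vp p 1 = 0"
  using vp_fraction[of p 1 1] by simp

lemma vp_power: "prime p \<Longrightarrow> x \<noteq> 0 \<Longrightarrow> vp p (x ^ k) = int k * vp p x"
  by (induction k) (simp_all add: vp_one vp_mult algebra_simps)

lemma vp_inverse: "prime p \<Longrightarrow> x \<noteq> 0 \<Longrightarrow> vp p (inverse x) = - vp p x"
  using vp_mult[of p x "inverse x"] by (simp add: vp_one)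

lemma vp_powi: "prime p \<Longrightarrow> x \<noteq> 0 \<Longrightarrow> vp p (x powi k) = k * vp p x"
  by (simp add: power_int_def vp_power vp_inverse power_inverse)

lemma vp_minus: "prime p \<Longrightarrow> vp p (- x) = vp p x"
proof (cases "x = 0")
  case False
  assume p: "prime p"
  have "vp p (- 1) = 0" using vp_fraction[of p "- 1" 1] p by (simp add: multiplicity_unit_right)
  then show ?thesis using vp_mult[of p "- 1" x] p False by simp
qed simp

lemma vp_abs: "prime p \<Longrightarrow> vp p \<bar>x\<bar> = vp p x"
  by (simp add: abs_if vp_minus)

lemma vp_prime: "prime p \<Longrightarrow> prime q \<Longrightarrow> vp p (of_nat q) = (if p = q then 1 else 0)"
proof -
  assume pq: "prime p" "prime q"
  have "vp p (of_nat q) = int (multiplicity (int p) (int q)) - int (multiplicity (int p) 1)"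
    using vp_fraction[of p "int q" 1] pq by (simp add: prime_gt_0_nat)
  also have "\<dots> = (if p = q then 1 else 0)"
  proof (cases "p = q")
    case True
    have "multiplicity (int q) (int q) = 1"
      using pq(2) prime_gt_1_nat[OF pq(2)] by (intro multiplicity_self) auto
    then show ?thesis using True by simp
  next
    case False
    then have "multiplicity (int p) (int q) = 0" using pq by (intro prime_multiplicity_other) auto
    then show ?thesis using False by simp
  qed
  finally show ?thesis .
qed

definition rat_of_val :: "nat set \<Rightarrow> (nat \<Rightarrow> int) \<Rightarrow> rat" where
  "rat_of_val A f = (\<Prod>p\<in>A. of_nat p powi f p)"

lemma rat_of_val_pos:
  assumes "\<And>p. p \<in> A \<Longrightarrow> prime p"
  shows "rat_of_val A f > 0"
  unfolding rat_of_val_def using assms prime_gt_0_nat by (intro prod_pos) (simp add: zero_less_power_int)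

lemma vp_rat_of_val:
  assumes "finite A" "\<And>p. p \<in> A \<Longrightarrow> prime p" "prime q"
  shows "vp q (rat_of_val A f) = (if q \<in> A then f q else 0)"
  using assms(1,2)
proof (induction A rule: finite_induct)
  case empty
  then show ?case using assms(3) by (simp add: rat_of_val_def vp_one)
next
  case (insert p A)
  have "rat_of_val (insert p A) f = of_nat p powi f p * rat_of_val A f"
    using insert.hyps by (simp add: rat_of_val_def)
  moreover have "of_nat p \<noteq> (0 :: rat)" using insert.prems prime_gt_0_nat[of p] by simp
  moreover have "rat_of_val A f \<noteq> 0" using rat_of_val_pos[of A f] insert.prems by simp
  ultimately show ?case using insert assms(3)
    by (auto simp: vp_mult vp_powi vp_prime)
qed

text \<open>Numerator and denominator have equal multiplicities at every prime, so unique
  factorisation makes them associated.\<close>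

lemma abs_eq_one_if_vp_zero:
  assumes "x \<noteq> 0" "\<And>p. prime p \<Longrightarrow> vp p x = 0"
  shows "\<bar>x\<bar> = 1"
proof -
  obtain a b where q: "quotient_of x = (a, b)" by (cases "quotient_of x")
  have b: "b > 0" using quotient_of_denom_pos[OF q] .
  have x: "x = of_int a / of_int b" using quotient_of_div[OF q] .
  have a: "a \<noteq> 0" using assms(1) x by auto
  have "normalize a = normalize b"
  proof (rule multiplicity_eq_imp_eq)
    fix p :: int assume p: "prime p"
    then have "prime (nat p)" "int (nat p) = p" using prime_ge_0_int by auto
    with assms(2)[of "nat p"] show "multiplicity p a = multiplicity p b"
      by (simp add: vp_def q)
  qed (use a b in auto)
  then have "\<bar>a\<bar> = b" using b by simp
  then have "\<bar>of_int a :: rat\<bar> = of_int b" by (metis of_int_abs)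
  then show ?thesis using b by (simp add: x abs_divide)
qed

lemma abs_eq_if_vp_eq:
  assumes "x \<noteq> 0" "y \<noteq> 0" "\<And>p. prime p \<Longrightarrow> vp p x = vp p y"
  shows "\<bar>x\<bar> = \<bar>y\<bar>"
proof -
  have "\<bar>x * inverse y\<bar> = 1"
    using assms by (intro abs_eq_one_if_vp_zero) (auto simp: vp_mult vp_inverse)
  then show ?thesis using assms by (simp add: abs_mult field_simps)
qed

lemma finite_vp_support: "x \<noteq> 0 \<Longrightarrow> finite {p. prime p \<and> vp p x \<noteq> 0}"
proof -
  assume x: "x \<noteq> 0"
  obtain a b where ab: "x = of_int a / of_int b" "b \<noteq> 0" "a \<noteq> 0" using rat_fraction[of x] x by blast
  have "{p. prime p \<and> vp p x \<noteq> 0} \<subseteq> {p. int p dvd a} \<union> {p. int p dvd b}"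
  proof
    fix p assume "p \<in> {p. prime p \<and> vp p x \<noteq> 0}"
    then have "multiplicity (int p) a \<noteq> 0 \<or> multiplicity (int p) b \<noteq> 0"
      using ab by (auto simp: vp_fraction)
    then have "int p dvd a \<or> int p dvd b"
      using not_dvd_imp_multiplicity_0[of "int p" a] not_dvd_imp_multiplicity_0[of "int p" b] by argo
    then show "p \<in> {p. int p dvd a} \<union> {p. int p dvd b}" by simp
  qed
  moreover have "finite {p. int p dvd c}" if "c \<noteq> 0" for c :: int
  proof -
    have "{p. int p dvd c} = {p. p dvd nat \<bar>c\<bar>}" by (auto simp: nat_dvd_iff)
    moreover have "finite {p. p dvd nat \<bar>c\<bar>}" using that by (intro finite_divisors_nat) auto
    ultimately show ?thesis by simp
  qed
  ultimately show ?thesis using ab by (meson finite_UnI finite_subset)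
qed

text \<open>The product formula in logarithmic form: it trades the real place for the finite
  ones.\<close>

lemma ln_abs_vp:
  assumes "x \<noteq> 0" "finite A" "\<And>p. p \<in> A \<Longrightarrow> prime p" "\<And>p. prime p \<Longrightarrow> vp p x \<noteq> 0 \<Longrightarrow> p \<in> A"
  shows "ln \<bar>real_of_rat x\<bar> = (\<Sum>p\<in>A. real_of_int (vp p x) * ln (real p))"
proof -
  define y where "y = rat_of_val A (\<lambda>p. vp p x)"
  have y: "y > 0" unfolding y_def using assms(3) by (rule rat_of_val_pos)
  have "\<bar>x\<bar> = \<bar>y\<bar>"
    using assms y by (intro abs_eq_if_vp_eq) (auto simp: y_def vp_rat_of_val)
  then have "\<bar>real_of_rat x\<bar> = real_of_rat y" proof -
    assume "\<bar>x\<bar> = \<bar>y\<bar>"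
    then have "x = y \<or> x = - y" by (simp add: abs_eq_iff)
    then show ?thesis using y by (auto simp: of_rat_minus)
  qed
  also have "\<dots> = (\<Prod>p\<in>A. real p powi vp p x)"
    unfolding y_def rat_of_val_def of_rat_prod
    by (rule prod.cong) (simp_all add: power_int_def of_rat_power of_rat_inverse)
  finally have "ln \<bar>real_of_rat x\<bar> = ln (\<Prod>p\<in>A. real p powi vp p x)" by simp
  also have "\<dots> = (\<Sum>p\<in>A. ln (real p powi vp p x))"
  proof -
    have "p > 0" if "p \<in> A" for p
      using prime_gt_0_nat[OF assms(3)[OF that]] .
    then show ?thesis using assms(2) by (intro ln_prod) auto
  qed
  also have "\<dots> = (\<Sum>p\<in>A. real_of_int (vp p x) * ln (real p))"
  proof (rule sum.cong)
    fix p assume "p \<in> A"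
    then have "real p > 0" using prime_gt_0_nat[OF assms(3)] by simp
    then show "ln (real p powi vp p x) = real_of_int (vp p x) * ln (real p)"
      by (simp add: power_int_def ln_realpow ln_inverse)
  qed simp
  finally show ?thesis .
qed

section \<open>Simultaneous congruences\<close>

text \<open>\<open>gcd\<close> distributes over \<open>lcm\<close>. Compatibility with each earlier
  modulus thus implies compatibility with their lcm.\<close>

lemma dvd_gcd_Lcm:
  fixes n :: "'a \<Rightarrow> nat"
  assumes "finite S" "\<And>i. i \<in> S \<Longrightarrow> gcd k (n i) dvd x"
  shows "gcd k (Lcm (n ` S)) dvd x"
  using assms
proof (induction S rule: finite_induct)
  case (insert i S)
  have "gcd k (Lcm (n ` insert i S)) = lcm (gcd k (n i)) (gcd k (Lcm (n ` S)))"
    by (simp add: gcd_lcm_distrib)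
  then show ?case using insert by (simp add: lcm_least)
qed simp

lemma linear_cong_solvable:
  fixes a b c :: int
  assumes "gcd a b dvd c"
  shows "\<exists>y. a dvd c + b * y"
proof -
  obtain u v where uv: "u * a + v * b = gcd a b" using bezout_int by blast
  obtain k where k: "c = gcd a b * k" using assms by blast
  have "c + b * (- v * k) = a * (u * k)" unfolding k uv[symmetric] by (simp add: algebra_simps)
  then show ?thesis by (metis dvd_triv_left)
qed

text \<open>The Chinese remainder theorem for moduli that need not be coprime, adding one modulus at
  a time; a new congruence is solved within the solutions of the earlier ones, which are translates
  by their lcm.\<close>

lemma simultaneous_cong:
  fixes n t :: "'a \<Rightarrow> nat"
  assumes "finite S" "\<And>i. i \<in> S \<Longrightarrow> n i > 0"
    and "\<And>i j. i \<in> S \<Longrightarrow> j \<in> S \<Longrightarrow> [t i = t j] (mod gcd (n i) (n j))"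
  shows "\<exists>m. \<forall>i\<in>S. n i dvd t i + m"
proof -
  have "\<exists>x::int. \<forall>i\<in>S. int (n i) dvd int (t i) + x"
    using assms
  proof (induction S rule: finite_induct)
    case (insert k S)
    have "\<exists>x::int. \<forall>i\<in>S. int (n i) dvd int (t i) + x"
      by (rule insert.IH) (use insert.prems in auto)
    then obtain x where x: "\<And>i. i \<in> S \<Longrightarrow> int (n i) dvd int (t i) + x" by blast
    define L where "L = Lcm (n ` S)"
    have "gcd (n k) L dvd nat \<bar>int (t k) + x\<bar>"
      unfolding L_def
    proof (rule dvd_gcd_Lcm[OF insert.hyps(1)])
      fix i assume i: "i \<in> S"
      have "int (gcd (n k) (n i)) dvd int (t k) - int (t i)"
        using insert.prems(2)[of k i] i by (simp add: cong_int_iff[symmetric] cong_iff_dvd_diff)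
      moreover have "int (gcd (n k) (n i)) dvd int (t i) + x"
        using x[OF i] by (meson dvd_trans gcd_dvd2 of_nat_dvd_iff)
      ultimately have "int (gcd (n k) (n i)) dvd (int (t k) - int (t i)) + (int (t i) + x)" by (rule dvd_add)
      then have "int (gcd (n k) (n i)) dvd int (nat \<bar>int (t k) + x\<bar>)" by simp
      then show "gcd (n k) (n i) dvd nat \<bar>int (t k) + x\<bar>" by (simp only: int_dvd_int_iff)
    qed
    then have "int (gcd (n k) L) dvd int (nat \<bar>int (t k) + x\<bar>)" by (simp only: int_dvd_int_iff)
    then have "gcd (int (n k)) (int L) dvd int (t k) + x" by simp
    from linear_cong_solvable[OF this] obtain y where y: "int (n k) dvd int (t k) + x + int L * y" by blast
    have "int (n i) dvd int (t i) + (x + int L * y)" if "i \<in> insert k S" for i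
    proof (cases "i = k")
      case True then show ?thesis using y by (simp add: add.assoc)
    next
      case False
      then have i: "i \<in> S" using that by simp
      have "n i dvd L" unfolding L_def using i by (intro dvd_Lcm) auto
      then have "int (n i) dvd int L * y" by (simp add: dvd_mult2)
      then have "int (n i) dvd (int (t i) + x) + int L * y" using x[OF i] by (rule dvd_add[rotated])
      then show ?thesis by (simp add: add.assoc)
    qed
    then show ?case by blast
  qed simp
  then obtain x :: int where x: "\<And>i. i \<in> S \<Longrightarrow> int (n i) dvd int (t i) + x" by blast
  define N where "N = (\<Prod>i\<in>S. n i)"
  have N: "N > 0" unfolding N_def using assms(2) by (intro prod_pos) auto
  \<comment> \<open>Adding a multiple of all moduli makes the solution nonnegative.\<close>
  define m where "m = nat (x + \<bar>x\<bar> * int N)"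
  have "\<bar>x\<bar> * 1 \<le> \<bar>x\<bar> * int N" using N by (intro mult_left_mono) auto
  then have m: "int m = x + \<bar>x\<bar> * int N" unfolding m_def by simp
  have "n i dvd t i + m" if i: "i \<in> S" for i
  proof -
    have "n i dvd N" unfolding N_def using i assms(1) by (rule dvd_prodI[rotated])
    then have "int (n i) dvd \<bar>x\<bar> * int N" by simp
    then have "int (n i) dvd (int (t i) + x) + \<bar>x\<bar> * int N" using x[OF i] by (rule dvd_add[rotated])
    then have "int (n i) dvd int (t i + m)" using m by (simp add: add.assoc)
    then show ?thesis by (simp only: int_dvd_int_iff)
  qed
  then show ?thesis by blast
qed

text \<open>Bezout writes \<open>l ^ gcd a b\<close> as a quotient of powers of \<open>l ^ a\<close>
  and \<open>l ^ b\<close>.\<close>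

lemma Rats_power_gcd:
  fixes l :: complex
  assumes "l \<noteq> 0" "l ^ a \<in> \<rat>" "l ^ b \<in> \<rat>"
  shows "l ^ gcd a b \<in> \<rat>"
proof (cases "a = 0")
  case False
  then obtain x y where xy: "a * x = b * y + gcd a b" using bezout_nat by blast
  have "l ^ (a * x) = l ^ (b * y) * l ^ gcd a b" unfolding xy by (simp add: power_add)
  then have "l ^ gcd a b = (l ^ a) ^ x / (l ^ b) ^ y"
    using assms(1) by (simp add: power_mult field_simps)
  then show ?thesis using assms by simp
qed (use assms in simp)

lemma Rats_power_Gcd:
  fixes l :: complex
  assumes "finite S" "l \<noteq> 0" "\<And>i. i \<in> S \<Longrightarrow> l ^ q i \<in> \<rat>"
  shows "l ^ Gcd (q ` S) \<in> \<rat>"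
  using assms by (induction S rule: finite_induct) (auto intro: Rats_power_gcd)

section \<open>Points with given support\<close>

definition embed :: "nat set \<Rightarrow> (nat \<Rightarrow> rat) \<Rightarrow> nat \<Rightarrow> complex" where
  "embed I x = (\<lambda>i\<in>I. of_rat (x i))"

lemma represents_embed: "represents I x P \<longleftrightarrow> embed I x \<in> P"
  by (simp add: represents_def embed_def)

lemma wp_rel_equiv: "equiv (wp_tuples I) (wp_rel I q)"
proof (rule equivI)
  show "wp_rel I q \<subseteq> wp_tuples I \<times> wp_tuples I" by (auto simp: wp_rel_def)
  show "refl_on (wp_tuples I) (wp_rel I q)"
    by (rule refl_onI) (auto simp: wp_rel_def intro!: exI[of _ 1])
  show "sym (wp_rel I q)"
  proof (rule symI)
    fix x y assume "(x, y) \<in> wp_rel I q"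
    then obtain l where l: "x \<in> wp_tuples I" "y \<in> wp_tuples I" "algebraic l" "l \<noteq> 0"
      "\<forall>i\<in>I. y i = l ^ q i * x i" by (auto simp: wp_rel_def)
    then have "\<forall>i\<in>I. x i = inverse l ^ q i * y i" by (simp add: field_simps)
    then show "(y, x) \<in> wp_rel I q"
      using l by (auto simp: wp_rel_def intro!: exI[of _ "inverse l"] algebraic_inverse)
  qed
  show "trans (wp_rel I q)"
  proof (rule transI)
    fix x y z assume "(x, y) \<in> wp_rel I q" "(y, z) \<in> wp_rel I q"
    then obtain l m where l: "x \<in> wp_tuples I" "y \<in> wp_tuples I" "algebraic l" "l \<noteq> 0"
      "\<forall>i\<in>I. y i = l ^ q i * x i"
      and m: "z \<in> wp_tuples I" "algebraic m" "m \<noteq> 0" "\<forall>i\<in>I. z i = m ^ q i * y i"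
      by (auto simp: wp_rel_def)
    have "\<forall>i\<in>I. z i = (m * l) ^ q i * x i" using l m by (simp add: power_mult_distrib)
    then show "(x, z) \<in> wp_rel I q"
      using l m algebraic_mult by (auto simp: wp_rel_def intro!: exI[of _ "m * l"])
  qed
qed

definition supported :: "nat set \<Rightarrow> nat set \<Rightarrow> (nat \<Rightarrow> rat) \<Rightarrow> bool" where
  "supported I S x \<longleftrightarrow> (\<forall>i\<in>I. x i \<noteq> 0 \<longleftrightarrow> i \<in> S)"

text \<open>\<open>I\<close> indexes the ambient space and \<open>S\<close> the nonzero coordinates.
  Taking \<open>I = S\<close> gives the interior counts.\<close>

locale stratum =
  fixes I S :: "nat set" and q :: "nat \<Rightarrow> nat"
  assumes finI: "finite I" and SI: "S \<subseteq> I" and S_ne: "S \<noteq> {}" and q_pos: "\<And>i. i \<in> I \<Longrightarrow> q i > 0"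
begin

lemma finS: "finite S" using SI finI by (rule finite_subset)

abbreviation "d \<equiv> weight_gcd S q"
abbreviation "u \<equiv> stratum_reduced q S"
abbreviation "U \<equiv> weight_lcm S u"
abbreviation "n \<equiv> lp_exponent S q"
abbreviation "qS \<equiv> weight_lcm S q"

lemma qS_pos': "i \<in> S \<Longrightarrow> q i > 0" using q_pos SI by blast
lemma d_pos: "d > 0" using S_ne qS_pos' by (rule weight_gcd_pos)
lemma du: "i \<in> S \<Longrightarrow> d * u i = q i" by (rule stratum_reduced_mult)
lemma u_pos: "i \<in> S \<Longrightarrow> u i > 0" using du qS_pos' by (metis gr0I mult_0_right less_irrefl)
lemma n_pos: "i \<in> S \<Longrightarrow> n i > 0" using finS qS_pos' by (rule lp_exponent_pos)
lemma nq: "i \<in> S \<Longrightarrow> n i * q i = qS" by (rule lp_exponent_mult)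
lemma dU: "d * U = qS" using S_ne d_pos by (rule weight_lcm_reduced)
lemma nu: "i \<in> S \<Longrightarrow> n i * u i = U"
proof -
  assume i: "i \<in> S"
  have "d * (n i * u i) = n i * (d * u i)" by (rule mult.left_commute)
  also have "\<dots> = d * U" unfolding du[OF i] nq[OF i] dU ..
  finally show ?thesis using d_pos by simp
qed
lemma qS_pos: "qS > 0"
proof -
  obtain i where "i \<in> S" using S_ne by blast
  then show ?thesis using nq[of i] n_pos[of i] qS_pos'[of i] by (metis nat_0_less_mult_iff)
qed
lemma U_pos: "U > 0" using dU qS_pos by (metis nat_0_less_mult_iff)

lemma Gcd_u: "Gcd (u ` S) = 1"
proof -
  have "q ` S = (*) d ` (u ` S)" unfolding image_image using du by (intro image_cong) auto
  from arg_cong[OF this, of Gcd] have "Gcd (q ` S) = d * Gcd (u ` S)" by (simp only: Gcd_mult normalize_nat_def id_apply)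
  then have "d * 1 = d * Gcd (u ` S)" by (simp only: weight_gcd_def mult_1_right)
  then show ?thesis using d_pos by simp
qed

text \<open>The reduced weights are coprime. Scaling by -1 flips the sign at such an index, which
  can therefore be used to normalise signs.\<close>

lemma exists_odd_u: "\<exists>i\<in>S. odd (u i)"
proof (rule ccontr)
  assume "\<not> ?thesis"
  then have "2 dvd Gcd (u ` S)" by (intro Gcd_greatest) auto
  then show False by (simp add: Gcd_u)
qed

text \<open>After multiplication by \<open>n i\<close>, a weighted scaling adds the same multiple of
  \<open>U\<close> to all coordinates. The negative of the minimum, times \<open>ln p / qS\<close>,
  is the logarithm of the local height.\<close>

definition minv :: "(nat \<Rightarrow> rat) \<Rightarrow> nat \<Rightarrow> int" where
  "minv x p = Min ((\<lambda>i. int (n i) * vp p (x i)) ` S)"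

definition vmap :: "(nat \<Rightarrow> rat) \<Rightarrow> nat \<Rightarrow> nat \<Rightarrow> nat" where
  "vmap x p = (if prime p then (\<lambda>i\<in>S. nat (int (n i) * vp p (x i) - minv x p)) else (\<lambda>i\<in>S. 0))"

lemma minv_le: "i \<in> S \<Longrightarrow> minv x p \<le> int (n i) * vp p (x i)"
  unfolding minv_def using finS by (intro Min_le) auto

lemma minv_attained: "\<exists>i\<in>S. minv x p = int (n i) * vp p (x i)"
proof -
  have "minv x p \<in> (\<lambda>i. int (n i) * vp p (x i)) ` S"
    unfolding minv_def using finS S_ne by (intro Min_in) auto
  then show ?thesis by blast
qed

lemma minv_eqI: "(\<And>i. i \<in> S \<Longrightarrow> m \<le> int (n i) * vp p (x i)) \<Longrightarrow> k \<in> S \<Longrightarrow> m = int (n k) * vp p (x k) \<Longrightarrow> minv x p = m"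
  unfolding minv_def using finS by (intro Min_eqI) auto

definition vsupp :: "(nat \<Rightarrow> rat) \<Rightarrow> nat set" where
  "vsupp x = {p. prime p \<and> (\<exists>i\<in>S. vp p (x i) \<noteq> 0)}"

lemma finite_vsupp: "(\<And>i. i \<in> S \<Longrightarrow> x i \<noteq> 0) \<Longrightarrow> finite (vsupp x)"
proof -
  assume "\<And>i. i \<in> S \<Longrightarrow> x i \<noteq> 0"
  then have "finite (\<Union>i\<in>S. {p. prime p \<and> vp p (x i) \<noteq> 0})" using finS finite_vp_support by blast
  then show ?thesis by (rule rev_finite_subset) (auto simp: vsupp_def)
qed

lemma minv_zero: "prime p \<Longrightarrow> p \<notin> vsupp x \<Longrightarrow> minv x p = 0"
  using minv_attained[of x p] by (auto simp: vsupp_def)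

lemma vmap_zero: "p \<notin> vsupp x \<Longrightarrow> vmap x p = (\<lambda>i\<in>S. 0)"
  using minv_zero by (auto simp: vmap_def vsupp_def fun_eq_iff)

lemma vmap_apply: "prime p \<Longrightarrow> i \<in> S \<Longrightarrow> int (vmap x p i) = int (n i) * vp p (x i) - minv x p"
  using minv_le[of i x p] by (simp add: vmap_def)

text \<open>Each \<open>n i * vp p (x i)\<close> is 0 modulo \<open>gcd (n i) (n j)\<close>, and
  subtracting a common minimum does not affect differences.\<close>

lemma vmap_conf:
  assumes "\<And>i. i \<in> S \<Longrightarrow> x i \<noteq> 0"
  shows "vmap x \<in> conf S (lp_M S q)"
  unfolding conf_def
proof (intro CollectI conjI allI impI)
  fix p :: nat assume p: "prime p"
  obtain k where k: "k \<in> S" "minv x p = int (n k) * vp p (x k)" using minv_attained by blast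
  have "vmap x p k = 0" using k p by (simp add: vmap_def)
  then have "Min (vmap x p ` S) = 0" using k(1) finS by (intro Min_eqI) (auto intro: rev_image_eqI)
  moreover have "[vmap x p i = vmap x p j] (mod gcd (n i) (n j))" if "i \<in> S" "j \<in> S" for i j
  proof -
    have "int (gcd (n i) (n j)) dvd int (n i) * vp p (x i)"
      by (rule dvd_mult2) (simp only: int_dvd_int_iff gcd_dvd1)
    moreover have "int (gcd (n i) (n j)) dvd int (n j) * vp p (x j)"
      by (rule dvd_mult2) (simp only: int_dvd_int_iff gcd_dvd2)
    ultimately have "int (gcd (n i) (n j)) dvd int (vmap x p i) - int (vmap x p j)"
      unfolding vmap_apply[OF p that(1)] vmap_apply[OF p that(2)] by (simp add: dvd_diff)
    then have "[int (vmap x p i) = int (vmap x p j)] (mod int (gcd (n i) (n j)))"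
      by (simp only: cong_iff_dvd_diff)
    then show ?thesis by (simp only: cong_int_iff)
  qed
  moreover have "vmap x p \<in> S \<rightarrow>\<^sub>E UNIV" using p by (simp add: vmap_def)
  ultimately show "vmap x p \<in> lp_M S q" by (simp add: lp_M_def)
next
  fix p :: nat assume "\<not> prime p"
  then show "vmap x p = (\<lambda>i\<in>S. 0)" by (simp add: vmap_def)
next
  show "finite {p. vmap x p \<noteq> (\<lambda>i\<in>S. 0)}"
    by (rule finite_subset[OF _ finite_vsupp[of x]]) (use vmap_zero assms in auto)
qed

text \<open>The scaling adds \<open>U * vp p m\<close> to every coordinate and hence to the minimum.
  Only absolute values enter, so changes of sign are covered by \<open>m = 1\<close>.\<close>

lemma vmap_scale:
  assumes "m \<noteq> 0" "\<And>i. i \<in> S \<Longrightarrow> x i \<noteq> 0" "\<And>i. i \<in> S \<Longrightarrow> \<bar>y i\<bar> = \<bar>m ^ u i * x i\<bar>"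
  shows "vmap y = vmap x"
proof
  fix p
  show "vmap y p = vmap x p"
  proof (cases "prime p")
    case True
    have v: "int (n i) * vp p (y i) = int U * vp p m + int (n i) * vp p (x i)" if i: "i \<in> S" for i
    proof -
      have "vp p (y i) = vp p (m ^ u i * x i)" using assms(3)[OF i] vp_abs[OF True] by metis
      also have "\<dots> = int (u i) * vp p m + vp p (x i)" using assms i True by (simp add: vp_mult vp_power)
      finally show ?thesis using nu[OF i, symmetric] by (simp add: algebra_simps)
    qed
    obtain k where k: "k \<in> S" "minv x p = int (n k) * vp p (x k)" using minv_attained by blast
    have "int U * vp p m + minv x p \<le> int (n i) * vp p (y i)" if "i \<in> S" for i
      using v[OF that] minv_le[OF that, of x p] by simp
    then have "minv y p = int U * vp p m + minv x p"
      by (rule minv_eqI[OF _ k(1)]) (use v[OF k(1)] k(2) in auto)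
    then show ?thesis using v by (auto simp: vmap_def True fun_eq_iff)
  qed (simp add: vmap_def)
qed

text \<open>The congruences in \<open>lp_M\<close> are what is needed to shift the vector at each
  prime by a common amount to one divisible by all \<open>n i\<close>; the quotients are taken as
  valuations.\<close>

lemma vmap_surj:
  assumes C: "C \<in> conf S (lp_M S q)"
  shows "\<exists>x. (\<forall>i. x i > 0) \<and> vmap x = C"
proof -
  let ?z = "\<lambda>i\<in>S. (0::nat)"
  define A where "A = {p. C p \<noteq> ?z}"
  have finA: "finite A" using C by (simp add: A_def conf_def)
  have pA: "prime p" if "p \<in> A" for p using that conf_supp_prime[OF C] by (auto simp: A_def)
  have CM: "C p \<in> lp_M S q" if "prime p" for p using C that by (simp add: conf_def)
  have "\<forall>p\<in>A. \<exists>m. \<forall>i\<in>S. n i dvd C p i + m"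
    using CM pA finS n_pos by (intro ballI simultaneous_cong) (auto simp: lp_M_def)
  then obtain m where m: "\<And>p i. p \<in> A \<Longrightarrow> i \<in> S \<Longrightarrow> n i dvd C p i + m p" by metis
  define x where "x = (\<lambda>i. rat_of_val A (\<lambda>p. int ((C p i + m p) div n i)))"
  have x0: "x i > 0" for i unfolding x_def using pA by (rule rat_of_val_pos)
  have v1: "int (n i) * vp p (x i) = int (C p i) + int (m p)" if "p \<in> A" "i \<in> S" for p i
  proof -
    have "vp p (x i) = int ((C p i + m p) div n i)"
      unfolding x_def using vp_rat_of_val[OF finA pA pA[OF that(1)]] that by simp
    then have "int (n i) * vp p (x i) = int (n i * ((C p i + m p) div n i))" by simp
    also have "n i * ((C p i + m p) div n i) = C p i + m p" using m[OF that] by simp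
    finally show ?thesis by simp
  qed
  have v0: "vp p (x i) = 0" if "prime p" "p \<notin> A" for p i
    unfolding x_def using vp_rat_of_val[OF finA pA that(1)] that by simp
  have "vmap x p = C p" for p
  proof (cases "p \<in> A")
    case True
    then have p: "prime p" by (rule pA)
    have "0 \<in> C p ` S" using CM[OF p] finS S_ne by (simp add: lp_M_def) (metis Min_in finite_imageI image_is_empty)
    then obtain k where k: "k \<in> S" "C p k = 0" by force
    have "minv x p = int (m p)"
      by (rule minv_eqI[OF _ k(1)]) (use v1[OF True] k in auto)
    then have "vmap x p i = C p i" if "i \<in> S" for i
      using vmap_apply[OF p that, of x] v1[OF True that] by simp
    moreover have "vmap x p \<in> S \<rightarrow>\<^sub>E UNIV" using p by (simp add: vmap_def)
    moreover have "C p \<in> S \<rightarrow>\<^sub>E UNIV" using CM[OF p] by (simp add: lp_M_def)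
    ultimately show ?thesis by (intro PiE_ext[of "vmap x p" S "\<lambda>_. UNIV" "C p"]) auto
  next
    case False
    then have "p \<notin> vsupp x" using v0 by (auto simp: vsupp_def)
    then show ?thesis using False vmap_zero by (simp add: A_def)
  qed
  then show ?thesis using x0 by blast
qed

text \<open>At each prime the minima differ by \<open>D p\<close>, a multiple of every
  \<open>n i\<close>. Since \<open>U = n i * u i\<close> divides \<open>D p * u i\<close> for all
  \<open>i\<close> and the \<open>u i\<close> are coprime, \<open>U\<close> divides
  \<open>D p\<close>, and the scalar \<open>m\<close> has the valuations
  \<open>D p / U\<close>.\<close>

lemma vmap_eq_imp_scaled:
  assumes x: "\<And>i. i \<in> S \<Longrightarrow> x i \<noteq> 0" and y: "\<And>i. i \<in> S \<Longrightarrow> y i \<noteq> 0" and eq: "vmap x = vmap y"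
  shows "\<exists>m>0. \<forall>i\<in>S. \<bar>x i\<bar> = m ^ u i * \<bar>y i\<bar>"
proof -
  define D where "D = (\<lambda>p. minv x p - minv y p)"
  have D: "int (n i) * (vp p (x i) - vp p (y i)) = D p" if "prime p" "i \<in> S" for p i
    using vmap_apply[OF that, of x] vmap_apply[OF that, of y] eq by (simp add: D_def algebra_simps)
  have UD: "int U dvd D p" if p: "prime p" for p
  proof -
    have "U dvd nat \<bar>D p\<bar> * u i" if i: "i \<in> S" for i
    proof -
      have "n i dvd nat \<bar>D p\<bar>"
      proof -
        have "int (n i) dvd D p" using D[OF p i] by (metis dvd_triv_left)
        then have "int (n i) dvd int (nat \<bar>D p\<bar>)" by simp
        then show ?thesis by (simp only: int_dvd_int_iff)
      qed
      then show ?thesis using nu[OF i] by (metis mult_dvd_mono dvd_refl)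
    qed
    then have "U dvd Gcd ((*) (nat \<bar>D p\<bar>) ` (u ` S))" by (intro Gcd_greatest) auto
    then have "U dvd nat \<bar>D p\<bar>" by (simp add: Gcd_mult Gcd_u)
    then have "int U dvd int (nat \<bar>D p\<bar>)" by (simp only: int_dvd_int_iff)
    then show ?thesis by simp
  qed
  define A where "A = vsupp x \<union> vsupp y"
  have finA: "finite A" unfolding A_def using finite_vsupp x y by blast
  have pA: "prime p" if "p \<in> A" for p using that by (auto simp: A_def vsupp_def)
  define m where "m = rat_of_val A (\<lambda>p. D p div int U)"
  have m0: "m > 0" unfolding m_def using pA by (rule rat_of_val_pos)
  have vm: "vp p (x i) - vp p (y i) = int (u i) * vp p m" if p: "prime p" and i: "i \<in> S" for p i
  proof (cases "p \<in> A")
    case True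
    have "int U * vp p m = D p"
      unfolding m_def using vp_rat_of_val[OF finA pA p] True UD[OF p] by simp
    then have "int (n i) * (vp p (x i) - vp p (y i)) = int (n i) * (int (u i) * vp p m)"
      using D[OF p i] nu[OF i] by (metis mult.assoc of_nat_mult)
    then show ?thesis using n_pos[OF i] by simp
  next
    case False
    then show ?thesis unfolding m_def using vp_rat_of_val[OF finA pA p] p i
      by (auto simp: A_def vsupp_def)
  qed
  have "\<bar>x i\<bar> = m ^ u i * \<bar>y i\<bar>" if i: "i \<in> S" for i
  proof -
    have "\<bar>x i\<bar> = \<bar>m ^ u i * y i\<bar>"
    proof (rule abs_eq_if_vp_eq)
      show "vp p (x i) = vp p (m ^ u i * y i)" if p: "prime p" for p
        using vm[OF p i] m0 y[OF i] p by (simp add: vp_mult vp_power)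
    qed (use x[OF i] y[OF i] m0 in auto)
    then show ?thesis using m0 by (simp add: abs_mult)
  qed
  with m0 show ?thesis by blast
qed

text \<open>Coordinates outside \<open>S\<close> contribute 0 and never attain the maximum.\<close>

lemma local_height_padic:
  assumes x: "supported I S x" and p: "prime p"
  shows "local_height (padic_abs p) I q x = exp (- real_of_int (minv x p) * ln (real p) / real qS)"
proof -
  have p0: "real p > 1" using prime_gt_1_nat[OF p] by simp
  have out: "padic_abs p (x i) powr (1 / real (q i)) = 0" if "i \<in> I - S" for i
    using x that by (simp add: supported_def padic_abs_def)
  have inS: "padic_abs p (x i) powr (1 / real (q i)) = exp (- real_of_int (int (n i) * vp p (x i)) * ln (real p) / real qS)"
    if i: "i \<in> S" for i
  proof -
    have "x i \<noteq> 0" using x i SI by (auto simp: supported_def)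
    then have "padic_abs p (x i) powr (1 / real (q i)) = exp (- real_of_int (vp p (x i)) / real (q i) * ln (real p))"
      using p0 by (simp add: padic_abs_vp powr_def)
    also have "real qS = real (n i) * real (q i)" using nq[OF i] by (metis of_nat_mult)
    then have "- real_of_int (vp p (x i)) / real (q i) * ln (real p) =
        - real_of_int (int (n i) * vp p (x i)) * ln (real p) / real qS"
      using n_pos[OF i] qS_pos'[OF i] by (simp add: field_simps)
    finally show ?thesis .
  qed
  obtain k where k: "k \<in> S" "minv x p = int (n k) * vp p (x k)" using minv_attained by blast
  show ?thesis unfolding local_height_def
  proof (rule Max_eqI)
    show "finite ((\<lambda>i. padic_abs p (x i) powr (1 / real (q i))) ` I)" using finI by simp
    show "exp (- real_of_int (minv x p) * ln (real p) / real qS) \<in> (\<lambda>i. padic_abs p (x i) powr (1 / real (q i))) ` I"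
      using inS[OF k(1)] k SI by (intro image_eqI[of _ _ k]) auto
    fix y assume "y \<in> (\<lambda>i. padic_abs p (x i) powr (1 / real (q i))) ` I"
    then obtain i where i: "i \<in> I" "y = padic_abs p (x i) powr (1 / real (q i))" by blast
    show "y \<le> exp (- real_of_int (minv x p) * ln (real p) / real qS)"
    proof (cases "i \<in> S")
      case True
      have "real_of_int (minv x p) * ln (real p) \<le> real_of_int (int (n i) * vp p (x i)) * ln (real p)"
      proof (rule mult_right_mono)
        show "real_of_int (minv x p) \<le> real_of_int (int (n i) * vp p (x i))"
          using minv_le[OF True, of x p] by (simp only: of_int_le_iff)
      qed (use p0 in simp)
      then show ?thesis unfolding i(2) inS[OF True] using qS_pos
        by (simp add: divide_right_mono)
    next
      case False
      then show ?thesis using out[of i] i by simp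
    qed
  qed
qed

text \<open>The finite places contribute \<open>exp (- m / qS)\<close>. By the product formula every
  \<open>n i * ln |x i|\<close> contains the same \<open>m\<close>, so the two cancel and only the
  normalised valuations remain.\<close>

lemma tuple_height_le_iff:
  assumes x: "supported I S x" and X: "X > 0"
  shows "tuple_height I q x \<le> X \<longleftrightarrow> (\<forall>i\<in>S. log_height S (vmap x) i \<le> real qS * ln X)"
proof -
  have x0: "x i \<noteq> 0" if "i \<in> S" for i using x that SI by (auto simp: supported_def)
  define A where "A = vsupp x"
  have finA: "finite A" unfolding A_def using finite_vsupp x0 by blast
  have pA: "prime p" if "p \<in> A" for p using that by (auto simp: A_def vsupp_def)
  define m where "m = (\<Sum>p\<in>A. real_of_int (minv x p) * ln (real p))"
  have "(\<Prod>p \<in> {p. prime p \<and> local_height (padic_abs p) I q x \<noteq> 1}. local_height (padic_abs p) I q x) =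
      (\<Prod>p\<in>A. local_height (padic_abs p) I q x)"
  proof (rule prod.mono_neutral_left[OF finA])
    show "{p. prime p \<and> local_height (padic_abs p) I q x \<noteq> 1} \<subseteq> A"
    proof
      fix p assume "p \<in> {p. prime p \<and> local_height (padic_abs p) I q x \<noteq> 1}"
      then have "prime p" "minv x p \<noteq> 0" using local_height_padic[OF x, of p] by auto
      then show "p \<in> A" using minv_zero unfolding A_def by blast
    qed
    show "\<forall>p\<in>A - {p. prime p \<and> local_height (padic_abs p) I q x \<noteq> 1}. local_height (padic_abs p) I q x = 1"
      using pA by auto
  qed
  also have "\<dots> = (\<Prod>p\<in>A. exp (- real_of_int (minv x p) * ln (real p) / real qS))"
    by (rule prod.cong[OF refl local_height_padic[OF x pA]])
  also have "\<dots> = exp (- m / real qS)"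
    by (simp add: exp_sum[OF finA, symmetric] m_def sum_divide_distrib sum_negf)
  finally have prod_eq: "(\<Prod>p \<in> {p. prime p \<and> local_height (padic_abs p) I q x \<noteq> 1}. local_height (padic_abs p) I q x) =
      exp (- m / real qS)" .
  have lh: "real (n i) * ln \<bar>real_of_rat (x i)\<bar> = log_height S (vmap x) i + m" if i: "i \<in> S" for i
  proof -
    have "ln \<bar>real_of_rat (x i)\<bar> = (\<Sum>p\<in>A. real_of_int (vp p (x i)) * ln (real p))"
    proof (rule ln_abs_vp[OF x0[OF i] finA pA])
      show "p \<in> A" if "prime p" "vp p (x i) \<noteq> 0" for p
        unfolding A_def vsupp_def using that i by blast
    qed
    then have "real (n i) * ln \<bar>real_of_rat (x i)\<bar> = (\<Sum>p\<in>A. real_of_int (int (n i) * vp p (x i)) * ln (real p))"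
      by (simp add: sum_distrib_left mult.assoc)
    also have "\<dots> = (\<Sum>p\<in>A. real (vmap x p i) * ln (real p) + real_of_int (minv x p) * ln (real p))"
    proof (rule sum.cong)
      fix p assume "p \<in> A"
      then have "int (n i) * vp p (x i) = int (vmap x p i) + minv x p" using vmap_apply[OF pA i, of p x] by simp
      then show "real_of_int (int (n i) * vp p (x i)) * ln (real p) =
          real (vmap x p i) * ln (real p) + real_of_int (minv x p) * ln (real p)"
        by (simp only: of_int_add of_int_of_nat_eq distrib_right)
    qed simp
    also have "\<dots> = (\<Sum>p\<in>A. real (vmap x p i) * ln (real p)) + m" by (simp add: sum.distrib m_def)
    also have "(\<Sum>p\<in>A. real (vmap x p i) * ln (real p)) = log_height S (vmap x) i"
      unfolding log_height_def
    proof (rule sum.mono_neutral_right[OF finA])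
      show "{p. vmap x p \<noteq> (\<lambda>i\<in>S. 0)} \<subseteq> A" using vmap_zero by (auto simp: A_def)
    qed (use i in auto)
    finally show ?thesis .
  qed
  have term_iff: "\<bar>real_of_rat (x i)\<bar> powr (1 / real (q i)) * exp (- m / real qS) \<le> X \<longleftrightarrow>
      log_height S (vmap x) i \<le> real qS * ln X" if i: "i \<in> S" for i
  proof -
    have qq: "real qS = real (n i) * real (q i)" using nq[OF i] by (metis of_nat_mult)
    have "\<bar>real_of_rat (x i)\<bar> powr (1 / real (q i)) = exp (ln \<bar>real_of_rat (x i)\<bar> / real (q i))"
      using x0[OF i] by (simp add: powr_def)
    also have "ln \<bar>real_of_rat (x i)\<bar> / real (q i) = (log_height S (vmap x) i + m) / real qS"
      unfolding lh[OF i, symmetric] qq using n_pos[OF i] by simp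
    finally have "\<bar>real_of_rat (x i)\<bar> powr (1 / real (q i)) * exp (- m / real qS) = exp (log_height S (vmap x) i / real qS)"
      by (simp add: exp_add[symmetric] add_divide_distrib)
    also have "\<dots> \<le> X \<longleftrightarrow> log_height S (vmap x) i / real qS \<le> ln X"
      using X by (metis exp_le_cancel_iff exp_ln)
    also have "\<dots> \<longleftrightarrow> log_height S (vmap x) i \<le> real qS * ln X" using qS_pos by (simp add: field_simps)
    finally show ?thesis .
  qed
  have I_ne: "I \<noteq> {}" using S_ne SI by blast
  have th: "tuple_height I q x =
      Max ((\<lambda>i. \<bar>real_of_rat (x i)\<bar> powr (1 / real (q i))) ` I) * exp (- m / real qS)"
    unfolding tuple_height_def prod_eq by (simp only: local_height_def)
  have "tuple_height I q x \<le> X \<longleftrightarrow>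
      Max ((\<lambda>i. \<bar>real_of_rat (x i)\<bar> powr (1 / real (q i))) ` I) \<le> X / exp (- m / real qS)"
    unfolding th by (simp only: pos_le_divide_eq exp_gt_zero)
  also have "\<dots> \<longleftrightarrow> (\<forall>i\<in>I. \<bar>real_of_rat (x i)\<bar> powr (1 / real (q i)) \<le> X / exp (- m / real qS))"
    using finI I_ne by (subst Max_le_iff) auto
  also have "\<dots> \<longleftrightarrow> (\<forall>i\<in>I. \<bar>real_of_rat (x i)\<bar> powr (1 / real (q i)) * exp (- m / real qS) \<le> X)"
    by (simp add: pos_le_divide_eq)
  also have "\<dots> \<longleftrightarrow> (\<forall>i\<in>S. \<bar>real_of_rat (x i)\<bar> powr (1 / real (q i)) * exp (- m / real qS) \<le> X)"
  proof -
    have "\<bar>real_of_rat (x i)\<bar> powr (1 / real (q i)) * exp (- m / real qS) \<le> X" if "i \<in> I" "i \<notin> S" for i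
    proof -
      have "x i = 0" using x that by (auto simp: supported_def)
      then show ?thesis using X by simp
    qed
    then show ?thesis using SI by blast
  qed
  also have "\<dots> \<longleftrightarrow> (\<forall>i\<in>S. log_height S (vmap x) i \<le> real qS * ln X)"
    using term_iff by blast
  finally show ?thesis .
qed

lemma embed_in_tuples: "supported I S x \<Longrightarrow> embed I x \<in> wp_tuples I"
proof -
  assume x: "supported I S x"
  obtain i where "i \<in> S" using S_ne by blast
  then have "i \<in> I" "x i \<noteq> 0" using x SI by (auto simp: supported_def)
  then show ?thesis by (auto simp: wp_tuples_def embed_def intro!: rat_imp_algebraic)
qed

text \<open>The scalar \<open>l\<close> may be irrational, but its powers \<open>l ^ q i\<close> for
  \<open>i\<close> in \<open>S\<close> are rational, hence so is \<open>l ^ d\<close>, which acts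
  through the reduced weights. Conversely, \<open>l\<close> is taken as a \<open>d\<close>-th root
  of \<open>m\<close>.\<close>

lemma rel_iff:
  assumes x: "supported I S x" and y: "supported I S y"
  shows "(embed I x, embed I y) \<in> wp_rel I q \<longleftrightarrow> (\<exists>m. m \<noteq> 0 \<and> (\<forall>i\<in>S. y i = m ^ u i * x i))"
proof
  assume "(embed I x, embed I y) \<in> wp_rel I q"
  then obtain l where l: "l \<noteq> 0" "\<forall>i\<in>I. embed I y i = l ^ q i * embed I x i" by (auto simp: wp_rel_def)
  have eq: "of_rat (y i) = l ^ q i * of_rat (x i)" if "i \<in> S" for i
    using l(2) that SI by (auto simp: embed_def)
  have "l ^ q i \<in> \<rat>" if i: "i \<in> S" for i
  proof -
    have "x i \<noteq> 0" using x i SI by (auto simp: supported_def)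
    then have "l ^ q i = of_rat (y i / x i)" using eq[OF i] by (simp add: of_rat_divide)
    then show ?thesis by simp
  qed
  then have "l ^ d \<in> \<rat>" unfolding weight_gcd_def using finS l(1) by (intro Rats_power_Gcd)
  then obtain m where m: "l ^ d = of_rat m" by (metis Rats_cases)
  have "m \<noteq> 0" using m l(1) by auto
  moreover have "y i = m ^ u i * x i" if i: "i \<in> S" for i
  proof -
    have "of_rat (y i) = (l ^ d) ^ u i * of_rat (x i)"
      using eq[OF i] du[OF i] by (simp add: power_mult[symmetric])
    also have "\<dots> = of_rat (m ^ u i * x i)" by (simp add: m of_rat_mult of_rat_power)
    finally show ?thesis by (simp only: of_rat_eq_iff)
  qed
  ultimately show "\<exists>m. m \<noteq> 0 \<and> (\<forall>i\<in>S. y i = m ^ u i * x i)" by blast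
next
  assume "\<exists>m. m \<noteq> 0 \<and> (\<forall>i\<in>S. y i = m ^ u i * x i)"
  then obtain m where m: "m \<noteq> 0" "\<And>i. i \<in> S \<Longrightarrow> y i = m ^ u i * x i" by blast
  have "\<exists>l :: complex. l ^ d = of_rat m"
    by (rule exists_complex_root[of d "of_rat m"]) (use d_pos in auto)
  then obtain l :: complex where l: "l ^ d = of_rat m" by blast
  have "l \<noteq> 0"
  proof
    assume "l = 0"
    then have "of_rat m = (0 :: complex)" using l d_pos by (simp add: power_0_left)
    with m(1) show False by simp
  qed
  moreover have "algebraic l"
  proof (rule algebraic_root)
    show "algebraic (of_rat m :: complex)" by (rule rat_imp_algebraic) simp
    show "poly (monom 1 d) l = of_rat m" by (simp add: poly_monom l)
    show "degree (monom (1::complex) d) > 0" using d_pos by (simp add: degree_monom_eq)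
  qed (auto simp: coeff_monom degree_monom_eq)
  moreover have "embed I y i = l ^ q i * embed I x i" if i: "i \<in> I" for i
  proof (cases "i \<in> S")
    case True
    have "of_rat (y i) = (l ^ d) ^ u i * of_rat (x i)"
      by (simp add: m(2)[OF True] l of_rat_mult of_rat_power)
    then show ?thesis using du[OF True] i by (simp add: embed_def power_mult[symmetric])
  next
    case False
    then have "x i = 0" "y i = 0" using x y i by (auto simp: supported_def)
    then show ?thesis using i by (simp add: embed_def)
  qed
  ultimately show "(embed I x, embed I y) \<in> wp_rel I q"
    using embed_in_tuples[OF x] embed_in_tuples[OF y] by (auto simp: wp_rel_def)
qed

section \<open>Points as families of local vectors with signs\<close>

definition points :: "real \<Rightarrow> (nat \<Rightarrow> complex) set set" where
  "points X = {P \<in> wp_rational I q. (\<forall>x\<in>P. \<forall>i\<in>I. x i \<noteq> 0 \<longleftrightarrow> i \<in> S) \<and> weighted_height I q P \<le> X}"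

abbreviation cls :: "(nat \<Rightarrow> rat) \<Rightarrow> (nat \<Rightarrow> complex) set" where
  "cls x \<equiv> wp_rel I q `` {embed I x}"

lemma cls_eq_iff:
  assumes x: "supported I S x" and y: "supported I S y"
  shows "cls x = cls y \<longleftrightarrow> (\<exists>m. m \<noteq> 0 \<and> (\<forall>i\<in>S. y i = m ^ u i * x i))"
  unfolding eq_equiv_class_iff[OF wp_rel_equiv embed_in_tuples[OF x] embed_in_tuples[OF y]]
  by (rule rel_iff[OF x y])

lemma supported_in_cls:
  assumes x: "supported I S x" and z: "embed I z \<in> cls x"
  shows "supported I S z" "cls z = cls x"
proof -
  have rel: "(embed I x, embed I z) \<in> wp_rel I q" using z by simp
  then obtain l where l: "l \<noteq> 0" "\<forall>i\<in>I. embed I z i = l ^ q i * embed I x i" by (auto simp: wp_rel_def)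
  then have "z i \<noteq> 0 \<longleftrightarrow> x i \<noteq> 0" if "i \<in> I" for i using that by (force simp: embed_def)
  then show "supported I S z" using x by (simp add: supported_def)
  show "cls z = cls x" using equiv_class_eq[OF wp_rel_equiv rel] by simp
qed

lemma vmap_cls:
  assumes x: "supported I S x" and z: "supported I S z" and eq: "cls x = cls z"
  shows "vmap z = vmap x"
proof -
  obtain m where m: "m \<noteq> 0" "\<forall>i\<in>S. z i = m ^ u i * x i" using cls_eq_iff[OF x z] eq by blast
  show ?thesis using m x SI by (intro vmap_scale[of m]) (auto simp: supported_def)
qed

text \<open>Whichever representative \<open>SOME\<close> picks, it has the same \<open>vmap\<close>
  as \<open>x\<close>, so the condition on the height can be read off from \<open>x\<close>.\<close>

lemma weighted_height_cls:
  assumes x: "supported I S x" and X: "X > 0"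
  shows "weighted_height I q (cls x) \<le> X \<longleftrightarrow> (\<forall>i\<in>S. log_height S (vmap x) i \<le> real qS * ln X)"
proof -
  define z where "z = (SOME z. represents I z (cls x))"
  have "represents I x (cls x)"
    unfolding represents_embed using equiv_class_self[OF wp_rel_equiv embed_in_tuples[OF x]] by simp
  then have "represents I z (cls x)" unfolding z_def by (rule someI[of "\<lambda>z. represents I z (cls x)"])
  then have z: "supported I S z" "cls z = cls x" using supported_in_cls[OF x] by (auto simp: represents_embed)
  then have "vmap z = vmap x" using vmap_cls[OF x z(1)] by simp
  then show ?thesis unfolding weighted_height_def z_def[symmetric]
    using tuple_height_le_iff[OF z(1) X] by simp
qed

lemma points_eq:
  assumes X: "X > 0"
  shows "points X = {cls x | x. supported I S x \<and> (\<forall>i\<in>S. log_height S (vmap x) i \<le> real qS * ln X)}"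
proof (intro equalityI subsetI)
  fix P assume P: "P \<in> points X"
  then obtain x where x: "embed I x \<in> P" and Q: "P \<in> wp_tuples I // wp_rel I q"
    by (auto simp: points_def wp_rational_def represents_embed wp_space_def)
  have Pc: "P = cls x"
    using Q x by (elim quotientE) (metis Image_singleton_iff equiv_class_eq wp_rel_equiv)
  have "supported I S x" using P x by (force simp: points_def supported_def embed_def)
  moreover have "weighted_height I q P \<le> X" using P by (simp add: points_def)
  ultimately show "P \<in> {cls x | x. supported I S x \<and> (\<forall>i\<in>S. log_height S (vmap x) i \<le> real qS * ln X)}"
    using weighted_height_cls[OF _ X] Pc by blast
next
  fix P assume "P \<in> {cls x | x. supported I S x \<and> (\<forall>i\<in>S. log_height S (vmap x) i \<le> real qS * ln X)}"
  then obtain x where x: "P = cls x" "supported I S x" "\<forall>i\<in>S. log_height S (vmap x) i \<le> real qS * ln X" by blast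
  have "P \<in> wp_rational I q"
    unfolding wp_rational_def wp_space_def x(1) represents_embed
    using embed_in_tuples[OF x(2)] equiv_class_self[OF wp_rel_equiv embed_in_tuples[OF x(2)]]
    by (auto intro: quotientI)
  moreover have "z i \<noteq> 0 \<longleftrightarrow> i \<in> S" if z: "z \<in> P" and i: "i \<in> I" for z i
  proof -
    obtain l where "l \<noteq> 0" "z i = l ^ q i * embed I x i"
      using z i unfolding x(1) by (auto simp: wp_rel_def)
    then show ?thesis using x(2) i by (auto simp: embed_def supported_def)
  qed
  ultimately show "P \<in> points X" using weighted_height_cls[OF x(2) X] x by (auto simp: points_def)
qed

definition odd_index :: nat where "odd_index = (SOME i. i \<in> S \<and> odd (u i))"

lemma odd_index: "odd_index \<in> S" "odd (u odd_index)"
  unfolding odd_index_def using someI_ex[of "\<lambda>i. i \<in> S \<and> odd (u i)"] exists_odd_u by blast+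

text \<open>One sign pattern from each pair that the scaling by -1 identifies, normalised at an
  index of odd weight.\<close>

definition signs :: "(nat \<Rightarrow> rat) set" where
  "signs = (\<Pi>\<^sub>E i\<in>S. if i = odd_index then {1} else {1, -1})"

lemma card_signs: "card signs = 2 ^ (card S - 1)"
proof -
  have "card signs = (\<Prod>i\<in>S. card (if i = odd_index then {1} else {1, -1 :: rat}))"
    unfolding signs_def using finS by (rule card_PiE)
  also have "\<dots> = (\<Prod>i\<in>S - {odd_index}. card {1, -1 :: rat})"
    using finS odd_index(1) by (subst prod.remove[of S odd_index]) (auto intro!: prod.cong)
  also have "\<dots> = 2 ^ (card S - 1)" using finS odd_index(1) by (simp add: card_Diff_singleton numeral_2_eq_2)
  finally show ?thesis .
qed

definition section_map :: "(nat \<Rightarrow> nat \<Rightarrow> nat) \<Rightarrow> nat \<Rightarrow> rat" where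
  "section_map C = (SOME x. (\<forall>i. x i > 0) \<and> vmap x = C)"

definition signed :: "(nat \<Rightarrow> rat) \<Rightarrow> (nat \<Rightarrow> rat) \<Rightarrow> nat \<Rightarrow> rat" where
  "signed \<sigma> x i = (if i \<in> S then \<sigma> i * x i else 0)"

lemma section_map:
  assumes "C \<in> conf S (lp_M S q)"
  shows "section_map C i > 0" "vmap (section_map C) = C"
  using someI_ex[OF vmap_surj[OF assms]] by (auto simp: section_map_def)

lemma signs_cases: "\<sigma> \<in> signs \<Longrightarrow> i \<in> S \<Longrightarrow> \<sigma> i = 1 \<or> \<sigma> i = -1"
proof -
  assume "\<sigma> \<in> signs" "i \<in> S"
  then have "\<sigma> i \<in> (if i = odd_index then {1} else {1, -1})" unfolding signs_def by blast
  then show ?thesis by (auto split: if_splits)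
qed

lemma signs_odd: "\<sigma> \<in> signs \<Longrightarrow> \<sigma> odd_index = 1"
proof -
  assume "\<sigma> \<in> signs"
  then have "\<sigma> odd_index \<in> (if odd_index = odd_index then {1} else {1, -1})"
    using odd_index(1) unfolding signs_def by blast
  then show ?thesis by simp
qed

lemma signed_supported:
  assumes "\<sigma> \<in> signs" "\<And>i. x i > 0"
  shows "supported I S (signed \<sigma> x)"
proof -
  have "\<sigma> i * x i \<noteq> 0" if "i \<in> S" for i
    using signs_cases[OF assms(1) that] assms(2)[of i] by auto
  then show ?thesis by (auto simp: supported_def signed_def)
qed

lemma vmap_signed:
  assumes "\<sigma> \<in> signs" "\<And>i. x i > 0"
  shows "vmap (signed \<sigma> x) = vmap x"
proof (rule vmap_scale[of 1])
  show "\<bar>signed \<sigma> x i\<bar> = \<bar>1 ^ u i * x i\<bar>" if "i \<in> S" for i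
    using signs_cases[OF assms(1) that] that by (auto simp: signed_def abs_mult)
qed (use assms(2) in \<open>auto simp: less_le\<close>)

text \<open>The family of local vectors fixes the absolute values up to a positive scaling; the
  normalised signs are the only other invariant of a class.\<close>

theorem card_points:
  assumes X: "X > 0"
  shows "finite (points X)" "card (points X) = 2 ^ (card S - 1) * height_count S q (real qS * ln X)"
proof -
  define \<C> where "\<C> = {C \<in> conf S (lp_M S q). \<forall>i\<in>S. log_height S C i \<le> real qS * ln X}"
  have CM: "C \<in> conf S (lp_M S q)" if "C \<in> \<C>" for C using that by (simp add: \<C>_def)
  have bij: "bij_betw (\<lambda>(C, \<sigma>). cls (signed \<sigma> (section_map C))) (\<C> \<times> signs) (points X)"
    unfolding bij_betw_def
  proof
    show "inj_on (\<lambda>(C, \<sigma>). cls (signed \<sigma> (section_map C))) (\<C> \<times> signs)"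
    proof (rule inj_onI, clarify)
      fix C \<sigma> C' \<sigma>'
      assume C: "C \<in> \<C>" "C' \<in> \<C>" and \<sigma>: "\<sigma> \<in> signs" "\<sigma>' \<in> signs"
        and eq: "cls (signed \<sigma> (section_map C)) = cls (signed \<sigma>' (section_map C'))"
      note sm = section_map[OF CM[OF C(1)]] and sm' = section_map[OF CM[OF C(2)]]
      note sup = signed_supported[OF \<sigma>(1) sm(1)] and sup' = signed_supported[OF \<sigma>(2) sm'(1)]
      have CC: "C = C'"
        using vmap_cls[OF sup sup' eq] vmap_signed[OF \<sigma>(1) sm(1)] vmap_signed[OF \<sigma>(2) sm'(1)] sm(2) sm'(2) by simp
      obtain m where m: "m \<noteq> 0" "\<forall>i\<in>S. signed \<sigma>' (section_map C) i = m ^ u i * signed \<sigma> (section_map C) i"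
        using iffD1[OF cls_eq_iff[OF sup sup'] eq] unfolding CC[symmetric] by blast
      have ms: "\<sigma>' i = m ^ u i * \<sigma> i" if i: "i \<in> S" for i
        using m(2) i sm(1)[of i] by (auto simp: signed_def)
      have modd: "m ^ u odd_index = 1" using ms[OF odd_index(1)] signs_odd[OF \<sigma>(1)] signs_odd[OF \<sigma>(2)] by simp
      then have "\<bar>m\<bar> ^ u odd_index = 1" by (simp add: power_abs[symmetric])
      then have "\<bar>m\<bar> = 1"
        using u_pos[OF odd_index(1)] power_eq_imp_eq_base[of "\<bar>m\<bar>" "u odd_index" 1] by simp
      then have "m = 1 \<or> m = -1" using abs_eq_iff[of m 1] by simp
      \<comment> \<open>The value -1 is excluded since its odd power is not 1.\<close>
      then have "m = 1" using modd odd_index(2) by auto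
      then have "\<sigma>' i = \<sigma> i" if "i \<in> S" for i using ms[OF that] by simp
      then have "\<sigma> = \<sigma>'" using \<sigma> unfolding signs_def by (intro PiE_ext[of \<sigma> S _ \<sigma>']) auto
      with CC show "C = C' \<and> \<sigma> = \<sigma>'" by blast
    qed
    show "(\<lambda>(C, \<sigma>). cls (signed \<sigma> (section_map C))) ` (\<C> \<times> signs) = points X"
    proof (intro equalityI subsetI)
      fix P assume "P \<in> (\<lambda>(C, \<sigma>). cls (signed \<sigma> (section_map C))) ` (\<C> \<times> signs)"
      then obtain C \<sigma> where C: "C \<in> \<C>" and \<sigma>: "\<sigma> \<in> signs" and P: "P = cls (signed \<sigma> (section_map C))" by blast
      note sm = section_map[OF CM[OF C]]
      have "vmap (signed \<sigma> (section_map C)) = C" using vmap_signed[OF \<sigma> sm(1)] sm(2) by simp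
      then show "P \<in> points X" unfolding points_eq[OF X] P
        using signed_supported[OF \<sigma> sm(1)] C by (auto simp: \<C>_def)
    next
      fix P assume "P \<in> points X"
      then obtain y where y: "P = cls y" "supported I S y" "\<forall>i\<in>S. log_height S (vmap y) i \<le> real qS * ln X"
        unfolding points_eq[OF X] by blast
      have y0: "y i \<noteq> 0" if "i \<in> S" for i using y(2) that SI by (auto simp: supported_def)
      define C where "C = vmap y"
      have C: "C \<in> \<C>" using vmap_conf[of y] y0 y(3) by (simp add: \<C>_def C_def)
      note sm = section_map[OF CM[OF C]]
      define x where "x = section_map C"
      have x0: "x i > 0" for i unfolding x_def by (rule sm)
      have vx: "vmap y = vmap x" using sm(2) by (simp add: x_def C_def)
      have xn: "x i \<noteq> 0" for i using x0[of i] by simp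
      obtain m where m: "m > 0" "\<forall>i\<in>S. \<bar>y i\<bar> = m ^ u i * \<bar>x i\<bar>"
        using vmap_eq_imp_scaled[of y x, OF y0 xn vx] by blast
      \<comment> \<open>Chosen to make \<open>\<sigma>\<close> equal to 1 at the odd index, where
        \<open>\<epsilon>\<close> survives in \<open>m' ^ u odd_index\<close> because the exponent
        is odd.\<close>
      define \<epsilon> where "\<epsilon> = sgn (y odd_index)"
      define m' where "m' = \<epsilon> * m"
      have e: "\<epsilon> = 1 \<or> \<epsilon> = -1" using y0[OF odd_index(1)] by (auto simp: \<epsilon>_def sgn_if)
      have m'0: "m' \<noteq> 0" using e m(1) by (auto simp: m'_def)
      define \<sigma> where "\<sigma> = (\<lambda>i\<in>S. y i / (m' ^ u i * x i))"
      have yeq: "y i = m' ^ u i * (\<sigma> i * x i)" if "i \<in> S" for i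
        using that m'0 xn by (simp add: \<sigma>_def)
      have abs1: "\<bar>\<sigma> i\<bar> = 1" if i: "i \<in> S" for i
      proof -
        have "\<bar>m'\<bar> = m" using e m(1) by (auto simp: m'_def abs_mult)
        then have "\<bar>m' ^ u i * x i\<bar> = \<bar>y i\<bar>" using m(2) i by (simp add: abs_mult power_abs)
        then show ?thesis using i y0[OF i] by (simp add: \<sigma>_def abs_divide)
      qed
      have one: "\<sigma> odd_index = 1"
      proof -
        have "\<epsilon> ^ u odd_index = \<epsilon>" using e odd_index(2) by auto
        then have "m' ^ u odd_index * x odd_index = \<epsilon> * (m ^ u odd_index * \<bar>x odd_index\<bar>)"
          using x0[of odd_index] by (simp add: m'_def power_mult_distrib mult.assoc)
        also have "\<dots> = \<epsilon> * \<bar>y odd_index\<bar>" using m(2) odd_index(1) by simp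
        also have "\<dots> = y odd_index" unfolding \<epsilon>_def by (simp add: sgn_mult_abs)
        finally show ?thesis using odd_index(1) y0[OF odd_index(1)] by (simp add: \<sigma>_def)
      qed
      have \<sigma>: "\<sigma> \<in> signs"
        unfolding signs_def
      proof (rule PiE_I)
        fix i assume i: "i \<in> S"
        have "\<sigma> i = 1 \<or> \<sigma> i = -1" using abs1[OF i] abs_eq_iff[of "\<sigma> i" 1] by simp
        then show "\<sigma> i \<in> (if i = odd_index then {1} else {1, -1})" using one by auto
      qed (simp add: \<sigma>_def)
      have "\<forall>i\<in>S. y i = m' ^ u i * signed \<sigma> x i" using yeq by (simp add: signed_def)
      then have "\<exists>m. m \<noteq> 0 \<and> (\<forall>i\<in>S. y i = m ^ u i * signed \<sigma> x i)" using m'0 by blast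
      then have "cls (signed \<sigma> x) = cls y"
        by (rule iffD2[OF cls_eq_iff[OF signed_supported[OF \<sigma> x0] y(2)]])
      then have "P = (\<lambda>(C, \<sigma>). cls (signed \<sigma> (section_map C))) (C, \<sigma>)" by (simp add: y(1) x_def)
      then show "P \<in> (\<lambda>(C, \<sigma>). cls (signed \<sigma> (section_map C))) ` (\<C> \<times> signs)"
        using C \<sigma> by blast
    qed
  qed
  have "finite \<C>" unfolding \<C>_def using finS lp_M_ext by (rule finite_bounded_conf)
  moreover have "finite signs" unfolding signs_def using finS by (intro finite_PiE) auto
  ultimately show "finite (points X)" using bij_betw_finite[OF bij] finite_cartesian_product by blast
  have "card (points X) = card (\<C> \<times> signs)" using bij_betw_same_card[OF bij] by (rule sym)
  then show "card (points X) = 2 ^ (card S - 1) * height_count S q (real qS * ln X)"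
    by (simp add: card_cartesian_product card_signs height_count_def \<C>_def)
qed

end

section \<open>Asymptotics\<close>

lemma power_times_exp_tendsto_0:
  fixes e :: real
  assumes "e > 0"
  shows "((\<lambda>L. L ^ k * exp (- (e * L))) \<longlongrightarrow> 0) at_top"
proof -
  have "filterlim (\<lambda>L. e * L) at_top at_top"
    using assms by (intro filterlim_tendsto_pos_mult_at_top[OF tendsto_const]) (auto simp: filterlim_ident)
  then have "((\<lambda>L. (e * L) ^ k / exp (e * L)) \<longlongrightarrow> 0) at_top"
    by (rule filterlim_compose[OF tendsto_power_div_exp_0])
  then have "((\<lambda>L. (e * L) ^ k / exp (e * L) / e ^ k) \<longlongrightarrow> 0 / e ^ k) at_top"
    using assms by (intro tendsto_divide tendsto_const) auto
  moreover have "(e * L) ^ k / exp (e * L) / e ^ k = L ^ k * exp (- (e * L))" for L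
    using assms by (simp add: power_mult_distrib exp_minus field_simps)
  ultimately show ?thesis by simp
qed

definition growth :: "real \<Rightarrow> nat \<Rightarrow> real \<Rightarrow> real" where
  "growth a b X = X powr a * ln X ^ b"

lemma growth_eq: "X > 0 \<Longrightarrow> growth a b X = exp (a * ln X) * ln X ^ b"
  by (simp add: growth_def powr_def)

lemma growth_pos: "X > 1 \<Longrightarrow> growth a b X > 0"
  by (simp add: growth_def)

text \<open>In terms of \<open>L = ln X\<close> a gap in the first exponent is exponential and beats
  every power of \<open>L\<close>; otherwise a negative power of \<open>L\<close> remains.\<close>

lemma growth_ratio_tendsto_0:
  assumes "a < a' \<or> (a = a' \<and> b < b')"
  shows "((\<lambda>X. growth a b X / growth a' b' X) \<longlongrightarrow> 0) at_top"
proof -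
  have "((\<lambda>L. exp (a * L) * L ^ b / (exp (a' * L) * L ^ b')) \<longlongrightarrow> 0) at_top"
    using assms
  proof
    assume "a < a'"
    then have "((\<lambda>L. L ^ b * exp (- ((a' - a) * L))) \<longlongrightarrow> 0) at_top"
      by (intro power_times_exp_tendsto_0) simp
    moreover have "eventually (\<lambda>L. norm (exp (a * L) * L ^ b / (exp (a' * L) * L ^ b')) \<le>
        L ^ b * exp (- ((a' - a) * L))) at_top"
      using eventually_ge_at_top[of 1]
    proof eventually_elim
      case (elim L)
      have "exp (a * L) / exp (a' * L) = exp (- ((a' - a) * L))"
        by (simp add: exp_diff[symmetric] algebra_simps)
      then have "exp (a * L) * L ^ b / (exp (a' * L) * L ^ b') = L ^ b * exp (- ((a' - a) * L)) / L ^ b'"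
        by (metis times_divide_times_eq mult.commute times_divide_eq_right)
      moreover have "L ^ b' \<ge> 1" using elim by (rule one_le_power)
      moreover have "L ^ b * exp (- ((a' - a) * L)) \<ge> 0" using elim by simp
      ultimately have "exp (a * L) * L ^ b / (exp (a' * L) * L ^ b') \<ge> 0"
        "exp (a * L) * L ^ b / (exp (a' * L) * L ^ b') \<le> L ^ b * exp (- ((a' - a) * L)) / 1"
        using elim by (simp, simp only:, intro divide_left_mono) auto
      then show ?case by simp
    qed
    ultimately show ?thesis by (rule Lim_null_comparison[rotated])
  next
    assume ab: "a = a' \<and> b < b'"
    have "((\<lambda>L::real. inverse (L ^ (b' - b))) \<longlongrightarrow> 0) at_top"
      using ab by (intro tendsto_inverse_0_at_top filterlim_pow_at_top) (auto simp: filterlim_ident)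
    moreover have "eventually (\<lambda>L. inverse (L ^ (b' - b)) = exp (a * L) * L ^ b / (exp (a' * L) * L ^ b')) at_top"
      using eventually_gt_at_top[of 0]
    proof eventually_elim
      case (elim L)
      have "L ^ b' = L ^ b * L ^ (b' - b)" using ab by (simp add: power_add[symmetric])
      then show ?case using ab elim by (simp add: field_simps)
    qed
    ultimately show ?thesis by (rule Lim_transform_eventually)
  qed
  then have "((\<lambda>X. exp (a * ln X) * ln X ^ b / (exp (a' * ln X) * ln X ^ b')) \<longlongrightarrow> 0) at_top"
    by (rule filterlim_compose[OF _ ln_at_top])
  then show ?thesis
    by (rule Lim_transform_eventually)
       (use eventually_gt_at_top[of 0] in \<open>eventually_elim, simp add: growth_eq\<close>)
qed

text \<open>Limits of quotients by a common function can be added over the strata, whereas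
  equivalences cannot; hence the translation.\<close>

lemma asymp_equiv_scaled_iff:
  fixes f g :: "real \<Rightarrow> real"
  assumes g: "eventually (\<lambda>x. g x > 0) at_top" and c: "c \<noteq> 0"
  shows "f \<sim>[at_top] (\<lambda>x. c * g x) \<longleftrightarrow> ((\<lambda>x. f x / g x) \<longlongrightarrow> c) at_top"
proof -
  have nz: "eventually (\<lambda>x. c * g x \<noteq> 0) at_top" using g c by (auto elim: eventually_mono)
  have "f \<sim>[at_top] (\<lambda>x. c * g x) \<longleftrightarrow> ((\<lambda>x. f x / (c * g x)) \<longlongrightarrow> 1) at_top"
    unfolding asymp_equiv_def
    by (rule filterlim_cong[OF refl refl]) (use nz in \<open>auto elim!: eventually_mono\<close>)
  also have "\<dots> \<longleftrightarrow> ((\<lambda>x. f x / g x) \<longlongrightarrow> c) at_top"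
  proof
    assume "((\<lambda>x. f x / (c * g x)) \<longlongrightarrow> 1) at_top"
    then have "((\<lambda>x. c * (f x / (c * g x))) \<longlongrightarrow> c * 1) at_top" by (intro tendsto_intros)
    then show "((\<lambda>x. f x / g x) \<longlongrightarrow> c) at_top" using c by simp
  next
    assume "((\<lambda>x. f x / g x) \<longlongrightarrow> c) at_top"
    then have "((\<lambda>x. f x / g x / c) \<longlongrightarrow> c / c) at_top" using c by (intro tendsto_intros) auto
    then show "((\<lambda>x. f x / (c * g x)) \<longlongrightarrow> 1) at_top" using c by (simp add: mult.commute)
  qed
  finally show ?thesis .
qed

lemma growth_eventually_pos: "eventually (\<lambda>X. growth a b X > 0) at_top"
  using eventually_gt_at_top[of 1] by eventually_elim (rule growth_pos)

text \<open>Substituting \<open>L = k * ln X\<close> brings out \<open>k ^ b\<close>. Comparing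
  \<open>k = qS = d * U\<close> with \<open>k = U\<close> explains the factor
  \<open>d ^ \<beta>\<close> in the stratum constants.\<close>

lemma height_count_growth:
  assumes lim: "((\<lambda>L. real (height_count S q L) / (exp (a * L) * L ^ b)) \<longlongrightarrow> l) at_top" and k: "k > 0"
  shows "((\<lambda>X. real (2 ^ c * height_count S q (k * ln X)) / growth (k * a) b X) \<longlongrightarrow> 2 ^ c * l * k ^ b) at_top"
proof -
  have "filterlim (\<lambda>X. k * ln X) at_top at_top"
    using k by (intro filterlim_tendsto_pos_mult_at_top[OF tendsto_const] ln_at_top) auto
  then have "((\<lambda>X. real (height_count S q (k * ln X)) / (exp (a * (k * ln X)) * (k * ln X) ^ b)) \<longlongrightarrow> l) at_top"
    by (rule filterlim_compose[OF lim])
  then have "((\<lambda>X. 2 ^ c * (real (height_count S q (k * ln X)) / (exp (a * (k * ln X)) * (k * ln X) ^ b)) * k ^ b)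
      \<longlongrightarrow> 2 ^ c * l * k ^ b) at_top"
    by (intro tendsto_intros)
  then show ?thesis
  proof (rule Lim_transform_eventually)
    show "eventually (\<lambda>X. 2 ^ c * (real (height_count S q (k * ln X)) / (exp (a * (k * ln X)) * (k * ln X) ^ b)) * k ^ b =
        real (2 ^ c * height_count S q (k * ln X)) / growth (k * a) b X) at_top"
      using eventually_gt_at_top[of 1]
    proof eventually_elim
      case (elim X)
      then have "growth (k * a) b X = exp (a * (k * ln X)) * ln X ^ b"
        by (simp add: growth_eq mult_ac)
      then show ?case using k by (simp add: power_mult_distrib field_simps)
    qed
  qed
qed

lemma interior_count_eq:
  assumes "finite S" "S \<noteq> {}" "\<And>i. i \<in> S \<Longrightarrow> u i > 0" "weight_gcd S u = 1" "X > 0"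
  shows "interior_count S u X = 2 ^ (card S - 1) * height_count S u (real (weight_lcm S u) * ln X)"
proof -
  interpret stratum S S u using assms by unfold_locales auto
  have "{P \<in> wp_rational S u. (\<forall>x\<in>P. \<forall>i\<in>S. x i \<noteq> 0) \<and> weighted_height S u P \<le> X} = points X"
    by (auto simp: points_def)
  then show ?thesis using card_points(2)[OF assms(5)] by (simp add: interior_count_def)
qed

section \<open>Asymptotics on one stratum\<close>

context stratum
begin

lemma weight_gcd_reduced: "weight_gcd S u = 1"
  using Gcd_u by (simp add: weight_gcd_def)

text \<open>Both counts come from \<open>height_count S q\<close>, at \<open>U * ln X\<close> and at
  \<open>qS * ln X\<close>. The first shows that the description in \<open>interior_const\<close>
  has a unique solution, by uniqueness of limits; the second is then expressed through it.\<close>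

lemma stratum_asymptotics:
  assumes "card S \<ge> 2"
  shows "interior_const S u > 0"
    and "((\<lambda>X. real (card (points X)) / growth (stratum_alpha q S) (stratum_beta q S) X)
      \<longlongrightarrow> stratum_const q S) at_top"
    and "stratum_const q S > 0"
proof -
  let ?a = "lp_value S q" and ?b = "lp_beta S q"
  obtain l where l: "l > 0" "((\<lambda>L. real (height_count S q L) / (exp (?a * L) * L ^ ?b)) \<longlongrightarrow> l) at_top"
    using height_count_asymptotics[of S q, OF finS assms qS_pos'] by blast
  define c where "c = 2 ^ (card S - 1) * l * real U ^ ?b"
  have c: "c > 0" using l(1) U_pos by (simp add: c_def)
  have red: "lp_value S u = ?a" "lp_beta S u = ?b" "height_count S u = height_count S q"
    using lp_reduced[OF S_ne qS_pos'] by auto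
  have "((\<lambda>X. real (2 ^ (card S - 1) * height_count S q (real U * ln X)) / growth (real U * ?a) ?b X) \<longlongrightarrow> c) at_top"
    unfolding c_def using height_count_growth[OF l(2)] U_pos by simp
  then have "((\<lambda>X. real (interior_count S u X) / growth (real U * ?a) ?b X) \<longlongrightarrow> c) at_top"
  proof (rule Lim_transform_eventually)
    show "eventually (\<lambda>X. real (2 ^ (card S - 1) * height_count S q (real U * ln X)) / growth (real U * ?a) ?b X =
      real (interior_count S u X) / growth (real U * ?a) ?b X) at_top"
      using eventually_gt_at_top[of 0]
    proof eventually_elim
      case (elim X)
      show ?case
        using interior_count_eq[of S u X, OF finS S_ne u_pos weight_gcd_reduced elim] by (simp add: red)
    qed
  qed
  note int_lim = this
  have iff: "(\<lambda>X. real (interior_count S u X)) \<sim>[at_top] (\<lambda>X. c' * X powr (real (weight_lcm S u) * lp_value S u) * ln X ^ lp_beta S u)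
      \<longleftrightarrow> ((\<lambda>X. real (interior_count S u X) / growth (real U * ?a) ?b X) \<longlongrightarrow> c') at_top" if "c' > 0" for c'
    using asymp_equiv_scaled_iff[OF growth_eventually_pos, of c' "\<lambda>X. real (interior_count S u X)" "real U * ?a" ?b] that
    by (simp add: red growth_def mult.assoc)
  have const: "interior_const S u = c"
    unfolding interior_const_def
  proof (rule the_equality)
    show "c > 0 \<and> (\<lambda>X. real (interior_count S u X)) \<sim>[at_top]
      (\<lambda>X. c * X powr (real (weight_lcm S u) * lp_value S u) * ln X ^ lp_beta S u)"
      using iff[OF c] int_lim c by blast
    fix c' assume c': "c' > 0 \<and> (\<lambda>X. real (interior_count S u X)) \<sim>[at_top]
      (\<lambda>X. c' * X powr (real (weight_lcm S u) * lp_value S u) * ln X ^ lp_beta S u)"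
    then have "((\<lambda>X. real (interior_count S u X) / growth (real U * ?a) ?b X) \<longlongrightarrow> c') at_top"
      using iff by blast
    then show "c' = c" using int_lim by (intro tendsto_unique) auto
  qed
  then show "interior_const S u > 0" using c by simp
  have sc: "stratum_const q S = 2 ^ (card S - 1) * l * real qS ^ ?b"
    unfolding stratum_const_def const c_def stratum_beta_def using dU[symmetric]
    by (simp add: power_mult_distrib)
  then show "stratum_const q S > 0" using l(1) qS_pos by simp
  have "((\<lambda>X. real (2 ^ (card S - 1) * height_count S q (real qS * ln X)) / growth (real qS * ?a) ?b X)
      \<longlongrightarrow> stratum_const q S) at_top"
    unfolding sc using height_count_growth[OF l(2)] qS_pos by simp
  then show "((\<lambda>X. real (card (points X)) / growth (stratum_alpha q S) (stratum_beta q S) X)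
      \<longlongrightarrow> stratum_const q S) at_top"
  proof (rule Lim_transform_eventually)
    show "eventually (\<lambda>X. real (2 ^ (card S - 1) * height_count S q (real qS * ln X)) / growth (real qS * ?a) ?b X =
      real (card (points X)) / growth (stratum_alpha q S) (stratum_beta q S) X) at_top"
      using eventually_gt_at_top[of 0]
      by eventually_elim (simp add: card_points stratum_alpha_def stratum_beta_def)
  qed
qed

end

text \<open>With a single index, minimum 0 leaves only the zero vector. Supports of one coordinate
  thus contribute a bounded number of points.\<close>

lemma height_count_singleton: "height_count {i} q L \<le> 1"
proof -
  have "conf {i} (lp_M {i} q) \<subseteq> {\<lambda>p. \<lambda>j\<in>{i}. 0}"
  proof
    fix C assume C: "C \<in> conf {i} (lp_M {i} q)"
    have "C p = (\<lambda>j\<in>{i}. 0)" for p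
    proof (cases "prime p")
      case True
      then have "C p \<in> lp_M {i} q" using C by (simp add: conf_def)
      then show ?thesis by (auto simp: lp_M_def fun_eq_iff PiE_iff extensional_def)
    qed (use C in \<open>simp add: conf_def\<close>)
    then show "C \<in> {\<lambda>p. \<lambda>j\<in>{i}. 0}" by auto
  qed
  then have "card {C \<in> conf {i} (lp_M {i} q). \<forall>j\<in>{i}. log_height {i} C j \<le> L} \<le> card {\<lambda>p :: nat. \<lambda>j\<in>{i}. 0 :: nat}"
    by (intro card_mono) auto
  then show ?thesis by (simp add: height_count_def)
qed

text \<open>Nonzero scalars preserve the set of vanishing coordinates, so it depends only on the
  class and the strata partition the space.\<close>

lemma point_count_strata:
  assumes "finite I" "\<And>i. i \<in> I \<Longrightarrow> q i > 0" "X > 0"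
  shows "point_count I q X = (\<Sum>S\<in>Pow I - {{}}. card (stratum.points I S q X))"
proof -
  have st: "stratum I S q" if "S \<in> Pow I - {{}}" for S
    using that assms by (auto intro!: stratum.intro)
  have sup: "\<exists>S\<in>Pow I - {{}}. \<forall>x\<in>P. \<forall>i\<in>I. x i \<noteq> 0 \<longleftrightarrow> i \<in> S" if P: "P \<in> wp_rational I q" for P
  proof -
    obtain y where y: "y \<in> wp_tuples I" "P = wp_rel I q `` {y}"
      using P by (auto simp: wp_rational_def wp_space_def elim: quotientE)
    have "x i \<noteq> 0 \<longleftrightarrow> y i \<noteq> 0" if x: "x \<in> P" and i: "i \<in> I" for x i
    proof -
      obtain l where "l \<noteq> 0" "x i = l ^ q i * y i" using x i unfolding y(2) by (auto simp: wp_rel_def)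
      then show ?thesis by simp
    qed
    moreover have "{i\<in>I. y i \<noteq> 0} \<noteq> {}" using y(1) by (auto simp: wp_tuples_def)
    ultimately show ?thesis by (intro bexI[of _ "{i\<in>I. y i \<noteq> 0}"]) auto
  qed
  have "{P \<in> wp_rational I q. weighted_height I q P \<le> X} = (\<Union>S\<in>Pow I - {{}}. stratum.points I S q X)"
  proof (intro equalityI subsetI)
    fix P assume P: "P \<in> {P \<in> wp_rational I q. weighted_height I q P \<le> X}"
    then obtain S where S: "S \<in> Pow I - {{}}" "\<forall>x\<in>P. \<forall>i\<in>I. x i \<noteq> 0 \<longleftrightarrow> i \<in> S" using sup by blast
    then have "P \<in> stratum.points I S q X"
      using P by (simp add: stratum.points_def[OF st[OF S(1)]])
    then show "P \<in> (\<Union>S\<in>Pow I - {{}}. stratum.points I S q X)" using S(1) by blast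
  next
    fix P assume "P \<in> (\<Union>S\<in>Pow I - {{}}. stratum.points I S q X)"
    then obtain S where S: "S \<in> Pow I - {{}}" "P \<in> stratum.points I S q X" by blast
    then show "P \<in> {P \<in> wp_rational I q. weighted_height I q P \<le> X}"
      by (simp add: stratum.points_def[OF st[OF S(1)]])
  qed
  moreover have "card (\<Union>S\<in>Pow I - {{}}. stratum.points I S q X) = (\<Sum>S\<in>Pow I - {{}}. card (stratum.points I S q X))"
  proof (rule card_UN_disjoint)
    show "finite (Pow I - {{}})" using assms(1) by simp
    show "\<forall>S\<in>Pow I - {{}}. finite (stratum.points I S q X)"
      using stratum.card_points(1)[OF st assms(3)] by blast
    show "\<forall>S\<in>Pow I - {{}}. \<forall>S'\<in>Pow I - {{}}. S \<noteq> S' \<longrightarrow> stratum.points I S q X \<inter> stratum.points I S' q X = {}"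
    proof (intro ballI impI, rule ccontr)
      fix S S' assume S: "S \<in> Pow I - {{}}" "S' \<in> Pow I - {{}}" "S \<noteq> S'"
        and "stratum.points I S q X \<inter> stratum.points I S' q X \<noteq> {}"
      then obtain P where P: "P \<in> stratum.points I S q X" "P \<in> stratum.points I S' q X" by blast
      then obtain x where "x \<in> P"
        by (auto simp: stratum.points_def[OF st[OF S(1)]] wp_rational_def represents_def)
      then have "i \<in> S \<longleftrightarrow> i \<in> S'" if "i \<in> I" for i
        using P that by (auto simp: stratum.points_def[OF st[OF S(1)]] stratum.points_def[OF st[OF S(2)]])
      then show False using S by blast
    qed
  qed
  ultimately show ?thesis by (simp add: point_count_def)
qed

text \<open>All strata are divided by the growth function of the lexicographic maximum; those below
  it tend to 0.\<close>

lemma point_count_asymptotics: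
  assumes q: "\<And>i. i \<in> {0..n} \<Longrightarrow> q i > 0"
    and max: "is_lex_max (\<alpha>, \<beta>) ((\<lambda>S. (stratum_alpha q S, stratum_beta q S)) ` strata n)"
    and \<alpha>: "\<alpha> > 0"
  defines "Mx \<equiv> {S \<in> strata n. (stratum_alpha q S, stratum_beta q S) = (\<alpha>, \<beta>)}"
  shows "((\<lambda>X. real (point_count {0..n} q X) / growth \<alpha> \<beta> X) \<longlongrightarrow> (\<Sum>S\<in>Mx. stratum_const q S)) at_top"
proof -
  let ?I = "{0..n}"
  have st: "stratum ?I S q" if "S \<in> Pow ?I - {{}}" for S
    using that q by (auto intro!: stratum.intro)
  define lm where "lm = (\<lambda>S. if S \<in> Mx then stratum_const q S else 0)"
  have lim: "((\<lambda>X. real (card (stratum.points ?I S q X)) / growth \<alpha> \<beta> X) \<longlongrightarrow> lm S) at_top"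
    if S: "S \<in> Pow ?I - {{}}" for S
  proof -
    interpret stratum ?I S q by (rule st[OF S])
    show ?thesis
    proof (cases "card S \<ge> 2")
      case True
      then have SS: "S \<in> strata n" using S by (auto simp: strata_def)
      note lim = stratum_asymptotics(2)[OF True]
      have "((\<lambda>X. (real (card (points X)) / growth (stratum_alpha q S) (stratum_beta q S) X) *
          (growth (stratum_alpha q S) (stratum_beta q S) X / growth \<alpha> \<beta> X)) \<longlongrightarrow> lm S) at_top"
      proof (cases "S \<in> Mx")
        case True
        have "((\<lambda>X. growth \<alpha> \<beta> X / growth \<alpha> \<beta> X) \<longlongrightarrow> 1) at_top"
          by (rule tendsto_eventually)
             (use growth_eventually_pos[of \<alpha> \<beta>] in \<open>eventually_elim, simp\<close>)
        then show ?thesis using tendsto_mult[OF lim, of _ 1] True by (simp add: Mx_def lm_def)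
      next
        case False
        have "lex_le (stratum_alpha q S, stratum_beta q S) (\<alpha>, \<beta>)"
          using max SS by (auto simp: is_lex_max_def)
        then have "stratum_alpha q S < \<alpha> \<or> (stratum_alpha q S = \<alpha> \<and> stratum_beta q S < \<beta>)"
          using False SS by (auto simp: lex_le_def Mx_def)
        from tendsto_mult[OF lim growth_ratio_tendsto_0[OF this]] show ?thesis
          using False by (simp add: lm_def)
      qed
      then show ?thesis
      proof (rule Lim_transform_eventually)
        show "eventually (\<lambda>X. (real (card (points X)) / growth (stratum_alpha q S) (stratum_beta q S) X) *
          (growth (stratum_alpha q S) (stratum_beta q S) X / growth \<alpha> \<beta> X) =
          real (card (points X)) / growth \<alpha> \<beta> X) at_top"
          using growth_eventually_pos[of "stratum_alpha q S" "stratum_beta q S"] by eventually_elim simp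
      qed
    next
      case False
      have "card S > 0" using finS S_ne by (simp add: card_gt_0_iff)
      then have "card S = 1" using False by linarith
      then obtain i where i: "S = {i}" by (meson card_1_singletonE)
      have "S \<notin> Mx" using False by (simp add: Mx_def strata_def)
      \<comment> \<open>For a single coordinate: \<open>growth 0 0\<close> is the constant 1, which
        is negligible because \<open>\<alpha> > 0\<close>.\<close>
      have "((\<lambda>X. growth 0 0 X / growth \<alpha> \<beta> X) \<longlongrightarrow> 0) at_top"
        using \<alpha> by (intro growth_ratio_tendsto_0) simp
      then have "((\<lambda>X. real (card (points X)) / growth \<alpha> \<beta> X) \<longlongrightarrow> 0) at_top"
      proof (rule Lim_null_comparison[rotated])
        show "eventually (\<lambda>X. norm (real (card (points X)) / growth \<alpha> \<beta> X) \<le> growth 0 0 X / growth \<alpha> \<beta> X) at_top"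
          using eventually_gt_at_top[of 1]
        proof eventually_elim
          case (elim X)
          have "card (points X) \<le> 1"
            using card_points(2)[of X] elim height_count_singleton[of i q] by (simp add: i)
          then have "real (card (points X)) \<le> growth 0 0 X" using elim by (simp add: growth_def)
          then show ?case using growth_pos[OF elim, of \<alpha> \<beta>] by (simp add: divide_right_mono)
        qed
      qed
      then show ?thesis using \<open>S \<notin> Mx\<close> by (simp add: lm_def)
    qed
  qed
  have "((\<lambda>X. \<Sum>S\<in>Pow ?I - {{}}. real (card (stratum.points ?I S q X)) / growth \<alpha> \<beta> X) \<longlongrightarrow> (\<Sum>S\<in>Pow ?I - {{}}. lm S)) at_top"
    by (intro tendsto_sum lim)
  also have "(\<Sum>S\<in>Pow ?I - {{}}. lm S) = (\<Sum>S\<in>Mx. stratum_const q S)"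
    unfolding lm_def by (rule sum.mono_neutral_cong_right) (auto simp: Mx_def strata_def)
  finally show ?thesis
  proof (rule Lim_transform_eventually)
    show "eventually (\<lambda>X. (\<Sum>S\<in>Pow ?I - {{}}. real (card (stratum.points ?I S q X)) / growth \<alpha> \<beta> X) =
        real (point_count ?I q X) / growth \<alpha> \<beta> X) at_top"
      using eventually_gt_at_top[of 0]
    proof eventually_elim
      case (elim X)
      show ?case using point_count_strata[of ?I q X] q elim by (simp add: sum_divide_distrib)
    qed
  qed
qed

theorem corollary3:
  fixes n :: nat and q :: "nat \<Rightarrow> nat" and \<alpha> :: real and \<beta> :: nat
  assumes "n \<ge> 1"
    and "\<And>i. i \<in> {0..n} \<Longrightarrow> q i > 0"
    and "weight_gcd {0..n} q = 1"
    and "is_lex_max (\<alpha>, \<beta>) ((\<lambda>S. (stratum_alpha q S, stratum_beta q S)) ` strata n)"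
  shows "(\<forall>S \<in> strata n. interior_const S (stratum_reduced q S) > 0) \<and>
    (\<lambda>X. real (point_count {0..n} q X)) \<sim>[at_top]
      (\<lambda>X. (\<Sum>S \<in> {S \<in> strata n. (stratum_alpha q S, stratum_beta q S) = (\<alpha>, \<beta>)}. stratum_const q S)
        * X powr \<alpha> * ln X ^ \<beta>) \<and>
    (\<forall>S \<in> strata n. lp_value S q \<le> real (card S)) \<and>
    (\<forall>S \<in> strata n. S \<noteq> {0..n} \<longrightarrow>
      stratum_alpha q S \<le> real (weight_lcm S q * card S) \<and>
      weight_lcm S q * card S \<le> weight_lcm {0..n} q * n) \<and>
    (lp_value {0..n} q < real (n + 1) \<longrightarrow>
      (\<lambda>X. real (point_count {0..n} q X)) \<in> o(\<lambda>X. X ^ (weight_lcm {0..n} q * (n + 1))))"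
proof -
  let ?I = "{0..n}" and ?Mx = "{S \<in> strata n. (stratum_alpha q S, stratum_beta q S) = (\<alpha>, \<beta>)}"
  have st: "stratum ?I S q" "card S \<ge> 2" "finite S" "S \<subseteq> ?I" "\<And>i. i \<in> S \<Longrightarrow> q i > 0" if "S \<in> strata n" for S
    using that assms(2) by (auto simp: strata_def intro!: stratum.intro intro: finite_subset)
  have lpv: "0 < lp_value S q" "lp_value S q \<le> real (card S)" if "S \<in> strata n" for S
    using lp_value_bounds[of S q] st[OF that] by auto
  have lcm_pos: "weight_lcm S q > 0" if "S \<in> strata n" for S using stratum.qS_pos[OF st(1)[OF that]] .
  have alpha_le: "stratum_alpha q S \<le> real (weight_lcm S q * card S)" if "S \<in> strata n" for S
    using lpv(2)[OF that] by (simp add: stratum_alpha_def mult_left_mono)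
  have proper: "weight_lcm S q * card S \<le> weight_lcm ?I q * n" if S: "S \<in> strata n" "S \<noteq> ?I" for S
  proof (rule mult_le_mono)
    have "?I \<in> strata n" using assms(1) by (simp add: strata_def)
    moreover have "weight_lcm S q dvd weight_lcm ?I q"
      unfolding weight_lcm_def using st(4)[OF S(1)] by (intro Lcm_subset image_mono)
    ultimately show "weight_lcm S q \<le> weight_lcm ?I q" using lcm_pos by (intro dvd_imp_le) auto
    have "card S < card ?I" using st(4)[OF S(1)] S(2) by (intro psubset_card_mono) auto
    then show "card S \<le> n" by simp
  qed
  obtain S0 where S0: "S0 \<in> strata n" "stratum_alpha q S0 = \<alpha>" "stratum_beta q S0 = \<beta>"
    using assms(4) by (auto simp: is_lex_max_def)
  have \<alpha>: "\<alpha> > 0" using lpv(1)[OF S0(1)] lcm_pos[OF S0(1)] S0(2) by (auto simp: stratum_alpha_def)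
  define c where "c = (\<Sum>S\<in>?Mx. stratum_const q S)"
  have finMx: "finite ?Mx" by (rule finite_subset[of _ "Pow ?I"]) (auto simp: strata_def)
  have c: "c > 0" unfolding c_def
    using finMx S0 stratum.stratum_asymptotics(3)[OF st(1) st(2)] by (intro sum_pos) auto
  have lim: "((\<lambda>X. real (point_count ?I q X) / growth \<alpha> \<beta> X) \<longlongrightarrow> c) at_top"
    unfolding c_def using assms(2,4) \<alpha> by (rule point_count_asymptotics)
  have "(\<lambda>X. real (point_count ?I q X)) \<sim>[at_top] (\<lambda>X. c * X powr \<alpha> * ln X ^ \<beta>)"
    using asymp_equiv_scaled_iff[OF growth_eventually_pos, of c "\<lambda>X. real (point_count ?I q X)" \<alpha> \<beta>] lim c
    by (simp add: growth_def mult.assoc)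
  moreover have "(\<lambda>X. real (point_count ?I q X)) \<in> o(\<lambda>X. X ^ (weight_lcm ?I q * (n + 1)))"
    if lt: "lp_value ?I q < real (n + 1)"
  proof (rule smalloI_tendsto)
    define N where "N = weight_lcm ?I q * (n + 1)"
    have I: "?I \<in> strata n" using assms(1) by (simp add: strata_def)
    \<comment> \<open>On the full support the strict hypothesis on \<open>lp_value\<close> applies;
      on a proper stratum \<open>\<alpha>\<close> is at most the lcm of all weights times
      \<open>n\<close>, which is below \<open>N\<close>.\<close>
    have "\<alpha> < real N"
    proof (cases "S0 = ?I")
      case True
      have "real (weight_lcm ?I q) * lp_value ?I q < real (weight_lcm ?I q) * real (n + 1)"
        using lt lcm_pos[OF I] by (intro mult_strict_left_mono) auto
      then show ?thesis using S0(2) True by (simp add: stratum_alpha_def N_def algebra_simps)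
    next
      case False
      have "\<alpha> \<le> real (weight_lcm S0 q * card S0)" using alpha_le[OF S0(1)] S0(2) by simp
      also have "\<dots> \<le> real (weight_lcm ?I q * n)" using proper[OF S0(1) False] by (rule of_nat_mono)
      also have "\<dots> < real N" using lcm_pos[OF I] unfolding N_def by (intro of_nat_less_iff[THEN iffD2]) simp
      finally show ?thesis .
    qed
    then have "((\<lambda>X. growth \<alpha> \<beta> X / growth (real N) 0 X) \<longlongrightarrow> 0) at_top"
      by (intro growth_ratio_tendsto_0) simp
    from tendsto_mult[OF lim this]
    have "((\<lambda>X. (real (point_count ?I q X) / growth \<alpha> \<beta> X) * (growth \<alpha> \<beta> X / growth (real N) 0 X)) \<longlongrightarrow> 0) at_top" by simp
    then show "((\<lambda>X. real (point_count ?I q X) / X ^ (weight_lcm ?I q * (n + 1))) \<longlongrightarrow> 0) at_top"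
    proof (rule Lim_transform_eventually)
      show "eventually (\<lambda>X. (real (point_count ?I q X) / growth \<alpha> \<beta> X) * (growth \<alpha> \<beta> X / growth (real N) 0 X) =
          real (point_count ?I q X) / X ^ (weight_lcm ?I q * (n + 1))) at_top"
        using eventually_gt_at_top[of 1]
      proof eventually_elim
        case (elim X)
        have "growth (real N) 0 X = X ^ N" using elim by (simp add: growth_def powr_realpow)
        then show ?case using growth_pos[OF elim, of \<alpha> \<beta>] by (simp add: N_def)
      qed
    qed
    show "eventually (\<lambda>X::real. X ^ (weight_lcm ?I q * (n + 1)) \<noteq> 0) at_top"
      using eventually_gt_at_top[of 0] by eventually_elim simp
  qed
  ultimately show ?thesis
    using stratum.stratum_asymptotics(1)[OF st(1) st(2)] lpv(2) alpha_le proper unfolding c_def by blast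
qed

end
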